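(* Let $p$ be a prime with $p\equiv 1\pmod 4$, let $t=\frac{p-1}{4}$, let $T$ be a generator of the character group $\widehat{\mathbb F_p^{\times}}$, and let $\lambda\in\mathbb F_p^{\times}$. Then \begin{align*} \#X_{\lambda}^4(\mathbb F_p)&=\frac{p^3-1}{p-1}+12p\,T^t(-1)\,T^{2t}(1-\lambda^4)\\ &\quad+{}_3G_3\left[\left.\begin{array}{ccc} 1/4&2/4&3/4\\ 0&0&0\end{array}\right|\lambda^4\right]_p+3p\,{}_2G_2\left[\left.\begin{array}{cc} 3/4&1/4\\ 0&2/4\end{array}\right|\lambda^4\right]_p. \end{align*}
   Context: For $\lambda\in\mathbb F_p$, $X_\lambda^4$ is the Dwork K3 surface in $\mathbb P^3$ defined by $x_1^4+x_2^4+x_3^4+x_4^4=4\lambda x_1x_2x_3x_4$, and $\#X_\lambda^4(\mathbb F_p)$ is its number of $\mathbb F_p$-rational points. Characters are extended to $\mathbb F_p$ by $\chi(0)=0$. Let $\omega$ be the Teichmüller character of $\mathbb F_p$ (values in $\mathbb Z_p$, $\omega(x)\equiv x\pmod p$), $\overline\omega=\omega^{-1}$, with $\overline\omega^j(0)=0$. $\Gamma_p$ is Morita's $p$-adic Gamma function. For $x\in\mathbb Q$, $\lfloor x\rfloor$ is the floor and $\langle x\rangle=x-\lfloor x\rfloor$. McCarthy's $p$-adic hypergeometric function is defined, for $a_i,b_i\in\mathbb Q\cap\mathbb Z_p$ and $u\in\mathbb F_p$, by $${}_nG_n\left[\left.\begin{array}{ccc}a_1&\ldots&a_n\\ b_1&\ldots&b_n\end{array}\right|u\right]_p:=\frac{-1}{p-1}\sum_{j=0}^{p-2}(-1)^{jn}\,\overline\omega^j(u)\prod_{i=1}^n\frac{\Gamma_p(\langle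 a_i-\frac{j}{p-1}\rangle)}{\Gamma_p(\langle a_i\rangle)}\frac{\Gamma_p(\langle -b_i+\frac{j}{p-1}\rangle)}{\Gamma_p(\langle -b_i\rangle)}(-p)^{-\lfloor\langle a_i\rangle-\frac{j}{p-1}\rfloor-\lfloor\langle -b_i\rangle+\frac{j}{p-1}\rfloor}.$$ *)

theory Defs
  imports "HOL-Number_Theory.Number_Theory"
begin

text \<open>A p-adic integer x is represented by the sequence of its residues:
  x k is the unique integer in [0, p^k) congruent to x modulo p^k.\<close>

type_synonym zp = "nat \<Rightarrow> int"

definition zp_valid :: "nat \<Rightarrow> zp \<Rightarrow> bool" where
  "zp_valid p x \<longleftrightarrow>
     (\<forall>k. 0 \<le> x k \<and> x k < int p ^ k \<and> x (Suc k) mod int p ^ k = x k)"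

definition zp_of_int :: "nat \<Rightarrow> int \<Rightarrow> zp" where
  "zp_of_int p a = (\<lambda>k. a mod int p ^ k)"

definition zp_add :: "nat \<Rightarrow> zp \<Rightarrow> zp \<Rightarrow> zp" where
  "zp_add p x y = (\<lambda>k. (x k + y k) mod int p ^ k)"

definition zp_mult :: "nat \<Rightarrow> zp \<Rightarrow> zp \<Rightarrow> zp" where
  "zp_mult p x y = (\<lambda>k. (x k * y k) mod int p ^ k)"

definition zp_pow :: "nat \<Rightarrow> zp \<Rightarrow> nat \<Rightarrow> zp" where
  "zp_pow p x n = (\<lambda>k. (x k ^ n) mod int p ^ k)"

definition zp_inv :: "nat \<Rightarrow> zp \<Rightarrow> zp" where
  "zp_inv p x = (\<lambda>k. (SOME y. 0 \<le> y \<and> y < int p ^ k \<and> [x k * y = 1] (mod int p ^ k)))"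

definition zp_prod :: "nat \<Rightarrow> zp list \<Rightarrow> zp" where
  "zp_prod p xs = foldr (zp_mult p) xs (zp_of_int p 1)"

text \<open>A rational number a/b (lowest terms, p not dividing b) as an element of Z_p.\<close>
definition zp_of_rat :: "nat \<Rightarrow> rat \<Rightarrow> zp" where
  "zp_of_rat p q = (case quotient_of q of (a, b) \<Rightarrow>
      zp_mult p (zp_of_int p a) (zp_inv p (zp_of_int p b)))"

text \<open>omega(x) = lim x^(p^k); modulo p^k it is x^(p^k). omega(0) = 0.\<close>
definition teich :: "nat \<Rightarrow> int \<Rightarrow> zp" where
  "teich p x = (\<lambda>k. ((x mod int p) ^ (p ^ k)) mod int p ^ k)"

text \<open>omegabar^j(u) = omega(u)^(-j), with omegabar^j(0) = 0 for every j.\<close>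
definition omegabar_pow :: "nat \<Rightarrow> nat \<Rightarrow> int \<Rightarrow> zp" where
  "omegabar_pow p j u =
     (if int p dvd u then zp_of_int p 0
      else zp_pow p (teich p u) ((p - 1) - j mod (p - 1)))"

definition gamma_nat :: "nat \<Rightarrow> nat \<Rightarrow> int" where
  "gamma_nat p n = (-1) ^ n * (\<Prod>j \<in> {j. 0 < j \<and> j < n \<and> \<not> p dvd j}. int j)"

text \<open>Gamma_p extended by continuity: for p odd, Gamma_p(x) mod p^k equals
  Gamma_p(N) mod p^k for any natural N congruent to x mod p^k.\<close>
definition gamma_p :: "nat \<Rightarrow> rat \<Rightarrow> zp" where
  "gamma_p p x = (\<lambda>k. gamma_nat p (nat (zp_of_rat p x k)) mod int p ^ k)"

text \<open>(e, z) represents p^e * z with z in Z_p.\<close>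
type_synonym qp = "int \<times> zp"

definition qp_of_zp :: "zp \<Rightarrow> qp" where
  "qp_of_zp z = (0, z)"

definition qp_of_int :: "nat \<Rightarrow> int \<Rightarrow> qp" where
  "qp_of_int p a = (0, zp_of_int p a)"

definition qp_mult :: "nat \<Rightarrow> qp \<Rightarrow> qp \<Rightarrow> qp" where
  "qp_mult p x y = (fst x + fst y, zp_mult p (snd x) (snd y))"

definition qp_add :: "nat \<Rightarrow> qp \<Rightarrow> qp \<Rightarrow> qp" where
  "qp_add p x y = (let m = min (fst x) (fst y) in
     (m, zp_add p (zp_mult p (zp_of_int p (int p ^ nat (fst x - m))) (snd x))
                  (zp_mult p (zp_of_int p (int p ^ nat (fst y - m))) (snd y))))"

definition qp_eq :: "nat \<Rightarrow> qp \<Rightarrow> qp \<Rightarrow> bool" where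
  "qp_eq p x y = (let m = min (fst x) (fst y) in
     zp_mult p (zp_of_int p (int p ^ nat (fst x - m))) (snd x) =
     zp_mult p (zp_of_int p (int p ^ nat (fst y - m))) (snd y))"

definition qp_sum :: "nat \<Rightarrow> ('a \<Rightarrow> qp) \<Rightarrow> 'a list \<Rightarrow> qp" where
  "qp_sum p f xs = foldr (\<lambda>j acc. qp_add p (f j) acc) xs (0, zp_of_int p 0)"

definition negp_pow :: "nat \<Rightarrow> int \<Rightarrow> qp" where
  "negp_pow p e = (e, zp_of_int p ((-1) ^ nat \<bar>e\<bar>))"

definition mcG :: "nat \<Rightarrow> rat list \<Rightarrow> rat list \<Rightarrow> int \<Rightarrow> qp" where
  "mcG p as bs u =
    (let n = length as; d = rat_of_nat (p - 1) in
     qp_mult p (qp_of_zp (zp_of_rat p (- 1 / d)))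
      (qp_sum p (\<lambda>j. let jj = rat_of_nat j / d in
         qp_mult p
          (qp_of_zp (zp_mult p (zp_of_int p ((-1) ^ (j * n)))
            (zp_mult p (omegabar_pow p j u)
              (zp_prod p (map (\<lambda>(a, b).
                 zp_mult p
                   (zp_mult p (gamma_p p (frac (a - jj))) (zp_inv p (gamma_p p (frac a))))
                   (zp_mult p (gamma_p p (frac (- b + jj))) (zp_inv p (gamma_p p (frac (- b))))))
                 (zip as bs))))))
          (negp_pow p (\<Sum>(a, b) \<leftarrow> zip as bs.
              - \<lfloor>frac a - jj\<rfloor> - \<lfloor>frac (- b) + jj\<rfloor>)))
        [0..<p - 1]))"

definition is_char :: "nat \<Rightarrow> (int \<Rightarrow> zp) \<Rightarrow> bool" where
  "is_char p \<chi> \<longleftrightarrow>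
     (\<forall>x. zp_valid p (\<chi> x)) \<and>
     (\<forall>x y. [x = y] (mod int p) \<longrightarrow> \<chi> x = \<chi> y) \<and>
     (\<forall>x. int p dvd x \<longrightarrow> \<chi> x = zp_of_int p 0) \<and>
     \<chi> 1 = zp_of_int p 1 \<and>
     (\<forall>x y. \<chi> (x * y) = zp_mult p (\<chi> x) (\<chi> y))"

text \<open>Generator of the (cyclic, order p-1) character group: no power chi^m
  with 0 < m < p - 1 is the trivial character.\<close>
definition is_char_generator :: "nat \<Rightarrow> (int \<Rightarrow> zp) \<Rightarrow> bool" where
  "is_char_generator p \<chi> \<longleftrightarrow> is_char p \<chi> \<and>
     (\<forall>m. 0 < m \<and> m < p - 1 \<longrightarrow>
        (\<exists>x. \<not> int p dvd x \<and> zp_pow p (\<chi> x) m \<noteq> zp_of_int p 1))"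

definition dwork_affine_solutions :: "nat \<Rightarrow> int \<Rightarrow> (int \<times> int \<times> int \<times> int) set" where
  "dwork_affine_solutions p lam =
     {(x1, x2, x3, x4). x1 \<in> {0..<int p} \<and> x2 \<in> {0..<int p} \<and> x3 \<in> {0..<int p} \<and>
        x4 \<in> {0..<int p} \<and> (x1, x2, x3, x4) \<noteq> (0, 0, 0, 0) \<and>
        [x1 ^ 4 + x2 ^ 4 + x3 ^ 4 + x4 ^ 4 = 4 * lam * x1 * x2 * x3 * x4] (mod int p)}"

text \<open>Projective points = nonzero affine solutions modulo scaling by F_p^*.\<close>
definition dwork_count :: "nat \<Rightarrow> int \<Rightarrow> nat" where
  "dwork_count p lam = card (dwork_affine_solutions p lam) div (p - 1)"

end

theory Submission
  imports Defs Complex_Main "HOL-Computational_Algebra.Computational_Algebra"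
begin

text \<open>Expanding the number of points of the quartic in Gauss sums, the difference to the Fermat
  quartic becomes, by the Hasse-Davenport relation for the quadratic character, a sum over a running
  character of Jacobi sums involving characters of order dividing four. Orthogonality turns it into
  sums of powers of \<open>\<i>\<close> over the solutions of \<open>v (1 - x) (1 - y) (1 - z) = x y z\<close> and
  \<open>v (1 - x) (1 - y) = x y\<close> modulo \<open>p\<close>. Identities between such sums use nothing
  but \<open>\<i>\<^sup>2 = -1\<close>; hence they hold modulo \<open>p ^ k\<close> for the square root of \<open>-1\<close> given by a power of the
  Teichmueller character.

  Conversely, the Gamma quotients in McCarthy's function are Jacobi sums of powers of the Teichmueller
  character, by the Gross-Koblitz formula. Only this Jacobi sum form of the formula is needed, and it has an
  elementary proof: Dwork's trace computation, carried out on the coefficients of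
  \<open>(1 - X ^ p) ^ b2 / (1 - X) ^ b1\<close>, compares the binomial coefficients attached to the
  truncated expansions of \<open>- i / (p - 1)\<close> and \<open>- j / (p - 1)\<close> at consecutive levels.\<close>

section \<open>Jacobi sums and Morita's Gamma function\<close>

text \<open>Gauss sums involve p-th roots of unity, which \<open>zp\<close> does not contain. They
  are therefore used over the complex numbers only, and what crosses to the p-adic side are Jacobi
  sums rewritten with powers of a fourth root of unity. On that side everything is a congruence
  modulo \<open>p ^ k\<close>, where only integers prime to \<open>p\<close> can be cancelled. This
  shapes the Gross-Koblitz step in three ways. The series is a polynomial modulo
  \<open>p ^ k\<close> only after both exponents are raised by some \<open>s \<ge> k\<close>, so the
  binomial coefficients are first compared in shifted form. The trace argument yields a congruence
  multiplied by products divisible by powers of \<open>p\<close>; each of the two has valuation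
  about a third of the precision, so modulus \<open>p ^ (3 * K + 7)\<close> leaves precision
  \<open>K\<close>. It covers positive exponents with \<open>i + j \<le> p - 2\<close>; larger sums
  follow by reflection, which creates the factor \<open>- p\<close>. In the point count, the fourth
  powers of Gauss sums coming from the Fermat quartic cancel against three exceptional indices, at
  which one Gauss sum in a denominator belongs to the trivial character.\<close>

definition geom_fps :: "int fps" where "geom_fps = Abs_fps (\<lambda>_. 1)"

definition frob_fps :: "nat \<Rightarrow> nat \<Rightarrow> nat \<Rightarrow> int fps" where
  "frob_fps p b2 b1 = (1 - fps_X ^ p) ^ b2 * geom_fps ^ b1"

text \<open>Integer indices with zeros to the left let the recurrences hold uniformly, also where
  \<open>z - 1\<close> or \<open>z - int p\<close> is negative.\<close>

definition icoeff :: "int fps \<Rightarrow> int \<Rightarrow> int" where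
  "icoeff f z = (if z < 0 then 0 else f $ nat z)"

lemma one_minus_X_mult_geom: "(1 - fps_X) * geom_fps = 1"
proof (rule fps_ext)
  fix n show "((1 - fps_X) * geom_fps) $ n = (1 :: int fps) $ n"
    by (cases n) (simp_all add: geom_fps_def algebra_simps)
qed

lemma geom_fps_power_nth: "(geom_fps ^ Suc r) $ n = int ((r + n) choose n)"
proof (induction r arbitrary: n)
  case 0 show ?case by (simp add: geom_fps_def)
next
  case (Suc r)
  have "(geom_fps ^ Suc (Suc r)) $ n = (geom_fps ^ Suc r * geom_fps) $ n"
    by (simp only: power_Suc mult.commute)
  also have "\<dots> = (\<Sum>i\<le>n. (geom_fps ^ Suc r) $ i)"
    by (simp only: fps_mult_nth) (simp add: geom_fps_def atMost_atLeast0)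
  also have "\<dots> = int (\<Sum>i\<le>n. ((r + i) choose i))"
    unfolding Suc.IH by simp
  also have "\<dots> = int ((Suc r + n) choose n)"
    by (simp only: sum_choose_lower) simp
  finally show ?case .
qed

lemma fps_deriv_geom: "fps_deriv geom_fps = geom_fps ^ 2"
proof (rule fps_ext)
  fix n
  show "fps_deriv geom_fps $ n = (geom_fps ^ 2) $ n"
    using geom_fps_power_nth[of 1 n] by (simp add: geom_fps_def numeral_2_eq_2)
qed

lemma frob_fps_shift:
  "(1 - fps_X) * frob_fps p (Suc b2) (Suc b1) = (1 - fps_X ^ p) * frob_fps p b2 b1"
proof -
  have "(1 - fps_X) * frob_fps p (Suc b2) (Suc b1)
      = ((1 - fps_X) * geom_fps) * ((1 - fps_X ^ p) * frob_fps p b2 b1)"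
    by (simp add: frob_fps_def algebra_simps)
  then show ?thesis by (simp add: one_minus_X_mult_geom)
qed

text \<open>The logarithmic derivative of \<open>frob_fps p b2 b1\<close> is
  \<open>b1 / (1 - X)\<close> minus \<open>p * b2 * X ^ (p - 1) / (1 - X ^ p)\<close>. After
  multiplication by \<open>1 - X ^ p\<close> the first summand is the series with both exponents
  raised by one.\<close>

lemma frob_fps_deriv:
  assumes "p > 0"
  shows "(1 - fps_X ^ p) * fps_deriv (frob_fps p b2 b1)
    = of_nat b1 * frob_fps p (Suc b2) (Suc b1) - of_nat (p * b2) * fps_X ^ (p - 1) * frob_fps p b2 b1"
proof -
  have D: "fps_deriv (1 - fps_X ^ p :: int fps) = - of_nat p * fps_X ^ (p - 1)"
    by (simp add: fps_deriv_power fps_of_nat[symmetric])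
  have 1: "(1 - fps_X ^ p) * fps_deriv ((1 - fps_X ^ p) ^ b2)
      = - of_nat (p * b2) * fps_X ^ (p - 1) * (1 - fps_X ^ p :: int fps) ^ b2"
  proof (induction b2)
    case (Suc b)
    have "(1 - fps_X ^ p) * fps_deriv ((1 - fps_X ^ p :: int fps) ^ Suc b)
      = (1 - fps_X ^ p) * (fps_deriv (1 - fps_X ^ p) * (1 - fps_X ^ p) ^ b)
        + (1 - fps_X ^ p) * ((1 - fps_X ^ p) * fps_deriv ((1 - fps_X ^ p) ^ b))"
      by (simp only: power_Suc fps_deriv_mult distrib_left add.commute)
    then show ?case unfolding Suc D by (simp add: algebra_simps)
  qed simp
  have 2: "fps_deriv (geom_fps ^ b1) = of_nat b1 * geom_fps ^ Suc b1"
    by (induction b1) (simp_all add: fps_deriv_geom power2_eq_square algebra_simps)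
  have "(1 - fps_X ^ p) * fps_deriv (frob_fps p b2 b1)
     = (1 - fps_X ^ p) * fps_deriv ((1 - fps_X ^ p) ^ b2) * geom_fps ^ b1
       + (1 - fps_X ^ p) ^ Suc b2 * fps_deriv (geom_fps ^ b1)"
    by (simp add: frob_fps_def algebra_simps)
  then show ?thesis unfolding 1 2 by (simp add: frob_fps_def algebra_simps)
qed

lemma fps_of_nat_mult_nth: "(of_nat k * f) $ n = int k * (f $ n)" for f :: "int fps"
  by (metis fps_mult_left_const_nth fps_of_nat)

lemma frob_fps_coeff_shift:
  assumes "p > 0"
  shows "icoeff (frob_fps p (Suc b2) (Suc b1)) z - icoeff (frob_fps p (Suc b2) (Suc b1)) (z - 1)
    = icoeff (frob_fps p b2 b1) z - icoeff (frob_fps p b2 b1) (z - int p)"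
proof (cases "z < 0")
  case True then show ?thesis by (simp add: icoeff_def)
next
  case False
  then obtain n where n: "z = int n" using zero_le_imp_eq_int[of z] by auto
  have "((1 - fps_X) * frob_fps p (Suc b2) (Suc b1)) $ n = ((1 - fps_X ^ p) * frob_fps p b2 b1) $ n"
    by (simp only: frob_fps_shift)
  then show ?thesis
    by (auto simp: n icoeff_def algebra_simps fps_X_power_mult_nth nat_diff_distrib split: if_splits)
qed

lemma frob_fps_coeff_deriv:
  assumes "p > 0"
  shows "z * icoeff (frob_fps p b2 b1) z - (z - int p) * icoeff (frob_fps p b2 b1) (z - int p)
    = int b1 * icoeff (frob_fps p (Suc b2) (Suc b1)) (z - 1) - int p * int b2 * icoeff (frob_fps p b2 b1) (z - int p)"
proof (cases "z \<le> 0")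
  case True then show ?thesis using assms by (auto simp: icoeff_def)
next
  case False
  then obtain m where m: "z = int (Suc m)" by (metis linorder_not_le gr0_implies_Suc zero_less_imp_eq_int)
  have L: "((1 - fps_X ^ p) * fps_deriv (frob_fps p b2 b1)) $ m
     = z * icoeff (frob_fps p b2 b1) z - (z - int p) * icoeff (frob_fps p b2 b1) (z - int p)"
  proof -
    consider "p \<le> m" | "p = Suc m" | "p > Suc m" by linarith
    then show ?thesis
    proof cases
      case 1
      then have "nat (1 + int m - int p) = Suc (m - p)" "nat (1 + int m) = Suc m" by simp_all
      then show ?thesis using 1
        by (simp add: m icoeff_def algebra_simps fps_X_power_mult_nth of_nat_diff)
    next
      case 2
      moreover have "nat (1 + int m) = Suc m" by simp
      ultimately show ?thesis
        by (simp add: m icoeff_def algebra_simps fps_X_power_mult_nth)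
    next
      case 3
      moreover have "nat (1 + int m) = Suc m" by simp
      ultimately show ?thesis
        by (simp add: m icoeff_def algebra_simps fps_X_power_mult_nth)
    qed
  qed
  have "(fps_X ^ (p - 1) * frob_fps p b2 b1) $ m = icoeff (frob_fps p b2 b1) (z - int p)"
  proof -
    have "nat (1 + int m - int p) = m - (p - 1)" if "p \<le> Suc m" using that assms by simp
    then show ?thesis using assms
      by (auto simp: m icoeff_def fps_X_power_mult_nth not_less not_le)
  qed
  then have R: "(of_nat b1 * frob_fps p (Suc b2) (Suc b1) - of_nat (p * b2) * fps_X ^ (p - 1) * frob_fps p b2 b1) $ m
     = int b1 * icoeff (frob_fps p (Suc b2) (Suc b1)) (z - 1) - int p * int b2 * icoeff (frob_fps p b2 b1) (z - int p)"
    by (simp only: fps_sub_nth mult.assoc fps_of_nat_mult_nth) (simp add: m icoeff_def)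
  show ?thesis using L R frob_fps_deriv[OF assms, of b2 b1] by simp
qed

text \<open>Combines the shift relation and the derivative relation. The form is chosen for
  summation over \<open>i\<close>: the left side links the entries \<open>a + p * i - j\<close> for
  \<open>j\<close> and \<open>j + 1\<close>, and the right side becomes a difference in
  \<open>i\<close> once weighted by \<open>rising_coeff\<close>.\<close>

lemma frob_fps_coeff_rec:
  fixes i j a n' :: int and p b1 b2 :: nat
  assumes "p > 0"
  defines "c \<equiv> icoeff (frob_fps p b2 b1)" and "c1 \<equiv> icoeff (frob_fps p (Suc b2) (Suc b1))"
    and "n \<equiv> int p * n' + a"
  shows "(n - j) * c1 (a + int p * i - j) - (n + int b1 - j) * c1 (a + int p * i - (j + 1))
    = int p * ((n' - i) * c (a + int p * i - j) - (n' + int b2 - i + 1) * c (a + int p * (i - 1) - j))"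
proof -
  define m where "m = a + int p * i - j"
  have 1: "c1 m = c1 (m - 1) + c m - c (m - int p)"
    using frob_fps_coeff_shift[OF assms(1), of b2 b1 m] by (simp add: c_def c1_def)
  have 2: "m * c m - (m - int p) * c (m - int p) = int b1 * c1 (m - 1) - int p * int b2 * c (m - int p)"
    using frob_fps_coeff_deriv[OF assms(1), of m b2 b1] by (simp add: c_def c1_def)
  have e: "a + int p * i - (j + 1) = m - 1" "a + int p * (i - 1) - j = m - int p"
    by (simp_all add: m_def algebra_simps)
  have n: "int p * n' = n - j - m + int p * i" by (simp add: n_def m_def)
  have R: "int p * ((n' - i) * x - (n' + int b2 - i + 1) * y)
      = (n - j - m) * x - (n - j - m + int p + int p * int b2) * y" for x y
  proof -
    have "int p * ((n' - i) * x - (n' + int b2 - i + 1) * y)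
      = (int p * n') * (x - y) - int p * (i * x + (int b2 - i + 1) * y)"
      by (simp add: algebra_simps)
    then show ?thesis unfolding n by (simp add: algebra_simps)
  qed
  show ?thesis unfolding e R m_def[symmetric] using 2 unfolding 1
    by (simp add: algebra_simps)
qed

text \<open>The passage between consecutive levels: a power of \<open>1 / (1 - X)\<close> splits
  into a similar series in \<open>X ^ p\<close>, belonging to the lower level, and the series
  \<open>frob_fps\<close> that plays the part of Dwork's kernel.\<close>

lemma geom_fps_factor:
  assumes "p > 0"
  shows "(geom_fps ^ Suc b2 oo fps_X ^ p) * frob_fps p (Suc b2) (Suc b1) = geom_fps ^ Suc b1"
proof -
  have X0: "(fps_X ^ p :: int fps) $ 0 = 0" using assms by simp
  have "((1 - fps_X) * geom_fps) ^ Suc b2 oo fps_X ^ p = (1 :: int fps)"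
    by (simp only: one_minus_X_mult_geom power_one fps_compose_1)
  then have "((1 - fps_X) ^ Suc b2 oo fps_X ^ p) * (geom_fps ^ Suc b2 oo fps_X ^ p) = 1"
    by (simp only: power_mult_distrib fps_compose_mult_distrib[OF X0])
  moreover have "((1 - fps_X) ^ Suc b2 oo fps_X ^ p) = (1 - fps_X ^ p :: int fps) ^ Suc b2"
    by (simp only: fps_compose_power[OF X0, symmetric] fps_compose_sub_distrib fps_compose_1 fps_X_fps_compose_startby0[OF X0])
  ultimately have "(geom_fps ^ Suc b2 oo fps_X ^ p) * (1 - fps_X ^ p :: int fps) ^ Suc b2 = 1"
    by (simp only: mult.commute)
  then show ?thesis
    by (simp only: frob_fps_def mult.assoc[symmetric] mult_1_left)
qed

text \<open>This is the coefficient of \<open>X ^ (n' - i)\<close> in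
  \<open>(1 - X) ^ (- (b + 1))\<close>; counting down from \<open>n'\<close> matches the index
  \<open>a + p * i\<close> left for the other factor.\<close>

definition rising_coeff :: "nat \<Rightarrow> nat \<Rightarrow> nat \<Rightarrow> int" where
  "rising_coeff b n' i = (if i \<le> n' then int ((b + (n' - i)) choose (n' - i)) else 0)"

lemma rising_coeff_step:
  "(int n' - int i) * rising_coeff b n' i = (int b + int n' - int i) * rising_coeff b n' (Suc i)"
proof (cases "i < n'")
  case True
  then obtain r where r: "n' = i + Suc r" using less_iff_Suc_add by auto
  have "Suc r * ((b + Suc r) choose Suc r) = (b + Suc r) * ((b + r) choose r)"
    using Suc_times_binomial[of r "b + r"] by simp
  then have "int (Suc r) * int ((b + Suc r) choose Suc r) = int (b + Suc r) * int ((b + r) choose r)"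
    by (metis of_nat_mult)
  then show ?thesis by (simp add: rising_coeff_def r algebra_simps)
qed (auto simp: rising_coeff_def)

text \<open>For \<open>j = 0\<close> this extracts a coefficient of the product in
  \<open>geom_fps_factor\<close>. Larger \<open>j\<close> cut off the first rows and move to another
  column of the matrix with entries at \<open>a + p * i - j\<close>, whose diagonal entries
  \<open>a + (p - 1) * j\<close> are the ones that enter the trace.\<close>

definition frob_sum :: "nat \<Rightarrow> nat \<Rightarrow> nat \<Rightarrow> nat \<Rightarrow> nat \<Rightarrow> nat \<Rightarrow> int" where
  "frob_sum p b2 b1 a n' j = (\<Sum>i = j..n'. rising_coeff b2 n' i *
     icoeff (frob_fps p (Suc b2) (Suc b1)) (int a + int p * int i - int j))"

lemma frob_sum_0:
  assumes "a < p"
  shows "frob_sum p b2 b1 a n' 0 = int ((b1 + (p * n' + a)) choose (p * n' + a))"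
proof -
  define n where "n = p * n' + a"
  define F where "F = frob_fps p (Suc b2) (Suc b1)"
  have p: "p > 0" using assms by simp
  have "int ((b1 + n) choose n) = (geom_fps ^ Suc b1) $ n"
    by (simp only: geom_fps_power_nth)
  also have "\<dots> = ((geom_fps ^ Suc b2 oo fps_X ^ p) * F) $ n"
    by (simp only: geom_fps_factor[OF p] F_def)
  also have "\<dots> = (\<Sum>l=0..n. (if p dvd l then (geom_fps ^ Suc b2) $ (l div p) else 0) * F $ (n - l))"
    by (simp only: fps_mult_nth fps_nth_compose_X_power)
  \<comment> \<open>Only \<open>l = p * (n' - i)\<close> contributes, and then the complementary
    index \<open>n - l\<close> is \<open>a + p * i\<close>.\<close>
  also have "\<dots> = (\<Sum>l\<in>(\<lambda>i. p * (n' - i)) ` {0..n'}. (if p dvd l then (geom_fps ^ Suc b2) $ (l div p) else 0) * F $ (n - l))"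
  proof (rule sum.mono_neutral_right)
    show "(\<lambda>i. p * (n' - i)) ` {0..n'} \<subseteq> {0..n}"
      by (auto simp: n_def diff_mult_distrib2)
    show "\<forall>i\<in>{0..n} - (\<lambda>i. p * (n' - i)) ` {0..n'}.
       (if p dvd i then (geom_fps ^ Suc b2) $ (i div p) else 0) * F $ (n - i) = 0"
    proof
      fix l assume l: "l \<in> {0..n} - (\<lambda>i. p * (n' - i)) ` {0..n'}"
      have "\<not> p dvd l"
      proof
        assume "p dvd l"
        then obtain r where r: "l = p * r" by blast
        have "p * r < p * Suc n'" using l r assms unfolding n_def by simp
        then have "r \<le> n'" by (simp only: nat_mult_less_cancel_disj) simp
        then have "l = p * (n' - (n' - r))" "n' - r \<in> {0..n'}" using r by auto
        then show False using l by blast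
      qed
      then show "(if p dvd l then (geom_fps ^ Suc b2) $ (l div p) else 0) * F $ (n - l) = 0" by simp
    qed
  qed simp
  also have "\<dots> = (\<Sum>i=0..n'. (geom_fps ^ Suc b2) $ (n' - i) * F $ (n - p * (n' - i)))"
    by (subst sum.reindex) (use p in \<open>auto simp: inj_on_def simp del: power_Suc\<close>)
  also have "\<dots> = frob_sum p b2 b1 a n' 0"
    unfolding frob_sum_def
  proof (rule sum.cong[OF refl])
    fix i assume i: "i \<in> {0..n'}"
    have "n - p * (n' - i) = a + p * i"
    proof -
      have "p * n' = p * (n' - i) + p * i" using i by (simp add: distrib_left[symmetric])
      then show ?thesis by (simp add: n_def)
    qed
    moreover have "nat (int a + int p * int i) = a + p * i" by (simp add: nat_eq_iff)
    moreover have "\<not> int a + int p * int i < 0" by (simp add: not_less)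
    ultimately show "(geom_fps ^ Suc b2) $ (n' - i) * F $ (n - p * (n' - i)) = rising_coeff b2 n' i *
         icoeff (frob_fps p (Suc b2) (Suc b1)) (int a + int p * int i - int 0)"
      using i by (simp add: rising_coeff_def geom_fps_power_nth icoeff_def F_def del: power_Suc)
  qed
  finally show ?thesis by (simp add: n_def)
qed

text \<open>The weighted recurrence is summed over \<open>i\<close>; by
  \<open>rising_coeff_step\<close> its right side is a telescoping difference of \<open>f\<close>.
  The upper end vanishes through the factor \<open>n' - i\<close>, and the lower end leaves the
  diagonal coefficient of the series with unraised exponents.\<close>

lemma frob_sum_step:
  fixes a p b1 b2 j n' :: nat
  assumes "p > 0" "j \<le> n'"
  defines "n \<equiv> int (p * n' + a)"
  shows "(n + int b1 - int j) * frob_sum p b2 b1 a n' (Suc j)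
    = (n - int j) * (frob_sum p b2 b1 a n' j
         - rising_coeff b2 n' j * icoeff (frob_fps p (Suc b2) (Suc b1)) (int a + (int p - 1) * int j))
      + int p * (int n' - int j) * rising_coeff b2 n' j * icoeff (frob_fps p b2 b1) (int a + (int p - 1) * int j)"
proof -
  define w where "w = rising_coeff b2 n'"
  define c where "c = icoeff (frob_fps p b2 b1)"
  define c1 where "c1 = icoeff (frob_fps p (Suc b2) (Suc b1))"
  define f where "f i = w i * (int n' - int i) * c (int a + int p * int i - int j)" for i
  have rec: "(n + int b1 - int j) * (w i * c1 (int a + int p * int i - int (Suc j)))
     = (n - int j) * (w i * c1 (int a + int p * int i - int j)) - int p * (f i - f (i - 1))"
    if i: "i \<in> {Suc j..n'}" for i
  proof -
    obtain i' where i': "i = Suc i'" using i by (cases i) auto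
    have W: "w i * (int n' + int b2 - int i + 1) = w i' * (int n' - int i')"
      using rising_coeff_step[of n' i' b2] by (simp add: i' w_def algebra_simps)
    have "(n - int j) * c1 (int a + int p * int i - int j) - (n + int b1 - int j) * c1 (int a + int p * int i - (int j + 1))
    = int p * ((int n' - int i) * c (int a + int p * int i - int j) - (int n' + int b2 - int i + 1) * c (int a + int p * (int i - 1) - int j))"
      using frob_fps_coeff_rec[OF assms(1), of "int n'" "int a" "int j" b2 b1 "int i"]
      unfolding c_def c1_def n_def by simp
    then have "w i * ((n - int j) * c1 (int a + int p * int i - int j) - (n + int b1 - int j) * c1 (int a + int p * int i - (int j + 1)))
    = w i * (int p * ((int n' - int i) * c (int a + int p * int i - int j) - (int n' + int b2 - int i + 1) * c (int a + int p * (int i - 1) - int j)))"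
      by (simp only:)
    also have "\<dots> = int p * (w i * (int n' - int i) * c (int a + int p * int i - int j) - (w i * (int n' + int b2 - int i + 1)) * c (int a + int p * (int i - 1) - int j))"
      by (simp add: algebra_simps)
    also have "\<dots> = int p * (f i - f (i - 1))"
      unfolding W f_def by (simp add: i')
    finally show ?thesis by (simp add: algebra_simps)
  qed
  have tele: "(\<Sum>i = Suc j..n'. f i - f (i - 1)) = f n' - f j"
    using sum_telescope''[OF assms(2), of f] by (simp add: atLeastSucAtMost_greaterThanAtMost)
  have "(n + int b1 - int j) * frob_sum p b2 b1 a n' (Suc j)
     = (\<Sum>i = Suc j..n'. (n + int b1 - int j) * (w i * c1 (int a + int p * int i - int (Suc j))))"
    by (simp add: frob_sum_def w_def c1_def sum_distrib_left)
  also have "\<dots> = (\<Sum>i = Suc j..n'. (n - int j) * (w i * c1 (int a + int p * int i - int j)) - int p * (f i - f (i - 1)))"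
    by (rule sum.cong[OF refl rec])
  also have "\<dots> = (n - int j) * (\<Sum>i = Suc j..n'. w i * c1 (int a + int p * int i - int j)) - int p * (f n' - f j)"
    by (simp only: sum_subtractf[of _ "\<lambda>i. int p * (f i - f (i - 1))"] sum_distrib_left[symmetric] tele)
  also have "(\<Sum>i = Suc j..n'. w i * c1 (int a + int p * int i - int j))
     = frob_sum p b2 b1 a n' j - w j * c1 (int a + (int p - 1) * int j)"
    unfolding frob_sum_def using sum.atLeast_Suc_atMost[OF assms(2), of "\<lambda>i. w i * c1 (int a + int p * int i - int j)"]
    by (simp add: w_def c1_def algebra_simps)
  also have "f n' = 0" by (simp add: f_def)
  also have "f j = w j * (int n' - int j) * c (int a + (int p - 1) * int j)"
    by (simp add: f_def algebra_simps)
  finally show ?thesis by (simp add: w_def c_def c1_def algebra_simps)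
qed

text \<open>The sums telescope: modulo \<open>M\<close>, the recurrence multiplies what remains of the sum at \<open>j\<close>
  after subtracting a multiple of \<open>rising_coeff\<close> by a ratio of consecutive factors of the product, and nothing remains at \<open>j = K\<close>.\<close>

lemma frob_sum_trace:
  fixes M :: int
  assumes "a < p" and K: "K \<le> Suc n'"
    and n: "M dvd int (p * n' + a) - int n'" and b: "M dvd int b1 - int b2"
    and van: "\<And>i. i \<ge> K \<Longrightarrow> M dvd icoeff (frob_fps p (Suc b2) (Suc b1)) (int a + int p * int i - int K)"
  shows "M dvd (\<Prod>j<K. int (p * n' + a) - int j) *
    (int ((b1 + (p * n' + a)) choose (p * n' + a)) - int ((b2 + n') choose n') *
      (\<Sum>t<K. icoeff (frob_fps p (Suc b2) (Suc b1)) (int a + (int p - 1) * int t)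
           - int p * icoeff (frob_fps p b2 b1) (int a + (int p - 1) * int t)))"
proof -
  have p: "p > 0" using assms(1) by simp
  define N where "N = int (p * n' + a)"
  define w where "w = rising_coeff b2 n'"
  define R where "R = frob_sum p b2 b1 a n'"
  define c where "c t = icoeff (frob_fps p b2 b1) (int a + (int p - 1) * int t)" for t :: nat
  define c1 where "c1 t = icoeff (frob_fps p (Suc b2) (Suc b1)) (int a + (int p - 1) * int t)" for t :: nat
  define S where "S j = (\<Sum>t = j..<K. c1 t - int p * c t)" for j
  define E where "E j = R j - w j * S j" for j
  have step: "M dvd (N - int j) * E j - (N + int b1 - int j) * E (Suc j)" if j: "j < K" for j
  proof -
    have S: "S j = c1 j - int p * c j + S (Suc j)"
      unfolding S_def using j by (subst sum.atLeast_Suc_lessThan) simp_all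
    have R: "(N + int b1 - int j) * R (Suc j) = (N - int j) * (R j - w j * c1 j) + int p * (int n' - int j) * w j * c j"
      using frob_sum_step[OF p, of j n' a b1 b2] j K
      by (simp add: N_def R_def w_def c_def c1_def)
    have W: "(int n' - int j) * w j = (int b2 + int n' - int j) * w (Suc j)"
      using rising_coeff_step by (simp add: w_def)
    \<comment> \<open>The error is collected into multiples of \<open>N - n'\<close> and
      \<open>b1 - b2\<close>, the two quantities by which consecutive levels differ; both are
      divisible by \<open>M\<close>.\<close>
    have "(N - int j) * E j - (N + int b1 - int j) * E (Suc j)
       = (N - int n') * (int p * w j * c j - w j * S (Suc j) + w (Suc j) * S (Suc j)) + (int b1 - int b2) * (w (Suc j) * S (Suc j))"
    proof -
      have "((N - int j) * E j - (N + int b1 - int j) * E (Suc j))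
         - ((N - int n') * (int p * w j * c j - w j * S (Suc j) + w (Suc j) * S (Suc j)) + (int b1 - int b2) * (w (Suc j) * S (Suc j)))
       = ((N - int j) * (R j - w j * c1 j) + int p * (int n' - int j) * w j * c j - (N + int b1 - int j) * R (Suc j))
        + ((int b2 + int n' - int j) * w (Suc j) - (int n' - int j) * w j) * S (Suc j)"
          unfolding E_def S by (simp add: algebra_simps)
      then show ?thesis unfolding R W diff_self mult_zero_left add_0_left
        by (simp only: right_minus_eq)
    qed
    then show ?thesis using n b by (simp add: N_def)
  qed
  have ind: "M dvd (\<Prod>j<J. N - int j) * E 0 - (\<Prod>j<J. N + int b1 - int j) * E J" if "J \<le> K" for J
    using that
  proof (induction J)
    case (Suc J)
    have 1: "M dvd (N - int J) * ((\<Prod>j<J. N - int j) * E 0 - (\<Prod>j<J. N + int b1 - int j) * E J)"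
      using Suc by simp
    have 2: "M dvd (\<Prod>j<J. N + int b1 - int j) * ((N - int J) * E J - (N + int b1 - int J) * E (Suc J))"
      using step[of J] Suc.prems by simp
    have "(\<Prod>j<Suc J. N - int j) * E 0 - (\<Prod>j<Suc J. N + int b1 - int j) * E (Suc J)
      = (N - int J) * ((\<Prod>j<J. N - int j) * E 0 - (\<Prod>j<J. N + int b1 - int j) * E J)
      + (\<Prod>j<J. N + int b1 - int j) * ((N - int J) * E J - (N + int b1 - int J) * E (Suc J))"
      by (simp add: algebra_simps)
    then show ?case using dvd_add[OF 1 2] by simp
  qed simp
  have "M dvd R K" unfolding R_def frob_sum_def
    by (intro dvd_sum dvd_mult van) simp
  then have "M dvd E K" by (simp add: E_def S_def)
  then have "M dvd (\<Prod>j<K. N - int j) * E 0"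
    using dvd_add[OF ind[OF order_refl] dvd_mult[of M "E K" "\<Prod>j<K. N + int b1 - int j"]] by simp
  moreover have "E 0 = int ((b1 + (p * n' + a)) choose (p * n' + a)) - int ((b2 + n') choose n') * (\<Sum>t<K. c1 t - int p * c t)"
    unfolding E_def R_def w_def S_def frob_sum_0[OF assms(1)] by (simp add: rising_coeff_def atLeast0LessThan)
  ultimately show ?thesis by (simp add: N_def c_def c1_def)
qed

section \<open>Teichmueller representatives modulo powers of a prime\<close>

lemma cong_power_prime_step:
  fixes a b :: int
  assumes "[a = b] (mod int p ^ Suc j)"
  shows "[a ^ p = b ^ p] (mod int p ^ Suc (Suc j))"
proof (cases p)
  case (Suc q)
  have ab: "[a = b] (mod int p)"
    using assms by (rule cong_dvd_modulus) simp
  have "[(\<Sum>i<Suc q. a ^ i * b ^ (q - i)) = (\<Sum>i<Suc q. b ^ i * b ^ (q - i))] (mod int p)"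
    by (intro cong_sum cong_mult cong_pow ab cong_refl)
  moreover have "(\<Sum>i<Suc q. b ^ i * b ^ (q - i)) = int p * b ^ q"
    by (simp add: power_add[symmetric] Suc del: sum.lessThan_Suc)
  ultimately have "int p dvd (\<Sum>i<Suc q. a ^ i * b ^ (q - i))"
    by (simp add: cong_dvd_iff del: sum.lessThan_Suc)
  moreover have "int p ^ Suc j dvd a - b"
    using assms by (simp add: cong_iff_dvd_diff)
  ultimately have "int p ^ Suc j * int p dvd (a - b) * (\<Sum>i<Suc q. a ^ i * b ^ (q - i))"
    by (intro mult_dvd_mono)
  also have "(a - b) * (\<Sum>i<Suc q. a ^ i * b ^ (q - i)) = a ^ p - b ^ p"
    by (simp only: Suc diff_power_eq_sum)
  finally show ?thesis by (simp add: cong_iff_dvd_diff mult.commute)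
qed (use assms in simp)

lemma cong_power_prime_power:
  fixes a b :: int
  assumes "[a = b] (mod int p)"
  shows "[a ^ p ^ k = b ^ p ^ k] (mod int p ^ Suc k)"
proof (induction k)
  case (Suc k)
  from cong_power_prime_step[OF Suc] show ?case
    by (simp add: power_mult[symmetric] mult.commute)
qed (use assms in simp)

lemma cong_prime_power_lower:
  fixes a b :: int
  assumes "[a = b] (mod int p ^ n)" "m \<le> n"
  shows "[a = b] (mod int p ^ m)"
  using assms(1) by (rule cong_dvd_modulus) (simp add: le_imp_power_dvd assms(2))

locale odd_prime =
  fixes p :: nat
  assumes prime: "prime p" and gt2: "p > 2"
begin

lemma pos: "p > 0" and int_prime: "prime (int p)" and gt1: "p > 1"
  using prime prime_gt_0_nat prime_gt_1_nat by auto

lemma odd: "odd p"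
  using prime gt2 prime_odd_nat by blast

definition units :: "int set" where "units = {1..<int p}"

lemma finite_units [simp]: "finite units" by (simp add: units_def)

lemma card_units: "card units = p - 1" by (simp add: units_def)

lemma units_not_dvd: "x \<in> units \<Longrightarrow> \<not> int p dvd x"
  by (auto simp: units_def dest: zdvd_imp_le)

lemma mod_in_units: "\<not> int p dvd x \<Longrightarrow> x mod int p \<in> units"
  using pos pos_mod_bound[of "int p" x] pos_mod_sign[of "int p" x]
  by (auto simp: units_def dvd_eq_mod_eq_0 simp del: pos_mod_bound pos_mod_sign)

lemma units_eqI: "x \<in> units \<Longrightarrow> y \<in> units \<Longrightarrow> [x = y] (mod int p) \<Longrightarrow> x = y"
  by (auto simp: units_def cong_def)

lemma not_dvd_mult: "\<not> int p dvd x \<Longrightarrow> \<not> int p dvd y \<Longrightarrow> \<not> int p dvd x * y"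
  using int_prime by (simp add: prime_dvd_mult_iff)

lemma not_dvd_power: "\<not> int p dvd x \<Longrightarrow> \<not> int p dvd x ^ n"
  using int_prime prime_dvd_power by blast

lemma coprime_power: "\<not> int p dvd x \<Longrightarrow> coprime x (int p ^ k)"
  using int_prime by (metis coprime_commute coprime_power_left_iff prime_imp_coprime)

lemma cong_cancel:
  assumes "[c * x = c * y] (mod int p ^ k)" "\<not> int p dvd c"
  shows "[x = y] (mod int p ^ k)"
  using assms coprime_power cong_mult_lcancel by blast

lemma fermat_int:
  assumes "\<not> int p dvd x" shows "[x ^ (p - 1) = 1] (mod int p)"
proof -
  define y where "y = nat (x mod int p)"
  have y: "int y = x mod int p" using pos by (simp add: y_def)
  have "\<not> p dvd y" using assms by (metis y dvd_mod_iff int_dvd_int_iff dvd_refl)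
  then have "[y ^ (p - 1) = 1] (mod p)" using fermat_theorem prime by blast
  then have "[int y ^ (p - 1) = 1] (mod int p)"
    by (metis cong_int_iff of_nat_1 of_nat_power)
  moreover have "[int y ^ (p - 1) = x ^ (p - 1)] (mod int p)"
    by (intro cong_pow) (simp add: y)
  ultimately show ?thesis using cong_sym cong_trans by blast
qed

lemma power_p_cong: "[x ^ p = x] (mod int p)" for x :: int
proof (cases "int p dvd x")
  case True
  then show ?thesis using pos
    by (metis cong_0_iff cong_sym cong_trans dvd_power dvd_trans)
next
  case False
  have "x ^ p = x ^ (p - 1) * x" using pos by (simp add: power_eq_if mult.commute)
  then show ?thesis using cong_mult[OF fermat_int[OF False] cong_refl[of x]] by simp
qed

text \<open>Modulo \<open>p ^ k\<close> this is the Teichmueller representative of \<open>x\<close>.\<close>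

definition tpow :: "nat \<Rightarrow> int \<Rightarrow> int" where "tpow k x = x ^ p ^ k"

lemma tpow_mult: "tpow k (x * y) = tpow k x * tpow k y"
  by (simp add: tpow_def power_mult_distrib)

lemma tpow_1 [simp]: "tpow k 1 = 1"
  by (simp add: tpow_def)

lemma tpow_cong:
  assumes "[x = y] (mod int p)" shows "[tpow k x = tpow k y] (mod int p ^ k)"
  unfolding tpow_def
  by (rule cong_prime_power_lower[OF cong_power_prime_power[OF assms]]) simp

lemma tpow_Suc_cong: "[tpow (Suc k) x = tpow k x] (mod int p ^ Suc k)"
  using cong_power_prime_power[OF power_p_cong, of x k]
  by (simp add: tpow_def power_mult[symmetric] mult.commute)

lemma tpow_lower_cong:
  assumes "k \<le> N" shows "[tpow N x = tpow k x] (mod int p ^ k)"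
  using assms
proof (induction N rule: dec_induct)
  case (step n)
  have "[tpow (Suc n) x = tpow n x] (mod int p ^ k)"
    by (rule cong_prime_power_lower[OF tpow_Suc_cong]) (use step in simp)
  then show ?case using step.IH cong_trans by blast
qed simp

lemma tpow_cong_self: "[tpow k x = x] (mod int p)"
proof (induction k)
  case (Suc k)
  have "[(x ^ p ^ k) ^ p = x ^ p ^ k] (mod int p)" by (rule power_p_cong)
  then show ?case using Suc cong_trans
    by (auto simp: tpow_def power_mult[symmetric] mult.commute)
qed (simp add: tpow_def)

lemma tpow_not_dvd: "\<not> int p dvd x \<Longrightarrow> \<not> int p dvd tpow k x"
  by (simp add: tpow_def not_dvd_power)

lemma tpow_order:
  assumes "\<not> int p dvd x" shows "[tpow k x ^ (p - 1) = 1] (mod int p ^ k)"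
  using tpow_cong[OF fermat_int[OF assms], of k]
  by (simp add: tpow_def power_mult[symmetric] mult.commute)

lemma tpow_power_mult:
  assumes "\<not> int p dvd x" "(p - 1) dvd e" shows "[tpow k x ^ e = 1] (mod int p ^ k)"
proof -
  obtain r where "e = (p - 1) * r" using assms(2) by blast
  then show ?thesis
    using cong_pow[OF tpow_order[OF assms(1), of k], of r] by (simp add: power_mult)
qed

lemma bij_betw_units_mult:
  assumes "\<not> int p dvd c"
  shows "bij_betw (\<lambda>x. (c * x) mod int p) units units"
proof -
  have "inj_on (\<lambda>x. (c * x) mod int p) units"
  proof (rule inj_onI)
    fix x y assume xy: "x \<in> units" "y \<in> units" "c * x mod int p = c * y mod int p"
    have "[c * x = c * y] (mod int p ^ 1)" using xy(3) by (simp add: cong_def)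
    from cong_cancel[OF this assms] show "x = y"
      using units_eqI[OF xy(1,2)] by simp
  qed
  moreover have "(\<lambda>x. (c * x) mod int p) ` units \<subseteq> units"
    using mod_in_units not_dvd_mult units_not_dvd assms by blast
  ultimately show ?thesis
    by (simp add: bij_betw_def endo_inj_surj)
qed

lemma sum_units_mult:
  assumes "\<not> int p dvd c"
  shows "(\<Sum>x\<in>units. f ((c * x) mod int p)) = (\<Sum>x\<in>units. f x)"
  using sum.reindex_bij_betw[OF bij_betw_units_mult[OF assms]] .

lemma exists_generator:
  obtains g :: int where "\<not> int p dvd g"
    "\<And>x. \<not> int p dvd x \<Longrightarrow> \<exists>i<p - 1. [x = g ^ i] (mod int p)"
    "\<And>e. [g ^ e = 1] (mod int p) \<longleftrightarrow> (p - 1) dvd e"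
proof -
  obtain g where g: "residue_primroot p g"
    using prime_primitive_root_exists[of p] prime gt1 by (auto simp: prime_gt_1_nat)
  have cop: "coprime p g" and ord: "ord p g = p - 1"
    using g totient_prime[OF prime] by (auto simp: residue_primroot_def)
  show thesis
  proof (rule that[of "int g"])
    show "\<not> int p dvd int g"
      using cop gt1 by (metis coprime_absorb_left int_dvd_int_iff nat_neq_iff coprime_commute is_unit_gcd gcd_nat.absorb1 nat_dvd_1_iff_1)
    show "[int g ^ e = 1] (mod int p) \<longleftrightarrow> (p - 1) dvd e" for e
      using ord_divides[of g e p] ord by (metis cong_int_iff of_nat_1 of_nat_power)
    show "\<exists>i<p - 1. [x = int g ^ i] (mod int p)" if x: "\<not> int p dvd x" for x
    proof -
      define y where "y = nat (x mod int p)"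
      have y: "int y = x mod int p" using pos by (simp add: y_def)
      have xu: "x mod int p \<in> units" using mod_in_units[OF x] .
      have "y \<in> totatives p"
        using xu y prime unfolding units_def
        by (auto simp: totatives_prime)
      then obtain i where i: "i < totient p" "y = g ^ i mod p"
        using residue_primroot_is_generator[OF gt1 g] by (auto simp: bij_betw_def)
      have "[int y = int g ^ i] (mod int p)"
        unfolding i(2) by (simp add: zmod_int)
      moreover have "[x = int y] (mod int p)" by (simp add: y)
      ultimately have "[x = int g ^ i] (mod int p)" using cong_trans by blast
      then show ?thesis using i(1) totient_prime[OF prime] by auto
    qed
  qed
qed

text \<open>Multiplying the summation variable by a generator multiplies the sum by
  \<open>tpow k g ^ e\<close>. If \<open>p - 1\<close> does not divide \<open>e\<close>, this factor
  differs from 1 already modulo \<open>p\<close>, so its difference from 1 can be cancelled modulo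
  \<open>p ^ k\<close>.\<close>

lemma sum_tpow_power:
  "[(\<Sum>x\<in>units. tpow k x ^ e) = (if (p - 1) dvd e then int p - 1 else 0)] (mod int p ^ k)"
proof (cases "(p - 1) dvd e")
  case True
  have "[(\<Sum>x\<in>units. tpow k x ^ e) = (\<Sum>x\<in>units. 1)] (mod int p ^ k)"
    by (intro cong_sum tpow_power_mult units_not_dvd True)
  then show ?thesis using True pos by (simp add: card_units of_nat_diff)
next
  case False
  obtain g where g: "\<not> int p dvd g" "\<And>e. [g ^ e = 1] (mod int p) \<longleftrightarrow> (p - 1) dvd e"
    using exists_generator by metis
  define S where "S = (\<Sum>x\<in>units. tpow k x ^ e)"
  have "S = (\<Sum>x\<in>units. tpow k ((g * x) mod int p) ^ e)"
    unfolding S_def using sum_units_mult[OF g(1), of "\<lambda>x. tpow k x ^ e"] by simp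
  also have "[\<dots> = (\<Sum>x\<in>units. tpow k (g * x) ^ e)] (mod int p ^ k)"
    by (intro cong_sum cong_pow tpow_cong) simp
  also have "(\<Sum>x\<in>units. tpow k (g * x) ^ e) = tpow k g ^ e * S"
    by (simp add: tpow_mult power_mult_distrib sum_distrib_left S_def)
  finally have "[(tpow k g ^ e - 1) * S = (tpow k g ^ e - 1) * 0] (mod int p ^ k)"
    by (simp add: cong_iff_dvd_diff algebra_simps dvd_diff_commute)
  moreover have "\<not> int p dvd tpow k g ^ e - 1"
  proof
    assume "int p dvd tpow k g ^ e - 1"
    then have "[tpow k g ^ e = 1] (mod int p)" by (simp add: cong_iff_dvd_diff)
    moreover have "[tpow k g ^ e = g ^ e] (mod int p)"
      by (intro cong_pow tpow_cong_self)
    ultimately show False using g(2) False cong_sym cong_trans by blast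
  qed
  ultimately have "[S = 0] (mod int p ^ k)" by (rule cong_cancel)
  then show ?thesis using False by (simp add: S_def)
qed

end

text \<open>Equal to \<open>(p ^ N - 1) / (p - 1)\<close> for \<open>p > 1\<close>, hence congruent
  to \<open>- 1 / (p - 1)\<close> modulo \<open>p ^ N\<close>. For a digit \<open>a < p\<close>, the
  number \<open>a * repunit p N\<close> has \<open>N\<close> base-p digits, all equal to
  \<open>a\<close>, and truncates \<open>- a / (p - 1)\<close>.\<close>

definition repunit :: "nat \<Rightarrow> nat \<Rightarrow> nat" where "repunit p N = (\<Sum>i<N. p ^ i)"

lemma repunit_0 [simp]: "repunit p 0 = 0"
  by (simp add: repunit_def)

lemma repunit_Suc: "repunit p (Suc N) = p * repunit p N + 1"
  unfolding repunit_def by (subst sum.lessThan_Suc_shift) (simp add: sum_distrib_left)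

lemma repunit_Suc_add: "repunit p (Suc N) = repunit p N + p ^ N"
  by (simp add: repunit_def)

lemma repunit_mult: "p > 0 \<Longrightarrow> (p - 1) * repunit p N + 1 = p ^ N"
proof (induction N)
  case (Suc N)
  have "(p - 1) * repunit p (Suc N) + 1 = ((p - 1) * repunit p N + 1) + (p - 1) * p ^ N"
    by (simp add: repunit_Suc_add distrib_left)
  then show ?case using Suc by (cases p) auto
qed simp

lemma one_minus_X_power_eq:
  "1 - monom 1 n = ([:1, -1:] :: int poly) * (\<Sum>i<n. monom 1 i)"
proof (induction n)
  case (Suc n)
  have "([:1, -1:] :: int poly) * monom 1 n = monom 1 n - monom 1 (Suc n)"
    by (simp add: monom_altdef algebra_simps)
  then show ?case using Suc by (simp add: distrib_left)
qed simp

context odd_prime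
begin

text \<open>Modulo \<open>p\<close> the polynomials \<open>1 - X ^ p\<close> and
  \<open>(1 - X) ^ p\<close> agree, and a factor \<open>1 - X\<close> can be removed because
  \<open>p\<close> is a prime element of the integral polynomials. The degree of \<open>h\<close> is
  recorded because it controls the degree of the polynomial \<open>G\<close> below.\<close>

lemma cyclotomic_cong:
  obtains h :: "int poly" where "degree h \<le> p - 1"
    "(\<Sum>i<p. monom 1 i) = [:1, -1:] ^ (p - 1) + smult (int p) h"
proof -
  define q :: "int poly" where "q = (\<Sum>i<p. monom 1 i)"
  define d where "d = q - [:1, -1:] ^ (p - 1)"
  have X: "[:1, -1:] = 1 + (- monom 1 1 :: int poly)"
    by (simp add: monom_altdef one_pCons)
  have "[:1, -1:] * d = (1 - monom 1 p) - [:1, -1:] ^ p"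
    using pos by (simp only: d_def q_def one_minus_X_power_eq right_diff_distrib) (simp add: power_eq_if)
  also have "[:int p:] dvd \<dots>"
  proof -
    have "([:1, -1:] :: int poly) ^ p = (\<Sum>k\<le>p. of_nat (p choose k) * 1 ^ k * (- monom 1 1) ^ (p - k))"
      unfolding X by (rule binomial_ring)
    also have "{..p} = insert 0 (insert p {0<..<p})" using pos by auto
    finally have "([:1, -1:] :: int poly) ^ p = (- monom 1 1) ^ p + 1 + (\<Sum>k\<in>{0<..<p}. of_nat (p choose k) * 1 ^ k * (- monom 1 1) ^ (p - k))"
      using pos by simp
    also have "(- monom 1 1) ^ p = - (monom 1 p :: int poly)"
      using odd by (simp add: monom_power)
    finally have "(1 - monom 1 p) - ([:1, -1:] :: int poly) ^ p = - (\<Sum>k\<in>{0<..<p}. of_nat (p choose k) * 1 ^ k * (- monom 1 1) ^ (p - k))"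
      by simp
    moreover have "[:int p:] dvd (of_nat (p choose k) :: int poly)" if "k \<in> {0<..<p}" for k
    proof -
      have "p dvd (p choose k)" using that by (intro dvd_choose_prime prime) auto
      then show ?thesis by (metis of_nat_dvd_iff of_nat_poly of_nat_mult dvd_def)
    qed
    ultimately show ?thesis by (auto intro!: dvd_sum dvd_mult2)
  qed
  finally have "[:int p:] dvd [:1, -1:] * d" .
  moreover have "prime_elem [:int p:]"
    using int_prime by (intro lift_prime_elem_poly) simp
  moreover have "\<not> [:int p:] dvd [:1, -1:]"
    using gt1 by (auto simp: const_poly_dvd_iff intro!: exI[of _ 0])
  ultimately have "[:int p:] dvd d" using prime_elem_dvd_multD by blast
  then obtain h where h: "d = smult (int p) h" by auto
  have "degree q \<le> p - 1"
    unfolding q_def by (rule degree_sum_le) (auto intro: order_trans[OF degree_monom_le])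
  moreover have "degree ([:1, -1:] ^ (p - 1) :: int poly) \<le> p - 1"
    by (rule order_trans[OF degree_power_le]) simp
  ultimately have "degree d \<le> p - 1"
    unfolding d_def by (rule degree_diff_le)
  then have "degree h \<le> p - 1" using h pos by simp
  then show thesis using that h by (simp add: d_def q_def)
qed

text \<open>With \<open>q = 1 + X + ... + X ^ (p - 1)\<close> the series is
  \<open>q ^ b2 / (1 - X) ^ (b * p ^ N)\<close>. Writing
  \<open>q = (1 - X) ^ (p - 1) + p * h\<close> and expanding, terms with at least \<open>k\<close>
  factors \<open>p * h\<close> vanish. For \<open>l < k\<close> the powers of \<open>1 - X\<close>
  leave the exponent \<open>(p - 1) * (s - l) - b\<close>, positive because
  \<open>l < k \<le> s\<close>; this is the purpose of the shift \<open>s\<close>, and it also gives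
  the zero at 1.\<close>

lemma frob_fps_cong_poly:
  fixes b k s N :: nat
  assumes b: "b \<le> p - 2" and ks: "k \<le> s"
  defines "b2 \<equiv> s + b * repunit p N"
  obtains G :: "int poly" where "degree G \<le> (p - 1) * s - b" "poly G 1 = 0"
    "[:int p ^ k:] dvd (\<Sum>i<p. monom 1 i) ^ b2 - G * [:1, -1:] ^ (b * p ^ N)"
    "\<And>m. [frob_fps p b2 (s + b * repunit p (Suc N)) $ m = coeff G m] (mod int p ^ k)"
proof -
  define q :: "int poly" where "q = (\<Sum>i<p. monom 1 i)"
  define D where "D = b * p ^ N"
  obtain h where h: "degree h \<le> p - 1" "q = [:1, -1:] ^ (p - 1) + smult (int p) h"
    using cyclotomic_cong unfolding q_def by blast
  define f where "f l = of_nat (b2 choose l) * smult (int p) h ^ l" for l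
  \<comment> \<open>By \<open>(p - 1) * repunit p N + 1 = p ^ N\<close> the large exponents
    depending on \<open>N\<close> cancel, leaving only \<open>s\<close> and
    \<open>b\<close>.\<close>
  have D: "(p - 1) * b2 + b = (p - 1) * s + D"
  proof -
    have "(p - 1) * b2 + b = (p - 1) * s + b * ((p - 1) * repunit p N + 1)"
      by (simp add: b2_def algebra_simps)
    then show ?thesis using repunit_mult[OF pos, of N] by (simp only: D_def)
  qed
  define G where "G = (\<Sum>l<k. f l * [:1, -1:] ^ ((p - 1) * (b2 - l) - D))"
  have kb2: "k \<le> b2" using ks by (simp add: b2_def)
  have e: "(p - 1) * (b2 - l) - D = (p - 1) * (s - l) - b" "(p - 1) * (b2 - l) \<ge> D" "b < (p - 1) * (s - l)" if "l < k" for l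
  proof -
    have "l < s" "l \<le> b2" using that ks kb2 by auto
    have 1: "(p - 1) * (b2 - l) + b = (p - 1) * (s - l) + D"
      using D \<open>l < s\<close> \<open>l \<le> b2\<close>
      by (smt (verit) add.assoc add.commute add_left_cancel diff_mult_distrib2 le_add_diff_inverse less_imp_le mult_le_mono2)
    have "b < p - 1" using b gt2 by linarith
    also have "p - 1 \<le> (p - 1) * (s - l)" using \<open>l < s\<close> by (simp add: Suc_le_eq)
    finally show "b < (p - 1) * (s - l)" .
    then show "(p - 1) * (b2 - l) - D = (p - 1) * (s - l) - b" "(p - 1) * (b2 - l) \<ge> D" using 1 by linarith+
  qed
  have "q ^ b2 = (\<Sum>l\<le>b2. f l * [:1, -1:] ^ ((p - 1) * (b2 - l)))"
    unfolding h(2) add.commute[of _ "smult (int p) h"] binomial_ring f_def power_mult ..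
  also have "{..b2} = {..<k} \<union> {k..b2}" using kb2 by auto
  also have "(\<Sum>l\<in>{..<k} \<union> {k..b2}. f l * [:1, -1:] ^ ((p - 1) * (b2 - l)))
     = (\<Sum>l<k. f l * [:1, -1:] ^ ((p - 1) * (b2 - l))) + (\<Sum>l=k..b2. f l * [:1, -1:] ^ ((p - 1) * (b2 - l)))"
    by (rule sum.union_disjoint) auto
  also have "(\<Sum>l<k. f l * [:1, -1:] ^ ((p - 1) * (b2 - l))) = G * [:1, -1:] ^ D"
    unfolding G_def sum_distrib_right
  proof (rule sum.cong[OF refl])
    fix l assume "l \<in> {..<k}"
    then have "(p - 1) * (b2 - l) = ((p - 1) * (b2 - l) - D) + D" using e(2) by simp
    then show "f l * [:1, - 1:] ^ ((p - 1) * (b2 - l)) = f l * [:1, - 1:] ^ ((p - 1) * (b2 - l) - D) * [:1, - 1:] ^ D"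
      by (metis power_add mult.assoc)
  qed
  finally have eq: "q ^ b2 - G * [:1, -1:] ^ D = (\<Sum>l=k..b2. f l * [:1, -1:] ^ ((p - 1) * (b2 - l)))"
    by simp
  have dvd: "[:int p ^ k:] dvd q ^ b2 - G * [:1, -1:] ^ D"
    unfolding eq
  proof (intro dvd_sum dvd_mult2)
    fix l assume "l \<in> {k..b2}"
    then have "int p ^ k dvd int p ^ l" by (simp add: le_imp_power_dvd)
    then have "[:int p ^ k:] dvd smult (int p) h ^ l"
      unfolding smult_power by (auto simp: const_poly_dvd_iff)
    then show "[:int p ^ k:] dvd f l" unfolding f_def by (rule dvd_mult)
  qed
  have deg: "degree G \<le> (p - 1) * s - b"
    unfolding G_def
  proof (rule degree_sum_le)
    fix l assume "l \<in> {..<k}"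
    then have l: "l < k" by simp
    have "degree (f l) \<le> l * (p - 1)"
    proof -
      have "degree (smult (int p) h ^ l) \<le> degree (smult (int p) h) * l" by (rule degree_power_le)
      also have "\<dots> \<le> l * (p - 1)" using h(1) by simp
      finally have *: "degree (smult (int p) h ^ l) \<le> l * (p - 1)" .
      show ?thesis unfolding f_def
        by (rule order_trans[OF degree_mult_le]) (use * in simp)
    qed
    moreover have "degree ([:1, -1:] ^ ((p - 1) * (s - l) - b) :: int poly) \<le> (p - 1) * (s - l) - b"
      by (rule order_trans[OF degree_power_le]) simp
    moreover have "l * (p - 1) + ((p - 1) * (s - l) - b) = (p - 1) * s - b"
    proof -
      have "(p - 1) * s = l * (p - 1) + (p - 1) * (s - l)"
        using l ks by (simp add: mult.commute[of l] distrib_left[symmetric])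
      then show ?thesis using e(3)[OF l] by linarith
    qed
    ultimately show "degree (f l * [:1, -1:] ^ ((p - 1) * (b2 - l) - D)) \<le> (p - 1) * s - b"
      unfolding e(1)[OF l] by (intro order_trans[OF degree_mult_le]) linarith
  qed simp
  have G1: "poly G 1 = 0"
    unfolding G_def poly_sum by (rule sum.neutral) (use e in \<open>auto simp: poly_power\<close>)
  have coeff: "[frob_fps p b2 (s + b * repunit p (Suc N)) $ m = coeff G m] (mod int p ^ k)" for m
  proof -
    have s: "s + b * repunit p (Suc N) = b2 + D"
      by (simp add: b2_def D_def repunit_Suc_add algebra_simps)
    have X: "fps_of_poly [:1, -1:] = (1 - fps_X :: int fps)"
      by (simp add: fps_of_poly_pCons numeral_fps_const)
    have Q: "fps_of_poly q * (1 - fps_X) = 1 - fps_X ^ p"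
      using arg_cong[OF one_minus_X_power_eq[of p], of fps_of_poly]
      by (simp only: fps_of_poly_diff fps_of_poly_mult fps_of_poly_1 fps_of_poly_monom' X q_def mult.commute)
    have g: "(1 - fps_X) ^ n * geom_fps ^ n = 1" for n
      by (simp only: power_mult_distrib[symmetric] one_minus_X_mult_geom power_one)
    have "frob_fps p b2 (b2 + D) = fps_of_poly q ^ b2 * geom_fps ^ D"
      unfolding frob_fps_def Q[symmetric] power_mult_distrib power_add
      using g[of b2] by (simp only: mult.assoc mult.left_commute[of "geom_fps ^ D"] mult_1_right flip: mult.assoc) (metis mult.assoc mult_1_right)
    moreover obtain H where "q ^ b2 - G * [:1, -1:] ^ D = [:int p ^ k:] * H" using dvd by blast
    then have "fps_of_poly q ^ b2 = fps_of_poly G * (1 - fps_X) ^ D + fps_const (int p ^ k) * fps_of_poly H"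
      unfolding X[symmetric] by (simp only: fps_of_poly_power[symmetric] fps_of_poly_mult[symmetric] fps_of_poly_add[symmetric] fps_of_poly_const[symmetric])
        (simp add: algebra_simps)
    ultimately have "frob_fps p b2 (b2 + D) = fps_of_poly G * ((1 - fps_X) ^ D * geom_fps ^ D) + fps_const (int p ^ k) * (fps_of_poly H * geom_fps ^ D)"
      by (simp add: algebra_simps)
    then have "frob_fps p b2 (b2 + D) $ m = coeff G m + int p ^ k * (fps_of_poly H * geom_fps ^ D) $ m"
      unfolding g by simp
    then show ?thesis unfolding s by (simp add: cong_iff_dvd_diff)
  qed
  show thesis using that[OF deg G1] dvd coeff unfolding q_def D_def by blast
qed

end

lemma repunit_ge: "p > 0 \<Longrightarrow> N \<le> repunit p N"
proof (induction N)
  case (Suc N)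
  moreover have "p ^ N \<ge> 1" using Suc by simp
  ultimately show ?case unfolding repunit_Suc_add by linarith
qed simp

section \<open>Jacobi sums as traces, and the shifted comparison of binomial coefficients\<close>

context odd_prime
begin

text \<open>The Jacobi sum, modulo \<open>p ^ k\<close>, of the characters \<open>\<omega>\<close> to the powers \<open>- i\<close> and \<open>- j\<close>.\<close>

definition jac :: "nat \<Rightarrow> nat \<Rightarrow> nat \<Rightarrow> int" where
  "jac k i j = (\<Sum>x\<in>{2..<int p}. tpow k x ^ (p - 1 - i) * tpow k (1 - x) ^ (p - 1 - j))"

lemma range2_not_dvd:
  assumes "x \<in> {2..<int p}" shows "\<not> int p dvd x" "\<not> int p dvd 1 - x"
proof -
  show "\<not> int p dvd x" using assms units_not_dvd[of x] by (auto simp: units_def)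
  have "\<not> int p dvd x - 1" using assms units_not_dvd[of "x - 1"] by (auto simp: units_def)
  then show "\<not> int p dvd 1 - x" by (simp add: dvd_diff_commute)
qed

text \<open>A Teichmueller representative satisfies \<open>\<tau> ^ p = \<tau>\<close>, so
  \<open>q\<close> takes the value 1 at \<open>\<tau>\<close> when \<open>1 - \<tau>\<close> is a
  unit. Hence \<open>G\<close> inverts \<open>(1 - \<tau>) ^ (b * p ^ N)\<close>, and raising to the
  power \<open>p ^ N\<close> turns \<open>1 - \<tau>\<close> into the representative of
  \<open>1 - x\<close>.\<close>

lemma poly_cong_at_tpow:
  assumes x: "x \<in> {2..<int p}" and kN: "k \<le> N" and b: "b \<le> p - 1"
    and G: "[:int p ^ k:] dvd (\<Sum>i<p. monom 1 i) ^ b2 - G * [:1, -1:] ^ (b * p ^ N)"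
  shows "[poly G (tpow k x) = tpow k (1 - x) ^ (p - 1 - b)] (mod int p ^ k)"
proof -
  define \<tau> where "\<tau> = tpow k x"
  define q :: "int poly" where "q = (\<Sum>i<p. monom 1 i)"
  note nd = range2_not_dvd[OF x]
  have \<tau>x: "[1 - \<tau> = 1 - x] (mod int p)"
    unfolding \<tau>_def by (intro cong_diff cong_refl tpow_cong_self)
  then have nd\<tau>: "\<not> int p dvd 1 - \<tau>" using nd(2) cong_dvd_iff by blast
  have "[\<tau> ^ p = \<tau>] (mod int p ^ k)"
    using cong_prime_power_lower[OF tpow_Suc_cong[of k x], of k]
    by (simp add: \<tau>_def tpow_def power_mult[symmetric] mult.commute)
  then have "[(1 - \<tau>) * poly q \<tau> = (1 - \<tau>) * 1] (mod int p ^ k)"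
  proof -
    assume "[\<tau> ^ p = \<tau>] (mod int p ^ k)"
    then have "[1 - \<tau> ^ p = 1 - \<tau>] (mod int p ^ k)" by (intro cong_diff cong_refl)
    moreover have "1 - \<tau> ^ p = (1 - \<tau>) * poly q \<tau>"
      using arg_cong[OF one_minus_X_power_eq[of p], of "\<lambda>f. poly f \<tau>"]
      by (simp add: q_def[symmetric] poly_monom algebra_simps)
    ultimately show ?thesis by simp
  qed
  then have q1: "[poly q \<tau> = 1] (mod int p ^ k)"
    using nd\<tau> by (rule cong_cancel)
  obtain H where "q ^ b2 - G * [:1, -1:] ^ (b * p ^ N) = [:int p ^ k:] * H"
    using G unfolding q_def by blast
  from arg_cong[OF this, of "\<lambda>f. poly f \<tau>"]
  have "poly q \<tau> ^ b2 - poly G \<tau> * (1 - \<tau>) ^ (b * p ^ N) = int p ^ k * poly H \<tau>"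
    by (simp add: poly_power)
  then have "[poly q \<tau> ^ b2 = poly G \<tau> * (1 - \<tau>) ^ (b * p ^ N)] (mod int p ^ k)"
    by (simp add: cong_iff_dvd_diff)
  then have 1: "[1 = poly G \<tau> * (1 - \<tau>) ^ (b * p ^ N)] (mod int p ^ k)"
    using cong_pow[OF q1, of b2] by (metis cong_sym cong_trans power_one)
  have "[(1 - \<tau>) ^ (b * p ^ N) = tpow N (1 - x) ^ b] (mod int p ^ k)"
  proof -
    have "[tpow N (1 - \<tau>) = tpow N (1 - x)] (mod int p ^ k)"
      using cong_prime_power_lower[OF tpow_cong[OF \<tau>x, of N] kN] .
    from cong_pow[OF this, of b] show ?thesis
      by (simp add: tpow_def power_mult[symmetric] mult.commute)
  qed
  also have "[tpow N (1 - x) ^ b = tpow k (1 - x) ^ b] (mod int p ^ k)"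
    by (intro cong_pow tpow_lower_cong kN)
  finally have "[poly G \<tau> * (1 - \<tau>) ^ (b * p ^ N) = poly G \<tau> * tpow k (1 - x) ^ b] (mod int p ^ k)"
    by (intro cong_mult cong_refl)
  with 1 have 2: "[tpow k (1 - x) ^ b * poly G \<tau> = 1] (mod int p ^ k)"
    by (metis cong_sym cong_trans mult.commute)
  have 3: "[tpow k (1 - x) ^ b * tpow k (1 - x) ^ (p - 1 - b) = 1] (mod int p ^ k)"
    using tpow_order[OF nd(2), of k] by (simp only: power_add[symmetric] le_add_diff_inverse[OF b])
  have "[tpow k (1 - x) ^ b * poly G \<tau> = tpow k (1 - x) ^ b * tpow k (1 - x) ^ (p - 1 - b)] (mod int p ^ k)"
    using 2 3 cong_sym cong_trans by blast
  then show ?thesis unfolding \<tau>_def[symmetric]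
    by (rule cong_cancel) (intro not_dvd_power tpow_not_dvd nd)
qed

text \<open>Orthogonality keeps the coefficients of \<open>G\<close> whose index is congruent to
  \<open>a\<close> modulo \<open>p - 1\<close>; as \<open>1 \<le> a \<le> p - 2\<close>, these
  indices are \<open>a + (p - 1) * t\<close>.\<close>

lemma sum_poly_tpow:
  assumes a: "1 \<le> a" "a \<le> p - 2" and K: "degree G < a + (p - 1) * K"
  shows "[(\<Sum>x\<in>units. tpow k x ^ (p - 1 - a) * poly G (tpow k x))
    = (int p - 1) * (\<Sum>t<K. coeff G (a + (p - 1) * t))] (mod int p ^ k)"
proof -
  define L where "L = a + (p - 1) * K"
  define A where "A = {m\<in>{..<L}. (p - 1) dvd (p - 1 - a + m)}"
  have "poly G y = (\<Sum>m<L. coeff G m * y ^ m)" for y :: int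
    unfolding poly_altdef
    by (rule sum.mono_neutral_left) (use K in \<open>auto simp: L_def coeff_eq_0 not_le\<close>)
  then have "(\<Sum>x\<in>units. tpow k x ^ (p - 1 - a) * poly G (tpow k x))
     = (\<Sum>x\<in>units. \<Sum>m<L. coeff G m * tpow k x ^ (p - 1 - a + m))"
    by (simp add: sum_distrib_left power_add mult.assoc mult.left_commute)
  also have "\<dots> = (\<Sum>m<L. coeff G m * (\<Sum>x\<in>units. tpow k x ^ (p - 1 - a + m)))"
    by (subst sum.swap) (simp add: sum_distrib_left)
  also have "[\<dots> = (\<Sum>m<L. coeff G m * (if (p - 1) dvd (p - 1 - a + m) then int p - 1 else 0))] (mod int p ^ k)"
    by (intro cong_sum cong_mult cong_refl sum_tpow_power)
  also have "(\<Sum>m<L. coeff G m * (if (p - 1) dvd (p - 1 - a + m) then int p - 1 else 0))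
    = (int p - 1) * (\<Sum>m\<in>A. coeff G m)"
    unfolding A_def by (subst sum.inter_filter) (auto simp: sum_distrib_left intro!: sum.cong)
  also have "A = (\<lambda>t. a + (p - 1) * t) ` {..<K}"
  proof (intro equalityI subsetI)
    fix m assume m: "m \<in> A"
    then obtain r where r: "p - 1 - a + m = (p - 1) * r" by (auto simp: A_def)
    have "r \<noteq> 0"
    proof
      assume "r = 0" then have "p - 1 - a = 0" using r by simp
      then show False using a gt2 by simp
    qed
    then obtain t where t: "r = Suc t" by (cases r) auto
    have ma: "m = a + (p - 1) * t" using r a unfolding t by simp
    have "(p - 1) * t < (p - 1) * K" using m ma by (simp add: A_def L_def)
    then have "t < K" by simp
    then show "m \<in> (\<lambda>t. a + (p - 1) * t) ` {..<K}" using ma by blast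
  next
    fix m assume "m \<in> (\<lambda>t. a + (p - 1) * t) ` {..<K}"
    then obtain t where t: "t < K" "m = a + (p - 1) * t" by auto
    have "p - 1 - a + m = (p - 1) * Suc t" using a t by simp
    moreover have "m < L" using t gt2 by (simp add: L_def)
    ultimately show "m \<in> A" by (simp add: A_def)
  qed
  also have "(\<Sum>m\<in>(\<lambda>t. a + (p - 1) * t) ` {..<K}. coeff G m) = (\<Sum>t<K. coeff G (a + (p - 1) * t))"
    by (subst sum.reindex) (use gt2 in \<open>auto simp: inj_on_def\<close>)
  finally show ?thesis .
qed

text \<open>The trace as a Jacobi sum: the diagonal coefficients of the series are those of
  \<open>G\<close>, and summing them amounts to evaluating \<open>G\<close> at Teichmueller
  representatives. The point \<open>x = 1\<close>, absent from \<open>jac\<close>, drops out because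
  \<open>G\<close> vanishes there. The second part is the degree bound for \<open>G\<close>.\<close>

lemma frob_coeff_sum:
  assumes a: "1 \<le> a" "a \<le> p - 2" and b: "1 \<le> b" "b \<le> p - 2" and ks: "k \<le> s" and kN: "k \<le> N"
    and K: "s \<le> K"
  shows "[(int p - 1) * (\<Sum>t<K. icoeff (frob_fps p (s + b * repunit p N) (s + b * repunit p (Suc N))) (int a + (int p - 1) * int t))
    = jac k a b] (mod int p ^ k)"
    and "s \<ge> 1 \<Longrightarrow> z > int (p - 1) * int s - int b \<Longrightarrow>
      int p ^ k dvd icoeff (frob_fps p (s + b * repunit p N) (s + b * repunit p (Suc N))) z"
proof -
  obtain G :: "int poly" where G: "degree G \<le> (p - 1) * s - b" "poly G 1 = 0"
    "[:int p ^ k:] dvd (\<Sum>i<p. monom 1 i) ^ (s + b * repunit p N) - G * [:1, -1:] ^ (b * p ^ N)"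
    "\<And>m. [frob_fps p (s + b * repunit p N) (s + b * repunit p (Suc N)) $ m = coeff G m] (mod int p ^ k)"
    using frob_fps_cong_poly[OF b(2) ks] by metis
  define F where "F = frob_fps p (s + b * repunit p N) (s + b * repunit p (Suc N))"
  show "int p ^ k dvd icoeff F z" if "s \<ge> 1" "z > int (p - 1) * int s - int b"
  proof (cases "z < 0")
    case False
    have "b \<le> (p - 1) * 1" using b by simp
    also have "\<dots> \<le> (p - 1) * s" using that by (intro mult_left_mono) auto
    finally have "int ((p - 1) * s - b) = int (p - 1) * int s - int b"
      by (simp add: of_nat_diff)
    then have "(p - 1) * s - b < nat z" using that False by linarith
    then have "coeff G (nat z) = 0" using G(1) by (intro coeff_eq_0) linarith
    then show ?thesis using G(4)[of "nat z"] False by (simp add: icoeff_def F_def cong_0_iff)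
  qed (simp add: icoeff_def)
  have deg: "degree G < a + (p - 1) * K"
  proof -
    have "(p - 1) * s \<le> (p - 1) * K" using K by simp
    then show ?thesis using G(1) a by linarith
  qed
  have ic: "icoeff F (int a + (int p - 1) * int t) = F $ (a + (p - 1) * t)" for t
  proof -
    have "int a + (int p - 1) * int t = int (a + (p - 1) * t)" using pos by (simp add: of_nat_diff)
    then show ?thesis by (simp add: icoeff_def del: of_nat_add of_nat_mult)
  qed
  have "[(int p - 1) * (\<Sum>t<K. icoeff F (int a + (int p - 1) * int t)) = (int p - 1) * (\<Sum>t<K. coeff G (a + (p - 1) * t))] (mod int p ^ k)"
    unfolding ic by (intro cong_mult cong_refl cong_sum G(4)[folded F_def])
  also have "[(int p - 1) * (\<Sum>t<K. coeff G (a + (p - 1) * t)) = (\<Sum>x\<in>units. tpow k x ^ (p - 1 - a) * poly G (tpow k x))] (mod int p ^ k)"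
    by (rule cong_sym[OF sum_poly_tpow[OF a deg]])
  also have "(\<Sum>x\<in>units. tpow k x ^ (p - 1 - a) * poly G (tpow k x)) = (\<Sum>x\<in>{2..<int p}. tpow k x ^ (p - 1 - a) * poly G (tpow k x))"
  proof -
    have "units = insert 1 {2..<int p}" using gt2 by (auto simp: units_def)
    then show ?thesis using G(2) by simp
  qed
  also have "[\<dots> = jac k a b] (mod int p ^ k)"
    unfolding jac_def
    by (intro cong_sum cong_mult cong_refl poly_cong_at_tpow[OF _ kN _ G(3)]) (use b in auto)
  finally show "[(int p - 1) * (\<Sum>t<K. icoeff F (int a + (int p - 1) * int t)) = jac k a b] (mod int p ^ k)" .
qed

text \<open>The trace expression \<open>Y\<close> is a difference of two traces, with shifts
  \<open>Suc k\<close> and \<open>k\<close>. Both have the value \<open>jac k a b / (p - 1)\<close>,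
  so \<open>Y\<close> is \<open>(1 - p) / (p - 1)\<close> times \<open>jac k a b\<close>, which
  explains the sign.\<close>

lemma binomial_jac_shifted:
  assumes a: "1 \<le> a" "a \<le> p - 2" and b: "1 \<le> b" "b \<le> p - 2" and kN: "k \<le> N"
  defines "n \<equiv> a * repunit p (Suc N)" and "n' \<equiv> a * repunit p N"
    and "b1 \<equiv> k + b * repunit p (Suc N)" and "b2 \<equiv> k + b * repunit p N"
  shows "int p ^ k dvd (\<Prod>j<Suc k. int n - int j) * (int ((b1 + n) choose n) + int ((b2 + n') choose n') * jac k a b)"
proof -
  have n: "n = p * n' + a" by (simp add: n_def n'_def repunit_Suc algebra_simps)
  define Y where "Y = (\<Sum>t<Suc k. icoeff (frob_fps p (Suc b2) (Suc b1)) (int a + (int p - 1) * int t)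
           - int p * icoeff (frob_fps p b2 b1) (int a + (int p - 1) * int t))"
  have 1: "[(int p - 1) * (\<Sum>t<Suc k. icoeff (frob_fps p (Suc b2) (Suc b1)) (int a + (int p - 1) * int t)) = jac k a b] (mod int p ^ k)"
    using frob_coeff_sum(1)[OF a b _ kN, of "Suc k" "Suc k"] by (simp add: b1_def b2_def)
  have 2: "[(int p - 1) * (\<Sum>t<Suc k. icoeff (frob_fps p b2 b1) (int a + (int p - 1) * int t)) = jac k a b] (mod int p ^ k)"
    using frob_coeff_sum(1)[OF a b _ kN, of k "Suc k"] by (simp add: b1_def b2_def)
  have "(int p - 1) * Y = (int p - 1) * (\<Sum>t<Suc k. icoeff (frob_fps p (Suc b2) (Suc b1)) (int a + (int p - 1) * int t))
     - int p * ((int p - 1) * (\<Sum>t<Suc k. icoeff (frob_fps p b2 b1) (int a + (int p - 1) * int t)))"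
    unfolding Y_def sum_subtractf sum_distrib_left[symmetric] by (simp add: right_diff_distrib mult.left_commute del: sum.lessThan_Suc)
  also have "[\<dots> = jac k a b - int p * jac k a b] (mod int p ^ k)"
    by (intro cong_diff cong_mult cong_refl 1 2)
  also have "jac k a b - int p * jac k a b = (int p - 1) * (- jac k a b)" by (simp add: algebra_simps)
  finally have Y: "[Y = - jac k a b] (mod int p ^ k)"
  proof (rule cong_cancel)
    show "\<not> int p dvd int p - 1" using gt1
      by (metis dvd_diff_right_iff dvd_refl int_prime not_prime_unit)
  qed
  have N: "int p ^ k dvd int p ^ N" using kN by (rule le_imp_power_dvd)
  have "int p ^ k dvd (\<Prod>j<Suc k. int (p * n' + a) - int j) *
    (int ((b1 + (p * n' + a)) choose (p * n' + a)) - int ((b2 + n') choose n') * Y)"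
    unfolding Y_def
  proof (rule frob_sum_trace)
    show "a < p" using a gt2 by linarith
    show "Suc k \<le> Suc n'"
      using repunit_ge[OF pos, of N] kN a(1) unfolding n'_def
      by (metis Suc_le_mono le_trans mult_le_mono nat_mult_1)
    have "int (p * n' + a) - int n' = int a * int p ^ N"
      unfolding n[symmetric] by (simp add: n_def n'_def repunit_Suc_add algebra_simps)
    then show "int p ^ k dvd int (p * n' + a) - int n'" using N by simp
    show "int p ^ k dvd int b1 - int b2" using N by (simp add: b1_def b2_def repunit_Suc_add algebra_simps)
    fix i assume i: "Suc k \<le> i"
    \<comment> \<open>Rows from \<open>Suc k\<close> on lie beyond the degree bound for the shift
      \<open>Suc k\<close>; hence the trace is cut off at \<open>Suc k\<close>.\<close>
    have "int (p - 1) * int (Suc k) - int b < int a + int p * int i - int (Suc k)"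
    proof -
      have "int p * int (Suc k) \<le> int p * int i" using i by (intro mult_left_mono) auto
      moreover have "int (p - 1) * int (Suc k) = int p * int (Suc k) - int (Suc k)"
        using pos by (simp add: of_nat_diff algebra_simps)
      ultimately show ?thesis using a b by linarith
    qed
    then show "int p ^ k dvd icoeff (frob_fps p (Suc b2) (Suc b1)) (int a + int p * int i - int (Suc k))"
      using frob_coeff_sum(2)[OF a b _ kN, of "Suc k" "Suc k"] by (simp add: b1_def b2_def)
  qed
  moreover have "int p ^ k dvd (\<Prod>j<Suc k. int n - int j) * (int ((b2 + n') choose n') * (Y + jac k a b))"
    using Y by (intro dvd_mult) (simp add: cong_iff_dvd_diff)
  ultimately have "int p ^ k dvd (\<Prod>j<Suc k. int n - int j) * (int ((b1 + n) choose n) - int ((b2 + n') choose n') * Y)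
     + (\<Prod>j<Suc k. int n - int j) * (int ((b2 + n') choose n') * (Y + jac k a b))"
    unfolding n by (rule dvd_add)
  then show ?thesis by (simp add: algebra_simps del: prod.lessThan_Suc)
qed

section \<open>Valuations of the products that have to be cancelled\<close>

lemma dvd_ap_term_iff:
  assumes "a < p"
  shows "p dvd a + (p - 1) * j \<longleftrightarrow> (\<exists>i. j = a + p * i)"
proof
  assume "p dvd a + (p - 1) * j"
  have "int (a + (p - 1) * j) = int p * int j + (int a - int j)"
    using pos by (simp only: of_nat_add of_nat_mult) (simp add: of_nat_diff algebra_simps)
  moreover have "int p dvd int (a + (p - 1) * j)"
    using \<open>p dvd a + (p - 1) * j\<close> by (simp only: int_dvd_int_iff)
  ultimately have d: "int p dvd int a - int j"
    by (metis dvd_add_right_iff dvd_triv_left)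
  have aj: "a \<le> j"
  proof (rule ccontr)
    assume "\<not> a \<le> j"
    then have "0 < int a - int j" "int a - int j < int p" using assms by auto
    then show False using d zdvd_imp_le by fastforce
  qed
  then have "p dvd j - a" using d
    by (metis dvd_diff_commute int_dvd_int_iff of_nat_diff)
  then show "\<exists>i. j = a + p * i" using aj by (auto elim!: dvdE) (metis le_add_diff_inverse)
next
  assume "\<exists>i. j = a + p * i"
  then obtain i where i: "j = a + p * i" by blast
  have "a + (p - 1) * j = p * (a + (p - 1) * i)"
    unfolding i using pos by (cases p) (auto simp: algebra_simps)
  then show "p dvd a + (p - 1) * j" by simp
qed

text \<open>The progression is self-similar: its multiples of \<open>p\<close> occur at
  \<open>j = a + p * i\<close>, where the term is \<open>p\<close> times the i-th term. Thus the sum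
  up to \<open>J\<close> is \<open>J'\<close> plus the sum up to \<open>J'\<close>, with
  \<open>J'\<close> about \<open>J / p\<close>. Two such products are cancelled later, so a rate
  below one half is required; \<open>p \<ge> 5\<close> gives one third.\<close>

lemma sum_multiplicity_ap:
  assumes a: "1 \<le> a" "a < p" and p5: "p \<ge> 5"
  shows "3 * (\<Sum>j<J. multiplicity p (a + (p - 1) * j)) \<le> J + 3"
proof (induction J rule: less_induct)
  case (less J)
  define f where "f j = multiplicity p (a + (p - 1) * j)" for j
  define J' where "J' = (J + p - 1 - a) div p"
  have lt: "a + p * i < J \<longleftrightarrow> i < J'" for i
  proof -
    have "i < J' \<longleftrightarrow> Suc i * p \<le> J + p - 1 - a"
      unfolding J'_def by (metis Suc_le_eq less_eq_div_iff_mult_less_eq pos)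
    also have "\<dots> \<longleftrightarrow> a + p * i < J" using a by (auto simp: mult.commute)
    finally show ?thesis by simp
  qed
  have S: "(\<Sum>j<J. f j) = J' + (\<Sum>i<J'. f i)"
  proof -
    have "(\<Sum>j<J. f j) = (\<Sum>j\<in>(\<lambda>i. a + p * i) ` {..<J'}. f j)"
    proof (rule sum.mono_neutral_right)
      show "(\<lambda>i. a + p * i) ` {..<J'} \<subseteq> {..<J}" using lt by auto
      show "\<forall>j\<in>{..<J} - (\<lambda>i. a + p * i) ` {..<J'}. f j = 0"
      proof
        fix j assume j: "j \<in> {..<J} - (\<lambda>i. a + p * i) ` {..<J'}"
        have "\<not> p dvd a + (p - 1) * j"
          unfolding dvd_ap_term_iff[OF a(2)] using j lt by auto
        then show "f j = 0" by (simp add: f_def not_dvd_imp_multiplicity_0)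
      qed
    qed simp
    also have "\<dots> = (\<Sum>i<J'. f (a + p * i))"
      by (subst sum.reindex) (use pos in \<open>auto simp: inj_on_def\<close>)
    also have "\<dots> = (\<Sum>i<J'. Suc (f i))"
    proof (rule sum.cong[OF refl])
      fix i
      have "a + (p - 1) * (a + p * i) = p * (a + (p - 1) * i)"
        using pos by (cases p) (auto simp: algebra_simps)
      then show "f (a + p * i) = Suc (f i)"
        unfolding f_def using a gt1 by (simp add: multiplicity_times_same)
    qed
    finally show ?thesis by (simp add: sum_Suc)
  qed
  show ?case
  proof (cases "J' = 0")
    case True then show ?thesis using S by (simp add: f_def)
  next
    case False
    then have "J' - 1 < J'" by simp
    then have "a + p * (J' - 1) < J" using lt by blast
    moreover have "p * (J' - 1) \<ge> 5 * (J' - 1)" using p5 by simp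
    ultimately have J: "5 * (J' - 1) + 2 \<le> J" using a by linarith
    then have "J' < J" using False by linarith
    define s where "s = (\<Sum>i<J'. f i)"
    have IH: "3 * s \<le> J' + 3" using less \<open>J' < J\<close> by (simp add: s_def f_def)
    have f0: "f 0 = 0" using a by (auto simp: f_def intro!: not_dvd_imp_multiplicity_0 dest: dvd_imp_le)
    \<comment> \<open>The induction hypothesis leaves \<open>4 * J' + 3\<close>, which
      \<open>5 * (J' - 1) + 2 \<le> J\<close> absorbs only from \<open>J' = 3\<close> on. For
      \<open>J' = 1\<close> the single term \<open>a\<close> is prime to \<open>p\<close>; for
      \<open>J' = 2\<close> integrality improves the bound.\<close>
    consider "J' = 1" | "J' = 2" | "J' \<ge> 3" using False by linarith
    then have "3 * (J' + s) \<le> J + 3"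
    proof cases
      case 1 then show ?thesis using f0 by (simp add: s_def)
    next
      case 2
      then have "3 * s \<le> 5" using IH by simp
      then have "s \<le> 1" by presburger
      moreover have "J \<ge> 7" using J 2 by simp
      ultimately show ?thesis using 2 by presburger
    next
      case 3 then show ?thesis using IH J by presburger
    qed
    then have "3 * (J' + (\<Sum>i<J'. f i)) \<le> J + 3" by (simp only: s_def)
    then show ?thesis using S by (simp add: f_def)
  qed
qed

lemma multiplicity_int_of_nat: "m > 0 \<Longrightarrow> multiplicity (int p) (int m) = multiplicity p m"
proof -
  assume m: "m > 0"
  have "n \<le> multiplicity (int p) (int m) \<longleftrightarrow> n \<le> multiplicity p m" for n
  proof -
    have "n \<le> multiplicity (int p) (int m) \<longleftrightarrow> int p ^ n dvd int m"
      using m gt1 by (subst power_dvd_iff_le_multiplicity) auto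
    also have "\<dots> \<longleftrightarrow> p ^ n dvd m" by (metis int_dvd_int_iff of_nat_power)
    also have "\<dots> \<longleftrightarrow> n \<le> multiplicity p m"
      using m gt1 by (subst power_dvd_iff_le_multiplicity) auto
    finally show ?thesis .
  qed
  then show ?thesis by (meson dual_order.antisym order_refl)
qed

lemma multiplicity_prod_ap:
  assumes "1 \<le> a" "a < p" "p \<ge> 5"
  shows "3 * multiplicity (int p) (\<Prod>j<J. int (a + (p - 1) * j)) \<le> J + 3"
proof -
  have "multiplicity (int p) (\<Prod>j<J. int (a + (p - 1) * j)) = (\<Sum>j<J. multiplicity (int p) (int (a + (p - 1) * j)))"
    using int_prime assms by (intro prime_elem_multiplicity_prod_distrib) (auto simp del: of_nat_add of_nat_mult of_nat_diff)
  also have "\<dots> = (\<Sum>j<J. multiplicity p (a + (p - 1) * j))"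
    by (intro sum.cong refl multiplicity_int_of_nat) (use assms in simp)
  finally show ?thesis using sum_multiplicity_ap[OF assms] by simp
qed

lemma prime_power_dvd_cancel:
  assumes "int p ^ k dvd A * x" "A \<noteq> 0" "K + multiplicity (int p) A \<le> k"
  shows "int p ^ K dvd x"
proof -
  define v where "v = multiplicity (int p) A"
  obtain A' where A': "A = int p ^ v * A'" "\<not> int p dvd A'"
    using multiplicity_decompose'[of A "int p"] assms(2) int_prime
    by (metis not_prime_unit v_def mult.commute)
  have "int p ^ (v + K) dvd int p ^ k" using assms(3) by (intro le_imp_power_dvd) (simp add: v_def)
  then have "int p ^ v * int p ^ K dvd int p ^ v * (A' * x)"
    using assms(1) A'(1) by (metis dvd_trans mult.assoc power_add)
  then have "int p ^ K dvd A' * x" using pos by simp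
  moreover have "coprime (int p ^ K) A'" using coprime_power[OF A'(2)] coprime_commute by blast
  ultimately show ?thesis by (simp add: coprime_dvd_mult_right_iff)
qed

end

text \<open>Both sides are \<open>(k + m + n)! / (m! * n!)\<close>. This removes the shift by
  \<open>k\<close> that the polynomial approximation required.\<close>

lemma binomial_shift_prod:
  "((k + m + n) choose n) * (\<Prod>r<k. m + 1 + r) = ((m + n) choose n) * (\<Prod>r<k. n + m + 1 + r)"
proof (induction k)
  case (Suc k)
  have step: "Suc (k + m) * ((Suc (k + m) + n) choose n) = Suc (k + m + n) * ((k + m + n) choose n)"
    using Suc_times_binomial[of "k + m" "k + m + n"] binomial_symmetric[of n "Suc (k + m) + n"] binomial_symmetric[of n "k + m + n"]
    by simp
  have e1: "(\<Prod>r<Suc k. m + 1 + r) = (\<Prod>r<k. m + 1 + r) * Suc (k + m)"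
    unfolding prod.lessThan_Suc by (rule arg_cong[of _ _ "\<lambda>x. _ * x"]) simp
  have e2: "(\<Prod>r<Suc k. n + m + 1 + r) = (\<Prod>r<k. n + m + 1 + r) * Suc (k + m + n)"
    unfolding prod.lessThan_Suc by (rule arg_cong[of _ _ "\<lambda>x. _ * x"]) simp
  have "((Suc k + m + n) choose n) * (\<Prod>r<Suc k. m + 1 + r)
    = (Suc (k + m) * ((Suc (k + m) + n) choose n)) * (\<Prod>r<k. m + 1 + r)"
    unfolding e1 add_Suc by (simp only: mult_ac)
  also have "\<dots> = Suc (k + m + n) * (((k + m + n) choose n) * (\<Prod>r<k. m + 1 + r))"
    unfolding step by (simp only: mult_ac)
  also have "\<dots> = ((m + n) choose n) * (\<Prod>r<Suc k. n + m + 1 + r)"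
    unfolding Suc e2 by (simp only: mult_ac)
  finally show ?case .
qed simp

context odd_prime
begin

lemma jac_lower_cong:
  assumes "k \<le> N" shows "[jac N i j = jac k i j] (mod int p ^ k)"
  unfolding jac_def by (intro cong_sum cong_mult cong_pow tpow_lower_cong assms)

definition binom_rep :: "nat \<Rightarrow> nat \<Rightarrow> nat \<Rightarrow> nat" where
  "binom_rep a b N = ((a * repunit p N + b * repunit p N) choose (a * repunit p N))"

text \<open>After the shift is removed, the congruence of \<open>binomial_jac_shifted\<close>
  carries the factors \<open>V\<close> and \<open>P (n + m)\<close>. Multiplied by powers of
  \<open>p - 1\<close> they become, up to sign, the products \<open>A1\<close> and \<open>A2\<close>
  over progressions with difference \<open>p - 1\<close>, independent of the level, so their
  valuations are bounded and can be traded for precision.\<close>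

lemma binom_rep_cong:
  assumes a: "1 \<le> a" and b: "1 \<le> b" and ab: "a + b \<le> p - 2" and N: "3 * K + 7 \<le> N"
  shows "[int (binom_rep a b (Suc N)) = - jac K a b * int (binom_rep a b N)] (mod int p ^ K)"
proof -
  have p5: "p \<ge> 5"
  proof -
    have "p \<noteq> 4" using odd by auto
    then show ?thesis using a b ab gt2 by linarith
  qed
  \<comment> \<open>With this precision \<open>A1\<close> and \<open>A2\<close> have valuation at
    most \<open>K + 3\<close> each, and \<open>K + 2 * (K + 3) \<le> k\<close>.\<close>
  define k where "k = 3 * K + 7"
  have kN: "k \<le> N" using N by (simp add: k_def)
  define n where "n = a * repunit p (Suc N)"
  define n' where "n' = a * repunit p N"
  define m where "m = b * repunit p (Suc N)"
  define m' where "m' = b * repunit p N"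
  define P where "P m = (\<Prod>r<k. int (m + 1 + r))" for m
  define V where "V = (\<Prod>j<Suc k. int n - int j)"
  define X where "X = int (binom_rep a b (Suc N)) + int (binom_rep a b N) * jac k a b"
  have N: "int p ^ k dvd int p ^ N" using kN by (rule le_imp_power_dvd)
  have mm: "[int m = int m'] (mod int p ^ k)" and nn: "[int n = int n'] (mod int p ^ k)"
    using N by (auto simp: m_def m'_def n_def n'_def repunit_Suc_add cong_iff_dvd_diff algebra_simps)
  have Pm: "[P m = P m'] (mod int p ^ k)" and Pnm: "[P (n + m) = P (n' + m')] (mod int p ^ k)"
    unfolding P_def using mm nn by (auto intro!: cong_prod cong_add)
  have sh: "int ((k + x + y) choose y) * P x = int ((x + y) choose y) * P (y + x)" for x y
    using arg_cong[OF binomial_shift_prod[of k x y], of int] by (simp add: P_def)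
  have 1: "int p ^ k dvd V * (int ((k + m + n) choose n) + int ((k + m' + n') choose n') * jac k a b)"
    using binomial_jac_shifted[OF a _ b _ kN] ab a b
    by (simp add: V_def n_def n'_def m_def m'_def del: prod.lessThan_Suc)
  have C: "int ((m + n) choose n) = int (binom_rep a b (Suc N))" "int ((m' + n') choose n') = int (binom_rep a b N)"
    by (simp_all add: binom_rep_def n_def n'_def m_def m'_def add.commute)
  have "[int ((k + m' + n') choose n') * P m = int ((k + m' + n') choose n') * P m'] (mod int p ^ k)"
    by (intro cong_mult cong_refl Pm)
  also have "int ((k + m' + n') choose n') * P m' = int (binom_rep a b N) * P (n' + m')" by (simp only: sh C)
  also have "[int (binom_rep a b N) * P (n' + m') = int (binom_rep a b N) * P (n + m)] (mod int p ^ k)"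
    by (intro cong_mult cong_refl cong_sym[OF Pnm])
  finally have 2: "[int ((k + m' + n') choose n') * P m = int (binom_rep a b N) * P (n + m)] (mod int p ^ k)" .
  have "int p ^ k dvd P m * (V * (int ((k + m + n) choose n) + int ((k + m' + n') choose n') * jac k a b))"
    using 1 by (rule dvd_mult)
  also have "P m * (V * (int ((k + m + n) choose n) + int ((k + m' + n') choose n') * jac k a b))
     = V * (int ((k + m + n) choose n) * P m + int ((k + m' + n') choose n') * P m * jac k a b)"
    by (simp add: algebra_simps)
  also have "\<dots> = V * (int (binom_rep a b (Suc N)) * P (n + m) + int ((k + m' + n') choose n') * P m * jac k a b)"
    by (simp only: sh C)
  finally have "[V * (int (binom_rep a b (Suc N)) * P (n + m) + int ((k + m' + n') choose n') * P m * jac k a b) = 0] (mod int p ^ k)"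
    by (simp add: cong_0_iff)
  moreover have "[V * (int (binom_rep a b (Suc N)) * P (n + m) + int ((k + m' + n') choose n') * P m * jac k a b)
     = V * (int (binom_rep a b (Suc N)) * P (n + m) + int (binom_rep a b N) * P (n + m) * jac k a b)] (mod int p ^ k)"
    by (intro cong_mult cong_add cong_refl 2)
  ultimately have "[V * (int (binom_rep a b (Suc N)) * P (n + m) + int (binom_rep a b N) * P (n + m) * jac k a b) = 0] (mod int p ^ k)"
    using cong_sym cong_trans by blast
  then have 3: "int p ^ k dvd V * P (n + m) * X"
    by (simp add: cong_0_iff X_def algebra_simps)
  define A1 where "A1 = (\<Prod>j<Suc k. int (a + (p - 1) * j))"
  \<comment> \<open>Modulo \<open>p ^ k\<close>, \<open>(p - 1) * (n + m)\<close> is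
    \<open>- (a + b)\<close>; so \<open>(p - 1) * (n + m + 1 + r)\<close> becomes
    \<open>c + (p - 1) * r\<close>.\<close>
  define c where "c = p - 1 - (a + b)"
  define A2 where "A2 = (\<Prod>r<k. int (c + (p - 1) * r))"
  have rn: "int (p - 1) * int (repunit p (Suc N)) = int p ^ Suc N - 1"
    using arg_cong[OF repunit_mult[OF pos, of "Suc N"], of int] by simp
  have pk: "int p ^ k dvd int p ^ Suc N" using kN by (intro le_imp_power_dvd) simp
  have V: "[int (p - 1) ^ Suc k * V = (- 1) ^ Suc k * A1] (mod int p ^ k)"
  proof -
    have "int (p - 1) ^ Suc k * V = (\<Prod>j<Suc k. int (p - 1) * (int n - int j))"
      by (simp add: V_def prod.distrib del: prod.lessThan_Suc power_Suc)
    also have "[\<dots> = (\<Prod>j<Suc k. (-1) * int (a + (p - 1) * j))] (mod int p ^ k)"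
    proof (rule cong_prod)
      fix j
      have "int (p - 1) * int n = int a * (int (p - 1) * int (repunit p (Suc N)))" by (simp add: n_def)
      then have "int (p - 1) * (int n - int j) - (-1) * int (a + (p - 1) * j) = int a * int p ^ Suc N"
        unfolding rn by (simp only: of_nat_add of_nat_mult of_nat_1) (simp add: algebra_simps del: power_Suc)
      then show "[int (p - 1) * (int n - int j) = (-1) * int (a + (p - 1) * j)] (mod int p ^ k)"
        using pk by (simp only: cong_iff_dvd_diff dvd_mult)
    qed
    also have "(\<Prod>j<Suc k. (-1) * int (a + (p - 1) * j)) = (- 1) ^ Suc k * A1"
      unfolding A1_def prod.distrib by simp
    finally show ?thesis .
  qed
  have Q: "[int (p - 1) ^ k * P (n + m) = A2] (mod int p ^ k)"
  proof -
    have "int (p - 1) ^ k * P (n + m) = (\<Prod>r<k. int (p - 1) * int (n + m + 1 + r))"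
      by (simp add: P_def prod.distrib)
    also have "[\<dots> = (\<Prod>r<k. int (c + (p - 1) * r))] (mod int p ^ k)"
    proof (rule cong_prod)
      fix r
      have "int (p - 1) * (int n + int m) = int (a + b) * (int (p - 1) * int (repunit p (Suc N)))"
        by (simp add: n_def m_def algebra_simps)
      moreover have "int c = int (p - 1) - int (a + b)" using ab by (simp add: c_def of_nat_diff)
      ultimately have "int (p - 1) * int (n + m + 1 + r) - int (c + (p - 1) * r) = int (a + b) * int p ^ Suc N"
        unfolding rn by (simp only: of_nat_add of_nat_mult of_nat_1) (simp add: algebra_simps del: power_Suc)
      then show "[int (p - 1) * int (n + m + 1 + r) = int (c + (p - 1) * r)] (mod int p ^ k)"
        using pk by (simp only: cong_iff_dvd_diff dvd_mult)
    qed
    finally show ?thesis by (simp add: A2_def)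
  qed
  have "[(- 1) ^ Suc k * A1 * A2 * X = (int (p - 1) ^ Suc k * V) * (int (p - 1) ^ k * P (n + m)) * X] (mod int p ^ k)"
    by (intro cong_mult cong_refl cong_sym[OF V] cong_sym[OF Q])
  also have "(int (p - 1) ^ Suc k * V) * (int (p - 1) ^ k * P (n + m)) * X = (int (p - 1) ^ Suc k * int (p - 1) ^ k) * (V * P (n + m) * X)"
    by (simp only: mult_ac)
  also have "[\<dots> = 0] (mod int p ^ k)" using 3 by (simp only: cong_0_iff dvd_mult)
  finally have "int p ^ k dvd (- 1) ^ Suc k * (A1 * A2 * X)" by (simp only: cong_0_iff mult.assoc)
  then have 4: "int p ^ k dvd (A1 * A2) * X"
    by (cases "even (Suc k)") simp_all
  have c: "1 \<le> c" "c < p" using ab pos gt2 by (auto simp: c_def)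
  have nz: "A1 \<noteq> 0" "A2 \<noteq> 0" using a c by (auto simp: A1_def A2_def simp del: of_nat_add of_nat_mult of_nat_diff)
  have "3 * multiplicity (int p) A1 \<le> Suc k + 3" unfolding A1_def
    by (rule multiplicity_prod_ap[OF a _ p5]) (use ab gt2 in linarith)
  moreover have "3 * multiplicity (int p) A2 \<le> k + 3" unfolding A2_def
    by (rule multiplicity_prod_ap[OF c p5])
  moreover have "multiplicity (int p) (A1 * A2) = multiplicity (int p) A1 + multiplicity (int p) A2"
    using int_prime nz by (intro prime_elem_multiplicity_mult_distrib) auto
  ultimately have "K + multiplicity (int p) (A1 * A2) \<le> k" by (simp add: k_def)
  from prime_power_dvd_cancel[OF 4 _ this] nz have "int p ^ K dvd X" by simp
  moreover have "[X = int (binom_rep a b (Suc N)) + int (binom_rep a b N) * jac K a b] (mod int p ^ K)"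
    unfolding X_def by (intro cong_add cong_mult cong_refl jac_lower_cong) (simp add: k_def)
  ultimately have "int p ^ K dvd int (binom_rep a b (Suc N)) + int (binom_rep a b N) * jac K a b"
    by (simp add: cong_dvd_iff)
  then show ?thesis by (simp add: cong_iff_dvd_diff mult.commute)
qed

section \<open>Morita's function on natural numbers: continuity, reflection, factorials\<close>

definition ufac :: "nat \<Rightarrow> int" where
  "ufac n = (\<Prod>i<n. if p dvd i then 1 else int i)"

lemma ufac_Suc: "ufac (Suc n) = ufac n * (if p dvd n then 1 else int n)"
  by (simp add: ufac_def)

lemma ufac_0 [simp]: "ufac 0 = 1"
  by (simp add: ufac_def)

lemma gamma_nat_eq: "gamma_nat p n = (-1) ^ n * ufac n"
proof -
  have "(\<Prod>j\<in>{j. 0 < j \<and> j < n \<and> \<not> p dvd j}. int j) = (\<Prod>j\<in>{j\<in>{..<n}. \<not> p dvd j}. int j)"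
    by (rule prod.cong) (auto intro!: Nat.gr0I)
  also have "\<dots> = (\<Prod>j<n. if \<not> p dvd j then int j else 1)"
    by (subst prod.inter_filter) auto
  also have "\<dots> = ufac n" unfolding ufac_def by (rule prod.cong) auto
  finally show ?thesis by (simp add: gamma_nat_def)
qed

lemma gamma_nat_Suc: "gamma_nat p (Suc n) = gamma_nat p n * - (if p dvd n then 1 else int n)"
  by (simp add: gamma_nat_eq ufac_Suc)

lemma ufac_not_dvd: "\<not> int p dvd ufac n"
proof (induction n)
  case 0 then show ?case using gt1 by simp
next
  case (Suc n)
  have "\<not> int p dvd (if p dvd n then 1 else int n)" using gt1 by auto
  then show ?case unfolding ufac_Suc using Suc not_dvd_mult by blast
qed

text \<open>Inversion permutes the residues prime to \<open>p\<close>, so their product is congruent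
  to the product of their inverses. This determines it up to sign only; the sign is read off modulo
  \<open>p\<close> from Wilson's theorem.\<close>

lemma ufac_prime_power_square: "[ufac (p ^ Suc M) ^ 2 = 1] (mod int p ^ Suc M)"
proof -
  define m where "m = int p ^ Suc M"
  define U where "U = {x\<in>{0..<m}. \<not> int p dvd x}"
  have m1: "m > 1" using gt1 unfolding m_def by (simp only: one_less_power)
  have fin: "finite U" unfolding U_def by (rule finite_subset[of _ "{0..<m}"]) auto
  have pm: "int p dvd m" by (simp add: m_def)
  have W: "ufac (p ^ Suc M) = \<Prod>U"
  proof -
    have "ufac (p ^ Suc M) = (\<Prod>i\<in>{i\<in>{..<p ^ Suc M}. \<not> p dvd i}. int i)"
      unfolding ufac_def by (subst prod.inter_filter) (auto intro!: prod.cong)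
    also have "\<dots> = \<Prod>(int ` {i\<in>{..<p ^ Suc M}. \<not> p dvd i})"
      by (subst prod.reindex) auto
    also have "int ` {i\<in>{..<p ^ Suc M}. \<not> p dvd i} = U"
    proof (intro equalityI subsetI)
      fix x assume x: "x \<in> U"
      then have "x = int (nat x)" "nat x < p ^ Suc M"
        by (auto simp: U_def m_def nat_less_iff simp del: power_Suc)
      moreover have "\<not> p dvd nat x" using x by (metis (no_types, lifting) U_def calculation(1) int_dvd_int_iff mem_Collect_eq)
      ultimately show "x \<in> int ` {i\<in>{..<p ^ Suc M}. \<not> p dvd i}" by blast
    next
      fix x assume "x \<in> int ` {i\<in>{..<p ^ Suc M}. \<not> p dvd i}"
      then obtain i where i: "x = int i" "i < p ^ Suc M" "\<not> p dvd i" by auto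
      have "int i < m" unfolding m_def using i(2) by (metis of_nat_less_iff of_nat_power)
      then show "x \<in> U" using i by (simp add: U_def)
    qed
    finally show ?thesis .
  qed
  have "\<forall>x\<in>U. \<exists>y\<in>U. [x * y = 1] (mod m)"
  proof
    fix x assume x: "x \<in> U"
    then have "coprime x m" unfolding m_def by (intro coprime_power) (simp add: U_def)
    then obtain y where y: "[x * y = 1] (mod m)" using cong_solve_coprime_int by blast
    have "[x * (y mod m) = 1] (mod m)" using y
      by (metis cong_def mod_mult_right_eq)
    moreover have "y mod m \<in> U"
    proof -
      have "\<not> int p dvd y"
      proof
        assume "int p dvd y"
        then have "int p dvd x * y" by simp
        moreover have "[x * y = 1] (mod int p)" using y pm by (rule cong_dvd_modulus)
        ultimately have "int p dvd 1" using cong_dvd_iff by blast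
        then show False using gt1 by simp
      qed
      then have "\<not> int p dvd y mod m" using pm dvd_mod_iff by blast
      then show ?thesis using m1 by (simp add: U_def)
    qed
    ultimately show "\<exists>y\<in>U. [x * y = 1] (mod m)" by blast
  qed
  then obtain f where f: "\<And>x. x \<in> U \<Longrightarrow> f x \<in> U" "\<And>x. x \<in> U \<Longrightarrow> [x * f x = 1] (mod m)"
    by metis
  have "inj_on f U"
  proof (rule inj_onI)
    fix x y assume xy: "x \<in> U" "y \<in> U" "f x = f y"
    have "[x * (y * f y) = x * 1] (mod m)" by (intro cong_mult cong_refl f xy)
    moreover have "[y * (x * f x) = y * 1] (mod m)" by (intro cong_mult cong_refl f xy)
    moreover have "x * (y * f y) = y * (x * f x)" by (simp add: xy(3))
    ultimately have "[x = y] (mod m)" by (metis cong_sym cong_trans mult.right_neutral)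
    then show "x = y" using xy by (auto simp: U_def cong_def)
  qed
  then have "bij_betw f U U" using f(1) fin
    by (simp add: bij_betw_def endo_inj_surj image_subsetI)
  then have "\<Prod>U = (\<Prod>x\<in>U. f x)" using prod.reindex_bij_betw[of f U U "\<lambda>x. x"] by simp
  then have "ufac (p ^ Suc M) ^ 2 = (\<Prod>x\<in>U. x * f x)"
    unfolding W power2_eq_square prod.distrib by simp
  also have "[\<dots> = (\<Prod>x\<in>U. 1)] (mod m)" by (intro cong_prod f)
  finally show ?thesis by (simp add: m_def)
qed

lemma ufac_multiple_mod_p: "[ufac (p * q) = (-1) ^ q] (mod int p)"
proof -
  have "ufac (p * q) = (\<Prod>s<q. \<Prod>i\<in>{s * p..<s * p + p}. if p dvd i then 1 else int i)"
    unfolding ufac_def by (simp add: prod.nat_group mult.commute)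
  also have "[\<dots> = (\<Prod>s<q. -1)] (mod int p)"
  proof (rule cong_prod)
    fix s
    have "(\<Prod>i\<in>{s * p..<s * p + p}. if p dvd i then 1 else int i) = (\<Prod>i\<in>{0..<p}. if p dvd i then 1 else int (i + s * p))"
      using prod.shift_bounds_nat_ivl[of "\<lambda>i. if p dvd i then 1 else int i" 0 "s * p" p]
      by (simp add: add.commute[of p])
    also have "[\<dots> = (\<Prod>i\<in>{0..<p}. if p dvd i then 1 else int i)] (mod int p)"
      by (intro cong_prod) (auto simp: cong_iff_dvd_diff)
    also have "(\<Prod>i\<in>{0..<p}. if p dvd i then 1 else int i) = (\<Prod>i\<in>{1..p - 1}. int i)"
    proof -
      have "{0..<p} = insert 0 {1..p - 1}" using pos by auto
      moreover have "(\<Prod>i\<in>{1..p - 1}. if p dvd i then 1 else int i) = (\<Prod>i\<in>{1..p - 1}. int i)"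
        by (rule prod.cong) (auto dest!: dvd_imp_le)
      ultimately show ?thesis by simp
    qed
    also have "\<dots> = fact (p - 1)" by (simp add: fact_prod)
    also have "[fact (p - 1) = - 1] (mod int p)" using wilson_theorem[OF prime] .
    finally show "[(\<Prod>i\<in>{s * p..<s * p + p}. if p dvd i then 1 else int i) = -1] (mod int p)" .
  qed
  finally show ?thesis by simp
qed

lemma square_cong_1:
  assumes "[x ^ 2 = 1] (mod int p ^ M)" "[x = -1] (mod int p)"
  shows "[x = -1] (mod int p ^ M)"
proof -
  have "[(x - 1) * (x + 1) = (x - 1) * 0] (mod int p ^ M)"
    using assms(1) by (simp add: cong_iff_dvd_diff power2_eq_square algebra_simps)
  moreover have "\<not> int p dvd x - 1"
  proof
    assume d: "int p dvd x - 1"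
    have "int p dvd x + 1" using assms(2) by (simp add: cong_iff_dvd_diff)
    then have "int p dvd (x + 1) - (x - 1)" using d by (rule dvd_diff)
    also have "(x + 1) - (x - 1) = 2" by simp
    finally have "int p dvd 2" .
    then show False using gt2 zdvd_imp_le by fastforce
  qed
  ultimately have "[x + 1 = 0] (mod int p ^ M)" by (rule cong_cancel)
  then show ?thesis by (simp add: cong_iff_dvd_diff)
qed

lemma ufac_prime_power: "[ufac (p ^ M) = -1] (mod int p ^ M)"
proof (cases M)
  case (Suc M')
  have "[ufac (p ^ M) = -1] (mod int p)"
    using ufac_multiple_mod_p[of "p ^ M'"] odd by (simp add: Suc)
  then show ?thesis using square_cong_1 ufac_prime_power_square[of M'] Suc by blast
qed simp

text \<open>Continuity of Morita's function. At \<open>r = 0\<close> the sign of the odd power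
  \<open>p ^ M\<close> cancels the \<open>-1\<close> of the generalised Wilson theorem; afterwards
  both sides acquire congruent factors.\<close>

lemma gamma_nat_add_prime_power: "[gamma_nat p (p ^ M + r) = gamma_nat p r] (mod int p ^ M)"
proof (induction r)
  case 0
  have "[(-1) ^ (p ^ M) * ufac (p ^ M) = (-1) ^ (p ^ M) * (-1)] (mod int p ^ M)"
    by (intro cong_mult cong_refl ufac_prime_power)
  then show ?case using odd by (simp add: gamma_nat_eq)
next
  case (Suc r)
  have "[(if p dvd p ^ M + r then 1 else int (p ^ M + r)) = (if p dvd r then 1 else int r)] (mod int p ^ M)"
  proof (cases M)
    case (Suc M')
    then have "p dvd p ^ M + r \<longleftrightarrow> p dvd r" by (simp add: dvd_add_right_iff)
    then show ?thesis by (simp add: cong_iff_dvd_diff)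
  qed simp
  then have "[- (if p dvd p ^ M + r then 1 else int (p ^ M + r)) = - (if p dvd r then 1 else int r)] (mod int p ^ M)"
    by (simp only: cong_minus_minus_iff)
  from cong_mult[OF Suc this] show ?case by (simp add: gamma_nat_Suc)
qed

lemma gamma_nat_cong:
  assumes "[x = y] (mod p ^ M)" shows "[gamma_nat p x = gamma_nat p y] (mod int p ^ M)"
proof -
  have *: "[gamma_nat p (p ^ M * q + r) = gamma_nat p r] (mod int p ^ M)" for q r
  proof (induction q)
    case (Suc q)
    have "[gamma_nat p (p ^ M + (p ^ M * q + r)) = gamma_nat p (p ^ M * q + r)] (mod int p ^ M)"
      by (rule gamma_nat_add_prime_power)
    from cong_trans[OF this Suc] show ?case by (simp add: add.assoc)
  qed simp
  have "[gamma_nat p x = gamma_nat p (x mod p ^ M)] (mod int p ^ M)"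
    using *[of "x div p ^ M" "x mod p ^ M"] by simp
  moreover have "[gamma_nat p y = gamma_nat p (y mod p ^ M)] (mod int p ^ M)"
    using *[of "y div p ^ M" "y mod p ^ M"] by simp
  ultimately show ?thesis using assms by (metis cong_def)
qed

text \<open>Reflection: the factors just below \<open>p ^ M\<close> are congruent to the negatives
  of those of \<open>ufac\<close>. The signs in Morita's function compensate this at each factor
  that is kept; each omitted multiple of \<open>p\<close> leaves one sign, whence
  \<open>n div p\<close>.\<close>

lemma gamma_nat_ufac:
  assumes "n < p ^ M"
  shows "[gamma_nat p (p ^ M - n) * ufac (Suc n) = (-1) ^ (n div p)] (mod int p ^ M)"
  using assms
proof (induction n)
  case 0
  then show ?case using gamma_nat_add_prime_power[of M 0] by (simp add: ufac_Suc gamma_nat_eq[of 0])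
next
  case (Suc n)
  define x where "x = p ^ M - Suc n"
  have x: "p ^ M - n = Suc x" "int x = int p ^ M - int (Suc n)"
    using Suc.prems by (auto simp: x_def of_nat_diff)
  have IH: "[gamma_nat p (Suc x) * ufac (Suc n) = (-1) ^ (n div p)] (mod int p ^ M)"
    using Suc unfolding x(1) by simp
  have M: "M \<noteq> 0" using Suc.prems by (cases M) auto
  have dx: "p dvd x \<longleftrightarrow> p dvd Suc n"
  proof -
    have "x + Suc n = p ^ M" using Suc.prems by (simp add: x_def)
    then have "p dvd x + Suc n" using M by (simp add: dvd_power)
    then show ?thesis using dvd_add_right_iff dvd_add_left_iff by blast
  qed
  show ?case
  proof (cases "p dvd Suc n")
    case True
    then have d: "Suc n div p = Suc (n div p)" by (metis dvd_imp_mod_0 div_Suc)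
    have "gamma_nat p x * ufac (Suc (Suc n)) = - (gamma_nat p (Suc x) * ufac (Suc n))"
      using True dx by (simp add: gamma_nat_Suc ufac_Suc[of "Suc n"])
    then show ?thesis unfolding x_def[symmetric] d
      using IH by (simp add: cong_minus_minus_iff)
  next
    case False
    then have d: "Suc n div p = n div p" by (metis dvd_eq_mod_eq_0 div_Suc)
    have "gamma_nat p x * ufac (Suc (Suc n)) = gamma_nat p x * int (Suc n) * ufac (Suc n)"
      using False by (simp add: ufac_Suc[of "Suc n"])
    also have "[\<dots> = gamma_nat p x * - int x * ufac (Suc n)] (mod int p ^ M)"
      by (intro cong_mult cong_refl) (simp add: x(2) cong_iff_dvd_diff)
    also have "gamma_nat p x * - int x * ufac (Suc n) = gamma_nat p (Suc x) * ufac (Suc n)"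
      using False dx by (simp add: gamma_nat_Suc)
    also note IH
    finally show ?thesis unfolding x_def[symmetric] d .
  qed
qed

text \<open>The multiples of \<open>p\<close> up to \<open>n\<close> are \<open>p\<close> times the
  numbers up to \<open>n div p\<close>.\<close>

lemma fact_ufac: "fact n = ufac (Suc n) * int p ^ (n div p) * fact (n div p)"
proof (induction n)
  case (Suc n)
  show ?case
  proof (cases "p dvd Suc n")
    case True
    then have d: "Suc n div p = Suc (n div p)" by (metis dvd_imp_mod_0 div_Suc)
    have "Suc n = p * Suc (n div p)" using True d by (metis dvd_mult_div_cancel)
    then have "int (Suc n) = int p * int (Suc (n div p))" by (metis of_nat_mult)
    then show ?thesis unfolding d fact_Suc[of n] fact_Suc[of "n div p"] using Suc True
      by (simp add: ufac_Suc[of "Suc n"] mult_ac)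
  next
    case False
    then have d: "Suc n div p = n div p" by (metis dvd_eq_mod_eq_0 div_Suc)
    show ?thesis unfolding d using Suc False by (simp add: ufac_Suc[of "Suc n"] mult_ac)
  qed
qed (simp add: ufac_def)

lemma repunit_Suc_div: "a < p \<Longrightarrow> (a * repunit p (Suc N)) div p = a * repunit p N"
proof -
  assume "a < p"
  moreover have "a * repunit p (Suc N) = a + p * (a * repunit p N)" by (simp add: repunit_Suc algebra_simps)
  ultimately show ?thesis by simp
qed

text \<open>Splitting the three factorials by \<open>fact_ufac\<close> reproduces the binomial
  coefficient of the level below. As \<open>a + b < p\<close>, the addition has no carry, so the
  powers of \<open>p\<close> cancel.\<close>

lemma binom_rep_ufac:
  assumes "a + b < p"
  shows "int (binom_rep a b (Suc N)) * (ufac (Suc (a * repunit p (Suc N))) * ufac (Suc (b * repunit p (Suc N))))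
     = int (binom_rep a b N) * ufac (Suc ((a + b) * repunit p (Suc N)))"
proof -
  have F: "int (binom_rep a b N) * (fact (a * repunit p N) * fact (b * repunit p N)) = fact ((a + b) * repunit p N)" for N
  proof -
    have "fact (a * repunit p N) * fact (b * repunit p N) * binom_rep a b N = (fact ((a + b) * repunit p N) :: nat)"
      using binomial_fact_lemma[of "a * repunit p N" "a * repunit p N + b * repunit p N"]
      by (simp add: binom_rep_def algebra_simps)
    from arg_cong[OF this, of int] show ?thesis by (simp add: mult_ac)
  qed
  have D: "fact (a * repunit p (Suc N)) = ufac (Suc (a * repunit p (Suc N))) * int p ^ (a * repunit p N) * fact (a * repunit p N)"
    if "a < p" for a
    using fact_ufac[of "a * repunit p (Suc N)"] repunit_Suc_div[OF that] by simp
  define X where "X = int p ^ (a * repunit p N) * int p ^ (b * repunit p N) * (fact (a * repunit p N) * fact (b * repunit p N))"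
  have "X * (int (binom_rep a b (Suc N)) * (ufac (Suc (a * repunit p (Suc N))) * ufac (Suc (b * repunit p (Suc N)))))
      = int (binom_rep a b (Suc N)) * (fact (a * repunit p (Suc N)) * fact (b * repunit p (Suc N)))"
    using assms by (simp add: D X_def mult_ac)
  also have "\<dots> = fact ((a + b) * repunit p (Suc N))" by (rule F)
  also have "\<dots> = ufac (Suc ((a + b) * repunit p (Suc N))) * int p ^ ((a + b) * repunit p N) * fact ((a + b) * repunit p N)"
    by (rule D[OF assms])
  also have "\<dots> = X * (int (binom_rep a b N) * ufac (Suc ((a + b) * repunit p (Suc N))))"
  proof -
    have "int p ^ ((a + b) * repunit p N) = int p ^ (a * repunit p N) * int p ^ (b * repunit p N)"
      by (simp add: distrib_right power_add)
    then show ?thesis unfolding F[symmetric, of N] X_def by (simp only: mult_ac)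
  qed
  finally show ?thesis using pos by (simp add: X_def)
qed

lemma binom_rep_not_dvd:
  assumes "a + b < p" shows "\<not> int p dvd int (binom_rep a b N)"
proof (induction N)
  case 0 then show ?case using gt1 by (simp add: binom_rep_def)
next
  case (Suc N)
  show ?case
  proof
    assume "int p dvd int (binom_rep a b (Suc N))"
    then have "int p dvd int (binom_rep a b N) * ufac (Suc ((a + b) * repunit p (Suc N)))"
      unfolding binom_rep_ufac[OF assms, symmetric] by (rule dvd_mult2)
    then show False using not_dvd_mult[OF Suc ufac_not_dvd] by blast
  qed
qed

text \<open>Since \<open>p ^ k - j * repunit p k\<close> is congruent to \<open>j / (p - 1)\<close> modulo \<open>p ^ k\<close>, this is the value of
  Morita's function at \<open>j / (p - 1)\<close>.\<close>

definition gam :: "nat \<Rightarrow> nat \<Rightarrow> int" where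
  "gam k j = gamma_nat p (p ^ k - j * repunit p k)"

lemma rep_less: "j \<le> p - 1 \<Longrightarrow> j * repunit p k < p ^ k"
  using repunit_mult[OF pos, of k] mult_le_mono1[of j "p - 1" "repunit p k"] by linarith

lemma gam_lower_cong:
  assumes "k \<le> N" "j \<le> p - 1" shows "[gam N j = gam k j] (mod int p ^ k)"
  unfolding gam_def
proof (rule gamma_nat_cong)
  have "[int (p ^ N) - int (j * repunit p N) = int (p ^ k) - int (j * repunit p k)] (mod int (p ^ k))"
  proof -
    have "int (p ^ k) dvd int (p ^ N)" using assms(1) by (simp add: le_imp_power_dvd)
    then have "[int (p ^ N) = int (p ^ k)] (mod int (p ^ k))" by (simp add: cong_iff_dvd_diff)
    moreover have "[int (j * repunit p N) = int (j * repunit p k)] (mod int (p ^ k))"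
    proof -
      have "repunit p N = repunit p k + (\<Sum>i = k..<N. p ^ i)"
        using assms(1) by (simp add: repunit_def lessThan_atLeast0 sum.atLeastLessThan_concat)
      moreover have "p ^ k dvd (\<Sum>i = k..<N. p ^ i)"
        by (rule dvd_sum) (auto intro: le_imp_power_dvd)
      ultimately have "[repunit p N = repunit p k] (mod p ^ k)"
        by (metis cong_add_lcancel_0_nat cong_0_iff)
      then have "[j * repunit p N = j * repunit p k] (mod p ^ k)" by (rule cong_scalar_left)
      then show ?thesis by (simp only: cong_int_iff)
    qed
    ultimately show ?thesis by (rule cong_diff)
  qed
  then have "[int (p ^ N - j * repunit p N) = int (p ^ k - j * repunit p k)] (mod int (p ^ k))"
    using rep_less[OF assms(2), of N] rep_less[OF assms(2), of k] by (simp add: of_nat_diff)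
  then show "[p ^ N - j * repunit p N = p ^ k - j * repunit p k] (mod p ^ k)"
    by (simp only: cong_int_iff)
qed

lemma gam_not_dvd: "\<not> int p dvd gam k j"
  unfolding gam_def gamma_nat_eq using ufac_not_dvd by (simp add: minus_one_power_iff)

lemma gam_0: "[gam k 0 = 1] (mod int p ^ k)"
  using gamma_nat_add_prime_power[of k 0] by (simp add: gam_def gamma_nat_eq[of 0])

lemma gam_ufac:
  assumes "j < p"
  shows "[gam (Suc k) j * ufac (Suc (j * repunit p (Suc k))) = (-1) ^ (j * repunit p k)] (mod int p ^ Suc k)"
  using gamma_nat_ufac[OF rep_less, of j "Suc k"] repunit_Suc_div[OF assms, of k] assms by (simp add: gam_def)

text \<open>The quotient of two consecutive values of \<open>binom_rep\<close> is known in two ways: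
  it is \<open>- jac\<close> by the trace argument and a quotient of \<open>ufac\<close> values by
  factorials. Since \<open>gam\<close> inverts \<open>ufac\<close> up to sign, equating them gives
  the formula; the binomial coefficients are prime to \<open>p\<close> and cancel.\<close>

lemma gam_jac_lt:
  assumes a: "1 \<le> a" and b: "1 \<le> b" and ab: "a + b \<le> p - 2"
  shows "[gam k a * gam k b = - (gam k (a + b) * jac k a b)] (mod int p ^ k)"
proof -
  define N where "N = 3 * k + 7"
  define u where "u j = ufac (Suc (j * repunit p (Suc N)))" for j
  define C where "C = int (binom_rep a b N)"
  have ab': "a + b < p" using ab gt2 by linarith
  have kN: "k \<le> Suc N" by (simp add: N_def)
  have "C * u (a + b) = int (binom_rep a b (Suc N)) * (u a * u b)"
    unfolding C_def u_def by (rule binom_rep_ufac[OF ab', symmetric])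
  also have "[\<dots> = (- jac k a b * C) * (u a * u b)] (mod int p ^ k)"
    unfolding C_def by (intro cong_mult cong_refl binom_rep_cong a b ab) (simp add: N_def)
  also have "(- jac k a b * C) * (u a * u b) = C * (- jac k a b * (u a * u b))" by (simp add: mult_ac)
  finally have 1: "[u (a + b) = - jac k a b * (u a * u b)] (mod int p ^ k)"
    by (rule cong_cancel) (simp only: C_def binom_rep_not_dvd[OF ab'] not_False_eq_True)
  define s where "s j = (-1 :: int) ^ (j * repunit p N)" for j
  have g: "[gam k j * u j = s j] (mod int p ^ k)" if "j < p" for j
  proof -
    have "[gam (Suc N) j * u j = s j] (mod int p ^ k)"
      unfolding u_def s_def by (rule cong_prime_power_lower[OF gam_ufac[OF that] kN])
    moreover have "[gam (Suc N) j * u j = gam k j * u j] (mod int p ^ k)"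
      using that by (intro cong_mult cong_refl gam_lower_cong kN) simp
    ultimately show ?thesis using cong_sym cong_trans by blast
  qed
  have ss: "s (a + b) = s a * s b" by (simp add: s_def distrib_right power_add)
  have "[s (a + b) * (gam k a * gam k b) = (gam k (a + b) * u (a + b)) * (gam k a * gam k b)] (mod int p ^ k)"
    by (intro cong_mult cong_refl cong_sym[OF g] ab')
  also have "[(gam k (a + b) * u (a + b)) * (gam k a * gam k b)
      = (gam k (a + b) * (- jac k a b * (u a * u b))) * (gam k a * gam k b)] (mod int p ^ k)"
    by (intro cong_mult cong_refl 1)
  also have "(gam k (a + b) * (- jac k a b * (u a * u b))) * (gam k a * gam k b)
     = - (gam k (a + b) * jac k a b) * ((gam k a * u a) * (gam k b * u b))" by (simp add: mult_ac)
  also have "[\<dots> = - (gam k (a + b) * jac k a b) * (s a * s b)] (mod int p ^ k)"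
    by (intro cong_mult cong_refl g) (use ab' in auto)
  finally have "[s (a + b) * (gam k a * gam k b) = s (a + b) * (- (gam k (a + b) * jac k a b))] (mod int p ^ k)"
    by (simp add: ss mult_ac)
  then show ?thesis
    by (rule cong_cancel) (use gt1 in \<open>simp add: s_def minus_one_power_iff\<close>)
qed

text \<open>The natural number at which the second factor is evaluated is
  \<open>j * repunit p k + 1\<close>, so that factor is itself \<open>ufac\<close> up to sign and
  \<open>gam_ufac\<close> applies.\<close>

lemma gam_reflect:
  assumes "1 \<le> j" "j \<le> p - 2"
  shows "[gam k j * gam k (p - 1 - j) = - ((-1) ^ j)] (mod int p ^ k)"
proof (cases k)
  case (Suc M)
  define n where "n = j * repunit p k"
  have jp: "j < p" "j \<le> p - 1" using assms gt2 by auto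
  have "p ^ k - (p - 1 - j) * repunit p k = Suc n"
  proof -
    have "(p - 1 - j) * repunit p k + n = (p - 1) * repunit p k"
      using jp by (simp add: n_def distrib_right[symmetric])
    then show ?thesis using repunit_mult[OF pos, of k] by linarith
  qed
  then have "gam k (p - 1 - j) = (-1) ^ Suc n * ufac (Suc n)" by (simp add: gam_def gamma_nat_eq)
  then have "gam k j * gam k (p - 1 - j) = (-1) ^ Suc n * (gam k j * ufac (Suc n))" by simp
  also have "[\<dots> = (-1) ^ Suc n * (-1) ^ (j * repunit p M)] (mod int p ^ k)"
    unfolding n_def Suc by (intro cong_mult cong_refl gam_ufac jp)
  also have "(-1 :: int) ^ Suc n * (-1) ^ (j * repunit p M) = - ((-1) ^ j)"
  proof -
    have "n = j * repunit p M + j * p ^ M" by (simp add: n_def Suc repunit_Suc_add distrib_left)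
    then show ?thesis using odd by (simp add: minus_one_power_iff)
  qed
  finally show ?thesis .
qed simp

end

section \<open>Reflection of Jacobi sums and the Gross-Koblitz formula for all exponents\<close>

lemma sum_affine_residues:
  fixes f :: "int \<Rightarrow> 'a::comm_monoid_add"
  assumes "m > 0" "coprime c m"
  shows "(\<Sum>x\<in>{0..<m}. f ((c * x + d) mod m)) = (\<Sum>x\<in>{0..<m}. f x)"
proof -
  have "inj_on (\<lambda>x. (c * x + d) mod m) {0..<m}"
  proof (rule inj_onI)
    fix x y assume xy: "x \<in> {0..<m}" "y \<in> {0..<m}" "(c * x + d) mod m = (c * y + d) mod m"
    then have "[c * x + d = c * y + d] (mod m)" by (simp add: cong_def)
    then have "[x = y] (mod m)" using assms(2) cong_add_rcancel cong_mult_lcancel by blast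
    then show "x = y" using xy by (simp add: cong_def)
  qed
  moreover have "(\<lambda>x. (c * x + d) mod m) ` {0..<m} \<subseteq> {0..<m}" using assms(1) by auto
  ultimately have "bij_betw (\<lambda>x. (c * x + d) mod m) {0..<m} {0..<m}"
    by (simp add: bij_betw_def endo_inj_surj)
  from sum.reindex_bij_betw[OF this, of f] show ?thesis .
qed

context odd_prime
begin

definition residues :: "int set" where "residues = {0..<int p}"

lemma finite_residues [simp]: "finite residues" by (simp add: residues_def)

lemma residues_units: "residues = insert 0 units" "0 \<notin> units"
  using pos by (auto simp: residues_def units_def)

lemma sum_cong_affine:
  assumes f: "\<And>x y. [x = y] (mod int p) \<Longrightarrow> [f x = f y] (mod m)" and c: "\<not> int p dvd c"
  shows "[(\<Sum>x\<in>residues. f (c * x + d)) = (\<Sum>x\<in>residues. f x)] (mod m)"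
proof -
  have "coprime c (int p)" using coprime_power[OF c, of 1] by simp
  then have "(\<Sum>x\<in>residues. f ((c * x + d) mod int p)) = (\<Sum>x\<in>residues. f x)"
    using sum_affine_residues[of "int p" c f d] pos by (simp add: residues_def)
  moreover have "[(\<Sum>x\<in>residues. f (c * x + d)) = (\<Sum>x\<in>residues. f ((c * x + d) mod int p))] (mod m)"
    by (intro cong_sum f) simp
  ultimately show ?thesis by simp
qed

definition chi :: "nat \<Rightarrow> nat \<Rightarrow> int \<Rightarrow> int" where
  "chi k e x = (if int p dvd x then 0 else tpow k x ^ e)"

lemma chi_mult: "chi k e (x * y) = chi k e x * chi k e y"
  using int_prime by (auto simp: chi_def prime_dvd_mult_iff tpow_mult power_mult_distrib)

lemma chi_1 [simp]: "chi k e 1 = 1"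
  using gt1 by (simp add: chi_def)

lemma chi_cong: "[x = y] (mod int p) \<Longrightarrow> [chi k e x = chi k e y] (mod int p ^ k)"
  using cong_dvd_iff by (auto simp: chi_def intro!: cong_pow tpow_cong)

lemma chi_add: "chi k (e + f) x = chi k e x * chi k f x"
  by (simp add: chi_def power_add)

lemma chi_order: "\<not> int p dvd x \<Longrightarrow> (p - 1) dvd e \<Longrightarrow> [chi k e x = 1] (mod int p ^ k)"
  by (simp add: chi_def tpow_power_mult)

lemma sum_chi: "[(\<Sum>x\<in>residues. chi k e x) = (if (p - 1) dvd e then int p - 1 else 0)] (mod int p ^ k)"
proof -
  have "(\<Sum>x\<in>residues. chi k e x) = (\<Sum>x\<in>units. tpow k x ^ e)"
    unfolding residues_units using units_not_dvd residues_units(2)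
    by (simp add: chi_def cong: sum.cong)
  then show ?thesis using sum_tpow_power by metis
qed

lemma jac_chi: "jac k i j = (\<Sum>x\<in>residues. chi k (p - 1 - i) x * chi k (p - 1 - j) (1 - x))"
  unfolding jac_def residues_def
proof (rule sum.mono_neutral_cong_left)
  show "\<forall>x\<in>{0..<int p} - {2..<int p}. chi k (p - 1 - i) x * chi k (p - 1 - j) (1 - x) = 0"
  proof
    fix x assume "x \<in> {0..<int p} - {2..<int p}"
    then have "x = 0 \<or> x = 1" by auto
    then show "chi k (p - 1 - i) x * chi k (p - 1 - j) (1 - x) = 0" by (auto simp: chi_def)
  qed
qed (use range2_not_dvd in \<open>auto simp: chi_def\<close>)

text \<open>On units \<open>chi k f'\<close> is the inverse of \<open>chi k f\<close>. Drawing it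
  into the argument and substituting \<open>1 / w\<close> makes the argument
  \<open>(1 - r) * w + r\<close>. Over all residues the sum vanishes unless this is constant; the
  subtracted term is the value at \<open>w = 0\<close>.\<close>

lemma sum_units_inverse_affine:
  assumes ff: "f + f' = p - 1" "\<not> (p - 1) dvd f"
  shows "[(\<Sum>w\<in>units. chi k f (1 - r + r * w) * chi k f' w)
    = (if int p dvd 1 - r then int p else 0) - chi k f r] (mod int p ^ k)" (is "[?L = ?R] (mod _)")
proof -
  define v where "v w = w ^ (p - 2) mod int p" for w :: int
  have v: "[w * v w = 1] (mod int p)" if "w \<in> units" for w
  proof -
    have "[w * v w = w * w ^ (p - 2)] (mod int p)" unfolding v_def by (intro cong_mult cong_refl) simp
    also have "w * w ^ (p - 2) = w ^ (p - 1)" using gt2 by (simp flip: power_Suc add: Suc_diff_Suc numeral_2_eq_2)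
    also have "[w ^ (p - 1) = 1] (mod int p)" using fermat_int units_not_dvd that by blast
    finally show ?thesis .
  qed
  have vu: "v w \<in> units" if "w \<in> units" for w
    unfolding v_def by (intro mod_in_units not_dvd_power units_not_dvd that)
  have "inj_on v units"
  proof (rule inj_onI)
    fix x y assume xy: "x \<in> units" "y \<in> units" "v x = v y"
    have "[x * (y * v y) = x * 1] (mod int p)" by (intro cong_mult cong_refl v xy)
    moreover have "[y * (x * v x) = y * 1] (mod int p)" by (intro cong_mult cong_refl v xy)
    moreover have "x * (y * v y) = y * (x * v x)" by (simp add: xy(3))
    ultimately have "[x = y] (mod int p)" by (metis cong_sym cong_trans mult.right_neutral)
    then show "x = y" using xy units_eqI by blast
  qed
  then have bij: "bij_betw v units units" using vu
    by (simp add: bij_betw_def endo_inj_surj image_subsetI)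
  have "[?L = (\<Sum>w\<in>units. chi k f ((1 - r) * v w + r))] (mod int p ^ k)"
  proof (rule cong_sum)
    fix w assume w: "w \<in> units"
    have 1: "[chi k f w * chi k f (v w) = 1] (mod int p ^ k)"
      using chi_cong[OF v[OF w], of k f] by (simp add: chi_mult)
    have 2: "[chi k f w * chi k f' w = 1] (mod int p ^ k)"
      using chi_order[OF units_not_dvd[OF w], of "p - 1" k] by (simp only: chi_add[symmetric] ff(1) dvd_refl)
    have "[chi k f' w = chi k f (v w)] (mod int p ^ k)"
    proof (rule cong_cancel)
      show "[chi k f w * chi k f' w = chi k f w * chi k f (v w)] (mod int p ^ k)"
        using 1 2 cong_sym cong_trans by blast
      show "\<not> int p dvd chi k f w" using units_not_dvd[OF w] by (simp add: chi_def not_dvd_power tpow_not_dvd)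
    qed
    then have "[chi k f (1 - r + r * w) * chi k f' w = chi k f (1 - r + r * w) * chi k f (v w)] (mod int p ^ k)"
      by (intro cong_mult cong_refl)
    also have "chi k f (1 - r + r * w) * chi k f (v w) = chi k f ((1 - r) * v w + r * (w * v w))"
      by (simp add: chi_mult[symmetric] algebra_simps)
    also have "[\<dots> = chi k f ((1 - r) * v w + r * 1)] (mod int p ^ k)"
      by (intro chi_cong cong_add cong_mult cong_refl v w)
    finally show "[chi k f (1 - r + r * w) * chi k f' w = chi k f ((1 - r) * v w + r)] (mod int p ^ k)" by simp
  qed
  also have "(\<Sum>w\<in>units. chi k f ((1 - r) * v w + r)) = (\<Sum>w\<in>units. chi k f ((1 - r) * w + r))"
    using sum.reindex_bij_betw[OF bij, of "\<lambda>w. chi k f ((1 - r) * w + r)"] .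
  also have "\<dots> = (\<Sum>w\<in>residues. chi k f ((1 - r) * w + r)) - chi k f r"
    unfolding residues_units using residues_units(2) by simp
  also have "[\<dots> = (if int p dvd 1 - r then int p else 0) - chi k f r] (mod int p ^ k)"
  proof (cases "int p dvd 1 - r")
    case True
    have "[(\<Sum>w\<in>residues. chi k f ((1 - r) * w + r)) = (\<Sum>w\<in>residues. chi k f 1)] (mod int p ^ k)"
    proof (intro cong_sum chi_cong)
      fix w
      have "(1 - r) * w + r - 1 = (1 - r) * (w - 1)" by (simp add: algebra_simps)
      then have "int p dvd (1 - r) * w + r - 1" using True by (simp only: dvd_mult2)
      then show "[(1 - r) * w + r = 1] (mod int p)" by (simp add: cong_iff_dvd_diff)
    qed
    then show ?thesis using True by (intro cong_diff) (simp_all add: residues_def)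
  next
    case False
    have "[(\<Sum>w\<in>residues. chi k f ((1 - r) * w + r)) = (\<Sum>w\<in>residues. chi k f w)] (mod int p ^ k)"
      by (rule sum_cong_affine[OF chi_cong False])
    also have "[(\<Sum>w\<in>residues. chi k f w) = 0] (mod int p ^ k)" using sum_chi[of k f] ff(2) by simp
    finally show ?thesis using False by (intro cong_diff) simp_all
  qed
  finally show ?thesis .
qed

lemma jac_mult_reflect:
  assumes i: "1 \<le> i" "i \<le> p - 2" and j: "1 \<le> j" "j \<le> p - 2" and ij: "i + j \<noteq> p - 1"
  shows "[jac k i j * jac k (p - 1 - i) (p - 1 - j) = int p] (mod int p ^ k)"
proof -
  define e where "e = p - 1 - i"
  define f where "f = p - 1 - j"
  have ei: "e + i = p - 1" "p - 1 - (p - 1 - i) = i" and fj: "f + j = p - 1" "p - 1 - (p - 1 - j) = j"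
    using i j by (auto simp: e_def f_def)
  have nd: "\<not> (p - 1) dvd n" if "0 < n" "n < p - 1" for n using that by (auto dest: dvd_imp_le)
  have nde: "\<not> (p - 1) dvd e" and ndf: "\<not> (p - 1) dvd f"
    using nd[of e] nd[of f] i j gt2 by (auto simp: e_def f_def)
  have ndef: "\<not> (p - 1) dvd e + f"
  proof
    assume "(p - 1) dvd e + f"
    then obtain q where q: "e + f = (p - 1) * q" by blast
    have "e + f \<noteq> p - 1" "0 < e + f" "e + f < 2 * (p - 1)" using i j ij gt2 by (auto simp: e_def f_def)
    then have "q \<noteq> 1" "q \<noteq> 0" "(p - 1) * q < (p - 1) * 2" unfolding q by auto
    then show False by (simp only: nat_mult_less_cancel_disj) linarith
  qed
  have ch: "[chi k e y * chi k i y = 1] (mod int p ^ k)" if "y \<in> units" for y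
    using chi_order[OF units_not_dvd[OF that], of "p - 1" k] by (simp only: chi_add[symmetric] ei(1) dvd_refl)
  have T: "[(\<Sum>y\<in>units. chi k f (1 - r * y) * chi k j (1 - y))
      = (if int p dvd 1 - r then int p else 0) - chi k f r - 1] (mod int p ^ k)" for r
  proof -
    have "(\<Sum>y\<in>units. chi k f (1 - r * y) * chi k j (1 - y)) = (\<Sum>y\<in>residues. chi k f (1 - r * y) * chi k j (1 - y)) - 1"
      unfolding residues_units using residues_units(2) by simp
    also have "[(\<Sum>y\<in>residues. chi k f (1 - r * y) * chi k j (1 - y)) - 1
       = (\<Sum>w\<in>residues. chi k f (1 - r * (-1 * w + 1)) * chi k j (1 - (-1 * w + 1))) - 1] (mod int p ^ k)"
    proof (rule cong_diff[OF cong_sym[OF sum_cong_affine[where f = "\<lambda>y. chi k f (1 - r * y) * chi k j (1 - y)"]] cong_refl])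
      show "[chi k f (1 - r * x) * chi k j (1 - x) = chi k f (1 - r * y) * chi k j (1 - y)] (mod int p ^ k)"
        if "[x = y] (mod int p)" for x y
        using that by (intro cong_mult chi_cong cong_diff cong_refl)
      show "\<not> int p dvd -1" using gt1 by simp
    qed
    also have "(\<Sum>w\<in>residues. chi k f (1 - r * (-1 * w + 1)) * chi k j (1 - (-1 * w + 1))) - 1
      = (\<Sum>w\<in>units. chi k f (1 - r + r * w) * chi k j w) - 1"
      unfolding residues_units using residues_units(2) by (simp add: chi_def[of k j 0] algebra_simps)
    also have "[(\<Sum>w\<in>units. chi k f (1 - r + r * w) * chi k j w) - 1
      = ((if int p dvd 1 - r then int p else 0) - chi k f r) - 1] (mod int p ^ k)"
      by (intro cong_diff cong_refl sum_units_inverse_affine fj ndf)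
    finally show ?thesis .
  qed
  have "jac k i j * jac k (p - 1 - i) (p - 1 - j)
    = (\<Sum>y\<in>residues. chi k i y * chi k j (1 - y) * (\<Sum>x\<in>residues. chi k e x * chi k f (1 - x)))"
  proof -
    have 1: "jac k i j = (\<Sum>x\<in>residues. chi k e x * chi k f (1 - x))"
      by (simp only: jac_chi e_def f_def)
    have 2: "jac k (p - 1 - i) (p - 1 - j) = (\<Sum>y\<in>residues. chi k i y * chi k j (1 - y))"
      by (simp only: jac_chi ei(2) fj(2))
    have "X * sum h residues = (\<Sum>y\<in>residues. h y * X)" for X :: int and h
      using sum_distrib_right[of h residues X] by (simp only: mult.commute[of X "sum h residues"])
    then show ?thesis unfolding 1 2 .
  qed
  also have "\<dots> = (\<Sum>y\<in>units. chi k i y * chi k j (1 - y) * (\<Sum>x\<in>residues. chi k e x * chi k f (1 - x)))"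
    unfolding residues_units(1) using residues_units(2) by (simp add: chi_def[of k i 0])
  finally have S0: "jac k i j * jac k (p - 1 - i) (p - 1 - j)
     = (\<Sum>y\<in>units. chi k i y * chi k j (1 - y) * (\<Sum>x\<in>residues. chi k e x * chi k f (1 - x)))" .
  have S1: "[(\<Sum>y\<in>units. chi k i y * chi k j (1 - y) * (\<Sum>x\<in>residues. chi k e x * chi k f (1 - x)))
     = (\<Sum>y\<in>units. \<Sum>r\<in>residues. chi k e r * (chi k f (1 - r * y) * chi k j (1 - y)))] (mod int p ^ k)"
  proof (rule cong_sum)
    fix y assume y: "y \<in> units"
    have "[(\<Sum>x\<in>residues. chi k e x * chi k f (1 - x)) = (\<Sum>x\<in>residues. chi k e (y * x + 0) * chi k f (1 - (y * x + 0)))] (mod int p ^ k)"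
    proof (rule cong_sym[OF sum_cong_affine[where f = "\<lambda>x. chi k e x * chi k f (1 - x)"]])
      show "[chi k e x * chi k f (1 - x) = chi k e y * chi k f (1 - y)] (mod int p ^ k)"
        if "[x = y] (mod int p)" for x y
        using that by (intro cong_mult chi_cong cong_diff cong_refl)
    qed (use units_not_dvd y in blast)
    then have "[chi k i y * chi k j (1 - y) * (\<Sum>x\<in>residues. chi k e x * chi k f (1 - x))
       = chi k i y * chi k j (1 - y) * (\<Sum>x\<in>residues. chi k e (y * x + 0) * chi k f (1 - (y * x + 0)))] (mod int p ^ k)"
      by (intro cong_mult cong_refl)
    also have "chi k i y * chi k j (1 - y) * (\<Sum>x\<in>residues. chi k e (y * x + 0) * chi k f (1 - (y * x + 0)))
      = (chi k e y * chi k i y) * (\<Sum>r\<in>residues. chi k e r * (chi k f (1 - r * y) * chi k j (1 - y)))"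
      by (simp add: chi_mult sum_distrib_left mult_ac)
    also have "[(chi k e y * chi k i y) * (\<Sum>r\<in>residues. chi k e r * (chi k f (1 - r * y) * chi k j (1 - y)))
      = 1 * (\<Sum>r\<in>residues. chi k e r * (chi k f (1 - r * y) * chi k j (1 - y)))] (mod int p ^ k)"
      by (intro cong_mult cong_refl ch y)
    finally show "[chi k i y * chi k j (1 - y) * (\<Sum>x\<in>residues. chi k e x * chi k f (1 - x))
      = (\<Sum>r\<in>residues. chi k e r * (chi k f (1 - r * y) * chi k j (1 - y)))] (mod int p ^ k)" by simp
  qed
  have S2: "(\<Sum>y\<in>units. \<Sum>r\<in>residues. chi k e r * (chi k f (1 - r * y) * chi k j (1 - y)))
    = (\<Sum>r\<in>residues. chi k e r * (\<Sum>y\<in>units. chi k f (1 - r * y) * chi k j (1 - y)))"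
    unfolding sum_distrib_left by (rule sum.swap)
  have S3: "[(\<Sum>r\<in>residues. chi k e r * (\<Sum>y\<in>units. chi k f (1 - r * y) * chi k j (1 - y)))
    = (\<Sum>r\<in>residues. chi k e r * ((if int p dvd 1 - r then int p else 0) - chi k f r - 1))] (mod int p ^ k)"
    by (rule cong_sum, rule cong_mult[OF cong_refl T])
  have S4: "(\<Sum>r\<in>residues. chi k e r * ((if int p dvd 1 - r then int p else 0) - chi k f r - 1))
    = (\<Sum>r\<in>residues. if r = 1 then int p else 0) - (\<Sum>r\<in>residues. chi k (e + f) r) - (\<Sum>r\<in>residues. chi k e r)"
  proof -
    have "chi k e r * ((if int p dvd 1 - r then int p else 0) - chi k f r - 1)
      = (if r = 1 then int p else 0) - chi k (e + f) r - chi k e r" if "r \<in> residues" for r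
    proof -
      have "int p dvd 1 - r \<longleftrightarrow> r = 1"
      proof -
        have "int p dvd 1 - r \<longleftrightarrow> [1 = r] (mod int p)" by (simp add: cong_iff_dvd_diff)
        also have "\<dots> \<longleftrightarrow> r = 1" using that gt1 by (auto simp: cong_def residues_def)
        finally show ?thesis .
      qed
      then show ?thesis by (simp add: chi_add algebra_simps)
    qed
    then show ?thesis by (simp add: sum_subtractf)
  qed
  have S5: "[(\<Sum>r\<in>residues. if r = 1 then int p else 0) - (\<Sum>r\<in>residues. chi k (e + f) r) - (\<Sum>r\<in>residues. chi k e r)
    = int p - 0 - 0] (mod int p ^ k)"
  proof (intro cong_diff)
    have "1 \<in> residues" using gt1 by (simp add: residues_def)
    then show "[(\<Sum>r\<in>residues. if r = 1 then int p else 0) = int p] (mod int p ^ k)" by simp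
    show "[(\<Sum>r\<in>residues. chi k (e + f) r) = 0] (mod int p ^ k)" using sum_chi[of k "e + f"] ndef by simp
    show "[(\<Sum>r\<in>residues. chi k e r) = 0] (mod int p ^ k)" using sum_chi[of k e] nde by simp
  qed
  have "[jac k i j * jac k (p - 1 - i) (p - 1 - j) = int p - 0 - 0] (mod int p ^ k)"
    unfolding S0 by (rule cong_trans[OF S1[unfolded S2] cong_trans[OF S3[unfolded S4] S5]])
  then show ?thesis by simp
qed

lemma jac_commute: "[jac k i j = jac k j i] (mod int p ^ k)"
proof -
  define f where "f x = chi k (p - 1 - i) x * chi k (p - 1 - j) (1 - x)" for x
  have "[(\<Sum>x\<in>residues. f (-1 * x + 1)) = (\<Sum>x\<in>residues. f x)] (mod int p ^ k)"
  proof (rule sum_cong_affine)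
    show "[f x = f y] (mod int p ^ k)" if "[x = y] (mod int p)" for x y
      unfolding f_def using that by (intro cong_mult chi_cong cong_diff cong_refl)
  qed (use gt1 in simp)
  then show ?thesis unfolding jac_chi f_def by (simp add: mult.commute cong_sym_eq)
qed

lemma jac_0:
  assumes "1 \<le> j" "j \<le> p - 2" shows "[jac k j 0 = -1] (mod int p ^ k)"
proof -
  have "[jac k j 0 = (\<Sum>x\<in>residues. chi k (p - 1 - j) x - (if x = 1 then 1 else 0))] (mod int p ^ k)"
    unfolding jac_chi
  proof (rule cong_sum)
    fix x assume x: "x \<in> residues"
    show "[chi k (p - 1 - j) x * chi k (p - 1 - 0) (1 - x) = chi k (p - 1 - j) x - (if x = 1 then 1 else 0)] (mod int p ^ k)"
    proof (cases "x = 1")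
      case False
      have "\<not> int p dvd 1 - x"
      proof
        assume "int p dvd 1 - x"
        then have "[x = 1] (mod int p)" by (simp add: cong_iff_dvd_diff dvd_diff_commute)
        then show False using x False gt1 by (simp add: cong_def residues_def)
      qed
      then have "[chi k (p - 1) (1 - x) = 1] (mod int p ^ k)" by (intro chi_order) simp_all
      from cong_mult[OF cong_refl[of "chi k (p - 1 - j) x"] this] show ?thesis using False by simp
    qed (simp add: chi_def)
  qed
  also have "(\<Sum>x\<in>residues. chi k (p - 1 - j) x - (if x = 1 then 1 else 0)) = (\<Sum>x\<in>residues. chi k (p - 1 - j) x) - 1"
    using gt1 by (simp add: sum_subtractf residues_def)
  also have "[(\<Sum>x\<in>residues. chi k (p - 1 - j) x) - 1 = 0 - 1] (mod int p ^ k)"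
  proof (intro cong_diff cong_refl)
    have "\<not> (p - 1) dvd (p - 1 - j)" using assms by (auto dest!: dvd_imp_le)
    then show "[(\<Sum>x\<in>residues. chi k (p - 1 - j) x) = 0] (mod int p ^ k)" using sum_chi[of k "p - 1 - j"] by simp
  qed
  finally show ?thesis by simp
qed

text \<open>If \<open>i + j\<close> exceeds \<open>p - 1\<close>, the complementary exponents
  \<open>p - 1 - i\<close> and \<open>p - 1 - j\<close> have a sum below \<open>p - 1\<close>, where
  \<open>gam_jac_lt\<close> holds. Reflection of \<open>gam\<close> and of \<open>jac\<close>
  transports the formula back, and the product \<open>p\<close> of the two Jacobi sums becomes the
  factor \<open>- p\<close>.\<close>

theorem gross_koblitz_jacobi:
  assumes i: "i \<le> p - 2" and j: "j \<le> p - 2" and ij: "i + j \<noteq> 0" "i + j \<noteq> p - 1"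
  shows "[gam k i * gam k j * (if i + j \<ge> p - 1 then - int p else 1)
    = - (gam k ((i + j) mod (p - 1)) * jac k i j)] (mod int p ^ k)"
proof -
  have zero: "[gam k 0 * gam k j = - (gam k j * jac k j 0)] (mod int p ^ k)" if "1 \<le> j" "j \<le> p - 2" for j
  proof -
    have "[gam k 0 * gam k j = 1 * gam k j] (mod int p ^ k)" by (intro cong_mult cong_refl gam_0)
    moreover have "[gam k j * - jac k j 0 = gam k j * - (-1)] (mod int p ^ k)"
      by (intro cong_mult cong_refl cong_uminus jac_0 that)
    ultimately show ?thesis by (simp add: cong_sym_eq) (metis cong_sym cong_trans)
  qed
  consider "j = 0" | "i = 0" | "1 \<le> i" "1 \<le> j" "i + j \<le> p - 2" | "1 \<le> i" "1 \<le> j" "i + j \<ge> p"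
    using ij by linarith
  then show ?thesis
  proof cases
    case 1
    moreover have "\<not> p - 1 \<le> i" using i gt2 by linarith
    ultimately show ?thesis using zero[of i] i ij gt2 by (simp add: mult.commute)
  next
    case 2
    have "[- (gam k j * jac k j 0) = - (gam k j * jac k 0 j)] (mod int p ^ k)"
      by (intro cong_uminus cong_mult cong_refl jac_commute)
    moreover have "\<not> p - 1 \<le> j" using j gt2 by linarith
    moreover have "[gam k 0 * gam k j = - (gam k j * jac k j 0)] (mod int p ^ k)" using zero[of j] 2 j ij by simp
    ultimately show ?thesis using 2 cong_trans by simp blast
  next
    case 3
    moreover have "\<not> p - 1 \<le> i + j" using 3 gt2 by linarith
    ultimately show ?thesis using gam_jac_lt[of i j k] by simp
  next
    case 4
    define i' where "i' = p - 1 - i"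
    define j' where "j' = p - 1 - j"
    define s where "s = i + j - (p - 1)"
    have s: "(i + j) mod (p - 1) = s" "1 \<le> s" "s \<le> p - 2" "p - 1 - s = i' + j'"
      using 4 i j gt2 by (auto simp: s_def i'_def j'_def mod_if)
    have i': "1 \<le> i'" "1 \<le> j'" "i' + j' \<le> p - 2" using 4 i j gt2 by (auto simp: i'_def j'_def)
    have m1: "(-1 :: int) ^ i * (-1) ^ j = (-1) ^ s"
    proof -
      have "i + j = s + (p - 1)" using 4 by (simp add: s_def)
      moreover have "even (p - 1)" using odd by simp
      ultimately show ?thesis by (metis power_add mult.right_neutral neg_one_even_power)
    qed
    have R: "[gam k x * gam k (p - 1 - x) = - ((-1) ^ x)] (mod int p ^ k)" if "1 \<le> x" "x \<le> p - 2" for x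
      using gam_reflect that .
    define A where "A = gam k i * gam k j"
    define A' where "A' = gam k i' * gam k j'"
    have 1: "[A' = - (gam k (i' + j') * jac k i' j')] (mod int p ^ k)"
      unfolding A'_def by (rule gam_jac_lt[OF i'])
    have 2: "[jac k i j * jac k i' j' = int p] (mod int p ^ k)"
      unfolding i'_def j'_def using 4 i j by (intro jac_mult_reflect) auto
    have AA: "[A * A' = (-1) ^ s] (mod int p ^ k)"
    proof -
      have "[(gam k i * gam k i') * (gam k j * gam k j') = - ((-1) ^ i) * - ((-1) ^ j)] (mod int p ^ k)"
        unfolding i'_def j'_def using 4 i j by (intro cong_mult R) auto
      then show ?thesis using m1 by (simp add: A_def A'_def mult_ac)
    qed
    have ss: "[gam k s * gam k (i' + j') = - ((-1) ^ s)] (mod int p ^ k)"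
      using R[OF s(2,3)] s(4) by simp
    have "[A' * (gam k s * jac k i j) = - (gam k (i' + j') * jac k i' j') * (gam k s * jac k i j)] (mod int p ^ k)"
      by (intro cong_mult cong_refl 1)
    also have "- (gam k (i' + j') * jac k i' j') * (gam k s * jac k i j) = - ((gam k s * gam k (i' + j')) * (jac k i j * jac k i' j'))"
      by (simp add: mult_ac)
    also have "[- ((gam k s * gam k (i' + j')) * (jac k i j * jac k i' j')) = - (- ((-1) ^ s) * int p)] (mod int p ^ k)"
      by (intro cong_uminus cong_mult ss 2)
    also have "- (- ((-1) ^ s) * int p) = (-1) ^ s * int p" by simp
    also have "[(-1) ^ s * int p = (A * A') * int p] (mod int p ^ k)"
      by (intro cong_mult cong_refl cong_sym[OF AA])
    also have "(A * A') * int p = A' * (A * int p)" by (simp add: mult_ac)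
    finally have "[gam k s * jac k i j = A * int p] (mod int p ^ k)"
      by (rule cong_cancel) (simp add: A'_def not_dvd_mult gam_not_dvd)
    then have "[- (gam k s * jac k i j) = - (A * int p)] (mod int p ^ k)" by (rule cong_uminus)
    moreover have "p - 1 \<le> i + j" using 4 by linarith
    ultimately show ?thesis unfolding s(1) A_def
      by (simp only: if_True mult_minus_right cong_sym_eq[of "- (gam k s * jac k i j)"])
  qed
qed

end

section \<open>Complex Gauss and Jacobi sums\<close>

locale prime_gen = odd_prime +
  fixes g :: int
  assumes g_not_dvd: "\<not> int p dvd g"
    and g_gen: "\<And>x. \<not> int p dvd x \<Longrightarrow> \<exists>i<p - 1. [x = g ^ i] (mod int p)"
    and g_ord: "\<And>e. [g ^ e = 1] (mod int p) \<longleftrightarrow> (p - 1) dvd e"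
begin

text \<open>A discrete logarithm, determined only modulo \<open>p - 1\<close>; no representative is
  fixed because it occurs in exponents of roots of unity whose order divides
  \<open>p - 1\<close>.\<close>

definition ind :: "int \<Rightarrow> nat" where "ind x = (SOME i. [x = g ^ i] (mod int p))"

lemma ind: "\<not> int p dvd x \<Longrightarrow> [x = g ^ ind x] (mod int p)"
  unfolding ind_def using g_gen by (metis (mono_tags, lifting) someI_ex)

lemma g_power_cong: "[g ^ i = g ^ j] (mod int p) \<longleftrightarrow> [i = j] (mod (p - 1))"
proof -
  have le: "[g ^ j = g ^ i] (mod int p) \<longleftrightarrow> [j = i] (mod (p - 1))" if ij: "i \<le> j" for i j
  proof -
    obtain d where d: "j = i + d" using le_Suc_ex[OF ij] by blast
    have "[g ^ j = g ^ i] (mod int p) \<longleftrightarrow> [g ^ d = 1] (mod int p)"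
    proof
      assume "[g ^ j = g ^ i] (mod int p)"
      then have "[g ^ i * g ^ d = g ^ i * 1] (mod int p ^ 1)" by (simp add: d power_add)
      from cong_cancel[OF this not_dvd_power[OF g_not_dvd]] show "[g ^ d = 1] (mod int p)" by simp
    next
      assume "[g ^ d = 1] (mod int p)"
      from cong_scalar_left[OF this, of "g ^ i"] show "[g ^ j = g ^ i] (mod int p)"
        by (simp add: d power_add)
    qed
    also have "\<dots> \<longleftrightarrow> (p - 1) dvd d" by (rule g_ord)
    also have "\<dots> \<longleftrightarrow> [j = i] (mod (p - 1))"
      unfolding d cong_add_lcancel_0_nat by (simp add: cong_0_iff)
    finally show ?thesis .
  qed
  show ?thesis
  proof (cases "i \<le> j")
    case True
    then show ?thesis using le[OF True] by (simp only: cong_sym_eq[of "g ^ i" "g ^ j"] cong_sym_eq[of i j])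
  next
    case False
    then have "j \<le> i" by simp
    from le[OF this] show ?thesis .
  qed
qed

lemma ind_cong: "[x = y] (mod int p) \<Longrightarrow> \<not> int p dvd x \<Longrightarrow> [ind x = ind y] (mod (p - 1))"
proof -
  assume xy: "[x = y] (mod int p)" "\<not> int p dvd x"
  then have "\<not> int p dvd y" using cong_dvd_iff by blast
  then have "[g ^ ind x = g ^ ind y] (mod int p)"
    using ind[OF xy(2)] ind[of y] xy(1) cong_sym cong_trans by meson
  then show ?thesis by (simp only: g_power_cong)
qed

lemma ind_mult: "\<not> int p dvd x \<Longrightarrow> \<not> int p dvd y \<Longrightarrow> [ind (x * y) = ind x + ind y] (mod (p - 1))"
proof -
  assume nd: "\<not> int p dvd x" "\<not> int p dvd y"
  have "[x * y = g ^ ind x * g ^ ind y] (mod int p)" by (intro cong_mult ind nd)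
  moreover have "[x * y = g ^ ind (x * y)] (mod int p)" by (intro ind not_dvd_mult nd)
  ultimately have "[g ^ ind (x * y) = g ^ (ind x + ind y)] (mod int p)"
    unfolding power_add using cong_sym cong_trans by blast
  then show ?thesis by (simp only: g_power_cong)
qed

lemma ind_1: "[ind 1 = 0] (mod (p - 1))"
proof -
  have "\<not> int p dvd 1" using gt1 by simp
  from cong_sym[OF ind[OF this]] show ?thesis unfolding g_power_cong[symmetric] by simp
qed

lemma ind_g: "[ind g = 1] (mod (p - 1))"
  using cong_sym[OF ind[OF g_not_dvd]] unfolding g_power_cong[symmetric] by simp

definition zeta :: complex where "zeta = cis (2 * pi / real (p - 1))"

lemma zeta_power_int: "zeta powi n = cis (2 * pi * of_int n / real (p - 1))"
  unfolding zeta_def cis_power_int by (simp add: mult_ac)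

lemma zeta_nonzero: "zeta \<noteq> 0" by (simp add: zeta_def)

lemma cis_eq_1_int: "cis (2 * pi * of_int n / real m) = 1 \<longleftrightarrow> int m dvd n" if "m > 0" for m :: nat
proof
  assume "int m dvd n"
  then obtain q where "n = int m * q" by blast
  then have "2 * pi * of_int n / real m = 2 * pi * of_int q" using that by simp
  then show "cis (2 * pi * of_int n / real m) = 1" by simp
next
  assume "cis (2 * pi * of_int n / real m) = 1"
  then have "cos (2 * pi * of_int n / real m) = 1" by (metis cis.simps(1) one_complex.simps(1))
  then obtain q :: int where q: "2 * pi * of_int n / real m = of_int q * 2 * pi" using cos_one_2pi_int by auto
  then have "(2 * pi) * (of_int n / real m) = (2 * pi) * of_int q" by (simp add: mult.commute)
  then have "of_int n / real m = of_int q" by (simp only: mult_cancel_left) simp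
  then have "real_of_int n = real_of_int (q * int m)" using that by (simp add: field_simps)
  then have "n = q * int m" by (simp only: of_int_eq_iff)
  then show "int m dvd n" by simp
qed

lemma zeta_eq_1: "zeta powi n = 1 \<longleftrightarrow> int (p - 1) dvd n"
  unfolding zeta_power_int using cis_eq_1_int[of "p - 1" n] gt1 by simp

lemma zeta_cong: "[m = n] (mod int (p - 1)) \<Longrightarrow> zeta powi m = zeta powi n"
proof -
  assume "[m = n] (mod int (p - 1))"
  then have "int (p - 1) dvd m - n" by (simp add: cong_iff_dvd_diff)
  then have "zeta powi (m - n) = 1" by (simp add: zeta_eq_1)
  then show ?thesis using zeta_nonzero by (simp add: power_int_diff)
qed

text \<open>The trivial character \<open>j = 0\<close> also vanishes at multiples of
  \<open>p\<close>. Hence its Gauss sum is \<open>-1\<close>, and \<open>G_mult\<close> holds even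
  if one of the two characters is trivial.\<close>

definition X :: "int \<Rightarrow> int \<Rightarrow> complex" where
  "X j x = (if int p dvd x then 0 else zeta powi (j * int (ind x)))"

lemma X_mult: "X j (x * y) = X j x * X j y"
proof (cases "int p dvd x \<or> int p dvd y")
  case True then show ?thesis by (auto simp: X_def)
next
  case False
  then have "[int (ind (x * y)) = int (ind x + ind y)] (mod int (p - 1))"
    unfolding cong_int_iff by (intro ind_mult) auto
  then have "zeta powi (j * int (ind (x * y))) = zeta powi (j * int (ind x + ind y))"
    by (intro zeta_cong cong_scalar_left)
  then show ?thesis using False not_dvd_mult[of x y]
    by (simp add: X_def distrib_left power_int_add zeta_nonzero)
qed

lemma X_add: "X (i + j) x = X i x * X j x"
  by (simp add: X_def distrib_right power_int_add zeta_nonzero)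

lemma X_cong: "[x = y] (mod int p) \<Longrightarrow> X j x = X j y"
proof (cases "int p dvd x")
  case True
  moreover assume "[x = y] (mod int p)"
  ultimately show ?thesis using cong_dvd_iff by (auto simp: X_def)
next
  case False
  moreover assume *: "[x = y] (mod int p)"
  ultimately have "[int (ind x) = int (ind y)] (mod int (p - 1))" using ind_cong by (simp only: cong_int_iff)
  then have "zeta powi (j * int (ind x)) = zeta powi (j * int (ind y))" by (intro zeta_cong cong_scalar_left)
  then show ?thesis using False * cong_dvd_iff by (auto simp: X_def)
qed

lemma X_mod: "[i = j] (mod int (p - 1)) \<Longrightarrow> X i x = X j x"
  by (auto simp: X_def intro!: zeta_cong cong_scalar_right)

lemma X_neg: "X (- j) x = inverse (X j x)"
  by (simp add: X_def power_int_minus)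

lemma X_zero: "X 0 x = (if int p dvd x then 0 else 1)"
  by (simp add: X_def)

lemma X_0 [simp]: "X j 0 = 0" by (simp add: X_def)

lemma X_1 [simp]: "X j 1 = 1"
proof -
  have "[int (ind 1) = 0] (mod int (p - 1))" using ind_1 by (metis cong_int_iff of_nat_0)
  then have "zeta powi (j * int (ind 1)) = zeta powi (j * 0)" by (intro zeta_cong cong_scalar_left)
  then show ?thesis using gt1 by (simp add: X_def)
qed

lemma X_eq_0_iff: "X j x = 0 \<longleftrightarrow> int p dvd x"
  by (simp add: X_def zeta_nonzero)

lemma X_mult_neg: "\<not> int p dvd x \<Longrightarrow> X j x * X (- j) x = 1"
  by (simp add: X_neg X_eq_0_iff)

lemma X_power: "X j (x ^ n) = X j x ^ n"
  by (induction n) (simp_all add: X_mult)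

lemma X_times: "n > 0 \<Longrightarrow> X (int n * j) x = X j (x ^ n)"
proof (induction n rule: nat_induct_non_zero)
  case (Suc n)
  have "X (int (Suc n) * j) x = X (j + int n * j) x" by (simp add: algebra_simps)
  then show ?case using Suc by (simp add: X_add X_mult)
qed simp

lemma X_g: "X j g = zeta powi j"
proof -
  have "[int (ind g) = 1] (mod int (p - 1))" using ind_g by (metis cong_int_iff of_nat_1)
  then have "zeta powi (j * int (ind g)) = zeta powi (j * 1)" by (intro zeta_cong cong_scalar_left)
  then show ?thesis using g_not_dvd by (simp add: X_def)
qed

lemma X_eq_1_all: "(\<forall>x. \<not> int p dvd x \<longrightarrow> X j x = 1) \<longleftrightarrow> int (p - 1) dvd j"
proof
  assume "\<forall>x. \<not> int p dvd x \<longrightarrow> X j x = 1"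
  then show "int (p - 1) dvd j" using g_not_dvd X_g zeta_eq_1 by metis
qed (simp add: X_def zeta_eq_1)

lemma sum_affine:
  fixes f :: "int \<Rightarrow> complex"
  assumes f: "\<And>x y. [x = y] (mod int p) \<Longrightarrow> f x = f y" and c: "\<not> int p dvd c"
  shows "(\<Sum>x\<in>residues. f (c * x + d)) = (\<Sum>x\<in>residues. f x)"
proof -
  have "coprime c (int p)" using coprime_power[OF c, of 1] by simp
  then have "(\<Sum>x\<in>residues. f ((c * x + d) mod int p)) = (\<Sum>x\<in>residues. f x)"
    using sum_affine_residues[of "int p" c f d] pos by (simp add: residues_def)
  moreover have "(\<Sum>x\<in>residues. f (c * x + d)) = (\<Sum>x\<in>residues. f ((c * x + d) mod int p))"
    by (intro sum.cong f refl) simp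
  ultimately show ?thesis by simp
qed

lemma sum_residues_units: "(\<Sum>x\<in>residues. f x) = f 0 + (\<Sum>x\<in>units. f x)" for f :: "int \<Rightarrow> complex"
  unfolding residues_units using residues_units(2) by simp

lemma sum_X: "(\<Sum>x\<in>residues. X j x) = (if int (p - 1) dvd j then of_nat (p - 1) else 0)"
proof (cases "int (p - 1) dvd j")
  case True
  have "(\<Sum>x\<in>residues. X j x) = (\<Sum>x\<in>units. 1)"
    unfolding sum_residues_units X_0 add_0_left
    by (intro sum.cong refl) (use True X_eq_1_all units_not_dvd in blast)
  then show ?thesis using True by (simp add: card_units)
next
  case False
  then obtain c where c: "\<not> int p dvd c" "X j c \<noteq> 1" using X_eq_1_all by blast
  have "(\<Sum>x\<in>residues. X j (c * x + 0)) = (\<Sum>x\<in>residues. X j x)"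
    by (rule sum_affine[where f = "X j", OF X_cong c(1)])
  moreover have "(\<Sum>x\<in>residues. X j (c * x + 0)) = X j c * (\<Sum>x\<in>residues. X j x)"
    by (simp add: X_mult sum_distrib_left)
  ultimately have "(X j c - 1) * (\<Sum>x\<in>residues. X j x) = 0"
    by (simp add: left_diff_distrib)
  then show ?thesis using c False by simp
qed

lemma sum_X_units: "(\<Sum>x\<in>units. X j x) = (if int (p - 1) dvd j then of_nat (p - 1) else 0)"
  using sum_X[of j] by (simp add: sum_residues_units)

definition exps :: "int set" where "exps = {0..<int (p - 1)}"

lemma finite_exps [simp]: "finite exps" by (simp add: exps_def)

lemma card_exps: "card exps = p - 1" by (simp add: exps_def)

lemma X_eq_1_gen: "X 1 x = 1 \<longleftrightarrow> [x = 1] (mod int p)"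
proof
  assume 1: "X 1 x = 1"
  then have nd: "\<not> int p dvd x" by (auto simp: X_def)
  then have "int (p - 1) dvd int (ind x)" using 1 zeta_eq_1[of "int (ind x)"] by (simp add: X_def)
  then have "[g ^ ind x = 1] (mod int p)" using g_ord by simp
  then show "[x = 1] (mod int p)" using ind[OF nd] cong_trans by blast
next
  assume "[x = 1] (mod int p)"
  from X_cong[OF this] show "X 1 x = 1" by simp
qed

lemma sum_exps_shift:
  fixes f :: "int \<Rightarrow> complex"
  assumes f: "\<And>i j. [i = j] (mod int (p - 1)) \<Longrightarrow> f i = f j"
  shows "(\<Sum>j\<in>exps. f (j + d)) = (\<Sum>j\<in>exps. f j)"
proof -
  have "(\<Sum>j\<in>exps. f ((1 * j + d) mod int (p - 1))) = (\<Sum>j\<in>exps. f j)"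
    unfolding exps_def using gt1 by (intro sum_affine_residues) auto
  moreover have "(\<Sum>j\<in>exps. f (j + d)) = (\<Sum>j\<in>exps. f ((1 * j + d) mod int (p - 1)))"
    by (intro sum.cong f refl) simp
  ultimately show ?thesis by simp
qed

lemma orthogonality: "(\<Sum>j\<in>exps. X j x) = (if [x = 1] (mod int p) then of_nat (p - 1) else 0)"
proof (cases "[x = 1] (mod int p)")
  case True
  then have "X j x = 1" for j using X_cong by fastforce
  then show ?thesis using True by (simp add: card_exps)
next
  case False
  have "(\<Sum>j\<in>exps. X (j + 1) x) = (\<Sum>j\<in>exps. X j x)" by (rule sum_exps_shift[OF X_mod])
  then have "(X 1 x - 1) * (\<Sum>j\<in>exps. X j x) = 0"
    by (simp add: X_add sum_distrib_right[symmetric] algebra_simps)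
  then show ?thesis using False X_eq_1_gen by simp
qed

definition ef :: "int \<Rightarrow> complex" where "ef x = cis (2 * pi * of_int x / real p)"

lemma ef_add: "ef (x + y) = ef x * ef y"
  by (simp add: ef_def cis_mult add_divide_distrib distrib_left)

lemma ef_0 [simp]: "ef 0 = 1" by (simp add: ef_def)

lemma ef_eq_1: "ef x = 1 \<longleftrightarrow> int p dvd x"
  unfolding ef_def by (rule cis_eq_1_int[OF pos])

lemma ef_cong: "[x = y] (mod int p) \<Longrightarrow> ef x = ef y"
proof -
  assume "[x = y] (mod int p)"
  then have "ef (x - y) = 1" by (simp add: ef_eq_1 cong_iff_dvd_diff)
  then show ?thesis using ef_add[of "x - y" y] by simp
qed

lemma sum_ef: "(\<Sum>x\<in>residues. ef (c * x)) = (if int p dvd c then of_nat p else 0)"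
proof (cases "int p dvd c")
  case True
  then have "ef (c * x) = 1" for x by (simp add: ef_eq_1)
  then show ?thesis using True by (simp add: residues_def)
next
  case False
  have "(\<Sum>x\<in>residues. ef (c * (1 * x + 1))) = (\<Sum>x\<in>residues. ef (c * x))"
    by (rule sum_affine[where f = "\<lambda>x. ef (c * x)"]) (use gt1 in \<open>auto intro!: ef_cong cong_scalar_left\<close>)
  moreover have "(\<Sum>x\<in>residues. ef (c * (1 * x + 1))) = ef c * (\<Sum>x\<in>residues. ef (c * x))"
    by (simp add: distrib_left ef_add sum_distrib_left mult.commute)
  ultimately have "(ef c - 1) * (\<Sum>x\<in>residues. ef (c * x)) = 0"
    by (simp add: left_diff_distrib)
  then show ?thesis using False ef_eq_1 by simp
qed

definition G :: "int \<Rightarrow> complex" where "G j = (\<Sum>x\<in>residues. X j x * ef x)"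

lemma X_ef_cong: "[x = y] (mod int p) \<Longrightarrow> X j x * ef x = X j y * ef y"
  using X_cong[of x y j] ef_cong[of x y] by simp

lemma G_mod: "[i = j] (mod int (p - 1)) \<Longrightarrow> G i = G j"
  unfolding G_def by (intro sum.cong refl arg_cong2[where f = times] X_mod)

lemma G_units: "G j = (\<Sum>x\<in>units. X j x * ef x)"
  unfolding G_def sum_residues_units by simp

lemma G_scale: 
  assumes "\<not> int p dvd v" shows "(\<Sum>x\<in>residues. X j x * ef (v * x)) = X (- j) v * G j"
proof -
  have "(\<Sum>x\<in>residues. X j (v * x + 0) * ef (v * x + 0)) = G j"
    unfolding G_def
    by (rule sum_affine[where f = "\<lambda>x. X j x * ef x", OF _ assms]) (simp only: X_cong ef_cong)
  then have eq: "X j v * (\<Sum>x\<in>residues. X j x * ef (v * x)) = G j"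
    by (simp add: X_mult sum_distrib_left mult.assoc)
  have "X (- j) v * G j = (X j v * X (- j) v) * (\<Sum>x\<in>residues. X j x * ef (v * x))"
    unfolding eq[symmetric] by (simp only: mult_ac)
  then show ?thesis unfolding X_mult_neg[OF assms] by simp
qed

lemma G_trivial: "int (p - 1) dvd j \<Longrightarrow> G j = -1"
proof -
  assume "int (p - 1) dvd j"
  then have "X j x = 1" if "x \<in> units" for x using X_eq_1_all units_not_dvd that by blast
  then have "G j = (\<Sum>x\<in>units. ef x)" unfolding G_units by simp
  moreover have "1 + (\<Sum>x\<in>units. ef x) = 0"
    using sum_ef[of 1] gt1 unfolding sum_residues_units by simp
  ultimately show ?thesis by (simp add: add_eq_0_iff)
qed

definition Jc :: "int \<Rightarrow> int \<Rightarrow> complex" where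
  "Jc i j = (\<Sum>x\<in>residues. X i x * X j (1 - x))"

text \<open>The substitution \<open>x = r * y\<close> isolates an additive character sum over
  \<open>y\<close>, which singles out \<open>r = -1\<close>.\<close>

lemma G_mult_neg:
  assumes "\<not> int (p - 1) dvd j" shows "G j * G (- j) = X j (-1) * of_nat p"
proof -
  have "G j * G (- j) = (\<Sum>y\<in>units. X (- j) y * ef y * (\<Sum>x\<in>residues. X j x * ef x))"
    unfolding G_units[of "- j"] by (subst mult.commute) (simp add: sum_distrib_right G_def)
  also have "\<dots> = (\<Sum>y\<in>units. \<Sum>r\<in>residues. X j r * ef ((r + 1) * y))"
  proof (rule sum.cong[OF refl])
    fix y assume y: "y \<in> units"
    have nd: "\<not> int p dvd y" using units_not_dvd[OF y] .
    have "(\<Sum>x\<in>residues. X j x * ef x) = (\<Sum>x\<in>residues. X j (y * x + 0) * ef (y * x + 0))"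
      by (rule sum_affine[where f = "\<lambda>x. X j x * ef x", OF X_ef_cong nd, symmetric])
    then have "X (- j) y * ef y * (\<Sum>x\<in>residues. X j x * ef x) = (X j y * X (- j) y) * (\<Sum>r\<in>residues. X j r * (ef (y * r) * ef y))"
      by (simp add: X_mult sum_distrib_left mult_ac)
    also have "\<dots> = (\<Sum>r\<in>residues. X j r * ef ((r + 1) * y))"
      using X_mult_neg[OF nd] by (simp add: ef_add[symmetric] algebra_simps)
    finally show "X (- j) y * ef y * (\<Sum>x\<in>residues. X j x * ef x) = (\<Sum>r\<in>residues. X j r * ef ((r + 1) * y))" .
  qed
  also have "\<dots> = (\<Sum>r\<in>residues. X j r * (\<Sum>y\<in>units. ef ((r + 1) * y)))"
    unfolding sum_distrib_left by (rule sum.swap)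
  also have "\<dots> = (\<Sum>r\<in>residues. X j r * (if int p dvd r + 1 then of_nat p else 0)) - (\<Sum>r\<in>residues. X j r)"
  proof -
    have "(\<Sum>y\<in>units. ef ((r + 1) * y)) = (if int p dvd r + 1 then of_nat p else 0) - 1" for r
      using sum_ef[of "r + 1"] unfolding sum_residues_units by (simp add: algebra_simps)
    then show ?thesis by (simp add: right_diff_distrib sum_subtractf)
  qed
  also have "(\<Sum>r\<in>residues. X j r) = 0" using sum_X assms by simp
  also have "(\<Sum>r\<in>residues. X j r * (if int p dvd r + 1 then of_nat p else 0)) = (\<Sum>r\<in>residues. if r = int p - 1 then X j r * of_nat p else 0)"
  proof (rule sum.cong[OF refl])
    fix r assume r: "r \<in> residues"
    have "int p dvd r + 1 \<longleftrightarrow> r = int p - 1"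
      using r by (auto simp: residues_def dest!: zdvd_imp_le)
    then show "X j r * (if int p dvd r + 1 then of_nat p else 0) = (if r = int p - 1 then X j r * of_nat p else 0)" by simp
  qed
  also have "\<dots> = X j (int p - 1) * of_nat p"
    using pos by (simp add: residues_def)
  also have "X j (int p - 1) = X j (-1)" by (rule X_cong) (simp add: cong_iff_dvd_diff)
  finally show ?thesis by simp
qed

lemma X_neg_1_nonzero: "X j (-1) \<noteq> 0"
  using gt1 by (simp add: X_eq_0_iff)

lemma G_nonzero: "G j \<noteq> 0"
  using G_trivial[of j] G_mult_neg[of j] X_neg_1_nonzero[of j] pos by (cases "int (p - 1) dvd j") auto

lemma G_mult:
  assumes "\<not> int (p - 1) dvd i + j" shows "G i * G j = Jc i j * G (i + j)"
proof -
  have "G i * G j = (\<Sum>x\<in>residues. \<Sum>y\<in>residues. X i x * X j y * ef (x + y))"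
    unfolding G_def sum_product by (simp add: ef_add mult_ac)
  also have "\<dots> = (\<Sum>x\<in>residues. \<Sum>s\<in>residues. X i x * X j (s - x) * ef s)"
  proof (rule sum.cong[OF refl])
    fix x
    have "(\<Sum>s\<in>residues. X i x * X j ((1 * s + - x)) * ef (x + (1 * s + - x))) = (\<Sum>y\<in>residues. X i x * X j y * ef (x + y))"
    proof (rule sum_affine[where f = "\<lambda>y. X i x * X j y * ef (x + y)"])
      show "X i x * X j a * ef (x + a) = X i x * X j b * ef (x + b)" if "[a = b] (mod int p)" for a b
        using X_cong[OF that, of j] ef_cong[OF cong_add[OF cong_refl that]] by simp
    qed (use gt1 in simp)
    then show "(\<Sum>y\<in>residues. X i x * X j y * ef (x + y)) = (\<Sum>s\<in>residues. X i x * X j (s - x) * ef s)" by simp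
  qed
  also have "\<dots> = (\<Sum>s\<in>residues. ef s * (\<Sum>x\<in>residues. X i x * X j (s - x)))"
    by (subst sum.swap) (simp add: sum_distrib_left mult.commute)
  also have "\<dots> = (\<Sum>s\<in>residues. X (i + j) s * ef s * Jc i j)"
  proof (rule sum.cong[OF refl])
    fix s assume s: "s \<in> residues"
    show "ef s * (\<Sum>x\<in>residues. X i x * X j (s - x)) = X (i + j) s * ef s * Jc i j"
    proof (cases "s = 0")
      case True
      have Xm: "X j (0 - x) = X j (-1) * X j x" for x using X_mult[of j "-1" x] by simp
      have "(\<Sum>x\<in>residues. X i x * X j (0 - x)) = X j (-1) * (\<Sum>x\<in>residues. X (i + j) x)"
        unfolding sum_distrib_left Xm X_add by (simp only: mult_ac)
      then show ?thesis using True sum_X[of "i + j"] assms by simp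
    next
      case False
      then have nd: "\<not> int p dvd s" using s units_not_dvd residues_units(1) by auto
      have a: "(\<Sum>x\<in>residues. X i (s * x + 0) * X j (s - (s * x + 0))) = (\<Sum>x\<in>residues. X i x * X j (s - x))"
      proof (rule sum_affine[where f = "\<lambda>x. X i x * X j (s - x)", OF _ nd])
        show "X i a * X j (s - a) = X i b * X j (s - b)" if "[a = b] (mod int p)" for a b
          using X_cong[OF that, of i] X_cong[OF cong_diff[OF cong_refl that]] by simp
      qed
      have b: "X i (s * x + 0) * X j (s - (s * x + 0)) = X (i + j) s * (X i x * X j (1 - x))" for x
      proof -
        have "s - (s * x + 0) = s * (1 - x)" by (simp add: algebra_simps)
        then show ?thesis by (simp add: X_mult X_add)
      qed
      show ?thesis unfolding a[symmetric] b Jc_def sum_distrib_left[symmetric] by (simp only: mult_ac)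
    qed
  qed
  also have "(\<Sum>s\<in>residues. X (i + j) s * ef s * Jc i j) = Jc i j * G (i + j)"
    unfolding G_def sum_distrib_left by (simp only: mult_ac)
  finally show ?thesis .
qed

lemma X_trivial: "int (p - 1) dvd j \<Longrightarrow> \<not> int p dvd x \<Longrightarrow> X j x = 1"
  using X_eq_1_all by blast

lemma orthogonality_units:
  assumes y: "y \<in> units" and w: "w \<in> units"
  shows "(\<Sum>n\<in>exps. X n y * X (- n) w) = (if y = w then of_nat (p - 1) else 0)"
proof -
  have ndw: "\<not> int p dvd w" using w units_not_dvd by blast
  define v where "v = w ^ (p - 2)"
  have ww: "w * v = w ^ (p - 1)" using gt2 unfolding v_def by (simp flip: power_Suc add: Suc_diff_Suc numeral_2_eq_2)
  then have wv: "[w * v = 1] (mod int p)" using fermat_int[OF ndw] by simp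
  have Xv: "X (- n) w = X n v" for n
  proof -
    have "X n w * X n v = 1" using X_cong[OF wv, of n] by (simp add: X_mult)
    then show ?thesis unfolding X_neg by (metis inverse_unique)
  qed
  have "(\<Sum>n\<in>exps. X n y * X (- n) w) = (\<Sum>n\<in>exps. X n (y * v))"
    by (simp add: Xv X_mult)
  also have "\<dots> = (if [y * v = 1] (mod int p) then of_nat (p - 1) else 0)" by (rule orthogonality)
  also have "[y * v = 1] (mod int p) \<longleftrightarrow> y = w"
  proof
    assume "y = w" then show "[y * v = 1] (mod int p)" using wv by simp
  next
    assume a: "[y * v = 1] (mod int p)"
    have "[y * (w * v) = y * 1] (mod int p)" by (intro cong_mult cong_refl wv)
    moreover have "[w * (y * v) = w * 1] (mod int p)" by (intro cong_mult cong_refl a)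
    moreover have "y * (w * v) = w * (y * v)" by (simp only: mult_ac)
    ultimately have "[y = w] (mod int p)" by (metis cong_sym cong_trans mult.right_neutral)
    then show "y = w" using y w units_eqI by blast
  qed
  finally show ?thesis .
qed

lemma p1_nonzero: "(of_nat (p - 1) :: complex) \<noteq> 0"
  using gt1 by simp

text \<open>Fourier expansion on the unit group: the value at \<open>x ^ d\<close> is written with
  all characters \<open>X n\<close>, and the sum over \<open>x\<close> keeps those whose d-th power
  is \<open>X m\<close>.\<close>

lemma sum_units_power:
  fixes F :: "int \<Rightarrow> complex"
  assumes F: "\<And>x y. [x = y] (mod int p) \<Longrightarrow> F x = F y" and d: "d > 0"
  shows "(\<Sum>x\<in>units. X m x * F (x ^ d))
    = (\<Sum>y\<in>units. (\<Sum>n\<in>exps. if int (p - 1) dvd m - int d * n then X n y else 0) * F y)"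
proof -
  have 1: "of_nat (p - 1) * F (x ^ d) = (\<Sum>y\<in>units. F y * (\<Sum>n\<in>exps. X n y * X (- n) (x ^ d)))" if x: "x \<in> units" for x
  proof -
    define w where "w = x ^ d mod int p"
    have w: "w \<in> units" unfolding w_def by (intro mod_in_units not_dvd_power units_not_dvd x)
    have wx: "[x ^ d = w] (mod int p)" by (simp add: w_def)
    have "(\<Sum>y\<in>units. F y * (\<Sum>n\<in>exps. X n y * X (- n) (x ^ d))) = (\<Sum>y\<in>units. F y * (\<Sum>n\<in>exps. X n y * X (- n) w))"
      by (simp only: X_cong[OF wx])
    also have "\<dots> = (\<Sum>y\<in>units. if y = w then F y * of_nat (p - 1) else 0)"
      by (intro sum.cong refl) (simp add: orthogonality_units w)
    also have "\<dots> = F w * of_nat (p - 1)" using w by simp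
    finally show ?thesis using F[OF wx] by simp
  qed
  have 2: "(\<Sum>x\<in>units. X m x * X (- n) (x ^ d)) = (if int (p - 1) dvd m - int d * n then of_nat (p - 1) else 0)" for n
  proof -
    have "X m x * X (- n) (x ^ d) = X (m - int d * n) x" for x
      using X_times[OF d, of "- n" x] X_add[of m "int d * - n" x] by simp
    then show ?thesis using sum_X_units by simp
  qed
  have "of_nat (p - 1) * (\<Sum>x\<in>units. X m x * F (x ^ d)) = (\<Sum>x\<in>units. X m x * (of_nat (p - 1) * F (x ^ d)))"
    by (simp add: sum_distrib_left mult.left_commute)
  also have "\<dots> = (\<Sum>x\<in>units. \<Sum>y\<in>units. \<Sum>n\<in>exps. F y * X n y * (X m x * X (- n) (x ^ d)))"
  proof (intro sum.cong refl)
    fix x assume x: "x \<in> units"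
    show "X m x * (of_nat (p - 1) * F (x ^ d)) = (\<Sum>y\<in>units. \<Sum>n\<in>exps. F y * X n y * (X m x * X (- n) (x ^ d)))"
      unfolding 1[OF x] sum_distrib_left by (simp only: mult_ac)
  qed
  also have "\<dots> = (\<Sum>y\<in>units. \<Sum>n\<in>exps. F y * X n y * (\<Sum>x\<in>units. X m x * X (- n) (x ^ d)))"
    unfolding sum_distrib_left by (subst sum.swap) (intro sum.cong refl sum.swap)
  also have "\<dots> = (\<Sum>y\<in>units. \<Sum>n\<in>exps. of_nat (p - 1) * ((if int (p - 1) dvd m - int d * n then X n y else 0) * F y))"
    unfolding 2 by (intro sum.cong refl) simp
  also have "\<dots> = of_nat (p - 1) * (\<Sum>y\<in>units. (\<Sum>n\<in>exps. if int (p - 1) dvd m - int d * n then X n y else 0) * F y)"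
    by (simp only: sum_distrib_left sum_distrib_right)
  finally show ?thesis using p1_nonzero by (simp only: mult_cancel_left) simp
qed

end

section \<open>The quadratic character, Hasse-Davenport and sums of Gauss sum ratios\<close>

locale prime_gen4 = prime_gen +
  assumes p_mod_4: "p mod 4 = 1"
begin

definition t :: int where "t = int ((p - 1) div 4)"

lemma p1: "int (p - 1) = 4 * t" and pt: "int p = 4 * t + 1" and t_pos: "t > 0"
proof -
  have "p = 4 * (p div 4) + 1" using p_mod_4 by (metis mult_div_mod_eq)
  then have "p - 1 = 4 * (p div 4)" by simp
  then have "(p - 1) div 4 = p div 4" by simp
  then have "p = 4 * ((p - 1) div 4) + 1" using \<open>p = 4 * (p div 4) + 1\<close> by simp
  then show "int p = 4 * t + 1" "int (p - 1) = 4 * t" unfolding t_def using pos by linarith+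
  then show "t > 0" using gt2 by linarith
qed

lemma exps_eq: "exps = {0..<4 * t}"
  unfolding exps_def p1 ..

lemma of_p1: "(of_nat (p - 1) :: complex) = of_nat p - 1"
  using pos by (simp add: of_nat_diff)

abbreviation phi :: "int \<Rightarrow> complex" where "phi \<equiv> X (2 * t)"

lemma phi_square: "\<not> int p dvd x \<Longrightarrow> phi (x ^ 2) = 1"
  using X_times[of 2 "2 * t" x] X_trivial[of "4 * t" x] p1 by simp

lemma phi_mult_self: "\<not> int p dvd x \<Longrightarrow> phi x * phi x = 1"
  using phi_square[of x] by (simp add: X_mult power2_eq_square)

lemma phi_neg_1: "phi (-1) = 1"
  using X_times[of 2 t "-1"] by simp

lemma phi_uminus: "phi (- x) = phi x"
  using X_mult[of "2 * t" "-1" x] phi_neg_1 by simp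

lemma phi_4th: "\<not> int p dvd x \<Longrightarrow> phi (x ^ 4) = 1"
  using phi_square[of "x ^ 2"] not_dvd_power by (simp flip: power_mult)

lemma sum_units_square:
  fixes F :: "int \<Rightarrow> complex"
  assumes F: "\<And>x y. [x = y] (mod int p) \<Longrightarrow> F x = F y"
  shows "(\<Sum>x\<in>residues. F (x ^ 2)) = (\<Sum>y\<in>residues. F y) + (\<Sum>y\<in>residues. phi y * F y)"
proof -
  have A: "(\<Sum>n\<in>exps. if int (p - 1) dvd 0 - int 2 * n then X n y else 0) = 1 + phi y" if y: "y \<in> units" for y
  proof -
    have "(\<Sum>n\<in>exps. if int (p - 1) dvd 0 - int 2 * n then X n y else 0) = (\<Sum>n\<in>{n\<in>exps. int (p - 1) dvd 0 - int 2 * n}. X n y)"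
      by (rule sum.inter_filter[symmetric]) simp
    also have "{n\<in>exps. int (p - 1) dvd 0 - int 2 * n} = {0, 2 * t}"
    proof (intro equalityI subsetI)
      fix n assume "n \<in> {n\<in>exps. int (p - 1) dvd 0 - int 2 * n}"
      then have n: "0 \<le> n" "n < 4 * t" "4 * t dvd 2 * n" unfolding exps_eq p1 by auto
      then obtain q where q: "2 * n = 4 * t * q" by blast
      then have "n = 2 * t * q" by simp
      moreover have "q < 2"
      proof -
        have "2 * t * q < 2 * t * 2" using n(2) unfolding \<open>n = 2 * t * q\<close> by linarith
        then show ?thesis by (rule mult_left_less_imp_less) (use t_pos in simp)
      qed
      moreover have "q \<ge> 0" using n t_pos \<open>n = 2 * t * q\<close> by (simp add: zero_le_mult_iff)
      ultimately have "q = 0 \<or> q = 1" by linarith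
      then show "n \<in> {0, 2 * t}" using \<open>n = 2 * t * q\<close> by auto
    next
      fix n assume "n \<in> {0, 2 * t}"
      then show "n \<in> {n\<in>exps. int (p - 1) dvd 0 - int 2 * n}" unfolding exps_eq p1 using t_pos by auto
    qed
    also have "(\<Sum>n\<in>{0, 2 * t}. X n y) = 1 + phi y"
      using t_pos units_not_dvd[OF y] by (simp add: X_zero)
    finally show ?thesis .
  qed
  have "(\<Sum>x\<in>units. F (x ^ 2)) = (\<Sum>x\<in>units. X 0 x * F (x ^ 2))"
    by (rule sum.cong) (simp_all add: X_zero units_not_dvd)
  also have "\<dots> = (\<Sum>y\<in>units. (1 + phi y) * F y)"
  proof -
    have "(\<Sum>x\<in>units. X 0 x * F (x ^ 2)) = (\<Sum>y\<in>units. (\<Sum>n\<in>exps. if int (p - 1) dvd 0 - int 2 * n then X n y else 0) * F y)"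
      by (rule sum_units_power[OF F]) simp_all
    also have "\<dots> = (\<Sum>y\<in>units. (1 + phi y) * F y)"
      by (rule sum.cong[OF refl]) (simp only: A)
    finally show ?thesis .
  qed
  also have "\<dots> = (\<Sum>y\<in>units. F y) + (\<Sum>y\<in>units. phi y * F y)"
    by (simp add: distrib_right sum.distrib)
  finally show ?thesis by (simp add: sum_residues_units)
qed

lemma Jc_commute: "Jc i j = Jc j i"
proof -
  have "(\<Sum>x\<in>residues. X i (-1 * x + 1) * X j (1 - (-1 * x + 1))) = (\<Sum>x\<in>residues. X i x * X j (1 - x))"
  proof (rule sum_affine[where f = "\<lambda>x. X i x * X j (1 - x)"])
    show "X i a * X j (1 - a) = X i b * X j (1 - b)" if "[a = b] (mod int p)" for a b
      using X_cong[OF that, of i] X_cong[OF cong_diff[OF cong_refl that], of j] by simp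
  qed (use gt1 in simp)
  then show ?thesis unfolding Jc_def by (simp add: mult.commute)
qed

text \<open>Completing the square, \<open>4 * x * (1 - x) = 1 - (1 - 2 * x) ^ 2\<close>. Passing
  from squares to all residues inserts \<open>1 + phi\<close>, and the summand 1 contributes the
  vanishing sum of a nontrivial character.\<close>

lemma Jc_diag: 
  assumes "\<not> int (p - 1) dvd j" shows "X j 4 * Jc j j = Jc j (2 * t)"
proof -
  have "X j 4 * Jc j j = (\<Sum>x\<in>residues. X j (1 - (-2 * x + 1) ^ 2))"
  proof -
    have "1 - (-2 * x + 1) ^ 2 = 4 * (x * (1 - x))" for x :: int
      by (simp add: power2_eq_square algebra_simps)
    then show ?thesis by (simp only: Jc_def sum_distrib_left X_mult)
  qed
  also have "\<dots> = (\<Sum>y\<in>residues. X j (1 - y ^ 2))"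
  proof (rule sum_affine[where f = "\<lambda>y. X j (1 - y ^ 2)"])
    show "X j (1 - a ^ 2) = X j (1 - b ^ 2)" if "[a = b] (mod int p)" for a b
      by (intro X_cong cong_diff cong_refl cong_pow that)
    show "\<not> int p dvd - 2" using gt2 zdvd_imp_le[of "int p" 2] by auto
  qed
  also have "\<dots> = (\<Sum>y\<in>residues. X j (1 - y)) + (\<Sum>y\<in>residues. phi y * X j (1 - y))"
    by (rule sum_units_square) (intro X_cong cong_diff cong_refl)
  also have "(\<Sum>y\<in>residues. X j (1 - y)) = (\<Sum>y\<in>residues. X j (-1 * y + 1))" by simp
  also have "\<dots> = (\<Sum>y\<in>residues. X j y)"
    by (rule sum_affine[where f = "X j", OF X_cong]) (use gt1 in auto)
  also have "\<dots> = 0" using sum_X assms by simp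
  also have "(\<Sum>y\<in>residues. phi y * X j (1 - y)) = Jc (2 * t) j" by (simp add: Jc_def)
  finally show ?thesis using Jc_commute by simp
qed

lemma nd4: "\<not> int p dvd 4"
proof
  assume "int p dvd 4"
  then have "int p \<le> 4" by (rule zdvd_imp_le) simp
  then have "p = 3 \<or> p = 4" using gt2 by linarith
  then show False using p_mod_4 by auto
qed

lemma X_4_cancel: "X (- j) 4 * X j 4 = 1"
  using X_mult_neg[OF nd4, of j] by (simp add: mult.commute)

text \<open>Generically both \<open>G j * G j\<close> and \<open>G j * G (2 * t)\<close> are
  expressed by Jacobi sums, which \<open>Jc_diag\<close> compares. If \<open>2 * j\<close> is
  trivial this is not possible, and the classes of \<open>0\<close> and \<open>2 * t\<close> are
  checked directly.\<close>

lemma hasse_davenport: "G j * G (j + 2 * t) = X (- j) 4 * G (2 * j) * G (2 * t)"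
proof (cases "int (p - 1) dvd 2 * j")
  case True
  then obtain q where "2 * j = 4 * t * q" unfolding p1 by blast
  then have j: "j = 2 * t * q" by simp
  show ?thesis
  proof (cases "even q")
    case True
    then have d: "int (p - 1) dvd j" unfolding j p1 by auto
    then have "[j + 2 * t = 2 * t] (mod int (p - 1))" by (simp add: cong_iff_dvd_diff)
    then have "G (j + 2 * t) = G (2 * t)" by (rule G_mod)
    moreover have "X (- j) 4 = 1" using d nd4 by (intro X_trivial) auto
    ultimately show ?thesis using d G_trivial[of j] G_trivial[of "2 * j"] by simp
  next
    case False
    then obtain r where r: "q = 2 * r + 1" by (auto elim: oddE)
    have "int (p - 1) dvd j + 2 * t" unfolding j r p1 by (auto simp: algebra_simps intro!: dvdI[of _ _ "r + 1"])
    then have 1: "G (j + 2 * t) = -1" by (rule G_trivial)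
    have "int (p - 1) dvd j - 2 * t" unfolding j r p1 by (auto simp: algebra_simps)
    then have 2: "G j = G (2 * t)" by (intro G_mod) (simp add: cong_iff_dvd_diff)
    have "X (- j) 4 = X (2 * (- j)) 2" using X_times[of 2 "- j" 2] by simp
    moreover have "X (2 * (- j)) 2 = 1"
    proof (rule X_trivial)
      show "int (p - 1) dvd 2 * (- j)" using \<open>int (p - 1) dvd 2 * j\<close> by simp
      show "\<not> int p dvd 2" using nd4 dvd_mult2[of "int p" 2 2] by auto
    qed
    ultimately show ?thesis using 1 2 G_trivial[OF \<open>int (p - 1) dvd 2 * j\<close>] by simp
  qed
next
  case False
  have nj: "\<not> int (p - 1) dvd j" using False by auto
  have n2: "\<not> int (p - 1) dvd j + 2 * t"
  proof
    assume "int (p - 1) dvd j + 2 * t"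
    then have "int (p - 1) dvd 2 * (j + 2 * t)" by (rule dvd_mult)
    then have "int (p - 1) dvd 2 * (j + 2 * t) - 4 * t" by (rule dvd_diff) (simp only: p1 dvd_refl)
    also have "2 * (j + 2 * t) - 4 * t = 2 * j" by simp
    finally show False using False by blast
  qed
  have 1: "G j * G j = Jc j j * G (2 * j)" using G_mult[of j j] False by simp
  have 2: "G j * G (2 * t) = Jc j (2 * t) * G (j + 2 * t)" by (rule G_mult[OF n2])
  have 3: "Jc j j = X (- j) 4 * Jc j (2 * t)"
    using Jc_diag[OF nj] X_4_cancel[of j] by (metis mult.assoc mult_1)
  have "G j * (G j * G (j + 2 * t)) = (G j * G j) * G (j + 2 * t)" by (simp only: mult_ac)
  also have "\<dots> = X (- j) 4 * G (2 * j) * (Jc j (2 * t) * G (j + 2 * t))"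
    unfolding 1 3 by (simp only: mult_ac)
  also have "\<dots> = G j * (X (- j) 4 * G (2 * j) * G (2 * t))"
    unfolding 2[symmetric] by (simp only: mult_ac)
  finally show ?thesis using G_nonzero[of j] by (simp only: mult_cancel_left) simp
qed

text \<open>Orthogonality in \<open>k\<close> leaves only \<open>x\<close> with
  \<open>mu * x = 1 - x\<close>, that is \<open>x = 1 / (1 + mu)\<close>; if \<open>1 + mu\<close>
  is zero there is none, in accordance with \<open>phi 0 = 0\<close>.\<close>

lemma sum_X_Jc:
  assumes mu: "\<not> int p dvd mu"
  shows "(\<Sum>k\<in>exps. X k mu * Jc k (2 * t - k)) = of_nat (p - 1) * (phi mu * phi (1 + mu))"
proof -
  have in0: "(\<Sum>k\<in>exps. X k mu * (X k x * X (2 * t - k) (1 - x)))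
     = (if [(1 + mu) * x = 1] (mod int p) then of_nat (p - 1) * phi (1 - x) else 0)" if x: "x \<in> residues" for x
  proof (cases "int p dvd x \<or> int p dvd 1 - x")
    case True
    have "\<not> [(1 + mu) * x = 1] (mod int p)"
    proof
      assume a: "[(1 + mu) * x = 1] (mod int p)"
      show False
      proof (cases "int p dvd x")
        case True
        then have "int p dvd (1 + mu) * x" by simp
        then have "int p dvd 1" using a cong_dvd_iff by blast
        then show False using gt1 by simp
      next
        case False
        then have d: "int p dvd 1 - x" using True by blast
        have "int p dvd (1 + mu) * x - 1" using a by (simp add: cong_iff_dvd_diff)
        then have "int p dvd ((1 + mu) * x - 1) + (1 - x)" using d by (rule dvd_add)
        also have "((1 + mu) * x - 1) + (1 - x) = mu * x" by (simp add: algebra_simps)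
        finally show False using mu False not_dvd_mult by blast
      qed
    qed
    moreover have "X k x * X (2 * t - k) (1 - x) = 0" for k using True by (auto simp: X_def)
    then have "(\<Sum>k\<in>exps. X k mu * (X k x * X (2 * t - k) (1 - x))) = 0"
      by (intro sum.neutral ballI) (simp only: mult_zero_right)
    ultimately show ?thesis by (simp only: if_False)
  next
    case False
    define y where "y = (mu * x) mod int p"
    define w where "w = (1 - x) mod int p"
    have y: "y \<in> units" unfolding y_def using mu False by (intro mod_in_units not_dvd_mult) auto
    have w: "w \<in> units" unfolding w_def using False by (intro mod_in_units) auto
    have yx: "[mu * x = y] (mod int p)" "[1 - x = w] (mod int p)" by (simp_all add: y_def w_def)
    have "X k mu * (X k x * X (2 * t - k) (1 - x)) = phi (1 - x) * (X k y * X (- k) w)" for k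
      using X_cong[OF yx(1), of k] X_cong[OF yx(2), of "- k"] X_add[of "2 * t" "- k" "1 - x"]
      by (simp add: X_mult mult_ac)
    then have "(\<Sum>k\<in>exps. X k mu * (X k x * X (2 * t - k) (1 - x))) = phi (1 - x) * (if y = w then of_nat (p - 1) else 0)"
      by (simp add: sum_distrib_left[symmetric] orthogonality_units[OF y w])
    moreover have "y = w \<longleftrightarrow> [(1 + mu) * x = 1] (mod int p)"
    proof -
      have "y = w \<longleftrightarrow> [mu * x = 1 - x] (mod int p)" by (simp add: y_def w_def cong_def)
      also have "\<dots> \<longleftrightarrow> [(1 + mu) * x = 1] (mod int p)" by (simp add: cong_iff_dvd_diff algebra_simps)
      finally show ?thesis .
    qed
    ultimately show ?thesis by simp
  qed
  have "(\<Sum>k\<in>exps. X k mu * Jc k (2 * t - k)) = (\<Sum>k\<in>exps. \<Sum>x\<in>residues. X k mu * (X k x * X (2 * t - k) (1 - x)))"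
    by (simp only: Jc_def sum_distrib_left)
  also have "\<dots> = (\<Sum>x\<in>residues. \<Sum>k\<in>exps. X k mu * (X k x * X (2 * t - k) (1 - x)))" by (rule sum.swap)
  also have "\<dots> = (\<Sum>x\<in>residues. if [(1 + mu) * x = 1] (mod int p) then of_nat (p - 1) * phi (1 - x) else 0)"
    by (intro sum.cong refl in0)
  also have "\<dots> = of_nat (p - 1) * (phi mu * phi (1 + mu))"
  proof (cases "int p dvd 1 + mu")
    case True
    have "\<not> [(1 + mu) * x = 1] (mod int p)" for x
    proof
      assume "[(1 + mu) * x = 1] (mod int p)"
      then have "int p dvd 1" using True cong_dvd_iff dvd_mult2 by blast
      then show False using gt1 by simp
    qed
    then show ?thesis using True by (simp add: X_def)
  next
    case False
    define c where "c = (1 + mu) ^ (p - 2) mod int p"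
    have c1: "[(1 + mu) * c = 1] (mod int p)"
    proof -
      have "[(1 + mu) * c = (1 + mu) * (1 + mu) ^ (p - 2)] (mod int p)" unfolding c_def by (intro cong_mult cong_refl) simp
      also have "(1 + mu) * (1 + mu) ^ (p - 2) = (1 + mu) ^ (p - 1)" using gt2 by (simp flip: power_Suc add: Suc_diff_Suc numeral_2_eq_2)
      finally show ?thesis using fermat_int[OF False] cong_trans by blast
    qed
    have cr: "c \<in> residues" unfolding c_def residues_def using pos by simp
    have uniq: "[(1 + mu) * x = 1] (mod int p) \<longleftrightarrow> x = c" if x: "x \<in> residues" for x
    proof
      assume "[(1 + mu) * x = 1] (mod int p)"
      then have "[(1 + mu) * x = (1 + mu) * c] (mod int p ^ 1)" using c1 cong_sym cong_trans by (metis power_one_right)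
      from cong_cancel[OF this False] show "x = c" using x cr by (simp add: cong_def residues_def)
    qed (use c1 in simp)
    have "(\<Sum>x\<in>residues. if [(1 + mu) * x = 1] (mod int p) then of_nat (p - 1) * phi (1 - x) else 0)
       = (\<Sum>x\<in>residues. if x = c then of_nat (p - 1) * phi (1 - x) else 0)"
      by (intro sum.cong refl) (simp add: uniq)
    also have "\<dots> = of_nat (p - 1) * phi (1 - c)" using cr by simp
    also have "phi (1 - c) = phi mu * phi c"
    proof -
      have "1 - c - mu * c = 1 - (1 + mu) * c" by (simp add: algebra_simps)
      then have "[1 - c = mu * c] (mod int p)" using cong_sym[OF c1] by (simp only: cong_iff_dvd_diff)
      from X_cong[OF this] show ?thesis by (simp add: X_mult)
    qed
    also have "phi c = phi (1 + mu)"
    proof -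
      have "phi (1 + mu) * phi c = 1" using X_cong[OF c1] by (simp add: X_mult)
      then have "phi (1 + mu) * phi c = phi (1 + mu) * phi (1 + mu)" using phi_mult_self[OF False] by simp
      then show ?thesis using False by (simp add: X_eq_0_iff)
    qed
    finally show ?thesis .
  qed
  finally show ?thesis .
qed

lemma G_half_square: "G (2 * t) * G (2 * t) = of_nat p"
proof -
  have nd: "\<not> int (p - 1) dvd 2 * t" unfolding p1 using t_pos by (auto dest!: zdvd_imp_le)
  have "[- (2 * t) = 2 * t] (mod int (p - 1))" unfolding p1 by (simp add: cong_iff_dvd_diff)
  from G_mod[OF this] show ?thesis using G_mult_neg[OF nd] phi_neg_1 by simp
qed

lemma Jc_0_right: "\<not> int (p - 1) dvd j \<Longrightarrow> Jc j 0 = -1"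
proof -
  assume "\<not> int (p - 1) dvd j"
  then have "- G j = Jc j 0 * G j" using G_mult[of j 0] G_trivial[of 0] by simp
  then have "(Jc j 0 + 1) * G j = - G j + G j" by (simp only: distrib_right mult_1)
  then have "(Jc j 0 + 1) * G j = 0" by simp
  then show ?thesis using G_nonzero[of j] by (simp add: add_eq_0_iff2)
qed

lemma X_neg_1_square: "X j (-1) * X j (-1) = 1"
  using X_mult[of j "-1" "-1"] by simp

text \<open>Replacing \<open>1 / G (k + 2 * t)\<close> by
  \<open>X k (-1) * G (2 * t - k) / p\<close> produces the Jacobi sums of \<open>sum_X_Jc\<close>.
  This fails only at \<open>k = 2 * t\<close>, where the denominator is the trivial Gauss sum; the
  correction is the \<open>- 1\<close> on the right.\<close>

lemma sum_G_ratio: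
  assumes mu: "\<not> int p dvd mu"
  shows "of_nat p * (\<Sum>k\<in>exps. X k mu * (G k / G (k + 2 * t))) = G (2 * t) * of_nat (p - 1) * (phi mu * (phi (1 - mu) - 1))"
proof -
  define h where "h = G (2 * t)"
  have h: "h * h = of_nat p" unfolding h_def by (rule G_half_square)
  have nd: "\<not> int (p - 1) dvd 2 * t" unfolding p1 using t_pos by (auto dest!: zdvd_imp_le)
  have tm: "of_nat p * (X k mu * (G k / G (k + 2 * t))) = h * (X k (- mu) * Jc k (2 * t - k)) - (if k = 2 * t then h * of_nat (p - 1) * phi mu else 0)"
    if k: "k \<in> exps" for k
  proof (cases "k = 2 * t")
    case True
    have "G (2 * t + 2 * t) = -1" by (rule G_trivial) (unfold p1, simp)
    moreover have "phi (- mu) = phi mu" by (rule phi_uminus)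
    ultimately show ?thesis unfolding True of_p1 using Jc_0_right[OF nd] by (simp add: h_def algebra_simps)
  next
    case False
    have ndk: "\<not> int (p - 1) dvd k + 2 * t"
    proof
      assume "int (p - 1) dvd k + 2 * t"
      then obtain q where q: "k + 2 * t = 4 * t * q" unfolding p1 by blast
      have q0: "0 < 4 * t * q" and q2: "4 * t * q < 4 * t * 2" using k t_pos unfolding q[symmetric] exps_eq by auto
      have "0 < q" using q0 t_pos by (simp add: zero_less_mult_iff)
      moreover have "q < 2" by (rule mult_left_less_imp_less[OF q2]) (use t_pos in simp)
      ultimately have "q = 1" by linarith
      then have "k = 2 * t" using q by simp
      then show False using False by blast
    qed
    have 1: "G (k + 2 * t) * G (- (k + 2 * t)) = X k (-1) * of_nat p"
      using G_mult_neg[OF ndk] phi_neg_1 by (simp add: X_add)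
    have "[- (k + 2 * t) = 2 * t - k] (mod int (p - 1))" unfolding p1 by (simp add: cong_iff_dvd_diff)
    then have 2: "G (- (k + 2 * t)) = G (2 * t - k)" by (rule G_mod)
    have 3: "G k * G (2 * t - k) = Jc k (2 * t - k) * h" using G_mult[of k "2 * t - k"] nd by (simp add: h_def)
    have Xm: "X k (- mu) = X k (-1) * X k mu" using X_mult[of k "-1" mu] by simp
    have "of_nat p / G (k + 2 * t) = X k (-1) * G (2 * t - k)"
    proof -
      have "X k (-1) * (G (k + 2 * t) * G (2 * t - k)) = (X k (-1) * X k (-1)) * of_nat p"
        unfolding 1[unfolded 2] by (simp only: mult_ac)
      then have "of_nat p = X k (-1) * G (2 * t - k) * G (k + 2 * t)"
        unfolding X_neg_1_square mult_1 by (simp only: mult_ac)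
      then show ?thesis by (simp only: nonzero_divide_eq_eq[OF G_nonzero])
    qed
    moreover have "of_nat p * (X k mu * (G k / G (k + 2 * t))) = X k mu * G k * (of_nat p / G (k + 2 * t))"
      unfolding divide_inverse by (simp only: mult_ac)
    ultimately have "of_nat p * (X k mu * (G k / G (k + 2 * t))) = X k mu * X k (-1) * (G k * G (2 * t - k))"
      by (simp only: mult_ac)
    also have "\<dots> = h * (X k (- mu) * Jc k (2 * t - k))" unfolding 3 Xm by (simp only: mult_ac)
    finally show ?thesis using False by simp
  qed
  have ndm: "\<not> int p dvd - mu" using mu by simp
  have k2: "2 * t \<in> exps" using t_pos by (simp add: exps_eq)
  have "of_nat p * (\<Sum>k\<in>exps. X k mu * (G k / G (k + 2 * t)))
     = (\<Sum>k\<in>exps. h * (X k (- mu) * Jc k (2 * t - k)) - (if k = 2 * t then h * of_nat (p - 1) * phi mu else 0))"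
    unfolding sum_distrib_left by (intro sum.cong refl tm)
  also have "\<dots> = h * (\<Sum>k\<in>exps. X k (- mu) * Jc k (2 * t - k)) - h * of_nat (p - 1) * phi mu"
    using k2 by (simp add: sum_subtractf sum_distrib_left)
  also have "(\<Sum>k\<in>exps. X k (- mu) * Jc k (2 * t - k)) = of_nat (p - 1) * (phi mu * phi (1 - mu))"
    using sum_X_Jc[OF ndm] phi_uminus[of mu] by simp
  finally show ?thesis by (simp add: h_def algebra_simps)
qed

lemma X_neg_1_parity: "k \<ge> 0 \<Longrightarrow> X k (-1) = (if even k then 1 else -1)"
proof -
  assume "k \<ge> 0"
  then obtain n where n: "k = int n" using zero_le_imp_eq_int by blast
  have "X 1 (-1) \<noteq> 1"
  proof
    assume "X 1 (-1) = 1"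
    then have "[-1 = 1] (mod int p)" by (simp only: X_eq_1_gen)
    then have "int p dvd 2" by (simp add: cong_iff_dvd_diff)
    then show False using gt2 by (auto dest: zdvd_imp_le)
  qed
  then have "X 1 (-1) = -1" using X_neg_1_square[of 1] square_eq_1_iff by blast
  then have "X (int n * 1) (-1) = (-1) ^ n"
  proof (cases "n = 0")
    case True
    have "\<not> int p dvd -1" using gt1 by simp
    then show ?thesis using True by (simp add: X_zero)
  next
    case False
    then have "n > 0" by simp
    from X_times[OF this, of 1 "-1"] show ?thesis by (simp only: X_power \<open>X 1 (-1) = -1\<close>)
  qed
  then show ?thesis by (simp add: n minus_one_power_iff)
qed

text \<open>Doubling is two-to-one onto the even classes, and \<open>1 + X k (-1)\<close> is twice
  the indicator of even \<open>k\<close>.\<close>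

lemma sum_exps_double:
  fixes f :: "int \<Rightarrow> complex"
  assumes f: "\<And>i j. [i = j] (mod int (p - 1)) \<Longrightarrow> f i = f j"
  shows "(\<Sum>k\<in>exps. f (2 * k)) = (\<Sum>k\<in>exps. (1 + X k (-1)) * f k)"
proof -
  have E: "exps = {0..<2 * t} \<union> {2 * t..<4 * t}" using t_pos by (auto simp: exps_eq)
  have "(\<Sum>k\<in>exps. f (2 * k)) = (\<Sum>k\<in>{0..<2 * t}. f (2 * k)) + (\<Sum>k\<in>{2 * t..<4 * t}. f (2 * k))"
    unfolding E by (rule sum.union_disjoint) auto
  also have "(\<Sum>k\<in>{2 * t..<4 * t}. f (2 * k)) = (\<Sum>k\<in>{0..<2 * t}. f (2 * k))"
  proof -
    have "f (2 * k - 4 * t) = f (2 * k)" for k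
      by (rule f) (unfold p1 cong_iff_dvd_diff, simp)
    then show ?thesis
      by (intro sum.reindex_bij_witness[of _ "\<lambda>k. k + 2 * t" "\<lambda>k. k - 2 * t"]) (auto simp: right_diff_distrib)
  qed
  finally have "(\<Sum>k\<in>exps. f (2 * k)) = 2 * (\<Sum>k\<in>{0..<2 * t}. f (2 * k))" by simp
  also have "(\<Sum>k\<in>{0..<2 * t}. f (2 * k)) = (\<Sum>k\<in>{k\<in>exps. even k}. f k)"
    by (rule sum.reindex_bij_witness[of _ "\<lambda>k. k div 2" "\<lambda>k. 2 * k"]) (auto simp: exps_eq)
  also have "2 * (\<Sum>k\<in>{k\<in>exps. even k}. f k) = (\<Sum>k\<in>exps. if even k then 2 * f k else 0)"
    by (subst sum.inter_filter) (auto simp: sum_distrib_left intro!: sum.cong)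
  also have "\<dots> = (\<Sum>k\<in>exps. (1 + X k (-1)) * f k)"
    by (intro sum.cong refl) (auto simp: exps_eq X_neg_1_parity)
  finally show ?thesis .
qed

end

section \<open>The number of points\<close>

lemma sum_swap4:
  fixes f :: "'q \<Rightarrow> 'a \<Rightarrow> 'a \<Rightarrow> 'a \<Rightarrow> 'a \<Rightarrow> complex"
  shows "(\<Sum>x1\<in>A. \<Sum>x2\<in>A. \<Sum>x3\<in>A. \<Sum>x4\<in>A. \<Sum>q\<in>Q. f q x1 x2 x3 x4)
    = (\<Sum>q\<in>Q. \<Sum>x1\<in>A. \<Sum>x2\<in>A. \<Sum>x3\<in>A. \<Sum>x4\<in>A. f q x1 x2 x3 x4)"
proof -
  have s: "(\<Sum>x\<in>A. \<Sum>q\<in>Q. g q x) = (\<Sum>q\<in>Q. \<Sum>x\<in>A. g q x)" for g :: "'q \<Rightarrow> 'a \<Rightarrow> complex"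
    by (rule sum.swap)
  show ?thesis by (simp only: s)
qed

lemma sum_power4:
  fixes a :: "'a \<Rightarrow> complex"
  shows "(\<Sum>x1\<in>A. \<Sum>x2\<in>A. \<Sum>x3\<in>A. \<Sum>x4\<in>A. c * (a x1 * (a x2 * (a x3 * a x4)))) = c * (\<Sum>x\<in>A. a x) ^ 4"
proof -
  have "(\<Sum>x1\<in>A. \<Sum>x2\<in>A. \<Sum>x3\<in>A. \<Sum>x4\<in>A. c * (a x1 * (a x2 * (a x3 * a x4))))
    = c * (sum a A * (sum a A * (sum a A * sum a A)))"
    by (simp only: sum_distrib_left[symmetric] sum_distrib_right[symmetric])
  then show ?thesis by (simp only: power4_eq_xxxx mult.assoc)
qed

context prime_gen4
begin

lemma orthogonality_pair:
  assumes "\<not> int p dvd y" "\<not> int p dvd w"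
  shows "(\<Sum>n\<in>exps. X n y * X (- n) w) = (if [y = w] (mod int p) then of_nat (p - 1) else 0)"
proof -
  have y: "[y = y mod int p] (mod int p)" and w: "[w = w mod int p] (mod int p)" by simp_all
  have "(\<Sum>n\<in>exps. X n y * X (- n) w) = (\<Sum>n\<in>exps. X n (y mod int p) * X (- n) (w mod int p))"
    by (intro sum.cong refl) (simp only: X_cong[OF y, symmetric] X_cong[OF w, symmetric])
  then show ?thesis
    unfolding orthogonality_units[OF mod_in_units[OF assms(1)] mod_in_units[OF assms(2)]] by (simp only: cong_def)
qed

definition delta :: "int \<Rightarrow> complex" where "delta z = (if int p dvd z then 1 else 0)"

text \<open>For \<open>S\<close> prime to \<open>p\<close> the sum over \<open>v\<close> is
  \<open>X (- m) S * G m\<close>, so dividing by \<open>G m\<close> leaves the orthogonality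
  relation for \<open>P = S\<close>. If \<open>p\<close> divides \<open>S\<close>, only
  \<open>m = 0\<close> survives, and \<open>G 0 = -1\<close> supplies the term
  \<open>- delta S\<close>.\<close>

lemma delta_diff_expansion:
  assumes P: "\<not> int p dvd P"
  shows "of_nat (p - 1) * (delta (S - P) - delta S)
    = (\<Sum>m\<in>exps. X m P / G m * (\<Sum>v\<in>units. X m v * ef (v * S)))"
proof (cases "int p dvd S")
  case True
  have e1: "ef (v * S) = 1" for v using True by (simp add: ef_eq_1)
  have "X m P / G m * (\<Sum>v\<in>units. X m v * ef (v * S)) = (if m = 0 then - of_nat (p - 1) else 0)" if m: "m \<in> exps" for m
  proof -
    have "int (p - 1) dvd m \<longleftrightarrow> m = 0" using m unfolding exps_def by (auto dest: zdvd_imp_le)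
    then show ?thesis using sum_X_units[of m] G_trivial[of 0] P by (auto simp: e1 X_zero)
  qed
  then have "(\<Sum>m\<in>exps. X m P / G m * (\<Sum>v\<in>units. X m v * ef (v * S))) = (\<Sum>m\<in>exps. if m = 0 then - of_nat (p - 1) else 0)"
    by (rule sum.cong[OF refl])
  also have "\<dots> = - of_nat (p - 1)" using t_pos by (simp add: exps_eq)
  finally have R: "(\<Sum>m\<in>exps. X m P / G m * (\<Sum>v\<in>units. X m v * ef (v * S))) = - of_nat (p - 1)" .
  have "\<not> int p dvd S - P"
  proof
    assume "int p dvd S - P"
    then have "int p dvd S - (S - P)" using True by (rule dvd_diff[rotated])
    then show False using P by simp
  qed
  then show ?thesis unfolding R using True by (simp add: delta_def)
next
  case False
  have "X m P / G m * (\<Sum>v\<in>units. X m v * ef (v * S)) = X m P * X (- m) S" for m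
  proof -
    have "(\<Sum>v\<in>units. X m v * ef (v * S)) = (\<Sum>v\<in>residues. X m v * ef (S * v))"
      unfolding sum_residues_units by (simp add: mult.commute)
    also have "\<dots> = X (- m) S * G m" by (rule G_scale[OF False])
    finally show ?thesis using G_nonzero[of m] by simp
  qed
  then have "(\<Sum>m\<in>exps. X m P / G m * (\<Sum>v\<in>units. X m v * ef (v * S))) = (\<Sum>m\<in>exps. X m P * X (- m) S)" by simp
  also have "\<dots> = (if [P = S] (mod int p) then of_nat (p - 1) else 0)" by (rule orthogonality_pair[OF P False])
  also have "[P = S] (mod int p) \<longleftrightarrow> int p dvd S - P" by (simp add: cong_iff_dvd_diff dvd_diff_commute)
  finally show ?thesis using False by (simp add: delta_def)
qed

definition quartic_sum :: "int \<Rightarrow> int \<Rightarrow> complex" where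
  "quartic_sum m v = (\<Sum>x\<in>units. X m x * ef (v * x ^ 4))"

definition quartic_count :: "int \<Rightarrow> complex" where
  "quartic_count L = (\<Sum>x1\<in>residues. \<Sum>x2\<in>residues. \<Sum>x3\<in>residues. \<Sum>x4\<in>residues.
     delta (x1 ^ 4 + x2 ^ 4 + x3 ^ 4 + x4 ^ 4 - L * x1 * x2 * x3 * x4))"

text \<open>At points with a zero coordinate both equations agree. Subtracting the Fermat quartic
  therefore leaves only unit coordinates, for which multiplicative characters of the product can be
  used.\<close>

lemma quartic_count_diff:
  assumes L: "\<not> int p dvd L"
  shows "of_nat (p - 1) * (quartic_count L - quartic_count 0)
    = (\<Sum>m\<in>exps. \<Sum>v\<in>units. X m L / G m * X m v * quartic_sum m v ^ 4)"
proof -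
  define D where "D x1 x2 x3 x4 = delta (x1 ^ 4 + x2 ^ 4 + x3 ^ 4 + x4 ^ 4 - L * x1 * x2 * x3 * x4)
     - delta (x1 ^ 4 + x2 ^ 4 + x3 ^ 4 + x4 ^ 4)" for x1 x2 x3 x4 :: int
  have D0: "D 0 x2 x3 x4 = 0" "D x1 0 x3 x4 = 0" "D x1 x2 0 x4 = 0" "D x1 x2 x3 0 = 0" for x1 x2 x3 x4
    by (simp_all add: D_def)
  define b where "b q x = X (fst q) x * ef (snd q * x ^ 4)" for q x
  define c where "c q = X (fst q) L / G (fst q) * X (fst q) (snd q)" for q
  have "quartic_count L - quartic_count 0 = (\<Sum>x1\<in>residues. \<Sum>x2\<in>residues. \<Sum>x3\<in>residues. \<Sum>x4\<in>residues. D x1 x2 x3 x4)"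
    by (simp add: quartic_count_def D_def sum_subtractf)
  also have "\<dots> = (\<Sum>x1\<in>units. \<Sum>x2\<in>units. \<Sum>x3\<in>units. \<Sum>x4\<in>units. D x1 x2 x3 x4)"
    by (simp add: sum_residues_units D0)
  finally have "of_nat (p - 1) * (quartic_count L - quartic_count 0)
     = (\<Sum>x1\<in>units. \<Sum>x2\<in>units. \<Sum>x3\<in>units. \<Sum>x4\<in>units. of_nat (p - 1) * D x1 x2 x3 x4)"
    by (simp add: sum_distrib_left)
  also have "\<dots> = (\<Sum>x1\<in>units. \<Sum>x2\<in>units. \<Sum>x3\<in>units. \<Sum>x4\<in>units. \<Sum>q\<in>exps \<times> units.
      c q * (b q x1 * (b q x2 * (b q x3 * b q x4))))"
  proof (intro sum.cong refl)
    fix x1 x2 x3 x4 assume x: "x1 \<in> units" "x2 \<in> units" "x3 \<in> units" "x4 \<in> units"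
    have nd: "\<not> int p dvd L * x1 * x2 * x3 * x4"
      by (intro not_dvd_mult L units_not_dvd x)
    have "of_nat (p - 1) * D x1 x2 x3 x4 = (\<Sum>m\<in>exps. \<Sum>v\<in>units. X m (L * x1 * x2 * x3 * x4) / G m * (X m v * ef (v * (x1 ^ 4 + x2 ^ 4 + x3 ^ 4 + x4 ^ 4))))"
      unfolding D_def delta_diff_expansion[OF nd] sum_distrib_left ..
    also have "\<dots> = (\<Sum>m\<in>exps. \<Sum>v\<in>units. c (m, v) * (b (m, v) x1 * (b (m, v) x2 * (b (m, v) x3 * b (m, v) x4))))"
      by (intro sum.cong refl) (simp add: c_def b_def X_mult ef_add distrib_left mult_ac)
    also have "\<dots> = (\<Sum>q\<in>exps \<times> units. c q * (b q x1 * (b q x2 * (b q x3 * b q x4))))"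
      by (simp add: sum.cartesian_product split_def)
    finally show "of_nat (p - 1) * D x1 x2 x3 x4 = (\<Sum>q\<in>exps \<times> units. c q * (b q x1 * (b q x2 * (b q x3 * b q x4))))" .
  qed
  also have "\<dots> = (\<Sum>q\<in>exps \<times> units. c q * (\<Sum>x\<in>units. b q x) ^ 4)"
    unfolding sum_swap4 sum_power4 ..
  also have "\<dots> = (\<Sum>m\<in>exps. \<Sum>v\<in>units. X m L / G m * X m v * quartic_sum m v ^ 4)"
    by (simp add: sum.cartesian_product split_def b_def c_def quartic_sum_def)
  finally show ?thesis .
qed

lemma quartic_sum_mod: "[i = j] (mod int (p - 1)) \<Longrightarrow> quartic_sum i v = quartic_sum j v"
  unfolding quartic_sum_def by (intro sum.cong refl) (simp only: X_mod)

lemma quartic_sum_eq: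
  assumes v: "v \<in> units"
  shows "quartic_sum m v = (\<Sum>n\<in>exps. if int (p - 1) dvd m - 4 * n then X (- n) v * G n else 0)"
proof -
  have "quartic_sum m v = (\<Sum>y\<in>units. (\<Sum>n\<in>exps. if int (p - 1) dvd m - int 4 * n then X n y else 0) * ef (v * y))"
    unfolding quartic_sum_def
    by (rule sum_units_power[where F = "\<lambda>y. ef (v * y)"]) (auto intro: ef_cong cong_scalar_left)
  also have "\<dots> = (\<Sum>n\<in>exps. if int (p - 1) dvd m - 4 * n then (\<Sum>y\<in>units. X n y * ef (v * y)) else 0)"
    unfolding sum_distrib_right by (subst sum.swap) (intro sum.cong refl, simp)
  also have "\<dots> = (\<Sum>n\<in>exps. if int (p - 1) dvd m - 4 * n then X (- n) v * G n else 0)"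
  proof -
    have "(\<Sum>y\<in>units. X n y * ef (v * y)) = X (- n) v * G n" for n
      using G_scale[OF units_not_dvd[OF v], of n] by (simp add: sum_residues_units)
    then show ?thesis by (simp only:)
  qed
  finally show ?thesis .
qed

lemma quartic_sum_4:
  assumes v: "v \<in> units"
  shows "quartic_sum (4 * n) v = X (- n) v * (G n + X (- t) v * G (n + t) + X (- t) v ^ 2 * G (n + 2 * t) + X (- t) v ^ 3 * G (n + 3 * t))"
proof -
  define f where "f j = X (- j) v * G j" for j
  have f: "f i = f j" if "[i = j] (mod int (p - 1))" for i j
    unfolding f_def using X_mod[of "- i" "- j" v] G_mod[OF that] that by (simp add: cong_minus_minus_iff)
  have "quartic_sum (4 * n) v = (\<Sum>j\<in>exps. if int (p - 1) dvd 4 * n - 4 * j then f j else 0)"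
    unfolding quartic_sum_eq[OF v] f_def ..
  also have "\<dots> = (\<Sum>j\<in>exps. if int (p - 1) dvd 4 * n - 4 * (j + n) then f (j + n) else 0)"
  proof (rule sum_exps_shift[symmetric])
    fix i j assume ij: "[i = j] (mod int (p - 1))"
    then have "int (p - 1) dvd i - j" by (simp only: cong_iff_dvd_diff)
    then have "int (p - 1) dvd 4 * (i - j)" by (rule dvd_mult)
    moreover have "4 * n - 4 * j = (4 * n - 4 * i) + 4 * (i - j)" by simp
    ultimately have "int (p - 1) dvd 4 * n - 4 * i \<longleftrightarrow> int (p - 1) dvd 4 * n - 4 * j"
      by (metis dvd_add_left_iff)
    then show "(if int (p - 1) dvd 4 * n - 4 * i then f i else 0) = (if int (p - 1) dvd 4 * n - 4 * j then f j else 0)"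
      using f[OF ij] by simp
  qed
  also have "\<dots> = (\<Sum>j\<in>exps. if t dvd j then f (j + n) else 0)"
    by (intro sum.cong refl) (simp add: p1[simplified] p1)
  also have "\<dots> = (\<Sum>j\<in>{j\<in>exps. t dvd j}. f (j + n))" by (rule sum.inter_filter[symmetric]) simp
  also have "{j\<in>exps. t dvd j} = {0, t, 2 * t, 3 * t}"
  proof (intro equalityI subsetI)
    fix j assume "j \<in> {j\<in>exps. t dvd j}"
    then have j: "t dvd j" "0 \<le> j" "j < t * 4" by (auto simp: exps_eq)
    from j(1) obtain q where "j = t * q" by blast
    then have q: "j = t * q" "0 \<le> t * q" "t * q < t * 4" using j(2,3) by simp_all
    have "q < 4" by (rule mult_left_less_imp_less[OF q(3)]) (use t_pos in simp)
    moreover have "0 \<le> q" using q(2) t_pos by (simp add: zero_le_mult_iff)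
    ultimately have "q = 0 \<or> q = 1 \<or> q = 2 \<or> q = 3" by linarith
    then show "j \<in> {0, t, 2 * t, 3 * t}" using q(1) by auto
  qed (use t_pos in \<open>auto simp: exps_eq\<close>)
  also have "(\<Sum>j\<in>{0, t, 2 * t, 3 * t}. f (j + n)) = f n + f (n + t) + f (n + 2 * t) + f (n + 3 * t)"
    using t_pos by (simp add: add.commute add.assoc)
  also have "f (n + t) = X (- n) v * (X (- t) v * G (n + t))"
    using X_add[of "- n" "- t" v] by (simp add: f_def)
  also have "f (n + 2 * t) = X (- n) v * (X (- t) v ^ 2 * G (n + 2 * t))"
    using X_add[of "- n" "- (2 * t)" v] X_add[of "- t" "- t" v] by (simp add: f_def power2_eq_square)
  also have "f (n + 3 * t) = X (- n) v * (X (- t) v ^ 3 * G (n + 3 * t))"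
    using X_add[of "- n" "- (3 * t)" v] X_add[of "- t" "- (2 * t)" v] X_add[of "- t" "- t" v]
    by (simp add: f_def power3_eq_cube)
  finally show ?thesis by (simp add: f_def distrib_left add.assoc)
qed

lemma sum_X_t_power:
  "(\<Sum>v\<in>units. X (- t) v ^ k) = (if 4 dvd k then of_nat (p - 1) else 0)"
proof -
  have "X (- t) v ^ k = X (int k * - t) v" if "v \<in> units" for v
  proof (cases "k = 0")
    case True then show ?thesis using units_not_dvd[OF that] by (simp add: X_zero)
  next
    case False then show ?thesis using X_times[of k "- t" v] by (simp add: X_power)
  qed
  then have "(\<Sum>v\<in>units. X (- t) v ^ k) = (\<Sum>v\<in>units. X (int k * - t) v)" by simp
  also have "int (p - 1) dvd int k * - t \<longleftrightarrow> 4 dvd k"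
  proof -
    have "int (p - 1) dvd int k * - t \<longleftrightarrow> t * 4 dvd t * int k" unfolding p1 by (simp add: mult.commute)
    also have "\<dots> \<longleftrightarrow> 4 dvd int k" using t_pos by (subst dvd_mult_cancel_left) auto
    also have "\<dots> \<longleftrightarrow> 4 dvd k" by (metis int_dvd_int_iff of_nat_numeral)
    finally show ?thesis .
  qed
  then have "(\<Sum>v\<in>units. X (int k * - t) v) = (if 4 dvd k then of_nat (p - 1) else 0)"
    unfolding sum_X_units by simp
  finally show ?thesis .
qed

text \<open>Here \<open>X (- t) v\<close> is a fourth root of unity, so of the expanded cube only
  the powers with exponents 0, 4 and 8 survive summation over \<open>v\<close>.\<close>

lemma sum_units_cube:
  "(\<Sum>v\<in>units. (g0 + X (- t) v * g1 + X (- t) v ^ 2 * g2 + X (- t) v ^ 3 * g3) ^ 3)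
   = of_nat (p - 1) * (g0 ^ 3 + 3 * g0 * g2 ^ 2 + 6 * g0 * g1 * g3 + 3 * g1 ^ 2 * g2 + 3 * g2 * g3 ^ 2)"
proof -
  have e: "(g0 + z * g1 + z ^ 2 * g2 + z ^ 3 * g3) ^ 3
    = z ^ 0 * g0 ^ 3 + z ^ 1 * (3 * g0 ^ 2 * g1) + z ^ 2 * (3 * g0 ^ 2 * g2 + 3 * g0 * g1 ^ 2)
    + z ^ 3 * (3 * g0 ^ 2 * g3 + 6 * g0 * g1 * g2 + g1 ^ 3)
    + z ^ 4 * (3 * g0 * g2 ^ 2 + 6 * g0 * g1 * g3 + 3 * g1 ^ 2 * g2)
    + z ^ 5 * (6 * g0 * g2 * g3 + 3 * g1 ^ 2 * g3 + 3 * g1 * g2 ^ 2)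
    + z ^ 6 * (3 * g0 * g3 ^ 2 + 6 * g1 * g2 * g3 + g2 ^ 3)
    + z ^ 7 * (3 * g1 * g3 ^ 2 + 3 * g2 ^ 2 * g3) + z ^ 8 * (3 * g2 * g3 ^ 2) + z ^ 9 * g3 ^ 3" for z :: complex
    by (simp add: power_numeral_reduce algebra_simps)
  show ?thesis unfolding e sum.distrib sum_distrib_right[symmetric] sum_X_t_power
    by (simp add: algebra_simps)
qed

lemma sum_units_quartic:
  "(\<Sum>v\<in>units. (X (- t) v * a + X (- t) v ^ 2 * h + X (- t) v ^ 3 * b) ^ 4)
   = of_nat (p - 1) * (a ^ 4 + h ^ 4 + 12 * a * h ^ 2 * b + 6 * a ^ 2 * b ^ 2 + b ^ 4)"
proof -
  have e: "(z * a + z ^ 2 * h + z ^ 3 * b) ^ 4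
    = z ^ 4 * a ^ 4 + z ^ 5 * (4 * a ^ 3 * h) + z ^ 6 * (6 * a ^ 2 * h ^ 2 + 4 * a ^ 3 * b)
    + z ^ 7 * (4 * a * h ^ 3 + 12 * a ^ 2 * h * b) + z ^ 8 * (h ^ 4 + 12 * a * h ^ 2 * b + 6 * a ^ 2 * b ^ 2)
    + z ^ 9 * (4 * h ^ 3 * b + 12 * a * h * b ^ 2) + z ^ 10 * (6 * h ^ 2 * b ^ 2 + 4 * a * b ^ 3)
    + z ^ 11 * (4 * h * b ^ 3) + z ^ 12 * b ^ 4" for z :: complex
    by (simp add: power_numeral_reduce algebra_simps)
  show ?thesis unfolding e sum.distrib sum_distrib_right[symmetric] sum_X_t_power
    by (simp add: algebra_simps)
qed

lemma quartic_count_0: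
  "of_nat p * quartic_count 0 = of_nat p ^ 4 + of_nat (p - 1) * (G t ^ 4 + G (2 * t) ^ 4
     + 12 * G t * G (2 * t) ^ 2 * G (3 * t) + 6 * G t ^ 2 * G (3 * t) ^ 2 + G (3 * t) ^ 4)"
proof -
  define b where "b v x = ef (v * x ^ 4)" for v x
  have "of_nat p * quartic_count 0 = (\<Sum>x1\<in>residues. \<Sum>x2\<in>residues. \<Sum>x3\<in>residues. \<Sum>x4\<in>residues. \<Sum>v\<in>residues.
     1 * (b v x1 * (b v x2 * (b v x3 * b v x4))))"
    unfolding quartic_count_def sum_distrib_left
  proof (intro sum.cong refl)
    fix x1 x2 x3 x4
    have "of_nat p * delta (x1 ^ 4 + x2 ^ 4 + x3 ^ 4 + x4 ^ 4 - 0 * x1 * x2 * x3 * x4)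
      = (\<Sum>v\<in>residues. ef ((x1 ^ 4 + x2 ^ 4 + x3 ^ 4 + x4 ^ 4) * v))"
      unfolding sum_ef by (simp add: delta_def)
    also have "\<dots> = (\<Sum>v\<in>residues. 1 * (b v x1 * (b v x2 * (b v x3 * b v x4))))"
      by (intro sum.cong refl) (simp add: b_def ef_add distrib_left distrib_right mult_ac)
    finally show "of_nat p * delta (x1 ^ 4 + x2 ^ 4 + x3 ^ 4 + x4 ^ 4 - 0 * x1 * x2 * x3 * x4)
      = (\<Sum>v\<in>residues. 1 * (b v x1 * (b v x2 * (b v x3 * b v x4))))" .
  qed
  also have "\<dots> = (\<Sum>v\<in>residues. 1 * (\<Sum>x\<in>residues. b v x) ^ 4)"
    unfolding sum_swap4 sum_power4 ..
  also have "\<dots> = (\<Sum>x\<in>residues. b 0 x) ^ 4 + (\<Sum>v\<in>units. (\<Sum>x\<in>residues. b v x) ^ 4)"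
    by (simp add: sum_residues_units)
  also have "(\<Sum>x\<in>residues. b 0 x) = of_nat p" by (simp add: b_def residues_def)
  also have "(\<Sum>v\<in>units. (\<Sum>x\<in>residues. b v x) ^ 4)
     = (\<Sum>v\<in>units. (X (- t) v * G t + X (- t) v ^ 2 * G (2 * t) + X (- t) v ^ 3 * G (3 * t)) ^ 4)"
  proof (intro sum.cong refl)
    fix v assume v: "v \<in> units"
    \<comment> \<open>The contribution 1 of \<open>x = 0\<close> cancels \<open>G 0 = -1\<close>,
      which leaves the three Gauss sums of nontrivial characters of order dividing four.\<close>
    have "(\<Sum>x\<in>residues. b v x) = 1 + quartic_sum 0 v"
      unfolding sum_residues_units quartic_sum_def by (simp add: b_def X_zero units_not_dvd)
    also have "quartic_sum 0 v = - 1 + X (- t) v * G t + X (- t) v ^ 2 * G (2 * t) + X (- t) v ^ 3 * G (3 * t)"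
      using quartic_sum_4[OF v, of 0] G_trivial[of 0] units_not_dvd[OF v] by (simp add: X_zero)
    finally show "(\<Sum>x\<in>residues. b v x) ^ 4 = (X (- t) v * G t + X (- t) v ^ 2 * G (2 * t) + X (- t) v ^ 3 * G (3 * t)) ^ 4"
      by (simp add: add.assoc)
  qed
  finally show ?thesis unfolding sum_units_quartic by simp
qed

text \<open>Only one of the four factors \<open>quartic_sum m v\<close> is expanded over the
  \<open>n\<close> with \<open>4 * n\<close> congruent to \<open>m\<close>. This makes
  \<open>n\<close> a free index and determines \<open>m = 4 * n\<close>; the other three factors
  give the cube of \<open>sum_units_cube\<close>.\<close>

lemma quartic_count_diff_eq:
  assumes L: "\<not> int p dvd L"
  shows "quartic_count L - quartic_count 0 = (\<Sum>n\<in>exps. X (4 * n) L / G (4 * n) * G n *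
    (G n ^ 3 + 3 * G n * G (n + 2 * t) ^ 2 + 6 * G n * G (n + t) * G (n + 3 * t) + 3 * G (n + t) ^ 2 * G (n + 2 * t) + 3 * G (n + 2 * t) * G (n + 3 * t) ^ 2))"
proof -
  define H where "H m v = X m L / G m * X m v * quartic_sum m v ^ 3" for m v
  have H: "H i v = H j v" if "[i = j] (mod int (p - 1))" for i j v
    unfolding H_def using X_mod[OF that] G_mod[OF that] quartic_sum_mod[OF that] by simp
  have one: "(\<Sum>m\<in>exps. if int (p - 1) dvd m - 4 * n then H m v else 0) = H (4 * n) v" for n v
  proof -
    define m0 where "m0 = (4 * n) mod int (p - 1)"
    have m0: "m0 \<in> exps" using gt1 by (simp add: m0_def exps_def)
    have "(if int (p - 1) dvd m - 4 * n then H m v else 0) = (if m = m0 then H (4 * n) v else 0)" if m: "m \<in> exps" for m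
    proof -
      have "int (p - 1) dvd m - 4 * n \<longleftrightarrow> [m = 4 * n] (mod int (p - 1))" by (simp only: cong_iff_dvd_diff)
      also have "\<dots> \<longleftrightarrow> m = m0" using m unfolding cong_def m0_def exps_def by simp
      finally show ?thesis using H[of m "4 * n" v] by (auto simp: cong_iff_dvd_diff)
    qed
    then have "(\<Sum>m\<in>exps. if int (p - 1) dvd m - 4 * n then H m v else 0) = (\<Sum>m\<in>exps. if m = m0 then H (4 * n) v else 0)"
      by (rule sum.cong[OF refl])
    then show ?thesis using m0 by simp
  qed
  have "of_nat (p - 1) * (quartic_count L - quartic_count 0) = (\<Sum>v\<in>units. \<Sum>m\<in>exps. H m v * quartic_sum m v)"
    unfolding quartic_count_diff[OF L] H_def by (subst sum.swap) (intro sum.cong refl, simp add: power4_eq_xxxx power3_eq_cube mult.assoc)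
  also have "\<dots> = (\<Sum>v\<in>units. \<Sum>n\<in>exps. X (- n) v * G n * (\<Sum>m\<in>exps. if int (p - 1) dvd m - 4 * n then H m v else 0))"
  proof (rule sum.cong[OF refl])
    fix v assume v: "v \<in> units"
    have "(\<Sum>m\<in>exps. H m v * quartic_sum m v) = (\<Sum>m\<in>exps. \<Sum>n\<in>exps. X (- n) v * G n * (if int (p - 1) dvd m - 4 * n then H m v else 0))"
      unfolding quartic_sum_eq[OF v] sum_distrib_left by (intro sum.cong refl) simp
    also have "\<dots> = (\<Sum>n\<in>exps. \<Sum>m\<in>exps. X (- n) v * G n * (if int (p - 1) dvd m - 4 * n then H m v else 0))"
      by (rule sum.swap)
    finally show "(\<Sum>m\<in>exps. H m v * quartic_sum m v) = (\<Sum>n\<in>exps. X (- n) v * G n * (\<Sum>m\<in>exps. if int (p - 1) dvd m - 4 * n then H m v else 0))"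
      by (simp only: sum_distrib_left)
  qed
  also have "\<dots> = (\<Sum>n\<in>exps. \<Sum>v\<in>units. X (- n) v * G n * H (4 * n) v)"
    unfolding one by (rule sum.swap)
  also have "\<dots> = (\<Sum>n\<in>exps. X (4 * n) L / G (4 * n) * G n * (\<Sum>v\<in>units. (G n + X (- t) v * G (n + t) + X (- t) v ^ 2 * G (n + 2 * t) + X (- t) v ^ 3 * G (n + 3 * t)) ^ 3))"
    unfolding sum_distrib_left
  proof (intro sum.cong refl)
    fix n v assume v: "v \<in> units"
    define W where "W = G n + X (- t) v * G (n + t) + X (- t) v ^ 2 * G (n + 2 * t) + X (- t) v ^ 3 * G (n + 3 * t)"
    have X1: "X (- n) v * X (4 * n) v * X (- n) v ^ 3 = 1"
    proof -
      have "X (- n) v * X (4 * n) v * X (- n) v ^ 3 = X (- n + 4 * n + - n + - n + - n) v"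
        by (simp only: X_add power3_eq_cube mult.assoc)
      then show ?thesis using units_not_dvd[OF v] by (simp add: X_zero)
    qed
    have "X (- n) v * G n * H (4 * n) v = X (4 * n) L / G (4 * n) * G n * (X (- n) v * X (4 * n) v * X (- n) v ^ 3) * W ^ 3"
      unfolding H_def quartic_sum_4[OF v] W_def[symmetric] power_mult_distrib by (simp only: mult_ac)
    then show "X (- n) v * G n * H (4 * n) v = X (4 * n) L / G (4 * n) * G n * W ^ 3"
      unfolding X1 by simp
  qed
  also have "\<dots> = of_nat (p - 1) * (\<Sum>n\<in>exps. X (4 * n) L / G (4 * n) * G n *
    (G n ^ 3 + 3 * G n * G (n + 2 * t) ^ 2 + 6 * G n * G (n + t) * G (n + 3 * t) + 3 * G (n + t) ^ 2 * G (n + 2 * t) + 3 * G (n + 2 * t) * G (n + 3 * t) ^ 2))"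
    unfolding sum_units_cube sum_distrib_left by (intro sum.cong refl) (simp only: mult_ac)
  finally show ?thesis using p1_nonzero by (simp only: mult_cancel_left) simp
qed

text \<open>If \<open>I ^ 2 = -1\<close> then \<open>(1 + I) ^ 4 = -4\<close>, so \<open>-4\<close>
  is a fourth power and a quartic character takes the value 1 there.\<close>

lemma X_t_minus_4: "X t (-4) = 1"
proof -
  define I where "I = g ^ nat t"
  have sq: "[I ^ 2 = -1] (mod int p)"
  proof -
    have e2: "I ^ 2 = g ^ nat (2 * t)" using t_pos by (simp add: I_def power_mult[symmetric] nat_mult_distrib mult.commute)
    have e4: "(I ^ 2) ^ 2 = g ^ (p - 1)"
    proof -
      have "nat (2 * t) * 2 = p - 1" using p1 by linarith
      then show ?thesis unfolding e2 by (simp only: power_mult[symmetric])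
    qed
    have "[(I ^ 2) ^ 2 = 1] (mod int p)" unfolding e4 by (rule fermat_int[OF g_not_dvd])
    then have "int p dvd (I ^ 2 - 1) * (I ^ 2 + 1)"
      by (simp add: cong_iff_dvd_diff power2_eq_square algebra_simps)
    moreover have "\<not> int p dvd I ^ 2 - 1"
    proof
      assume "int p dvd I ^ 2 - 1"
      then have "[g ^ nat (2 * t) = 1] (mod int p)" unfolding e2 by (simp only: cong_iff_dvd_diff)
      then have "p - 1 dvd nat (2 * t)" using g_ord by blast
      moreover have "0 < nat (2 * t)" "nat (2 * t) < p - 1" using t_pos p1 by linarith+
      ultimately show False by (auto dest: dvd_imp_le)
    qed
    ultimately have "int p dvd I ^ 2 + 1" using int_prime prime_dvd_mult_iff by blast
    then show ?thesis by (simp add: cong_iff_dvd_diff)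
  qed
  have "[(1 + I) ^ 4 = -4] (mod int p)"
  proof -
    have "(1 + I) ^ 4 - (-4) = (I ^ 2 - (-1)) * (I ^ 2 + 4 * I + 5)"
      by (simp add: power4_eq_xxxx power2_eq_square algebra_simps)
    then show ?thesis using sq by (simp only: cong_iff_dvd_diff dvd_mult2)
  qed
  then have 1: "X t (-4) = X t ((1 + I) ^ 4)" using X_cong by metis
  have "\<not> int p dvd 1 + I"
  proof
    assume "int p dvd 1 + I"
    then have "int p dvd (1 + I) ^ 4" by (simp add: dvd_power_same[of _ _ 4] dvd_trans[OF _ dvd_power])
    then have "int p dvd -4" using \<open>[(1 + I) ^ 4 = -4] (mod int p)\<close> cong_dvd_iff by blast
    then show False using nd4 by simp
  qed
  then have "X (4 * t) (1 + I) = 1" by (intro X_trivial) (simp only: p1 dvd_refl)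
  then show ?thesis using 1 X_times[of 4 t "1 + I"] by simp
qed

section \<open>The quartic product formula and evaluation of the resulting sums\<close>

abbreviation eta :: complex where "eta \<equiv> X t (-1)"

lemma eta_eta: "eta * eta = 1" by (rule X_neg_1_square)

lemma X_t_4: "X t 4 = eta"
proof -
  have "eta * X t 4 = 1" using X_t_minus_4 X_mult[of t "-1" 4] by simp
  then have "eta * X t 4 = eta * eta" by (simp only: eta_eta)
  then show ?thesis using X_neg_1_nonzero by simp
qed

lemma X_minus_t_4: "X (- t) 4 = eta"
  unfolding X_neg X_t_4 using eta_eta by (metis inverse_unique)

lemma nd_mult_t: "\<not> int (p - 1) dvd t" "\<not> int (p - 1) dvd 2 * t" "\<not> int (p - 1) dvd 3 * t"
  unfolding p1 using t_pos by (auto dest!: zdvd_imp_le)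

lemma G_t_G_3t: "G t * G (3 * t) = eta * of_nat p"
proof -
  have "[- t = 3 * t] (mod int (p - 1))" unfolding p1 by (simp add: cong_iff_dvd_diff)
  then have "G (- t) = G (3 * t)" by (rule G_mod)
  then show ?thesis using G_mult_neg[OF nd_mult_t(1)] by simp
qed

text \<open>The quadratic relation is applied at \<open>n\<close>, \<open>n + t\<close> and
  \<open>2 * n\<close>; the values at 4 differ from \<open>X (- (4 * n)) 4\<close> by
  \<open>X (- t) 4\<close>, which is \<open>eta\<close>.\<close>

lemma hasse_davenport_4:
  "G n * G (n + t) * G (n + 2 * t) * G (n + 3 * t) = X (- (4 * n)) 4 * eta * of_nat p * G (2 * t) * G (4 * n)"
proof -
  define h where "h = G (2 * t)"
  have 1: "G n * G (n + 2 * t) = X (- n) 4 * G (2 * n) * h" unfolding h_def by (rule hasse_davenport)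
  have 2: "G (n + t) * G (n + 3 * t) = X (- (n + t)) 4 * G (2 * n + 2 * t) * h"
    using hasse_davenport[of "n + t"] by (simp add: h_def algebra_simps)
  have 3: "G (2 * n) * G (2 * n + 2 * t) = X (- (2 * n)) 4 * G (4 * n) * h"
    using hasse_davenport[of "2 * n"] by (simp add: h_def)
  have "X (- (4 * n)) 4 * X (- t) 4 = X (- n) 4 * X (- (n + t)) 4 * X (- (2 * n)) 4"
    by (simp only: X_add[symmetric]) simp
  then have x: "X (- n) 4 * X (- (n + t)) 4 * X (- (2 * n)) 4 = X (- (4 * n)) 4 * eta"
    by (simp only: X_minus_t_4)
  have "G n * G (n + t) * G (n + 2 * t) * G (n + 3 * t) = (G n * G (n + 2 * t)) * (G (n + t) * G (n + 3 * t))"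
    by (simp only: mult_ac)
  also have "\<dots> = X (- n) 4 * X (- (n + t)) 4 * (G (2 * n) * G (2 * n + 2 * t)) * (h * h)"
    unfolding 1 2 by (simp only: mult_ac)
  also have "\<dots> = (X (- n) 4 * X (- (n + t)) 4 * X (- (2 * n)) 4) * G (4 * n) * h * (h * h)"
    unfolding 3 by (simp only: mult_ac)
  also have "\<dots> = X (- (4 * n)) 4 * eta * of_nat p * h * G (4 * n)"
    unfolding x using G_half_square by (simp add: h_def mult_ac)
  finally show ?thesis by (simp add: h_def)
qed

text \<open>The product formula trades \<open>G (4 * n)\<close> for the four Gauss sums at
  \<open>n\<close>, \<open>n + t\<close>, \<open>n + 2 * t\<close>, \<open>n + 3 * t\<close>. The
  character at 4 cancels, which is the reason for the coefficient \<open>4 * lam\<close> in the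
  equation.\<close>

lemma quartic_count_term:
  assumes lam: "\<not> int p dvd lam"
  shows "X (4 * n) (4 * lam) / G (4 * n) * G n *
    (G n ^ 3 + 3 * G n * G (n + 2 * t) ^ 2 + 6 * G n * G (n + t) * G (n + 3 * t) + 3 * G (n + t) ^ 2 * G (n + 2 * t) + 3 * G (n + 2 * t) * G (n + 3 * t) ^ 2)
   = eta * of_nat p * G (2 * t) * (X (4 * n) lam * (G n ^ 3 / (G (n + t) * G (n + 2 * t) * G (n + 3 * t)))
     + 3 * (X (4 * n) lam * (G n * G (n + 2 * t) / (G (n + t) * G (n + 3 * t))))
     + 6 * (X (4 * n) lam * (G n / G (n + 2 * t)))
     + 3 * (X (4 * n) lam * (G (n + t) / G (n + 3 * t)))
     + 3 * (X (4 * n) lam * (G (n + 3 * t) / G (n + t))))"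
proof -
  define A where "A = X (4 * n) lam"
  define C where "C = eta * of_nat p * G (2 * t)"
  have nz: "G n \<noteq> 0" "G (n + t) \<noteq> 0" "G (n + 2 * t) \<noteq> 0" "G (n + 3 * t) \<noteq> 0" "G (4 * n) \<noteq> 0" by (rule G_nonzero)+
  have "X (4 * n) 4 * X (- (4 * n)) 4 = 1" by (rule X_mult_neg[OF nd4])
  then have "X (4 * n) 4 * (G n * G (n + t) * G (n + 2 * t) * G (n + 3 * t)) = C * G (4 * n)"
    unfolding hasse_davenport_4 C_def by (metis (no_types, lifting) mult.assoc mult_1)
  then have "X (4 * n) 4 / G (4 * n) = C / (G n * G (n + t) * G (n + 2 * t) * G (n + 3 * t))"
    using nz by (simp add: frac_eq_eq)
  then have e: "X (4 * n) (4 * lam) / G (4 * n) = A * C / (G n * G (n + t) * G (n + 2 * t) * G (n + 3 * t))"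
    unfolding X_mult A_def by (metis mult.commute times_divide_eq_left)
  show ?thesis unfolding e A_def[symmetric] C_def[symmetric]
    using nz by (simp add: field_simps power2_eq_square power3_eq_cube)
qed

text \<open>Translating \<open>n\<close> by \<open>t\<close> or \<open>3 * t\<close> reduces two of
  the sums to the first, because \<open>X (4 * n) lam\<close> has period \<open>t\<close> in
  \<open>n\<close>. In the last sum Hasse-Davenport gives a ratio in \<open>2 * n\<close>, and
  halving the index brings in both \<open>lam ^ 2\<close> and \<open>- (lam ^ 2)\<close>.\<close>

lemma sum_ratio_lam:
  assumes lam: "\<not> int p dvd lam"
  shows "of_nat p * (\<Sum>n\<in>exps. X (4 * n) lam * (G n / G (n + 2 * t))) = G (2 * t) * of_nat (p - 1) * (phi (1 - lam ^ 4) - 1)"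
    and "(\<Sum>n\<in>exps. X (4 * n) lam * (G (n + t) / G (n + 3 * t))) = (\<Sum>n\<in>exps. X (4 * n) lam * (G n / G (n + 2 * t)))"
    and "(\<Sum>n\<in>exps. X (4 * n) lam * (G (n + 3 * t) / G (n + t))) = (\<Sum>n\<in>exps. X (4 * n) lam * (G n / G (n + 2 * t)))"
    and "of_nat p * (\<Sum>n\<in>exps. X (4 * n) lam * (G n * G (n + 2 * t) / (G (n + t) * G (n + 3 * t))))
      = eta * (G (2 * t) * of_nat (p - 1) * (phi (1 + lam ^ 2) + phi (1 - lam ^ 2) - 2))"
proof -
  have lam4: "\<not> int p dvd lam ^ 4" and lam2: "\<not> int p dvd lam ^ 2" using lam not_dvd_power by blast+
  have X4: "X (4 * n) lam = X n (lam ^ 4)" for n using X_times[of 4 n lam] by simp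
  show "of_nat p * (\<Sum>n\<in>exps. X (4 * n) lam * (G n / G (n + 2 * t))) = G (2 * t) * of_nat (p - 1) * (phi (1 - lam ^ 4) - 1)"
    unfolding X4 sum_G_ratio[OF lam4] phi_4th[OF lam] by simp
  define F where "F n = X (4 * n) lam * (G n / G (n + 2 * t))" for n
  have F: "F i = F j" if ij: "[i = j] (mod int (p - 1))" for i j
    unfolding F_def X4 using X_mod[OF ij] G_mod[OF ij] G_mod[OF cong_add[OF ij cong_refl, of "2 * t"]] by simp
  have X4s: "X (4 * (n + r * t)) lam = X (4 * n) lam" for n r
    by (rule X_mod) (unfold p1 cong_iff_dvd_diff, simp add: algebra_simps)
  have "(\<Sum>n\<in>exps. F (n + t)) = (\<Sum>n\<in>exps. F n)" by (rule sum_exps_shift[OF F])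
  then show "(\<Sum>n\<in>exps. X (4 * n) lam * (G (n + t) / G (n + 3 * t))) = (\<Sum>n\<in>exps. X (4 * n) lam * (G n / G (n + 2 * t)))"
    using X4s[of _ 1] by (simp add: F_def add.assoc)
  have G5: "G (n + 3 * t + 2 * t) = G (n + t)" for n
    by (rule G_mod) (unfold p1 cong_iff_dvd_diff, simp)
  have "(\<Sum>n\<in>exps. F (n + 3 * t)) = (\<Sum>n\<in>exps. F n)" by (rule sum_exps_shift[OF F])
  then show "(\<Sum>n\<in>exps. X (4 * n) lam * (G (n + 3 * t) / G (n + t))) = (\<Sum>n\<in>exps. X (4 * n) lam * (G n / G (n + 2 * t)))"
    unfolding F_def X4s G5 .
  have r: "X (4 * n) lam * (G n * G (n + 2 * t) / (G (n + t) * G (n + 3 * t))) = eta * (X (2 * n) (lam ^ 2) * (G (2 * n) / G (2 * n + 2 * t)))" for n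
  proof -
    have "X (4 * n) lam = X (2 * n) (lam ^ 2)" using X_times[of 2 "2 * n" lam] by simp
    moreover have "G (n + t) * G (n + 3 * t) = X (- (n + t)) 4 * G (2 * n + 2 * t) * G (2 * t)"
      using hasse_davenport[of "n + t"] by (simp add: algebra_simps)
    moreover have "G n * G (n + 2 * t) = eta * X (- (n + t)) 4 * G (2 * n) * G (2 * t)"
    proof -
      have "X (- n) 4 = X t 4 * X (- (n + t)) 4" by (simp only: X_add[symmetric]) simp
      then show ?thesis unfolding hasse_davenport X_t_4 by simp
    qed
    moreover have "X (- (n + t)) 4 \<noteq> 0" using nd4 by (simp add: X_eq_0_iff)
    ultimately show ?thesis using G_nonzero[of "2 * t"] by (simp add: field_simps)
  qed
  define f where "f k = X k (lam ^ 2) * (G k / G (k + 2 * t))" for k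
  have f: "f i = f j" if ij: "[i = j] (mod int (p - 1))" for i j
    unfolding f_def using X_mod[OF ij] G_mod[OF ij] G_mod[OF cong_add[OF ij cong_refl, of "2 * t"]] by simp
  have "(\<Sum>n\<in>exps. X (4 * n) lam * (G n * G (n + 2 * t) / (G (n + t) * G (n + 3 * t)))) = eta * (\<Sum>n\<in>exps. f (2 * n))"
    unfolding r f_def sum_distrib_left ..
  also have "(\<Sum>n\<in>exps. f (2 * n)) = (\<Sum>n\<in>exps. (1 + X n (-1)) * f n)" by (rule sum_exps_double[OF f])
  also have "\<dots> = (\<Sum>n\<in>exps. X n (lam ^ 2) * (G n / G (n + 2 * t))) + (\<Sum>n\<in>exps. X n (- (lam ^ 2)) * (G n / G (n + 2 * t)))"
  proof -
    have "(1 + X n (-1)) * f n = X n (lam ^ 2) * (G n / G (n + 2 * t)) + X n (- (lam ^ 2)) * (G n / G (n + 2 * t))" for n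
    proof -
      have m: "X n (- (lam ^ 2)) = X n (-1) * X n (lam ^ 2)" using X_mult[of n "-1" "lam ^ 2"] by simp
      show ?thesis unfolding m f_def by (simp only: distrib_right mult_1 mult.assoc)
    qed
    then show ?thesis by (simp only: sum.distrib)
  qed
  finally have s: "(\<Sum>n\<in>exps. X (4 * n) lam * (G n * G (n + 2 * t) / (G (n + t) * G (n + 3 * t))))
    = eta * ((\<Sum>n\<in>exps. X n (lam ^ 2) * (G n / G (n + 2 * t))) + (\<Sum>n\<in>exps. X n (- (lam ^ 2)) * (G n / G (n + 2 * t))))" .
  have lam2': "\<not> int p dvd - (lam ^ 2)" using lam2 by simp
  have "of_nat p * (\<Sum>n\<in>exps. X (4 * n) lam * (G n * G (n + 2 * t) / (G (n + t) * G (n + 3 * t))))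
    = eta * (of_nat p * (\<Sum>n\<in>exps. X n (lam ^ 2) * (G n / G (n + 2 * t))) + of_nat p * (\<Sum>n\<in>exps. X n (- (lam ^ 2)) * (G n / G (n + 2 * t))))"
    unfolding s by (simp only: distrib_left mult.left_commute)
  then show "of_nat p * (\<Sum>n\<in>exps. X (4 * n) lam * (G n * G (n + 2 * t) / (G (n + t) * G (n + 3 * t))))
      = eta * (G (2 * t) * of_nat (p - 1) * (phi (1 + lam ^ 2) + phi (1 - lam ^ 2) - 2))"
    unfolding sum_G_ratio[OF lam2] sum_G_ratio[OF lam2'] phi_uminus phi_square[OF lam]
    by (simp add: algebra_simps)
qed

text \<open>One Jacobi sum for each of the parameters \<open>1/4\<close>, \<open>2/4\<close>,
  \<open>3/4\<close> of McCarthy's function, each paired with the lower parameter 0.\<close>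

definition jac3 :: "int \<Rightarrow> complex" where
  "jac3 k = Jc (t - k) k * Jc (2 * t - k) k * Jc (3 * t - k) k"

lemma Jc_G: "\<not> int (p - 1) dvd i \<Longrightarrow> Jc (i - k) k * G i = G (i - k) * G k"
  using G_mult[of "i - k" k] by simp

lemma G_inverse: "(if int (p - 1) dvd j then of_nat p else 1) * X j (-1) * G (- j) * G j = of_nat p"
proof (cases "int (p - 1) dvd j")
  case True
  moreover have "X j (-1) = 1" using True gt1 by (intro X_trivial) auto
  ultimately show ?thesis using G_trivial[of j] G_trivial[of "- j"] by simp
next
  case False
  have "X j (-1) * G (- j) * G j = (X j (-1) * X j (-1)) * of_nat p"
    using G_mult_neg[OF False] by (metis mult.assoc mult.commute)
  then show ?thesis using False by (simp add: X_neg_1_square)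
qed

text \<open>Each of the three denominators is inverted by \<open>G_inverse\<close>. At
  \<open>k = t\<close>, \<open>2 * t\<close>, \<open>3 * t\<close> one of them is the trivial Gauss
  sum, whose inverse lacks the factor \<open>1 / p\<close> of the generic case; hence the
  exceptional weight \<open>p\<close>.\<close>

lemma jac3_term:
  assumes mu: "\<not> int p dvd mu" "phi mu = 1" and k: "k \<in> exps"
  shows "eta * of_nat p * G (2 * t) * (X k mu * (G k ^ 3 / (G (k + t) * G (k + 2 * t) * G (k + 3 * t))))
    = (if k \<in> {t, 2 * t, 3 * t} then of_nat p else 1) * (X k (- mu) * jac3 k)"
proof -
  define P where "P = (of_nat p :: complex)"
  define a where "a = G t"
  define h where "h = G (2 * t)"
  define b where "b = G (3 * t)"
  define w where "w j = (if int (p - 1) dvd j then P else 1)" for j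
  have P0: "P \<noteq> 0" using pos by (simp add: P_def)
  have ab: "a * b = eta * P" and hh: "h * h = P" using G_t_G_3t G_half_square by (simp_all add: a_def b_def h_def P_def)
  have dv: "int (p - 1) dvd k + r * t \<longleftrightarrow> k = (4 - r) * t" if r: "r \<in> {1, 2, 3}" for r
  proof
    assume "int (p - 1) dvd k + r * t"
    then obtain q where q: "k + r * t = 4 * t * q" unfolding p1 by blast
    have "0 < r * t" "r * t \<le> 3 * t" using r t_pos by auto
    moreover have "0 \<le> k" "k < 4 * t" using k by (auto simp: exps_eq)
    ultimately have q0: "0 < 4 * t * q" and q2: "4 * t * q < 4 * t * 2" unfolding q[symmetric] by linarith+
    have "0 < q" using q0 t_pos by (simp add: zero_less_mult_iff)
    moreover have "q < 2" by (rule mult_left_less_imp_less[OF q2]) (use t_pos in simp)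
    ultimately have "q = 1" by linarith
    then show "k = (4 - r) * t" using q by (simp add: algebra_simps)
  next
    assume "k = (4 - r) * t"
    then have "k + r * t = 4 * t" by (simp add: algebra_simps)
    then show "int (p - 1) dvd k + r * t" by (simp only: p1 dvd_refl)
  qed
  have W: "w (k + t) * w (k + 2 * t) * w (k + 3 * t) = (if k \<in> {t, 2 * t, 3 * t} then P else 1)"
    using dv[of 1] dv[of 2] dv[of 3] t_pos by (auto simp: w_def)
  have inv: "w j * X j (-1) * G (- j) * G j = P" for j
    unfolding w_def P_def by (rule G_inverse)
  have X1: "X (k + t) (-1) * X (k + 2 * t) (-1) * X (k + 3 * t) (-1) = X k (-1)"
  proof -
    have "X (k + t) (-1) * X (k + 2 * t) (-1) * X (k + 3 * t) (-1) = X k (-1) * (X k (-1) * X k (-1)) * (eta * X (3 * t) (-1)) * phi (-1)"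
      by (simp only: X_add mult_ac)
    moreover have "eta * X (3 * t) (-1) = 1"
      using X_add[of t "3 * t" "-1"] X_times[of 4 t "-1"] by simp
    ultimately show ?thesis by (simp add: X_neg_1_square phi_neg_1)
  qed
  have "[- (k + r * t) = (4 - r) * t - k] (mod int (p - 1))" for r
    unfolding p1 cong_iff_dvd_diff by (simp add: algebra_simps)
  then have Gs: "G (- (k + r * t)) = G ((4 - r) * t - k)" for r by (rule G_mod)
  have G1: "G (- (k + t)) = G (3 * t - k)" "G (- (k + 2 * t)) = G (2 * t - k)" "G (- (k + 3 * t)) = G (t - k)"
    using Gs[of 1] Gs[of 2] Gs[of 3] by simp_all
  define Q where "Q = G (k + t) * G (k + 2 * t) * G (k + 3 * t)"
  have Q0: "Q \<noteq> 0" using G_nonzero by (simp add: Q_def)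
  have J: "jac3 k * (a * h * b) = G (t - k) * G (2 * t - k) * G (3 * t - k) * G k ^ 3"
    unfolding jac3_def a_def h_def b_def
    using Jc_G[OF nd_mult_t(1), of k] Jc_G[OF nd_mult_t(2), of k] Jc_G[OF nd_mult_t(3), of k]
    by (simp add: power3_eq_cube mult_ac)
  have "P ^ 3 = (w (k + t) * X (k + t) (-1) * G (- (k + t)) * G (k + t)) * (w (k + 2 * t) * X (k + 2 * t) (-1) * G (- (k + 2 * t)) * G (k + 2 * t))
      * (w (k + 3 * t) * X (k + 3 * t) (-1) * G (- (k + 3 * t)) * G (k + 3 * t))"
    unfolding inv by (simp add: power3_eq_cube)
  also have "\<dots> = (w (k + t) * w (k + 2 * t) * w (k + 3 * t)) * (X (k + t) (-1) * X (k + 2 * t) (-1) * X (k + 3 * t) (-1))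
     * (G (t - k) * G (2 * t - k) * G (3 * t - k)) * Q"
    unfolding G1 Q_def by (simp only: mult_ac)
  finally have P3: "P ^ 3 = (if k \<in> {t, 2 * t, 3 * t} then P else 1) * X k (-1) * (G (t - k) * G (2 * t - k) * G (3 * t - k)) * Q"
    unfolding W X1 .
  have Xm: "X k (- mu) = X k (-1) * X k mu" using X_mult[of k "-1" mu] by simp
  define W' where "W' = (if k \<in> {t, 2 * t, 3 * t} then P else 1)"
  have "P ^ 3 * G k ^ 3 = W' * X k (-1) * (jac3 k * (a * h * b)) * Q"
    unfolding P3 W'_def[symmetric] J by (simp only: mult_ac)
  also have "a * h * b = eta * P * h" using ab by (simp add: mult_ac)
  finally have "P * (P ^ 2 * G k ^ 3) = P * (W' * X k (-1) * jac3 k * eta * h * Q)"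
    by (simp add: power2_eq_square power3_eq_cube mult_ac)
  then have "P ^ 2 * G k ^ 3 = W' * X k (-1) * jac3 k * eta * h * Q" using P0 by simp
  then have "P ^ 2 * (G k ^ 3 / Q) = W' * X k (-1) * jac3 k * eta * h" using Q0 by (simp add: field_simps)
  then have "eta * h * X k mu * (P ^ 2 * (G k ^ 3 / Q)) = eta * h * X k mu * (W' * X k (-1) * jac3 k * eta * h)" by (simp only:)
  also have "\<dots> = (eta * eta) * (h * h) * (W' * (X k (- mu) * jac3 k))" unfolding Xm by (simp only: mult_ac)
  also have "\<dots> = P * (W' * (X k (- mu) * jac3 k))" unfolding eta_eta hh by simp
  finally have "P * (eta * P * h * (X k mu * (G k ^ 3 / Q))) = P * (W' * (X k (- mu) * jac3 k))"
    by (simp add: power2_eq_square mult_ac)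
  then have "eta * P * h * (X k mu * (G k ^ 3 / Q)) = W' * (X k (- mu) * jac3 k)" using P0 by (simp only: mult_cancel_left) simp
  then show ?thesis unfolding Q_def W'_def P_def h_def .
qed

text \<open>At each exceptional index one of the three Jacobi sums has a trivial first character and
  equals \<open>-1\<close>, and the other two reduce to Gauss sums. These values are exactly what
  must cancel the fourth powers in \<open>quartic_count_0\<close>.\<close>

lemma jac3_special:
  assumes mu: "\<not> int p dvd mu" "phi mu = 1" "X t mu = 1"
  shows "of_nat p * (X t (- mu) * jac3 t) = - (G t ^ 4)"
    and "of_nat p * (phi (- mu) * jac3 (2 * t)) = - (of_nat p ^ 2)"
    and "of_nat p * (X (3 * t) (- mu) * jac3 (3 * t)) = - (G (3 * t) ^ 4)"
proof -
  define P where "P = (of_nat p :: complex)"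
  define a where "a = G t"
  define h where "h = G (2 * t)"
  define b where "b = G (3 * t)"
  have nz: "a \<noteq> 0" "h \<noteq> 0" "b \<noteq> 0" "P \<noteq> 0" using G_nonzero pos by (simp_all add: a_def h_def b_def P_def)
  have ab: "a * b = eta * P" and hh: "h * h = P" using G_t_G_3t G_half_square by (simp_all add: a_def b_def h_def P_def)
  have Gm: "G (- t) = b" "G (- (2 * t)) = h"
    unfolding b_def h_def by (rule G_mod, unfold p1 cong_iff_dvd_diff, simp)+
  have X3: "X (3 * t) (-1) = eta"
  proof -
    have "eta * X (3 * t) (-1) = 1" using X_add[of t "3 * t" "-1"] X_times[of 4 t "-1"] by simp
    then have "eta * X (3 * t) (-1) = eta * eta" by (simp only: eta_eta)
    then show ?thesis using X_neg_1_nonzero by simp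
  qed
  have X3m: "X (3 * t) mu = 1" using X_times[of 3 t mu] mu(3) by (simp add: X_power)
  have Xm: "X t (- mu) = eta" "phi (- mu) = 1" "X (3 * t) (- mu) = eta"
    using X_mult[of t "-1" mu] X_mult[of "3 * t" "-1" mu] mu phi_uminus[of mu] X3 X3m by simp_all
  note J1 = Jc_G[OF nd_mult_t(1)] and J2 = Jc_G[OF nd_mult_t(2)] and J3 = Jc_G[OF nd_mult_t(3)]
  have J0: "Jc 0 j = -1" if "\<not> int (p - 1) dvd j" for j using Jc_0_right[OF that] Jc_commute by simp
  have a1: "Jc t t * h = a * a" "Jc (2 * t) t * b = h * a"
    using J2[of t] J3[of t] by (simp_all add: a_def h_def b_def)
  have a2: "Jc (- t) (2 * t) * a = b * h" "Jc t (2 * t) * b = a * h"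
    using J1[of "2 * t"] J3[of "2 * t"] Gm by (simp_all add: a_def h_def b_def)
  have a3: "Jc (- 2 * t) (3 * t) * a = h * b" "Jc (- t) (3 * t) * h = b * b"
    using J1[of "3 * t"] J2[of "3 * t"] Gm by (simp_all add: a_def h_def b_def)
  have "jac3 t = - (Jc t t * Jc (2 * t) t)" using J0[OF nd_mult_t(1)] by (simp add: jac3_def)
  then have "jac3 t * (h * b) = - ((Jc t t * h) * (Jc (2 * t) t * b))" by (simp add: mult_ac)
  then have "jac3 t * b * h = - (a ^ 3) * h" unfolding a1 by (simp add: power3_eq_cube mult_ac)
  then have "jac3 t * b = - (a ^ 3)" using nz(2) by (simp only: mult_cancel_right) simp
  then have "jac3 t * (a * b) = - (a ^ 4)" by (simp add: power3_eq_cube power4_eq_xxxx mult_ac)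
  then show "of_nat p * (X t (- mu) * jac3 t) = - (G t ^ 4)" unfolding Xm ab by (simp add: P_def a_def mult_ac)
  have "jac3 (2 * t) = - (Jc (- t) (2 * t) * Jc t (2 * t))" using J0[OF nd_mult_t(2)] by (simp add: jac3_def)
  then have "jac3 (2 * t) * (a * b) = - ((Jc (- t) (2 * t) * a) * (Jc t (2 * t) * b))" by (simp add: mult_ac)
  then have "jac3 (2 * t) * (a * b) = - (h * h) * (a * b)" unfolding a2 by (simp add: mult_ac)
  then have "jac3 (2 * t) = - P" using nz(1,3) by (simp only: mult_cancel_right mult_eq_0_iff hh) simp
  then show "of_nat p * (phi (- mu) * jac3 (2 * t)) = - (of_nat p ^ 2)" unfolding Xm by (simp add: P_def power2_eq_square)
  have "jac3 (3 * t) = - (Jc (- 2 * t) (3 * t) * Jc (- t) (3 * t))" using J0[OF nd_mult_t(3)] by (simp add: jac3_def)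
  then have "jac3 (3 * t) * (a * h) = - ((Jc (- 2 * t) (3 * t) * a) * (Jc (- t) (3 * t) * h))" by (simp add: mult_ac)
  then have "jac3 (3 * t) * a * h = - (b ^ 3) * h" unfolding a3 by (simp add: power3_eq_cube mult_ac)
  then have "jac3 (3 * t) * a = - (b ^ 3)" using nz(2) by (simp only: mult_cancel_right) simp
  then have "(jac3 (3 * t) * a) * b = - (b ^ 3) * b" by (simp only:)
  then have "jac3 (3 * t) * (a * b) = - (b ^ 4)" by (simp add: power3_eq_cube power4_eq_xxxx mult_ac)
  then show "of_nat p * (X (3 * t) (- mu) * jac3 (3 * t)) = - (G (3 * t) ^ 4)" unfolding Xm ab by (simp add: P_def b_def mult_ac)
qed

lemma sum_jac3:
  assumes lam: "\<not> int p dvd lam"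
  shows "of_nat p * (eta * of_nat p * G (2 * t) * (\<Sum>n\<in>exps. X (4 * n) lam * (G n ^ 3 / (G (n + t) * G (n + 2 * t) * G (n + 3 * t)))))
    = of_nat p * (\<Sum>k\<in>exps. X k (- (lam ^ 4)) * jac3 k) - of_nat (p - 1) * (G t ^ 4 + of_nat p ^ 2 + G (3 * t) ^ 4)"
proof -
  define mu where "mu = lam ^ 4"
  have mu: "\<not> int p dvd mu" "phi mu = 1" unfolding mu_def using lam not_dvd_power phi_4th by blast+
  have Xt: "X t mu = 1" using X_times[of 4 t lam] X_trivial[of "4 * t" lam] lam by (simp add: mu_def p1[symmetric])
  have X4: "X (4 * n) lam = X n mu" for n using X_times[of 4 n lam] by (simp add: mu_def)
  have "eta * of_nat p * G (2 * t) * (\<Sum>n\<in>exps. X n mu * (G n ^ 3 / (G (n + t) * G (n + 2 * t) * G (n + 3 * t))))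
    = (\<Sum>k\<in>exps. X k (- mu) * jac3 k + (if k \<in> {t, 2 * t, 3 * t} then of_nat (p - 1) * (X k (- mu) * jac3 k) else 0))"
    unfolding sum_distrib_left
    by (intro sum.cong refl) (subst jac3_term[OF mu], assumption, unfold of_p1, simp add: left_diff_distrib)
  also have "\<dots> = (\<Sum>k\<in>exps. X k (- mu) * jac3 k) + (\<Sum>k\<in>{k\<in>exps. k \<in> {t, 2 * t, 3 * t}}. of_nat (p - 1) * (X k (- mu) * jac3 k))"
    unfolding sum.distrib by (subst sum.inter_filter) simp_all
  also have "{k\<in>exps. k \<in> {t, 2 * t, 3 * t}} = {t, 2 * t, 3 * t}" using t_pos by (auto simp: exps_eq)
  also have "(\<Sum>k\<in>{t, 2 * t, 3 * t}. of_nat (p - 1) * (X k (- mu) * jac3 k))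
     = of_nat (p - 1) * (X t (- mu) * jac3 t + phi (- mu) * jac3 (2 * t) + X (3 * t) (- mu) * jac3 (3 * t))"
    using t_pos by (simp add: distrib_left add.assoc)
  finally have e: "eta * of_nat p * G (2 * t) * (\<Sum>n\<in>exps. X n mu * (G n ^ 3 / (G (n + t) * G (n + 2 * t) * G (n + 3 * t))))
    = (\<Sum>k\<in>exps. X k (- mu) * jac3 k) + of_nat (p - 1) * (X t (- mu) * jac3 t + phi (- mu) * jac3 (2 * t) + X (3 * t) (- mu) * jac3 (3 * t))" .
  have "of_nat p * (X t (- mu) * jac3 t + phi (- mu) * jac3 (2 * t) + X (3 * t) (- mu) * jac3 (3 * t)) = - (G t ^ 4 + of_nat p ^ 2 + G (3 * t) ^ 4)"
    unfolding distrib_left jac3_special[OF mu Xt] by simp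
  then have "of_nat p * (of_nat (p - 1) * (X t (- mu) * jac3 t + phi (- mu) * jac3 (2 * t) + X (3 * t) (- mu) * jac3 (3 * t))) = - (of_nat (p - 1) * (G t ^ 4 + of_nat p ^ 2 + G (3 * t) ^ 4))"
    by (metis mult.left_commute mult_minus_right)
  then show ?thesis unfolding X4 mu_def[symmetric] e by (simp only: distrib_left[of "of_nat p"]) simp
qed

text \<open>With \<open>P\<close> standing for \<open>p\<close>, the Fermat quartic contributes
  \<open>a ^ 4 + b ^ 4 + 7 * P ^ 2 + 12 * eta * P ^ 2\<close>. The exceptional indices remove
  \<open>a ^ 4 + b ^ 4 + P ^ 2\<close>, the \<open>- 2\<close> in \<open>D - 2\<close> removes
  \<open>6 * P ^ 2\<close>, and the \<open>- 1\<close> in \<open>f - 1\<close> removes the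
  rest.\<close>

theorem quartic_count_formula:
  assumes lam: "\<not> int p dvd lam"
  shows "quartic_count (4 * lam) = of_nat p ^ 3 + (\<Sum>k\<in>exps. X k (- (lam ^ 4)) * jac3 k)
    + of_nat (p - 1) * (3 * of_nat p * (phi (1 + lam ^ 2) + phi (1 - lam ^ 2)) + 12 * of_nat p * eta * phi (1 - lam ^ 4))"
proof -
  define P where "P = (of_nat p :: complex)"
  define q where "q = (of_nat (p - 1) :: complex)"
  define a where "a = G t"
  define h where "h = G (2 * t)"
  define b where "b = G (3 * t)"
  define E1 where "E1 = (\<Sum>n\<in>exps. X (4 * n) lam * (G n ^ 3 / (G (n + t) * G (n + 2 * t) * G (n + 3 * t))))"
  define E2 where "E2 = (\<Sum>n\<in>exps. X (4 * n) lam * (G n * G (n + 2 * t) / (G (n + t) * G (n + 3 * t))))"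
  define E where "E = (\<Sum>n\<in>exps. X (4 * n) lam * (G n / G (n + 2 * t)))"
  define S where "S = (\<Sum>k\<in>exps. X k (- (lam ^ 4)) * jac3 k)"
  define D where "D = phi (1 + lam ^ 2) + phi (1 - lam ^ 2)"
  define f where "f = phi (1 - lam ^ 4)"
  have P0: "P \<noteq> 0" using pos by (simp add: P_def)
  have qP: "q = P - 1" unfolding q_def P_def by (rule of_p1)
  have ab: "a * b = eta * P" and hh: "h ^ 2 = P" using G_t_G_3t G_half_square by (simp_all add: a_def b_def h_def P_def power2_eq_square)
  have ee: "eta ^ 2 = 1" using eta_eta by (simp add: power2_eq_square)
  have L: "\<not> int p dvd 4 * lam" using nd4 lam not_dvd_mult by blast
  have "quartic_count (4 * lam) - quartic_count 0 = eta * P * h * (E1 + 3 * E2 + 6 * E + 3 * E + 3 * E)"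
    unfolding quartic_count_diff_eq[OF L] quartic_count_term[OF lam] P_def h_def E1_def E2_def
    by (simp only: sum_distrib_left[symmetric] sum.distrib sum_ratio_lam(2,3)[OF lam] E_def[symmetric])
  then have 1: "quartic_count (4 * lam) = quartic_count 0 + eta * P * h * E1 + 3 * eta * h * (P * E2) + 12 * eta * h * (P * E)"
    by (simp add: algebra_simps)
  have 2: "P * (eta * P * h * E1) = P * S - q * (a ^ 4 + P ^ 2 + b ^ 4)"
    using sum_jac3[OF lam] by (simp only: P_def h_def E1_def S_def q_def a_def b_def)
  have 3: "P * E2 = eta * (h * q * (D - 2))"
    using sum_ratio_lam(4)[OF lam] by (simp only: P_def E2_def h_def q_def D_def)
  have 4: "P * E = h * q * (f - 1)"
    using sum_ratio_lam(1)[OF lam] by (simp only: P_def E_def h_def q_def f_def)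
  have 5: "P * quartic_count 0 = P ^ 4 + q * (a ^ 4 + h ^ 4 + 12 * a * h ^ 2 * b + 6 * a ^ 2 * b ^ 2 + b ^ 4)"
    using quartic_count_0 by (simp only: P_def h_def q_def a_def b_def)
  have 6: "a ^ 4 + h ^ 4 + 12 * a * h ^ 2 * b + 6 * a ^ 2 * b ^ 2 + b ^ 4 = a ^ 4 + b ^ 4 + 7 * P ^ 2 + 12 * eta * P ^ 2"
  proof -
    have "h ^ 4 = P ^ 2" using hh by (metis mult_2 numeral_Bit0 power_add power2_eq_square)
    moreover have "12 * a * h ^ 2 * b = 12 * eta * P ^ 2" unfolding hh using ab by (simp add: power2_eq_square mult_ac)
    moreover have "6 * a ^ 2 * b ^ 2 = 6 * P ^ 2"
    proof -
      have "a ^ 2 * b ^ 2 = (eta * P) ^ 2" using ab by (metis power_mult_distrib)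
      then show ?thesis using ee by (simp add: power_mult_distrib mult.assoc)
    qed
    ultimately show ?thesis by (simp only: add.assoc) simp
  qed
  have "P * (3 * eta * h * (P * E2)) = P * (3 * (eta ^ 2) * h ^ 2 * (q * (D - 2)))" unfolding 3 by (simp add: power2_eq_square mult_ac)
  then have 7: "P * (3 * eta * h * (P * E2)) = 3 * P ^ 2 * (q * (D - 2))" unfolding ee hh by (simp add: power2_eq_square mult_ac)
  have "P * (12 * eta * h * (P * E)) = P * (12 * eta * h ^ 2 * (q * (f - 1)))" unfolding 4 by (simp add: power2_eq_square mult_ac)
  then have 8: "P * (12 * eta * h * (P * E)) = 12 * eta * P ^ 2 * (q * (f - 1))" unfolding hh by (simp add: power2_eq_square mult_ac)
  have "P * quartic_count (4 * lam) = P * quartic_count 0 + P * (eta * P * h * E1) + P * (3 * eta * h * (P * E2)) + P * (12 * eta * h * (P * E))"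
    unfolding 1 by (simp only: distrib_left)
  also have "\<dots> = P * (P ^ 3 + S + q * (3 * P * D + 12 * P * eta * f))"
    unfolding 2 5 6 7 8 by (simp add: algebra_simps power2_eq_square power3_eq_cube power4_eq_xxxx)
  finally have "quartic_count (4 * lam) = P ^ 3 + S + q * (3 * P * D + 12 * P * eta * f)" using P0 by (simp only: mult_cancel_left) simp
  then show ?thesis unfolding P_def S_def q_def D_def f_def .
qed

text \<open>The four Gauss sums in the numerator pair off by Hasse-Davenport at \<open>t - j\<close>
  and at \<open>j\<close>. The product becomes the constant \<open>Jc t (2 * t)\<close> times a
  Jacobi sum depending on \<open>2 * j\<close> only, so the sum is obtained from
  \<open>sum_exps_double\<close> and \<open>sum_X_Jc\<close>.\<close>

theorem jac2_sum:
  assumes lam: "\<not> int p dvd lam"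
  shows "(\<Sum>j\<in>exps. X j (lam ^ 4) * (Jc (3 * t - j) j * Jc (t - j) (j + 2 * t)))
    = of_nat (p - 1) * (Jc t (2 * t) * (phi (1 + lam ^ 2) + phi (1 - lam ^ 2)))"
proof -
  define a where "a = G t"
  define h where "h = G (2 * t)"
  define b where "b = G (3 * t)"
  have b0: "b \<noteq> 0" using G_nonzero by (simp add: b_def)
  have hh: "h * h = of_nat p" using G_half_square by (simp add: h_def)
  have ab: "a * b = eta * of_nat p" using G_t_G_3t by (simp add: a_def b_def)
  have lam2: "\<not> int p dvd lam ^ 2" "\<not> int p dvd - (lam ^ 2)" using lam not_dvd_power by simp_all
  have J: "Jc (3 * t - j) j * Jc (t - j) (j + 2 * t) = Jc t (2 * t) * Jc (2 * j) (2 * t - 2 * j)" for j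
  proof -
    have 1: "Jc (3 * t - j) j * b = G (3 * t - j) * G j" unfolding b_def by (rule Jc_G[OF nd_mult_t(3)])
    have 2: "Jc (t - j) (j + 2 * t) * b = G (t - j) * G (j + 2 * t)"
      using G_mult[of "t - j" "j + 2 * t"] nd_mult_t(3) by (simp add: b_def algebra_simps)
    have 3: "Jc t (2 * t) * b = a * h" using G_mult[of t "2 * t"] nd_mult_t(3) by (simp add: a_def b_def h_def)
    have 4: "Jc (2 * j) (2 * t - 2 * j) * h = G (2 * j) * G (2 * t - 2 * j)"
      using G_mult[of "2 * j" "2 * t - 2 * j"] nd_mult_t(2) by (simp add: h_def)
    have 5: "G (t - j) * G (3 * t - j) = X (- (t - j)) 4 * G (2 * t - 2 * j) * h"
      using hasse_davenport[of "t - j"] by (simp add: h_def algebra_simps)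
    have 6: "G j * G (j + 2 * t) = X (- j) 4 * G (2 * j) * h" unfolding h_def by (rule hasse_davenport)
    have 7: "X (- (t - j)) 4 * X (- j) 4 = eta" using X_add[of "- (t - j)" "- j" 4] X_minus_t_4 by simp
    have "(Jc (3 * t - j) j * Jc (t - j) (j + 2 * t)) * (b * b) = (Jc (3 * t - j) j * b) * (Jc (t - j) (j + 2 * t) * b)"
      by (simp only: mult_ac)
    also have "\<dots> = (G (t - j) * G (3 * t - j)) * (G j * G (j + 2 * t))" unfolding 1 2 by (simp only: mult_ac)
    also have "\<dots> = (X (- (t - j)) 4 * X (- j) 4) * (G (2 * j) * G (2 * t - 2 * j)) * (h * h)"
      unfolding 5 6 by (simp only: mult_ac)
    also have "\<dots> = (eta * of_nat p) * h * Jc (2 * j) (2 * t - 2 * j)" unfolding 7 4[symmetric] hh by (simp only: mult_ac)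
    also have "\<dots> = (Jc t (2 * t) * b) * b * Jc (2 * j) (2 * t - 2 * j)" unfolding ab[symmetric] 3 by (simp only: mult_ac)
    also have "\<dots> = (Jc t (2 * t) * Jc (2 * j) (2 * t - 2 * j)) * (b * b)" by (simp only: mult_ac)
    finally show ?thesis using b0 by (simp only: mult_cancel_right) simp
  qed
  define f where "f k = X k (lam ^ 2) * Jc k (2 * t - k)" for k
  have f: "f i = f j" if ij: "[i = j] (mod int (p - 1))" for i j
  proof -
    have "Jc i (2 * t - i) = Jc j (2 * t - j)"
      unfolding Jc_def by (intro sum.cong refl arg_cong2[where f = times] X_mod ij cong_diff cong_refl)
    then show ?thesis unfolding f_def using X_mod[OF ij] by simp
  qed
  have X4: "X j (lam ^ 4) = X (2 * j) (lam ^ 2)" for j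
    using X_times[of 2 j "lam ^ 2"] by (simp flip: power_mult)
  have "(\<Sum>j\<in>exps. X j (lam ^ 4) * (Jc (3 * t - j) j * Jc (t - j) (j + 2 * t))) = (\<Sum>j\<in>exps. Jc t (2 * t) * f (2 * j))"
    unfolding J X4 f_def by (intro sum.cong refl) (simp only: mult_ac)
  also have "\<dots> = Jc t (2 * t) * (\<Sum>k\<in>exps. (1 + X k (-1)) * f k)"
    using sum_exps_double[of f] f by (simp only: sum_distrib_left[symmetric])
  also have "(\<Sum>k\<in>exps. (1 + X k (-1)) * f k) = (\<Sum>k\<in>exps. X k (lam ^ 2) * Jc k (2 * t - k)) + (\<Sum>k\<in>exps. X k (- (lam ^ 2)) * Jc k (2 * t - k))"
  proof -
    have "(1 + X k (-1)) * f k = X k (lam ^ 2) * Jc k (2 * t - k) + X k (- (lam ^ 2)) * Jc k (2 * t - k)" for k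
    proof -
      have m: "X k (- (lam ^ 2)) = X k (-1) * X k (lam ^ 2)" using X_mult[of k "-1" "lam ^ 2"] by simp
      show ?thesis unfolding m f_def by (simp only: distrib_right mult_1 mult.assoc)
    qed
    then show ?thesis by (simp only: sum.distrib)
  qed
  also have "\<dots> = of_nat (p - 1) * (phi (1 + lam ^ 2) + phi (1 - lam ^ 2))"
    unfolding sum_X_Jc[OF lam2(1)] sum_X_Jc[OF lam2(2)] phi_uminus phi_square[OF lam] by (simp add: distrib_left)
  finally show ?thesis by (simp only: mult_ac)
qed

end

section \<open>Transfer to Teichmueller characters\<close>

definition i_re :: "nat \<Rightarrow> int" where
  "i_re n = (if n mod 4 = 0 then 1 else if n mod 4 = 2 then -1 else 0)"

definition i_im :: "nat \<Rightarrow> int" where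
  "i_im n = (if n mod 4 = 1 then 1 else if n mod 4 = 3 then -1 else 0)"

lemma i_re_im_Suc: "i_re (Suc n) = - i_im n" "i_im (Suc n) = i_re n"
proof -
  have "n mod 4 = 0 \<or> n mod 4 = 1 \<or> n mod 4 = 2 \<or> n mod 4 = 3" by presburger
  then show "i_re (Suc n) = - i_im n" "i_im (Suc n) = i_re n"
    by (elim disjE; simp add: i_re_def i_im_def mod_Suc)+
qed

lemma i_power_re_im: "\<i> ^ n = of_int (i_re n) + \<i> * of_int (i_im n)"
proof (induction n)
  case (Suc n)
  have "\<i> ^ Suc n = \<i> * of_int (i_re n) + (\<i> * \<i>) * of_int (i_im n)"
    by (simp only: power_Suc Suc distrib_left mult.assoc)
  then show ?case by (simp add: i_re_im_Suc)
qed (simp add: i_re_def i_im_def)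

lemma power_re_im_cong:
  fixes I M :: int
  assumes "[I ^ 2 = -1] (mod M)"
  shows "[I ^ n = i_re n + I * i_im n] (mod M)"
proof (induction n)
  case (Suc n)
  have "[I * I ^ n = I * (i_re n + I * i_im n)] (mod M)" by (intro cong_mult cong_refl Suc)
  moreover have "[I * (i_re n + I * i_im n) = I * i_re n + (-1) * i_im n] (mod M)"
  proof -
    have "[I * i_re n + I ^ 2 * i_im n = I * i_re n + (-1) * i_im n] (mod M)"
      by (intro cong_add cong_mult cong_refl assms)
    then show ?thesis by (simp add: distrib_left power2_eq_square mult.assoc)
  qed
  ultimately have "[I * I ^ n = I * i_re n + (-1) * i_im n] (mod M)" using cong_trans by blast
  then show ?case by (simp add: i_re_im_Suc add.commute)
qed (simp add: i_re_def i_im_def)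

text \<open>A complex identity that only uses \<open>\<i>\<^sup>2 = -1\<close> can be read modulo \<open>M\<close>, because the
  imaginary part of the left-hand side vanishes.\<close>

lemma sum_i_power_transfer:
  assumes "(\<Sum>s\<in>A. of_int (c s) * \<i> ^ e s) = (of_int C :: complex)"
  shows "(\<Sum>s\<in>A. c s * i_re (e s)) = C"
    and "\<And>I M. [I ^ 2 = -1] (mod M) \<Longrightarrow> [(\<Sum>s\<in>A. c s * I ^ e s) = C] (mod M)"
proof -
  define R where "R = (\<Sum>s\<in>A. c s * i_re (e s))"
  define Q where "Q = (\<Sum>s\<in>A. c s * i_im (e s))"
  have "(\<Sum>s\<in>A. of_int (c s) * \<i> ^ e s) = of_int R + \<i> * of_int Q"
    by (simp add: i_power_re_im R_def Q_def distrib_left sum.distrib sum_distrib_left mult_ac)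
  then have "of_int R + \<i> * of_int Q = (of_int C :: complex)" using assms by simp
  then have RC: "R = C" and Q0: "Q = 0" by (simp_all add: complex_eq_iff)
  show "R = C" by (rule RC)
  fix I M :: int assume I: "[I ^ 2 = -1] (mod M)"
  have "[(\<Sum>s\<in>A. c s * I ^ e s) = (\<Sum>s\<in>A. c s * (i_re (e s) + I * i_im (e s)))] (mod M)"
    by (intro cong_sum cong_mult cong_refl power_re_im_cong I)
  also have "(\<Sum>s\<in>A. c s * (i_re (e s) + I * i_im (e s))) = R + I * Q"
    by (simp add: R_def Q_def distrib_left sum.distrib sum_distrib_left mult_ac)
  finally show "[(\<Sum>s\<in>A. c s * I ^ e s) = C] (mod M)" by (simp add: RC Q0)
qed

context prime_gen4
begin

definition tn :: nat where "tn = (p - 1) div 4"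

lemma tn: "int tn = t" "p - 1 = 4 * tn" "tn > 0"
proof -
  show "int tn = t" by (simp add: tn_def t_def)
  then show "p - 1 = 4 * tn" "tn > 0" using p1 t_pos by linarith+
qed

lemma zeta_t: "zeta powi t = \<i>"
proof -
  have "2 * pi * of_int t / real (p - 1) = pi / 2"
  proof -
    have "real (p - 1) = 4 * of_int t" using tn by (metis of_int_of_nat_eq of_nat_mult of_nat_numeral)
    then show ?thesis using t_pos by simp
  qed
  then show ?thesis unfolding zeta_power_int by (simp only:) simp
qed

lemma X_t_power: 
  assumes "\<not> int p dvd x" shows "X (int r * t) x = \<i> ^ (r * ind x)"
proof -
  have "X (int r * t) x = zeta powi (t * int (r * ind x))" using assms by (simp add: X_def mult_ac)
  also have "\<dots> = \<i> ^ (r * ind x)" unfolding power_int_mult zeta_t by (rule power_int_of_nat)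
  finally show ?thesis .
qed

lemma X_t_ind: "\<not> int p dvd x \<Longrightarrow> X t x = \<i> ^ ind x" "\<not> int p dvd x \<Longrightarrow> X (2 * t) x = \<i> ^ (2 * ind x)" "\<not> int p dvd x \<Longrightarrow> X (3 * t) x = \<i> ^ (3 * ind x)"
  using X_t_power[of x 1] X_t_power[of x 2] X_t_power[of x 3] by simp_all

definition leg :: "int \<Rightarrow> int" where
  "leg x = (if int p dvd x then 0 else if even (ind x) then 1 else -1)"

lemma phi_leg: "phi x = of_int (leg x)"
proof (cases "int p dvd x")
  case False
  then have "phi x = (-1) ^ ind x" by (simp add: X_t_ind power_mult)
  then show ?thesis using False by (simp add: leg_def minus_one_power_iff)
qed (simp add: leg_def X_def)

lemma eta_parity: "eta = of_int ((-1) ^ tn)"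
  using X_neg_1_parity[of t] t_pos tn(1)[symmetric] by (simp add: minus_one_power_iff)

definition E3 :: "int \<Rightarrow> (int \<times> int \<times> int) set" where
  "E3 v = {(x, y, z). x \<in> {2..<int p} \<and> y \<in> {2..<int p} \<and> z \<in> {2..<int p} \<and>
     [v * ((1 - x) * (1 - y) * (1 - z)) = x * y * z] (mod int p)}"

definition E2 :: "int \<Rightarrow> (int \<times> int) set" where
  "E2 v = {(x, y). x \<in> {2..<int p} \<and> y \<in> {2..<int p} \<and> [v * ((1 - x) * (1 - y)) = x * y] (mod int p)}"

lemma residues_split: "residues = insert 0 (insert 1 {2..<int p})"
  using gt2 by (auto simp: residues_def)

lemma Jc_range: "Jc i j = (\<Sum>x\<in>{2..<int p}. X i x * X j (1 - x))"
  unfolding Jc_def residues_split by simp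

lemma finite_E2: "finite (E2 v)"
proof -
  have "E2 v \<subseteq> {2..<int p} \<times> {2..<int p}" by (auto simp: E2_def)
  then show ?thesis by (rule finite_subset) simp
qed

lemma sum_E3:
  fixes f :: "int \<Rightarrow> int \<Rightarrow> int \<Rightarrow> 'a::comm_monoid_add"
  shows "(\<Sum>s\<in>E3 v. case s of (x, y, z) \<Rightarrow> f x y z) = (\<Sum>x\<in>{2..<int p}. \<Sum>y\<in>{2..<int p}. \<Sum>z\<in>{2..<int p}.
     if [v * ((1 - x) * (1 - y) * (1 - z)) = x * y * z] (mod int p) then f x y z else 0)"
proof -
  have "E3 v = {s \<in> {2..<int p} \<times> {2..<int p} \<times> {2..<int p}. case s of (x, y, z) \<Rightarrow> [v * ((1 - x) * (1 - y) * (1 - z)) = x * y * z] (mod int p)}"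
    by (auto simp: E3_def)
  then have "(\<Sum>s\<in>E3 v. case s of (x, y, z) \<Rightarrow> f x y z) = (\<Sum>s\<in>{2..<int p} \<times> {2..<int p} \<times> {2..<int p}.
     if (case s of (x, y, z) \<Rightarrow> [v * ((1 - x) * (1 - y) * (1 - z)) = x * y * z] (mod int p)) then (case s of (x, y, z) \<Rightarrow> f x y z) else 0)"
    by (simp add: sum.inter_filter)
  then show ?thesis by (simp add: sum.cartesian_product split_def cong: if_cong)
qed

lemma sum_E2:
  fixes f :: "int \<Rightarrow> int \<Rightarrow> 'a::comm_monoid_add"
  shows "(\<Sum>s\<in>E2 v. case s of (x, y) \<Rightarrow> f x y) = (\<Sum>x\<in>{2..<int p}. \<Sum>y\<in>{2..<int p}.
     if [v * ((1 - x) * (1 - y)) = x * y] (mod int p) then f x y else 0)"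
proof -
  have "E2 v = {s \<in> {2..<int p} \<times> {2..<int p}. case s of (x, y) \<Rightarrow> [v * ((1 - x) * (1 - y)) = x * y] (mod int p)}"
    by (auto simp: E2_def)
  then have "(\<Sum>s\<in>E2 v. case s of (x, y) \<Rightarrow> f x y) = (\<Sum>s\<in>{2..<int p} \<times> {2..<int p}.
     if (case s of (x, y) \<Rightarrow> [v * ((1 - x) * (1 - y)) = x * y] (mod int p)) then (case s of (x, y) \<Rightarrow> f x y) else 0)"
    by (simp add: sum.inter_filter)
  then show ?thesis by (simp add: sum.cartesian_product split_def cong: if_cong)
qed

lemma sum_swap3_last:
  fixes f :: "'q \<Rightarrow> 'a \<Rightarrow> 'a \<Rightarrow> 'a \<Rightarrow> 'b::comm_monoid_add"
  shows "(\<Sum>q\<in>Q. \<Sum>x\<in>A. \<Sum>y\<in>A. \<Sum>z\<in>A. f q x y z) = (\<Sum>x\<in>A. \<Sum>y\<in>A. \<Sum>z\<in>A. \<Sum>q\<in>Q. f q x y z)"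
proof -
  have s: "(\<Sum>q\<in>Q. \<Sum>x\<in>A. g q x) = (\<Sum>x\<in>A. \<Sum>q\<in>Q. g q x)" for g :: "'q \<Rightarrow> 'a \<Rightarrow> 'b"
    by (rule sum.swap)
  show ?thesis by (simp only: s)
qed

lemma sum_product3:
  fixes a b c :: "'a \<Rightarrow> 'b::comm_semiring_1"
  shows "(\<Sum>x\<in>A. a x) * (\<Sum>x\<in>A. b x) * (\<Sum>x\<in>A. c x) = (\<Sum>x\<in>A. \<Sum>y\<in>A. \<Sum>z\<in>A. a x * (b y * c z))"
  by (simp only: sum_distrib_left[symmetric] sum_distrib_right[symmetric] mult.assoc)

lemma jac3_sum_E3:
  assumes v: "\<not> int p dvd v"
  shows "(\<Sum>k\<in>exps. X k v * jac3 k)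
    = of_nat (p - 1) * (\<Sum>s\<in>E3 v. case s of (x, y, z) \<Rightarrow> \<i> ^ (ind x + 2 * ind y + 3 * ind z))"
proof -
  define f where "f k x y z = X k v * (X (t - k) x * X k (1 - x) * (X (2 * t - k) y * X k (1 - y) * (X (3 * t - k) z * X k (1 - z))))" for k x y z
  have in0: "(\<Sum>k\<in>exps. f k x y z) = (if [v * ((1 - x) * (1 - y) * (1 - z)) = x * y * z] (mod int p) then of_nat (p - 1) * \<i> ^ (ind x + 2 * ind y + 3 * ind z) else 0)"
    if x: "x \<in> {2..<int p}" and y: "y \<in> {2..<int p}" and z: "z \<in> {2..<int p}" for x y z
  proof -
    note nd = range2_not_dvd[OF x] range2_not_dvd[OF y] range2_not_dvd[OF z]
    have n1: "\<not> int p dvd v * ((1 - x) * (1 - y) * (1 - z))" and n2: "\<not> int p dvd x * y * z"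
      by (intro not_dvd_mult v nd)+
    have "f k x y z = X t x * X (2 * t) y * X (3 * t) z * (X k (v * ((1 - x) * (1 - y) * (1 - z))) * X (- k) (x * y * z))" for k
      using X_add[of t "- k" x] X_add[of "2 * t" "- k" y] X_add[of "3 * t" "- k" z]
      by (simp add: f_def X_mult mult_ac)
    then have "(\<Sum>k\<in>exps. f k x y z) = X t x * X (2 * t) y * X (3 * t) z * (\<Sum>k\<in>exps. X k (v * ((1 - x) * (1 - y) * (1 - z))) * X (- k) (x * y * z))"
      by (simp only: sum_distrib_left)
    also have "\<dots> = \<i> ^ (ind x + 2 * ind y + 3 * ind z) * (if [v * ((1 - x) * (1 - y) * (1 - z)) = x * y * z] (mod int p) then of_nat (p - 1) else 0)"
      unfolding orthogonality_pair[OF n1 n2] by (simp only: X_t_ind(1)[OF nd(1)] X_t_ind(2)[OF nd(3)] X_t_ind(3)[OF nd(5)] power_add)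
    finally show ?thesis by simp
  qed
  have "(\<Sum>k\<in>exps. X k v * jac3 k) = (\<Sum>k\<in>exps. \<Sum>x\<in>{2..<int p}. \<Sum>y\<in>{2..<int p}. \<Sum>z\<in>{2..<int p}. f k x y z)"
    unfolding jac3_def Jc_range sum_product3 unfolding sum_distrib_left f_def by (rule refl)
  also have "\<dots> = (\<Sum>x\<in>{2..<int p}. \<Sum>y\<in>{2..<int p}. \<Sum>z\<in>{2..<int p}. \<Sum>k\<in>exps. f k x y z)"
    by (rule sum_swap3_last)
  also have "\<dots> = (\<Sum>x\<in>{2..<int p}. \<Sum>y\<in>{2..<int p}. \<Sum>z\<in>{2..<int p}.
     of_nat (p - 1) * (if [v * ((1 - x) * (1 - y) * (1 - z)) = x * y * z] (mod int p) then \<i> ^ (ind x + 2 * ind y + 3 * ind z) else 0))"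
    by (intro sum.cong refl) (simp only: in0, simp)
  also have "\<dots> = of_nat (p - 1) * (\<Sum>s\<in>E3 v. case s of (x, y, z) \<Rightarrow> \<i> ^ (ind x + 2 * ind y + 3 * ind z))"
    unfolding sum_E3 sum_distrib_left ..
  finally show ?thesis .
qed

lemma jac2_sum_E2:
  assumes v: "\<not> int p dvd v"
  shows "(\<Sum>k\<in>exps. X k v * (Jc (3 * t - k) k * Jc (t - k) (k + 2 * t)))
    = of_nat (p - 1) * (\<Sum>s\<in>E2 v. case s of (x, y) \<Rightarrow> \<i> ^ (3 * ind x + ind y + 2 * ind (1 - y)))"
proof -
  define f where "f k x y = X k v * (X (3 * t - k) x * X k (1 - x) * (X (t - k) y * X (k + 2 * t) (1 - y)))" for k x y
  have in0: "(\<Sum>k\<in>exps. f k x y) = (if [v * ((1 - x) * (1 - y)) = x * y] (mod int p) then of_nat (p - 1) * \<i> ^ (3 * ind x + ind y + 2 * ind (1 - y)) else 0)"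
    if x: "x \<in> {2..<int p}" and y: "y \<in> {2..<int p}" for x y
  proof -
    note nd = range2_not_dvd[OF x] range2_not_dvd[OF y]
    have n1: "\<not> int p dvd v * ((1 - x) * (1 - y))" and n2: "\<not> int p dvd x * y"
      by (intro not_dvd_mult v nd)+
    have "f k x y = X (3 * t) x * X t y * X (2 * t) (1 - y) * (X k (v * ((1 - x) * (1 - y))) * X (- k) (x * y))" for k
      using X_add[of t "- k" y] X_add[of "3 * t" "- k" x] X_add[of k "2 * t" "1 - y"]
      by (simp add: f_def X_mult mult_ac)
    then have "(\<Sum>k\<in>exps. f k x y) = X (3 * t) x * X t y * X (2 * t) (1 - y) * (\<Sum>k\<in>exps. X k (v * ((1 - x) * (1 - y))) * X (- k) (x * y))"
      by (simp only: sum_distrib_left)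
    also have "\<dots> = \<i> ^ (3 * ind x + ind y + 2 * ind (1 - y)) * (if [v * ((1 - x) * (1 - y)) = x * y] (mod int p) then of_nat (p - 1) else 0)"
      unfolding orthogonality_pair[OF n1 n2] by (simp only: X_t_ind(3)[OF nd(1)] X_t_ind(1)[OF nd(3)] X_t_ind(2)[OF nd(4)] power_add)
    finally show ?thesis by simp
  qed
  have "(\<Sum>k\<in>exps. X k v * (Jc (3 * t - k) k * Jc (t - k) (k + 2 * t))) = (\<Sum>k\<in>exps. \<Sum>x\<in>{2..<int p}. \<Sum>y\<in>{2..<int p}. f k x y)"
    unfolding Jc_range sum_product unfolding sum_distrib_left f_def by (rule refl)
  also have "\<dots> = (\<Sum>x\<in>{2..<int p}. \<Sum>y\<in>{2..<int p}. \<Sum>k\<in>exps. f k x y)"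
    by (subst sum.swap, rule sum.cong[OF refl], rule sum.swap)
  also have "\<dots> = (\<Sum>x\<in>{2..<int p}. \<Sum>y\<in>{2..<int p}.
     of_nat (p - 1) * (if [v * ((1 - x) * (1 - y)) = x * y] (mod int p) then \<i> ^ (3 * ind x + ind y + 2 * ind (1 - y)) else 0))"
    by (intro sum.cong refl) (simp only: in0, simp)
  also have "\<dots> = of_nat (p - 1) * (\<Sum>s\<in>E2 v. case s of (x, y) \<Rightarrow> \<i> ^ (3 * ind x + ind y + 2 * ind (1 - y)))"
    unfolding sum_E2 sum_distrib_left ..
  finally show ?thesis .
qed

definition sol_count :: "int \<Rightarrow> int" where
  "sol_count L = (\<Sum>x1\<in>residues. \<Sum>x2\<in>residues. \<Sum>x3\<in>residues. \<Sum>x4\<in>residues.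
     if int p dvd x1 ^ 4 + x2 ^ 4 + x3 ^ 4 + x4 ^ 4 - L * x1 * x2 * x3 * x4 then 1 else 0)"

lemma quartic_count_sol_count: "quartic_count L = of_int (sol_count L)"
  unfolding quartic_count_def sol_count_def delta_def of_int_sum by (intro sum.cong refl) simp

text \<open>The sum over \<open>E3 v\<close> of the powers of \<open>\<i>\<close> turns out to be an integer, so that the real parts suffice.\<close>

definition trace3 :: "int \<Rightarrow> int" where
  "trace3 v = (\<Sum>s\<in>E3 v. case s of (x, y, z) \<Rightarrow> i_re (ind x + 2 * ind y + 3 * ind z))"

lemma int_p1: "int (p - 1) = int p - 1" using pos by (simp add: of_nat_diff)

lemma sol_count_formula:
  assumes lam: "\<not> int p dvd lam"
  shows "sol_count (4 * lam) = int p ^ 3 + (int p - 1) * (trace3 (- (lam ^ 4)) + 3 * int p * (leg (1 + lam ^ 2) + leg (1 - lam ^ 2))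
      + 12 * int p * (-1) ^ tn * leg (1 - lam ^ 4))" (is ?A)
    and "[I ^ 2 = -1] (mod int p ^ k) \<Longrightarrow>
      [(\<Sum>s\<in>E3 (- (lam ^ 4)). case s of (x, y, z) \<Rightarrow> I ^ (ind x + 2 * ind y + 3 * ind z)) = trace3 (- (lam ^ 4))] (mod int p ^ k)"
proof -
  have v: "\<not> int p dvd - (lam ^ 4)" using lam not_dvd_power by simp
  \<comment> \<open>The factor \<open>p - 1\<close> is kept in the coefficients so that the right
    side of the complex identity is visibly an integer; it is prime to \<open>p\<close> and is
    cancelled after the transfer.\<close>
  define c where "c s = int p - 1" for s :: "int \<times> int \<times> int"
  define e where "e s = (case s of (x, y, z) \<Rightarrow> ind x + 2 * ind y + 3 * ind z)" for s
  define C where "C = sol_count (4 * lam) - int p ^ 3 - (int p - 1) * (3 * int p * (leg (1 + lam ^ 2) + leg (1 - lam ^ 2)) + 12 * int p * (-1) ^ tn * leg (1 - lam ^ 4))"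
  have "(\<Sum>s\<in>E3 (- (lam ^ 4)). of_int (c s) * \<i> ^ e s) = of_nat (p - 1) * (\<Sum>s\<in>E3 (- (lam ^ 4)). case s of (x, y, z) \<Rightarrow> \<i> ^ (ind x + 2 * ind y + 3 * ind z))"
    unfolding sum_distrib_left of_p1 by (intro sum.cong refl) (simp add: c_def e_def split: prod.split)
  also have "\<dots> = (\<Sum>k\<in>exps. X k (- (lam ^ 4)) * jac3 k)" by (rule jac3_sum_E3[OF v, symmetric])
  also have "\<dots> = of_int C"
    using quartic_count_formula[OF lam] unfolding quartic_count_sol_count phi_leg eta_parity of_p1 C_def by simp
  finally have main: "(\<Sum>s\<in>E3 (- (lam ^ 4)). of_int (c s) * \<i> ^ e s) = (of_int C :: complex)" .
  have tr: "(int p - 1) * trace3 (- (lam ^ 4)) = C"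
    using sum_i_power_transfer(1)[OF main] by (simp add: c_def e_def trace3_def sum_distrib_left split_def)
  then show ?A by (simp add: C_def algebra_simps)
  assume I: "[I ^ 2 = -1] (mod int p ^ k)"
  have "[(int p - 1) * (\<Sum>s\<in>E3 (- (lam ^ 4)). case s of (x, y, z) \<Rightarrow> I ^ (ind x + 2 * ind y + 3 * ind z)) = (int p - 1) * trace3 (- (lam ^ 4))] (mod int p ^ k)"
    using sum_i_power_transfer(2)[OF main I] unfolding tr by (simp add: c_def e_def sum_distrib_left split_def)
  then show "[(\<Sum>s\<in>E3 (- (lam ^ 4)). case s of (x, y, z) \<Rightarrow> I ^ (ind x + 2 * ind y + 3 * ind z)) = trace3 (- (lam ^ 4))] (mod int p ^ k)"
  proof (rule cong_cancel)
    show "\<not> int p dvd int p - 1" using gt1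
      by (metis dvd_diff_right_iff dvd_refl int_prime not_prime_unit)
  qed
qed

lemma jac2_cong:
  assumes lam: "\<not> int p dvd lam" and I: "[I ^ 2 = -1] (mod M)"
  shows "[(\<Sum>s\<in>E2 (lam ^ 4). case s of (x, y) \<Rightarrow> I ^ (3 * ind x + ind y + 2 * ind (1 - y)))
    = (leg (1 + lam ^ 2) + leg (1 - lam ^ 2)) * (\<Sum>x\<in>{2..<int p}. I ^ (ind x + 2 * ind (1 - x)))] (mod M)"
proof -
  have v: "\<not> int p dvd lam ^ 4" using lam not_dvd_power by simp
  define D where "D = leg (1 + lam ^ 2) + leg (1 - lam ^ 2)"
  define R where "R = {2..<int p}"
  \<comment> \<open>Both sides of the identity contain powers of the imaginary unit. Collecting them
    over a disjoint union, with coefficients 1 and \<open>- D\<close>, makes the right side the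
    integer 0, as the transfer requires.\<close>
  define c where "c s = (case s of Inl _ \<Rightarrow> 1 | Inr _ \<Rightarrow> - D)" for s :: "(int \<times> int) + int"
  define e where "e s = (case s of Inl q \<Rightarrow> (case q of (x, y) \<Rightarrow> 3 * ind x + ind y + 2 * ind (1 - y)) | Inr x \<Rightarrow> ind x + 2 * ind (1 - x))" for s :: "(int \<times> int) + int"
  have fin: "finite (E2 (lam ^ 4))" "finite R" using finite_E2 by (auto simp: R_def)
  have "Jc t (2 * t) = (\<Sum>x\<in>R. \<i> ^ (ind x + 2 * ind (1 - x)))"
    unfolding Jc_range R_def by (rule sum.cong[OF refl]) (simp add: X_t_ind range2_not_dvd power_add)
  moreover have "of_nat (p - 1) * (\<Sum>s\<in>E2 (lam ^ 4). case s of (x, y) \<Rightarrow> \<i> ^ (3 * ind x + ind y + 2 * ind (1 - y)))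
     = of_nat (p - 1) * (Jc t (2 * t) * of_int D)"
    unfolding jac2_sum_E2[OF v, symmetric] jac2_sum[OF lam] phi_leg D_def of_int_add by (simp only: mult_ac)
  ultimately have "(\<Sum>s\<in>E2 (lam ^ 4). case s of (x, y) \<Rightarrow> \<i> ^ (3 * ind x + ind y + 2 * ind (1 - y)))
     = (\<Sum>x\<in>R. \<i> ^ (ind x + 2 * ind (1 - x))) * of_int D"
    using p1_nonzero by (simp only: mult_cancel_left) simp
  then have "(\<Sum>s\<in>E2 (lam ^ 4) <+> R. of_int (c s) * \<i> ^ e s) = (of_int 0 :: complex)"
    unfolding sum.Plus[OF fin] by (simp add: c_def e_def split_def sum_distrib_left sum_negf mult.commute)
  from sum_i_power_transfer(2)[OF this I]
  have "[(\<Sum>s\<in>E2 (lam ^ 4). case s of (x, y) \<Rightarrow> I ^ (3 * ind x + ind y + 2 * ind (1 - y))) - D * (\<Sum>x\<in>R. I ^ (ind x + 2 * ind (1 - x))) = 0] (mod M)"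
    unfolding sum.Plus[OF fin] by (simp add: c_def e_def split_def sum_distrib_left sum_negf)
  then show ?thesis by (simp add: cong_iff_dvd_diff D_def R_def)
qed

end

section \<open>Orthogonality and Jacobi sums of powers of the Teichmueller character\<close>

context odd_prime
begin

lemma chi_mod: 
  assumes "\<not> int p dvd x" shows "[chi k e x = chi k (e mod (p - 1)) x] (mod int p ^ k)"
proof -
  have "[chi k ((p - 1) * (e div (p - 1))) x * chi k (e mod (p - 1)) x = 1 * chi k (e mod (p - 1)) x] (mod int p ^ k)"
    by (intro cong_mult cong_refl chi_order assms) simp
  then show ?thesis by (simp only: chi_add[symmetric] mult_div_mod_eq mult_1)
qed

lemma chi_exponent_cong:
  assumes "\<not> int p dvd x" "[e = f] (mod (p - 1))" shows "[chi k e x = chi k f x] (mod int p ^ k)"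
  using chi_mod[OF assms(1), of k e] chi_mod[OF assms(1), of k f] assms(2)
  by (metis cong_def)

lemma sum_chi_exponents:
  assumes x: "\<not> int p dvd x"
  shows "[(\<Sum>j<p - 1. chi k j x) = (if [x = 1] (mod int p) then int p - 1 else 0)] (mod int p ^ k)"
proof (cases "[x = 1] (mod int p)")
  case True
  have "[(\<Sum>j<p - 1. chi k j x) = (\<Sum>j<p - 1. chi k j 1)] (mod int p ^ k)"
    by (intro cong_sum chi_cong True)
  then show ?thesis using True pos by (simp add: of_nat_diff)
next
  case False
  have e: "(\<Sum>j<p - 1. chi k j x) = (\<Sum>j<p - 1. tpow k x ^ j)" using x by (simp add: chi_def)
  have "(tpow k x - 1) * (\<Sum>j<p - 1. chi k j x) = tpow k x ^ (p - 1) - 1"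
    unfolding e by (rule power_diff_1_eq[symmetric])
  also have "[tpow k x ^ (p - 1) - 1 = 1 - 1] (mod int p ^ k)"
    by (intro cong_diff cong_refl tpow_order x)
  finally have "[(tpow k x - 1) * (\<Sum>j<p - 1. chi k j x) = (tpow k x - 1) * 0] (mod int p ^ k)" by simp
  moreover have "\<not> int p dvd tpow k x - 1"
    using False tpow_cong_self[of k x] cong_sym cong_trans cong_iff_dvd_diff by blast
  ultimately have "[(\<Sum>j<p - 1. chi k j x) = 0] (mod int p ^ k)" by (rule cong_cancel)
  then show ?thesis using False by simp
qed

lemma chi_orthogonality:
  assumes v: "\<not> int p dvd v" and w: "\<not> int p dvd w"
  shows "[(\<Sum>j<p - 1. chi k (p - 1 - j) v * chi k j w) = (if [v = w] (mod int p) then int p - 1 else 0)] (mod int p ^ k)"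
proof -
  obtain v' where v': "[v * v' = 1] (mod int p)"
    using cong_solve_coprime_int[of v "int p"] coprime_power[OF v, of 1] by auto
  have nv': "\<not> int p dvd v'"
  proof
    assume "int p dvd v'"
    then have "int p dvd v * v'" by simp
    then have "int p dvd 1" using v' cong_dvd_iff by blast
    then show False using gt1 by simp
  qed
  have t: "[chi k (p - 1 - j) v * chi k j w = chi k j (v' * w)] (mod int p ^ k)" if j: "j < p - 1" for j
  proof -
    have a: "[1 * chi k (p - 1 - j) v = chi k j (v * v') * chi k (p - 1 - j) v] (mod int p ^ k)"
      using cong_sym[OF chi_cong[OF v', of k j]] by (intro cong_mult cong_refl) (simp only: chi_1)
    have b: "chi k j (v * v') * chi k (p - 1 - j) v = chi k (p - 1) v * chi k j v'"
      using chi_add[of k j "p - 1 - j" v] j by (simp add: chi_mult mult_ac)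
    have c: "[chi k (p - 1) v * chi k j v' = 1 * chi k j v'] (mod int p ^ k)"
      by (intro cong_mult cong_refl chi_order v) simp
    have "[chi k (p - 1 - j) v = chi k j v'] (mod int p ^ k)" using cong_trans[OF a[unfolded b] c] by (simp only: mult_1)
    from cong_mult[OF this cong_refl[of "chi k j w"]] show ?thesis by (simp only: chi_mult)
  qed
  have 1: "[(\<Sum>j<p - 1. chi k (p - 1 - j) v * chi k j w) = (\<Sum>j<p - 1. chi k j (v' * w))] (mod int p ^ k)"
    by (rule cong_sum) (rule t, simp)
  have 2: "[(\<Sum>j<p - 1. chi k j (v' * w)) = (if [v' * w = 1] (mod int p) then int p - 1 else 0)] (mod int p ^ k)"
    by (rule sum_chi_exponents[OF not_dvd_mult[OF nv' w]])
  have 3: "[v' * w = 1] (mod int p) \<longleftrightarrow> [v = w] (mod int p)"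
  proof
    assume "[v' * w = 1] (mod int p)"
    from cong_mult[OF cong_refl[of v] this] have 1: "[v * v' * w = v] (mod int p)" by (simp only: mult_1_right mult.assoc)
    from cong_mult[OF v' cong_refl[of w]] have 2: "[v * v' * w = w] (mod int p)" by (simp only: mult_1)
    show "[v = w] (mod int p)" by (rule cong_trans[OF cong_sym[OF 1] 2])
  next
    assume "[v = w] (mod int p)"
    then have "[v * v' = w * v'] (mod int p)" by (intro cong_mult cong_refl)
    from cong_trans[OF cong_sym[OF this] v'] show "[v' * w = 1] (mod int p)" by (simp only: mult.commute)
  qed
  show ?thesis using cong_trans[OF 1 2] unfolding 3 .
qed

lemma tpow_neg_1: "tpow k (-1) = -1"
  using odd by (simp add: tpow_def)

lemma chi_uminus: 
  assumes "j \<le> p - 1" shows "chi k (p - 1 - j) (- u) = (-1) ^ j * chi k (p - 1 - j) u"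
proof -
  have "chi k (p - 1 - j) (-1) = (-1) ^ (p - 1 - j)"
    using gt1 tpow_neg_1 by (simp add: chi_def)
  also have "\<dots> = (-1) ^ j" unfolding minus_one_power_iff by (intro if_cong refl) (use assms odd in presburger)
  finally show ?thesis using chi_mult[of k "p - 1 - j" "-1" u] by simp
qed

end

context prime_gen4
begin

text \<open>The counterpart of the imaginary unit \<open>X t g\<close>. Since \<open>jac\<close>
  uses negative powers of the Teichmueller character, \<open>X t\<close> corresponds to the exponent
  \<open>- tn\<close>, that is \<open>3 * tn\<close> modulo \<open>p - 1\<close>.\<close>

definition iroot :: "nat \<Rightarrow> int" where "iroot k = tpow k g ^ (3 * tn)"

lemma g_half: "[g ^ (2 * tn) = -1] (mod int p)"
proof -
  have "[(g ^ (2 * tn)) ^ 2 = 1] (mod int p)"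
    using fermat_int[OF g_not_dvd] tn(2) by (simp add: power_mult[symmetric] mult.commute)
  then have "int p dvd (g ^ (2 * tn) - 1) * (g ^ (2 * tn) + 1)"
    by (simp add: cong_iff_dvd_diff power2_eq_square algebra_simps)
  moreover have "\<not> int p dvd g ^ (2 * tn) - 1"
  proof
    assume "int p dvd g ^ (2 * tn) - 1"
    then have "p - 1 dvd 2 * tn" using g_ord by (simp only: cong_iff_dvd_diff[symmetric])
    then show False using tn by (auto dest: dvd_imp_le)
  qed
  ultimately have "int p dvd g ^ (2 * tn) + 1" using int_prime prime_dvd_mult_iff by blast
  then show ?thesis by (simp add: cong_iff_dvd_diff)
qed

lemma iroot_square: "[iroot k ^ 2 = -1] (mod int p ^ k)"
proof -
  have "iroot k ^ 2 = chi k (6 * tn) g" using g_not_dvd by (simp add: iroot_def chi_def power_mult[symmetric])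
  also have "[chi k (6 * tn) g = chi k (2 * tn) g] (mod int p ^ k)"
  proof (rule chi_exponent_cong[OF g_not_dvd])
    have "6 * tn = 2 * tn + 1 * (p - 1)" using tn(2) by simp
    then show "[6 * tn = 2 * tn] (mod p - 1)" by (simp only: cong_def mod_mult_self1)
  qed
  also have "chi k (2 * tn) g = tpow k (g ^ (2 * tn))"
    using g_not_dvd by (simp add: chi_def tpow_def power_mult[symmetric] mult.commute)
  also have "[tpow k (g ^ (2 * tn)) = tpow k (-1)] (mod int p ^ k)" by (rule tpow_cong[OF g_half])
  finally show ?thesis by (simp only: tpow_neg_1)
qed

lemma chi_iroot:
  assumes x: "\<not> int p dvd x" and e: "[e = 3 * tn * r + f] (mod (p - 1))"
  shows "[chi k e x = iroot k ^ (r * ind x) * chi k f x] (mod int p ^ k)"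
proof -
  have "[chi k e x = chi k (3 * tn * r) x * chi k f x] (mod int p ^ k)"
    using chi_exponent_cong[OF x e] by (simp only: chi_add)
  moreover have "[chi k (3 * tn * r) x * chi k f x = chi k (3 * tn * r) (g ^ ind x) * chi k f x] (mod int p ^ k)"
    by (intro cong_mult cong_refl chi_cong ind x)
  moreover have "chi k (3 * tn * r) (g ^ ind x) = iroot k ^ (r * ind x)"
    using not_dvd_power[OF g_not_dvd, of "ind x"]
    by (simp add: chi_def iroot_def tpow_def power_mult[symmetric] mult_ac)
  ultimately show ?thesis using cong_trans by simp
qed

lemma jac_iroot:
  assumes a: "[p - 1 - a = 3 * tn * r + e] (mod (p - 1))" and b: "[p - 1 - b = 3 * tn * s + f] (mod (p - 1))"
  shows "[jac k a b = (\<Sum>x\<in>{2..<int p}. iroot k ^ (r * ind x + s * ind (1 - x)) * (chi k e x * chi k f (1 - x)))] (mod int p ^ k)"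
proof -
  have "[jac k a b = (\<Sum>x\<in>{2..<int p}. (iroot k ^ (r * ind x) * chi k e x) * (iroot k ^ (s * ind (1 - x)) * chi k f (1 - x)))] (mod int p ^ k)"
    unfolding jac_def
  proof (rule cong_sum)
    fix x assume x: "x \<in> {2..<int p}"
    note nd = range2_not_dvd[OF x]
    have "[chi k (p - 1 - a) x * chi k (p - 1 - b) (1 - x) = (iroot k ^ (r * ind x) * chi k e x) * (iroot k ^ (s * ind (1 - x)) * chi k f (1 - x))] (mod int p ^ k)"
      by (intro cong_mult chi_iroot nd a b)
    then show "[tpow k x ^ (p - 1 - a) * tpow k (1 - x) ^ (p - 1 - b) = (iroot k ^ (r * ind x) * chi k e x) * (iroot k ^ (s * ind (1 - x)) * chi k f (1 - x))] (mod int p ^ k)"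
      using nd by (simp add: chi_def)
  qed
  then show ?thesis by (simp only: power_add mult_ac)
qed

text \<open>The numerator over \<open>p - 1\<close> of the fractional part of
  \<open>r / 4 - j / (p - 1)\<close>; the added \<open>p - 1\<close> keeps the subtraction of
  natural numbers from truncating for \<open>j < p - 1\<close>.\<close>

definition ix :: "nat \<Rightarrow> nat \<Rightarrow> nat" where "ix r j = (r * tn + (p - 1) - j) mod (p - 1)"

lemma ix_eq:
  assumes "r \<le> 3" "j < p - 1"
  shows "ix r j = (if j \<le> r * tn then r * tn - j else r * tn + (p - 1) - j)"
proof -
  have r: "r * tn < p - 1" using mult_le_mono1[OF assms(1), of tn] tn by linarith
  show ?thesis
  proof (cases "j \<le> r * tn")
    case True
    then have "r * tn + (p - 1) - j = (r * tn - j) + (p - 1)" by simp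
    then show ?thesis unfolding ix_def using True r by (simp only: mod_add_self2) simp
  qed (use r in \<open>simp add: ix_def\<close>)
qed

lemma ix_cong:
  assumes "j < p - 1" shows "[p - 1 - ix r j = 3 * tn * r + j] (mod (p - 1))"
proof -
  define N where "N = r * tn + (p - 1) - j"
  have lt: "ix r j < p - 1" unfolding ix_def using tn by simp
  have N: "int N = int r * t + 4 * t - int j" using assms tn p1 by (simp add: N_def of_nat_diff)
  have "N = (p - 1) * (N div (p - 1)) + ix r j" unfolding ix_def N_def by simp
  then have "int N = 4 * t * int (N div (p - 1)) + int (ix r j)" by (metis of_nat_add of_nat_mult p1)
  then have "int (p - 1 - ix r j) - int (3 * tn * r + j) = 4 * t * (int (N div (p - 1)) - int r)"
    using lt N p1 tn(1) by (simp add: of_nat_diff algebra_simps)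
  then have "int (p - 1) dvd int (p - 1 - ix r j) - int (3 * tn * r + j)" unfolding p1 by simp
  then show ?thesis by (simp only: cong_iff_dvd_diff[symmetric] cong_int_iff)
qed

lemma jac_ix: "j < p - 1 \<Longrightarrow> [jac k (ix r j) j = (\<Sum>x\<in>{2..<int p}. iroot k ^ (r * ind x) * (chi k j x * chi k (p - 1 - j) (1 - x)))] (mod int p ^ k)"
  using jac_iroot[OF ix_cong, of j j 0 "p - 1 - j" k r] by simp

lemma half_shift_cong:
  assumes "j < p - 1" shows "[p - 1 - (j + 2 * tn) mod (p - 1) = 3 * tn * 2 + (p - 1 - j)] (mod (p - 1))"
proof (cases "j < 2 * tn")
  case True
  then have "3 * tn * 2 + (p - 1 - j) = (p - 1 - (j + 2 * tn)) + 2 * (p - 1)" using tn by simp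
  moreover have "(j + 2 * tn) mod (p - 1) = j + 2 * tn" using True tn by simp
  ultimately show ?thesis by (simp only: cong_def mod_mult_self1)
next
  case False
  then have m: "(j + 2 * tn) mod (p - 1) = j - 2 * tn" using assms tn by (simp add: mod_if)
  have "3 * tn * 2 + (p - 1 - j) = (p - 1 - (j - 2 * tn)) + 1 * (p - 1)" using False assms tn by simp
  then show ?thesis unfolding m by (simp only: cong_def mod_mult_self1)
qed

lemma jac_half_shift:
  assumes j: "j < p - 1" shows "[jac k (ix 1 j) ((j + 2 * tn) mod (p - 1)) = (\<Sum>x\<in>{2..<int p}. iroot k ^ (ind x + 2 * ind (1 - x)) * (chi k j x * chi k (p - 1 - j) (1 - x)))] (mod int p ^ k)"
  using jac_iroot[OF ix_cong[OF j, of 1] half_shift_cong[OF j], of k] by simp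

lemma jac_quarter_half:
  "[jac k tn (2 * tn) = (\<Sum>x\<in>{2..<int p}. iroot k ^ (ind x + 2 * ind (1 - x)))] (mod int p ^ k)"
proof -
  have "[jac k tn (2 * tn) = (\<Sum>x\<in>{2..<int p}. iroot k ^ (1 * ind x + 2 * ind (1 - x)) * (chi k 0 x * chi k 0 (1 - x)))] (mod int p ^ k)"
  proof (rule jac_iroot)
    show "[p - 1 - tn = 3 * tn * 1 + 0] (mod p - 1)" using tn by simp
    have "3 * tn * 2 + 0 = (p - 1 - 2 * tn) + 1 * (p - 1)" using tn by simp
    then show "[p - 1 - 2 * tn = 3 * tn * 2 + 0] (mod p - 1)" by (simp only: cong_def mod_mult_self1)
  qed
  also have "(\<Sum>x\<in>{2..<int p}. iroot k ^ (1 * ind x + 2 * ind (1 - x)) * (chi k 0 x * chi k 0 (1 - x))) = (\<Sum>x\<in>{2..<int p}. iroot k ^ (ind x + 2 * ind (1 - x)))"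
    by (rule sum.cong[OF refl]) (use range2_not_dvd in \<open>simp add: chi_def\<close>)
  finally show ?thesis .
qed

text \<open>The p-adic twin of \<open>jac3_sum_E3\<close>: the same solution set and the same
  exponents appear, with \<open>iroot k\<close> in place of the imaginary unit, so that the
  transferred identity evaluates it.\<close>

lemma sum_jac3_E3:
  assumes v: "\<not> int p dvd v"
  shows "[(\<Sum>j<p - 1. chi k (p - 1 - j) v * (jac k (ix 1 j) j * jac k (ix 2 j) j * jac k (ix 3 j) j))
    = (int p - 1) * (\<Sum>s\<in>E3 v. case s of (x, y, z) \<Rightarrow> iroot k ^ (ind x + 2 * ind y + 3 * ind z))] (mod int p ^ k)"
proof -
  define h where "h r j x = iroot k ^ (r * ind x) * (chi k j x * chi k (p - 1 - j) (1 - x))" for r j x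
  define f where "f j x y z = chi k (p - 1 - j) v * (h 1 j x * (h 2 j y * h 3 j z))" for j x y z
  have J: "[jac k (ix r j) j = (\<Sum>x\<in>{2..<int p}. h r j x)] (mod int p ^ k)" if "j < p - 1" for r j
    unfolding h_def by (rule jac_ix[OF that])
  have in0: "[(\<Sum>j<p - 1. f j x y z) = (int p - 1) * (if [v * ((1 - x) * (1 - y) * (1 - z)) = x * y * z] (mod int p) then iroot k ^ (ind x + 2 * ind y + 3 * ind z) else 0)] (mod int p ^ k)"
    if x: "x \<in> {2..<int p}" and y: "y \<in> {2..<int p}" and z: "z \<in> {2..<int p}" for x y z
  proof -
    note nd = range2_not_dvd[OF x] range2_not_dvd[OF y] range2_not_dvd[OF z]
    have n1: "\<not> int p dvd v * ((1 - x) * (1 - y) * (1 - z))" and n2: "\<not> int p dvd x * y * z"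
      by (intro not_dvd_mult v nd)+
    have "f j x y z = iroot k ^ (ind x + 2 * ind y + 3 * ind z) * (chi k (p - 1 - j) (v * ((1 - x) * (1 - y) * (1 - z))) * chi k j (x * y * z))" for j
      by (simp add: f_def h_def chi_mult power_add mult_ac)
    then have "(\<Sum>j<p - 1. f j x y z) = iroot k ^ (ind x + 2 * ind y + 3 * ind z) * (\<Sum>j<p - 1. chi k (p - 1 - j) (v * ((1 - x) * (1 - y) * (1 - z))) * chi k j (x * y * z))"
      by (simp only: sum_distrib_left)
    moreover have "[iroot k ^ (ind x + 2 * ind y + 3 * ind z) * (\<Sum>j<p - 1. chi k (p - 1 - j) (v * ((1 - x) * (1 - y) * (1 - z))) * chi k j (x * y * z))
      = iroot k ^ (ind x + 2 * ind y + 3 * ind z) * (if [v * ((1 - x) * (1 - y) * (1 - z)) = x * y * z] (mod int p) then int p - 1 else 0)] (mod int p ^ k)"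
      by (intro cong_mult cong_refl chi_orthogonality n1 n2)
    ultimately show ?thesis by (simp only:) (auto simp: mult.commute split: if_splits)
  qed
  have "[(\<Sum>j<p - 1. chi k (p - 1 - j) v * (jac k (ix 1 j) j * jac k (ix 2 j) j * jac k (ix 3 j) j))
    = (\<Sum>j<p - 1. chi k (p - 1 - j) v * ((\<Sum>x\<in>{2..<int p}. h 1 j x) * (\<Sum>x\<in>{2..<int p}. h 2 j x) * (\<Sum>x\<in>{2..<int p}. h 3 j x)))] (mod int p ^ k)"
    by (intro cong_sum cong_mult cong_refl J) simp_all
  moreover have "(\<Sum>j<p - 1. chi k (p - 1 - j) v * ((\<Sum>x\<in>{2..<int p}. h 1 j x) * (\<Sum>x\<in>{2..<int p}. h 2 j x) * (\<Sum>x\<in>{2..<int p}. h 3 j x)))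
     = (\<Sum>j<p - 1. \<Sum>x\<in>{2..<int p}. \<Sum>y\<in>{2..<int p}. \<Sum>z\<in>{2..<int p}. f j x y z)"
    unfolding sum_product3 unfolding sum_distrib_left f_def by (rule refl)
  moreover have "(\<Sum>j<p - 1. \<Sum>x\<in>{2..<int p}. \<Sum>y\<in>{2..<int p}. \<Sum>z\<in>{2..<int p}. f j x y z)
     = (\<Sum>x\<in>{2..<int p}. \<Sum>y\<in>{2..<int p}. \<Sum>z\<in>{2..<int p}. \<Sum>j<p - 1. f j x y z)"
    by (rule sum_swap3_last)
  moreover have "[(\<Sum>x\<in>{2..<int p}. \<Sum>y\<in>{2..<int p}. \<Sum>z\<in>{2..<int p}. \<Sum>j<p - 1. f j x y z)
     = (\<Sum>x\<in>{2..<int p}. \<Sum>y\<in>{2..<int p}. \<Sum>z\<in>{2..<int p}. (int p - 1) * (if [v * ((1 - x) * (1 - y) * (1 - z)) = x * y * z] (mod int p) then iroot k ^ (ind x + 2 * ind y + 3 * ind z) else 0))] (mod int p ^ k)"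
    by (rule cong_sum, rule cong_sum, rule cong_sum) (rule in0)
  moreover have "(\<Sum>x\<in>{2..<int p}. \<Sum>y\<in>{2..<int p}. \<Sum>z\<in>{2..<int p}. (int p - 1) * (if [v * ((1 - x) * (1 - y) * (1 - z)) = x * y * z] (mod int p) then iroot k ^ (ind x + 2 * ind y + 3 * ind z) else 0))
     = (int p - 1) * (\<Sum>s\<in>E3 v. case s of (x, y, z) \<Rightarrow> iroot k ^ (ind x + 2 * ind y + 3 * ind z))"
    unfolding sum_E3 sum_distrib_left by (rule refl)
  ultimately show ?thesis by (simp only:) (rule cong_trans)
qed

lemma sum_jac2_E2:
  assumes v: "\<not> int p dvd v"
  shows "[(\<Sum>j<p - 1. chi k (p - 1 - j) v * (jac k (ix 3 j) j * jac k (ix 1 j) ((j + 2 * tn) mod (p - 1))))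
    = (int p - 1) * (\<Sum>s\<in>E2 v. case s of (x, y) \<Rightarrow> iroot k ^ (3 * ind x + ind y + 2 * ind (1 - y)))] (mod int p ^ k)"
proof -
  define h where "h j x = iroot k ^ (3 * ind x) * (chi k j x * chi k (p - 1 - j) (1 - x))" for j x
  define h' where "h' j x = iroot k ^ (ind x + 2 * ind (1 - x)) * (chi k j x * chi k (p - 1 - j) (1 - x))" for j x
  define f where "f j x y = chi k (p - 1 - j) v * (h j x * h' j y)" for j x y
  have in0: "[(\<Sum>j<p - 1. f j x y) = (int p - 1) * (if [v * ((1 - x) * (1 - y)) = x * y] (mod int p) then iroot k ^ (3 * ind x + ind y + 2 * ind (1 - y)) else 0)] (mod int p ^ k)"
    if x: "x \<in> {2..<int p}" and y: "y \<in> {2..<int p}" for x y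
  proof -
    note nd = range2_not_dvd[OF x] range2_not_dvd[OF y]
    have n1: "\<not> int p dvd v * ((1 - x) * (1 - y))" and n2: "\<not> int p dvd x * y"
      by (intro not_dvd_mult v nd)+
    have "f j x y = iroot k ^ (3 * ind x + ind y + 2 * ind (1 - y)) * (chi k (p - 1 - j) (v * ((1 - x) * (1 - y))) * chi k j (x * y))" for j
      by (simp add: f_def h_def h'_def chi_mult power_add mult_ac)
    then have "(\<Sum>j<p - 1. f j x y) = iroot k ^ (3 * ind x + ind y + 2 * ind (1 - y)) * (\<Sum>j<p - 1. chi k (p - 1 - j) (v * ((1 - x) * (1 - y))) * chi k j (x * y))"
      by (simp only: sum_distrib_left)
    moreover have "[iroot k ^ (3 * ind x + ind y + 2 * ind (1 - y)) * (\<Sum>j<p - 1. chi k (p - 1 - j) (v * ((1 - x) * (1 - y))) * chi k j (x * y))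
      = iroot k ^ (3 * ind x + ind y + 2 * ind (1 - y)) * (if [v * ((1 - x) * (1 - y)) = x * y] (mod int p) then int p - 1 else 0)] (mod int p ^ k)"
      by (intro cong_mult cong_refl chi_orthogonality n1 n2)
    ultimately show ?thesis by (simp only:) (auto simp: mult.commute split: if_splits)
  qed
  have "[(\<Sum>j<p - 1. chi k (p - 1 - j) v * (jac k (ix 3 j) j * jac k (ix 1 j) ((j + 2 * tn) mod (p - 1))))
    = (\<Sum>j<p - 1. chi k (p - 1 - j) v * ((\<Sum>x\<in>{2..<int p}. h j x) * (\<Sum>x\<in>{2..<int p}. h' j x)))] (mod int p ^ k)"
    unfolding h_def h'_def by (intro cong_sum cong_mult cong_refl jac_ix jac_half_shift) simp_all
  moreover have "(\<Sum>j<p - 1. chi k (p - 1 - j) v * ((\<Sum>x\<in>{2..<int p}. h j x) * (\<Sum>x\<in>{2..<int p}. h' j x)))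
     = (\<Sum>j<p - 1. \<Sum>x\<in>{2..<int p}. \<Sum>y\<in>{2..<int p}. f j x y)"
    unfolding sum_product unfolding sum_distrib_left f_def by (rule refl)
  moreover have "(\<Sum>j<p - 1. \<Sum>x\<in>{2..<int p}. \<Sum>y\<in>{2..<int p}. f j x y) = (\<Sum>x\<in>{2..<int p}. \<Sum>y\<in>{2..<int p}. \<Sum>j<p - 1. f j x y)"
    by (subst sum.swap, rule sum.cong[OF refl], rule sum.swap)
  moreover have "[(\<Sum>x\<in>{2..<int p}. \<Sum>y\<in>{2..<int p}. \<Sum>j<p - 1. f j x y)
     = (\<Sum>x\<in>{2..<int p}. \<Sum>y\<in>{2..<int p}. (int p - 1) * (if [v * ((1 - x) * (1 - y)) = x * y] (mod int p) then iroot k ^ (3 * ind x + ind y + 2 * ind (1 - y)) else 0))] (mod int p ^ k)"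
    by (rule cong_sum, rule cong_sum) (rule in0)
  moreover have "(\<Sum>x\<in>{2..<int p}. \<Sum>y\<in>{2..<int p}. (int p - 1) * (if [v * ((1 - x) * (1 - y)) = x * y] (mod int p) then iroot k ^ (3 * ind x + ind y + 2 * ind (1 - y)) else 0))
     = (int p - 1) * (\<Sum>s\<in>E2 v. case s of (x, y) \<Rightarrow> iroot k ^ (3 * ind x + ind y + 2 * ind (1 - y)))"
    unfolding sum_E2 sum_distrib_left by (rule refl)
  ultimately show ?thesis by (simp only:) (rule cong_trans)
qed

text \<open>The exponents add up to \<open>r * tn\<close> or to \<open>r * tn + (p - 1)\<close>. The
  carry occurs exactly for \<open>r * tn < j\<close>, which is also when the floor of
  \<open>r / 4 - j / (p - 1)\<close> is \<open>-1\<close>; so the powers of \<open>- p\<close> in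
  McCarthy's function are those of the Gross-Koblitz formula.\<close>

lemma gam_jac_ix:
  assumes r: "1 \<le> r" "r \<le> 3" and j: "j < p - 1"
  shows "[gam k (ix r j) * gam k j * (if r * tn < j then - int p else 1) = - (gam k (r * tn) * jac k (ix r j) j)] (mod int p ^ k)"
proof -
  define T where "T = r * tn"
  define M where "M = p - 1"
  have M2: "p - 2 = M - 1" by (simp add: M_def)
  have rt: "0 < T" "T < M" using r mult_le_mono1[OF r(2), of tn] tn by (simp_all add: T_def M_def)
  have s: "ix r j + j = (if T < j then T + M else T)" using ix_eq[OF r(2) j] j unfolding T_def[symmetric] M_def[symmetric] by auto
  have m: "(ix r j + j) mod M = T" unfolding s using rt by simp
  have c: "M \<le> ix r j + j \<longleftrightarrow> T < j" unfolding s using rt by simp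
  have "ix r j < M" unfolding ix_def M_def using tn by simp
  then have "ix r j \<le> p - 2" "j \<le> p - 2" "ix r j + j \<noteq> 0" "ix r j + j \<noteq> p - 1" 
    using j rt s unfolding M_def[symmetric] M2 by (auto split: if_splits)
  from gross_koblitz_jacobi[OF this, of k] show ?thesis unfolding M_def[symmetric] m c unfolding T_def .

qed

text \<open>The first exponent wraps around for \<open>j > tn\<close>, the second for
  \<open>j \<ge> 2 * tn\<close>. The two wraps compensate each other, so a carry remains only
  strictly between these bounds.\<close>

lemma gam_jac_half_shift:
  assumes j: "j < p - 1"
  shows "[gam k (ix 1 j) * gam k ((j + 2 * tn) mod (p - 1)) * (if tn < j \<and> j < 2 * tn then - int p else 1)
    = - (gam k (3 * tn) * jac k (ix 1 j) ((j + 2 * tn) mod (p - 1)))] (mod int p ^ k)"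
proof -
  define b where "b = (j + 2 * tn) mod (p - 1)"
  have b: "b = (if j < 2 * tn then j + 2 * tn else j - 2 * tn)" using j tn by (simp add: b_def mod_if)
  have a: "ix 1 j = (if j \<le> tn then tn - j else 5 * tn - j)" using ix_eq[of 1 j] j tn by simp
  have s: "ix 1 j + b = (if tn < j \<and> j < 2 * tn then 3 * tn + (p - 1) else 3 * tn)" 
    unfolding a b using j tn by auto
  have m: "(ix 1 j + b) mod (p - 1) = 3 * tn" unfolding s using tn by simp
  have c: "p - 1 \<le> ix 1 j + b \<longleftrightarrow> tn < j \<and> j < 2 * tn" unfolding s using tn by simp
  have "ix 1 j < p - 1" "b < p - 1" unfolding ix_def b_def using tn by simp_all
  then have "ix 1 j \<le> p - 2" "b \<le> p - 2" "ix 1 j + b \<noteq> 0" "ix 1 j + b \<noteq> p - 1" using tn s by (auto split: if_splits)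
  from gross_koblitz_jacobi[OF this, of k] show ?thesis unfolding m c unfolding b_def .
qed

lemma gam_jac_quarter_half: "[gam k tn * gam k (2 * tn) = - (gam k (3 * tn) * jac k tn (2 * tn))] (mod int p ^ k)"
proof -
  have "[gam k tn * gam k (2 * tn) * (if p - 1 \<le> tn + 2 * tn then - int p else 1) = - (gam k ((tn + 2 * tn) mod (p - 1)) * jac k tn (2 * tn))] (mod int p ^ k)"
    using tn by (intro gross_koblitz_jacobi) auto
  moreover have "\<not> p - 1 \<le> tn + 2 * tn" "(tn + 2 * tn) mod (p - 1) = 3 * tn" using tn by auto
  ultimately show ?thesis by simp
qed

text \<open>Here \<open>z j\<close> is a summand of McCarthy's function; its Gamma denominators are
  multiplied out because quotients are awkward modulo \<open>p ^ k\<close>. The sign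
  \<open>(-1) ^ j\<close> moves the argument from \<open>lam ^ 4\<close> to
  \<open>- (lam ^ 4)\<close>.\<close>

theorem sum_trace3:
  assumes lam: "\<not> int p dvd lam"
    and z: "\<And>j. j < p - 1 \<Longrightarrow> [z j * (gam k tn * gam k (2 * tn) * gam k (3 * tn)) = (-1) ^ j * chi k (p - 1 - j) (lam ^ 4) *
      (gam k (ix 1 j) * gam k j * (if tn < j then - int p else 1) * (gam k (ix 2 j) * gam k j * (if 2 * tn < j then - int p else 1)) *
      (gam k (ix 3 j) * gam k j * (if 3 * tn < j then - int p else 1)))] (mod int p ^ k)"
  shows "[(\<Sum>j<p - 1. z j) = - ((int p - 1) * trace3 (- (lam ^ 4)))] (mod int p ^ k)"
proof -
  define K where "K = gam k tn * gam k (2 * tn) * gam k (3 * tn)"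
  define c where "c j = chi k (p - 1 - j) (- (lam ^ 4)) * (jac k (ix 1 j) j * jac k (ix 2 j) j * jac k (ix 3 j) j)" for j
  have v: "\<not> int p dvd - (lam ^ 4)" using lam not_dvd_power by simp
  have K: "\<not> int p dvd K" unfolding K_def by (intro not_dvd_mult gam_not_dvd)
  have t: "[z j = - c j] (mod int p ^ k)" if j: "j < p - 1" for j
  proof -
    have "[(-1) ^ j * chi k (p - 1 - j) (lam ^ 4) *
      (gam k (ix 1 j) * gam k j * (if 1 * tn < j then - int p else 1) * (gam k (ix 2 j) * gam k j * (if 2 * tn < j then - int p else 1)) *
      (gam k (ix 3 j) * gam k j * (if 3 * tn < j then - int p else 1)))
      = (-1) ^ j * chi k (p - 1 - j) (lam ^ 4) * (- (gam k (1 * tn) * jac k (ix 1 j) j) * - (gam k (2 * tn) * jac k (ix 2 j) j) * - (gam k (3 * tn) * jac k (ix 3 j) j))] (mod int p ^ k)"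
      using j by (intro cong_mult cong_refl gam_jac_ix) simp_all
    moreover have "(-1) ^ j * chi k (p - 1 - j) (lam ^ 4) * (- (gam k (1 * tn) * jac k (ix 1 j) j) * - (gam k (2 * tn) * jac k (ix 2 j) j) * - (gam k (3 * tn) * jac k (ix 3 j) j)) = K * - c j"
      using chi_uminus[of j k "lam ^ 4"] j by (simp add: K_def c_def mult_ac)
    ultimately have "[K * z j = K * - c j] (mod int p ^ k)"
      using z[OF j] unfolding K_def[symmetric] mult.commute[of K "z j"] by (simp only: mult_1) (rule cong_trans)
    then show ?thesis using K by (rule cong_cancel)
  qed
  have 1: "[(\<Sum>j<p - 1. z j) = (\<Sum>j<p - 1. - c j)] (mod int p ^ k)" by (intro cong_sum t) simp
  have 2: "(\<Sum>j<p - 1. - c j) = - (\<Sum>j<p - 1. c j)" by (rule sum_negf)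
  have 3: "[- (\<Sum>j<p - 1. c j) = - ((int p - 1) * (\<Sum>s\<in>E3 (- (lam ^ 4)). case s of (x, y, z) \<Rightarrow> iroot k ^ (ind x + 2 * ind y + 3 * ind z)))] (mod int p ^ k)"
    unfolding c_def by (intro cong_uminus sum_jac3_E3 v)
  have 4: "[- ((int p - 1) * (\<Sum>s\<in>E3 (- (lam ^ 4)). case s of (x, y, z) \<Rightarrow> iroot k ^ (ind x + 2 * ind y + 3 * ind z))) = - ((int p - 1) * trace3 (- (lam ^ 4)))] (mod int p ^ k)"
    by (intro cong_uminus cong_mult cong_refl sol_count_formula(2) lam iroot_square)
  show ?thesis by (rule cong_trans[OF 1[unfolded 2] cong_trans[OF 3 4]])
qed

text \<open>The Gross-Koblitz formula produces \<open>gam k (3 * tn)\<close> twice, whereas the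
  denominators are \<open>gam\<close> at \<open>tn\<close>, \<open>2 * tn\<close> and
  \<open>3 * tn\<close>. The discrepancy is the Jacobi sum \<open>J\<close>, which occurs on the
  other side as well by \<open>jac2_cong\<close>; being a p-adic unit, it cancels.\<close>

theorem sum_trace2:
  assumes lam: "\<not> int p dvd lam"
    and z: "\<And>j. j < p - 1 \<Longrightarrow> [z j * (gam k (3 * tn) * (gam k tn * gam k (2 * tn))) = chi k (p - 1 - j) (lam ^ 4) *
      (gam k (ix 3 j) * gam k j * (if 3 * tn < j then - int p else 1) *
      (gam k (ix 1 j) * gam k ((j + 2 * tn) mod (p - 1)) * (if tn < j \<and> j < 2 * tn then - int p else 1)))] (mod int p ^ k)"
  shows "[(\<Sum>j<p - 1. z j) = - ((int p - 1) * (leg (1 + lam ^ 2) + leg (1 - lam ^ 2)))] (mod int p ^ k)"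
proof -
  define J where "J = jac k tn (2 * tn)"
  define Jf where "Jf = (\<Sum>x\<in>{2..<int p}. iroot k ^ (ind x + 2 * ind (1 - x)))"
  define D where "D = leg (1 + lam ^ 2) + leg (1 - lam ^ 2)"
  define K where "K = gam k (3 * tn) * gam k (3 * tn)"
  define c where "c j = chi k (p - 1 - j) (lam ^ 4) * (jac k (ix 3 j) j * jac k (ix 1 j) ((j + 2 * tn) mod (p - 1)))" for j
  have v: "\<not> int p dvd lam ^ 4" using lam not_dvd_power by simp
  have K: "\<not> int p dvd K" unfolding K_def by (intro not_dvd_mult gam_not_dvd)
  have t: "[J * z j = - c j] (mod int p ^ k)" if j: "j < p - 1" for j
  proof -
    have a: "[z j * (gam k (3 * tn) * - (gam k (3 * tn) * J)) = z j * (gam k (3 * tn) * (gam k tn * gam k (2 * tn)))] (mod int p ^ k)"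
      unfolding J_def by (intro cong_mult cong_refl cong_sym[OF gam_jac_quarter_half])
    have b: "[chi k (p - 1 - j) (lam ^ 4) *
      (gam k (ix 3 j) * gam k j * (if 3 * tn < j then - int p else 1) *
      (gam k (ix 1 j) * gam k ((j + 2 * tn) mod (p - 1)) * (if tn < j \<and> j < 2 * tn then - int p else 1)))
      = chi k (p - 1 - j) (lam ^ 4) * (- (gam k (3 * tn) * jac k (ix 3 j) j) * - (gam k (3 * tn) * jac k (ix 1 j) ((j + 2 * tn) mod (p - 1))))] (mod int p ^ k)"
      using j by (intro cong_mult cong_refl gam_jac_ix gam_jac_half_shift) simp_all
    have c1: "[z j * (gam k (3 * tn) * - (gam k (3 * tn) * J)) = chi k (p - 1 - j) (lam ^ 4) * (- (gam k (3 * tn) * jac k (ix 3 j) j) * - (gam k (3 * tn) * jac k (ix 1 j) ((j + 2 * tn) mod (p - 1))))] (mod int p ^ k)"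
      by (rule cong_trans[OF a cong_trans[OF z[OF j] b]])
    have c2: "z j * (gam k (3 * tn) * - (gam k (3 * tn) * J)) = K * - (J * z j)"
      by (simp add: K_def mult_ac)
    have c3: "chi k (p - 1 - j) (lam ^ 4) * (- (gam k (3 * tn) * jac k (ix 3 j) j) * - (gam k (3 * tn) * jac k (ix 1 j) ((j + 2 * tn) mod (p - 1)))) = K * c j"
      by (simp add: K_def c_def mult_ac)
    have "[K * - (J * z j) = K * c j] (mod int p ^ k)" using c1 unfolding c2 c3 .
    then have "[- (J * z j) = c j] (mod int p ^ k)" using K by (rule cong_cancel)
    then show ?thesis using cong_minus_minus_iff by fastforce
  qed
  \<comment> \<open>By Gross-Koblitz \<open>J\<close> is, up to sign, a quotient of units. This is
    visible modulo \<open>p\<close> only for positive \<open>k\<close>; for \<open>k = 0\<close> the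
    claim is trivial.\<close>
  have nJ: "\<not> int p dvd J" if "k > 0"
  proof
    assume "int p dvd J"
    then have "int p dvd - (gam k (3 * tn) * J)" by simp
    moreover have "[gam k tn * gam k (2 * tn) = - (gam k (3 * tn) * J)] (mod int p)"
      unfolding J_def by (rule cong_dvd_modulus[OF gam_jac_quarter_half[of k]]) (simp add: that)
    ultimately have "int p dvd gam k tn * gam k (2 * tn)" using cong_dvd_iff by blast
    then show False using not_dvd_mult gam_not_dvd by blast
  qed
  have 1: "[J * (\<Sum>j<p - 1. z j) = (\<Sum>j<p - 1. - c j)] (mod int p ^ k)" unfolding sum_distrib_left by (intro cong_sum t) simp
  have 2: "(\<Sum>j<p - 1. - c j) = - (\<Sum>j<p - 1. c j)" by (rule sum_negf)
  have 3: "[- (\<Sum>j<p - 1. c j) = - ((int p - 1) * (\<Sum>s\<in>E2 (lam ^ 4). case s of (x, y) \<Rightarrow> iroot k ^ (3 * ind x + ind y + 2 * ind (1 - y))))] (mod int p ^ k)"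
    unfolding c_def by (intro cong_uminus sum_jac2_E2 v)
  have 4: "[- ((int p - 1) * (\<Sum>s\<in>E2 (lam ^ 4). case s of (x, y) \<Rightarrow> iroot k ^ (3 * ind x + ind y + 2 * ind (1 - y)))) = - ((int p - 1) * (D * Jf))] (mod int p ^ k)"
    unfolding D_def Jf_def by (intro cong_uminus cong_mult cong_refl jac2_cong lam iroot_square)
  have 5: "[- ((int p - 1) * (D * Jf)) = - ((int p - 1) * (D * J))] (mod int p ^ k)"
    unfolding Jf_def J_def by (intro cong_uminus cong_mult cong_refl cong_sym[OF jac_quarter_half])
  have 6: "- ((int p - 1) * (D * J)) = J * - ((int p - 1) * D)" by simp
  have f: "[J * (\<Sum>j<p - 1. z j) = J * - ((int p - 1) * D)] (mod int p ^ k)" using cong_trans[OF 1[unfolded 2] cong_trans[OF 3 cong_trans[OF 4 5]]] unfolding 6 .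
  show ?thesis
  proof (cases "k > 0")
    case True
    then show ?thesis using cong_cancel[OF f nJ] by (simp add: D_def)
  qed (simp add: cong_def)
qed

end

section \<open>McCarthy's function\<close>

text \<open>\<open>qp_add\<close> stores the smaller exponent and the empty sum has exponent 0. With
  nonnegative exponents the result keeps exponent 0, and the powers of \<open>p\<close> move into
  the residues.\<close>

lemma qp_sum_nonneg:
  assumes "\<And>j. j \<in> set xs \<Longrightarrow> fst (f j) \<ge> 0"
  shows "fst (qp_sum p f xs) = 0"
    and "[snd (qp_sum p f xs) k = (\<Sum>j\<leftarrow>xs. int p ^ nat (fst (f j)) * snd (f j) k)] (mod int p ^ k)"
proof -
  have "fst (qp_sum p f xs) = 0 \<and> [snd (qp_sum p f xs) k = (\<Sum>j\<leftarrow>xs. int p ^ nat (fst (f j)) * snd (f j) k)] (mod int p ^ k)"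
    using assms
  proof (induction xs)
    case (Cons j xs)
    define s where "s = qp_sum p f xs"
    have s: "fst s = 0" "[snd s k = (\<Sum>j\<leftarrow>xs. int p ^ nat (fst (f j)) * snd (f j) k)] (mod int p ^ k)"
      using Cons unfolding s_def by auto
    have e: "qp_sum p f (j # xs) = qp_add p (f j) s" by (simp add: qp_sum_def s_def)
    have m: "min (fst (f j)) (fst s) = 0" using Cons.prems[of j] s(1) by simp
    have v: "snd (qp_add p (f j) s) k = ((int p ^ nat (fst (f j)) mod int p ^ k * snd (f j) k) mod int p ^ k + (1 mod int p ^ k * snd s k) mod int p ^ k) mod int p ^ k"
      unfolding qp_add_def Let_def m using s(1) by (simp add: zp_add_def zp_mult_def zp_of_int_def)
    have "[snd (qp_add p (f j) s) k = int p ^ nat (fst (f j)) * snd (f j) k + snd s k] (mod int p ^ k)"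
      unfolding v by (simp add: cong_def mod_simps)
    moreover have "[int p ^ nat (fst (f j)) * snd (f j) k + snd s k = int p ^ nat (fst (f j)) * snd (f j) k + (\<Sum>j\<leftarrow>xs. int p ^ nat (fst (f j)) * snd (f j) k)] (mod int p ^ k)"
      by (intro cong_add cong_refl s(2))
    ultimately have "[snd (qp_add p (f j) s) k = int p ^ nat (fst (f j)) * snd (f j) k + (\<Sum>j\<leftarrow>xs. int p ^ nat (fst (f j)) * snd (f j) k)] (mod int p ^ k)"
      by (rule cong_trans)
    moreover have "fst (qp_add p (f j) s) = 0" unfolding qp_add_def Let_def m by simp
    ultimately show ?case unfolding e by simp
  qed (simp add: qp_sum_def zp_of_int_def)
  then show "fst (qp_sum p f xs) = 0"
    and "[snd (qp_sum p f xs) k = (\<Sum>j\<leftarrow>xs. int p ^ nat (fst (f j)) * snd (f j) k)] (mod int p ^ k)" by simp_all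
qed

lemma zp_mult_cong: "[x k = a] (mod int p ^ k) \<Longrightarrow> [y k = b] (mod int p ^ k) \<Longrightarrow> [zp_mult p x y k = a * b] (mod int p ^ k)"
  unfolding zp_mult_def using cong_mult by simp

lemma zp_of_int_cong: "[zp_of_int p a k = a] (mod int p ^ k)"
  by (simp add: zp_of_int_def)

lemma zp_pow_cong: "[x k = a] (mod int p ^ k) \<Longrightarrow> [zp_pow p x n k = a ^ n] (mod int p ^ k)"
  unfolding zp_pow_def using cong_pow by simp

lemma qp_add_integral:
  assumes "fst x = 0" "fst y = 0"
  shows "fst (qp_add p x y) = 0"
    and "[snd x k = a] (mod int p ^ k) \<Longrightarrow> [snd y k = b] (mod int p ^ k) \<Longrightarrow> [snd (qp_add p x y) k = a + b] (mod int p ^ k)"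
proof -
  show "fst (qp_add p x y) = 0" using assms by (simp add: qp_add_def)
  assume ab: "[snd x k = a] (mod int p ^ k)" "[snd y k = b] (mod int p ^ k)"
  have "snd (qp_add p x y) k = ((1 mod int p ^ k * snd x k) mod int p ^ k + (1 mod int p ^ k * snd y k) mod int p ^ k) mod int p ^ k"
    using assms by (simp add: qp_add_def zp_add_def zp_mult_def zp_of_int_def)
  then have "[snd (qp_add p x y) k = snd x k + snd y k] (mod int p ^ k)" by (simp add: cong_def mod_simps)
  then show "[snd (qp_add p x y) k = a + b] (mod int p ^ k)" by (rule cong_trans) (rule cong_add[OF ab])
qed

lemma qp_mult_integral:
  assumes "fst x = 0" "fst y = 0"
  shows "fst (qp_mult p x y) = 0"
    and "[snd x k = a] (mod int p ^ k) \<Longrightarrow> [snd y k = b] (mod int p ^ k) \<Longrightarrow> [snd (qp_mult p x y) k = a * b] (mod int p ^ k)"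
  using assms by (simp_all add: qp_mult_def zp_mult_cong)

lemma qp_eq_integral:
  assumes "fst x = 0" "fst y = 0" "\<And>k. [snd x k = snd y k] (mod int p ^ k)"
  shows "qp_eq p x y"
proof -
  have "zp_mult p (zp_of_int p 1) (snd x) k = zp_mult p (zp_of_int p 1) (snd y) k" for k
    using assms(3)[of k] by (simp add: zp_mult_def zp_of_int_def cong_def mod_simps)
  then show ?thesis using assms(1,2) by (auto simp: qp_eq_def)
qed

definition mcF :: "nat \<Rightarrow> rat list \<Rightarrow> rat list \<Rightarrow> int \<Rightarrow> nat \<Rightarrow> qp" where
  "mcF p as bs u j = (let jj = rat_of_nat j / rat_of_nat (p - 1) in
     qp_mult p
      (qp_of_zp (zp_mult p (zp_of_int p ((-1) ^ (j * length as)))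
        (zp_mult p (omegabar_pow p j u)
          (zp_prod p (map (\<lambda>(a, b).
             zp_mult p
               (zp_mult p (gamma_p p (frac (a - jj))) (zp_inv p (gamma_p p (frac a))))
               (zp_mult p (gamma_p p (frac (- b + jj))) (zp_inv p (gamma_p p (frac (- b))))))
             (zip as bs))))))
      (negp_pow p (\<Sum>(a, b) \<leftarrow> zip as bs. - \<lfloor>frac a - jj\<rfloor> - \<lfloor>frac (- b) + jj\<rfloor>)))"

lemma mcG_mcF: "mcG p as bs u = qp_mult p (qp_of_zp (zp_of_rat p (- 1 / rat_of_nat (p - 1)))) (qp_sum p (mcF p as bs u) [0..<p - 1])"
  by (simp only: mcG_def mcF_def[abs_def] Let_def)

lemma frac_of_int_div:
  assumes "d > 0" shows "frac (of_int n / of_int d :: rat) = of_int (n mod d) / of_int d"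
proof -
  have "(of_int n :: rat) = of_int (n div d) * of_int d + of_int (n mod d)"
    by (metis div_mult_mod_eq of_int_add of_int_mult)
  then have "(of_int n / of_int d :: rat) = of_int (n div d) + of_int (n mod d) / of_int d"
    using assms by (simp add: field_simps)
  then show ?thesis by (simp add: frac_def floor_divide_of_int_eq)
qed

context odd_prime
begin

lemma zp_inv_cong:
  assumes "\<not> int p dvd x k" shows "[x k * zp_inv p x k = 1] (mod int p ^ k)"
proof -
  obtain y where y: "[x k * y = 1] (mod int p ^ k)"
    using cong_solve_coprime_int[OF coprime_power[OF assms]] by blast
  have P: "0 < int p ^ k" using pos by simp
  have "\<exists>y. 0 \<le> y \<and> y < int p ^ k \<and> [x k * y = 1] (mod int p ^ k)"
  proof (intro exI conjI)
    show "0 \<le> y mod int p ^ k" "y mod int p ^ k < int p ^ k" using P by simp_all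
    show "[x k * (y mod int p ^ k) = 1] (mod int p ^ k)" using y by (simp add: cong_def mod_simps)
  qed
  from someI_ex[OF this] show ?thesis by (simp add: zp_inv_def)
qed

text \<open>Any representation of \<open>q\<close> with denominator prime to \<open>p\<close> can be
  used, not just lowest terms: cross-multiplying with the reduced fraction shows that its
  denominator is prime to \<open>p\<close> too.\<close>

lemma zp_of_rat_cong:
  assumes q: "q * of_int d = of_int m" and d: "\<not> int p dvd d"
  shows "[d * zp_of_rat p q k = m] (mod int p ^ k)" and "0 \<le> zp_of_rat p q k"
proof -
  obtain a b where ab: "quotient_of q = (a, b)" by force
  then have b: "b > 0" and cop: "coprime a b" and qab: "q = of_int a / of_int b"
    using quotient_of_denom_pos quotient_of_coprime quotient_of_div by auto
  have "(of_int (a * d) :: rat) = of_int (m * b)" using q b unfolding qab by (simp add: field_simps)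
  then have adm: "a * d = m * b" by (simp only: of_int_eq_iff)
  have pb: "\<not> int p dvd b"
  proof
    assume "int p dvd b"
    then have "int p dvd a * d" unfolding adm by simp
    then have "int p dvd a" using d int_prime by (simp add: prime_dvd_mult_iff)
    then have "int p dvd 1" using \<open>int p dvd b\<close> cop by (meson coprime_def)
    then show False using gt1 by simp
  qed
  have z: "zp_of_rat p q = zp_mult p (zp_of_int p a) (zp_inv p (zp_of_int p b))" by (simp add: zp_of_rat_def ab)
  show "0 \<le> zp_of_rat p q k" unfolding z zp_mult_def using pos by simp
  define c where "c = zp_inv p (zp_of_int p b) k"
  have bb: "[zp_of_int p b k = b] (mod int p ^ k)" by (rule zp_of_int_cong)
  have bc: "[b * c = 1] (mod int p ^ k)"
  proof (cases "k = 0")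
    case False
    have "[zp_of_int p b k = b] (mod int p)" by (rule cong_dvd_modulus[OF bb]) (rule dvd_power, use False in simp)
    then have "\<not> int p dvd zp_of_int p b k" using pb cong_dvd_iff by blast
    from zp_inv_cong[of "zp_of_int p b", OF this] have "[zp_of_int p b k * c = 1] (mod int p ^ k)" by (simp only: c_def)
    moreover have "[b * c = zp_of_int p b k * c] (mod int p ^ k)" by (intro cong_mult cong_refl cong_sym[OF bb])
    ultimately show ?thesis using cong_trans by blast
  qed simp
  have zz: "[zp_of_rat p q k = a * c] (mod int p ^ k)" unfolding z c_def by (intro zp_mult_cong zp_of_int_cong cong_refl)
  have "[b * (d * zp_of_rat p q k) = b * (d * (a * c))] (mod int p ^ k)" by (intro cong_mult cong_refl zz)
  moreover have "b * (d * (a * c)) = (b * c) * (m * b)" unfolding adm[symmetric] by (simp only: mult_ac)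
  moreover have "[(b * c) * (m * b) = 1 * (m * b)] (mod int p ^ k)" by (intro cong_mult cong_refl bc)
  ultimately have "[b * (d * zp_of_rat p q k) = 1 * (m * b)] (mod int p ^ k)" by (simp only:) (rule cong_trans)
  then have "[b * (d * zp_of_rat p q k) = b * m] (mod int p ^ k)" by (simp only: mult_1 mult.commute)
  then show "[d * zp_of_rat p q k = m] (mod int p ^ k)" using pb by (rule cong_cancel)
qed

lemma p1_not_dvd: "\<not> int p dvd int (p - 1)"
  using gt1 by (simp add: zdvd_not_zless)

text \<open>Both the residue of \<open>m / (p - 1)\<close> and
  \<open>p ^ k - m * repunit p k\<close> solve \<open>(p - 1) * x = m\<close> modulo
  \<open>p ^ k\<close>, and Morita's function depends only on that class.\<close>

lemma gamma_p_gam: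
  assumes m: "m < p - 1" shows "[gamma_p p (of_nat m / of_nat (p - 1)) k = gam k m] (mod int p ^ k)"
proof -
  define q :: rat where "q = of_nat m / of_nat (p - 1)"
  define N where "N = nat (zp_of_rat p q k)"
  have "q * of_int (int (p - 1)) = of_int (int m)" using m by (simp add: q_def)
  note z = zp_of_rat_cong[OF this p1_not_dvd, of k]
  have 1: "[int (p - 1) * int N = int m] (mod int p ^ k)" using z by (simp add: N_def)
  have le: "m * repunit p k \<le> p ^ k" using rep_less[of m k] m by simp
  have "(p - 1) * (p ^ k - m * repunit p k) + m * p ^ k = (p - 1) * p ^ k + m"
  proof -
    have "(p - 1) * (m * repunit p k) + m = m * p ^ k" using repunit_mult[OF pos, of k] by (metis mult.left_commute distrib_left mult.right_neutral)
    moreover have "(p - 1) * (p ^ k - m * repunit p k) + (p - 1) * (m * repunit p k) = (p - 1) * p ^ k" using le by (simp add: distrib_left[symmetric])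
    ultimately show ?thesis by linarith
  qed
  then have "int (p - 1) * int (p ^ k - m * repunit p k) + int m * int p ^ k = int (p - 1) * int p ^ k + int m"
    by (metis of_nat_add of_nat_mult of_nat_power)
  then have "int (p - 1) * int (p ^ k - m * repunit p k) - int m = int p ^ k * (int (p - 1) - int m)" by (simp only: algebra_simps)
  then have 2: "[int (p - 1) * int (p ^ k - m * repunit p k) = int m] (mod int p ^ k)" by (simp add: cong_iff_dvd_diff)
  have "[int (p - 1) * int N = int (p - 1) * int (p ^ k - m * repunit p k)] (mod int p ^ k)" by (rule cong_trans[OF 1 cong_sym[OF 2]])
  then have "[int N = int (p ^ k - m * repunit p k)] (mod int p ^ k)" using p1_not_dvd by (rule cong_cancel)
  then have "[N = p ^ k - m * repunit p k] (mod p ^ k)" by (metis cong_int_iff of_nat_power)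
  from gamma_nat_cong[OF this] show ?thesis by (simp add: gamma_p_def gam_def N_def q_def)
qed

lemma gamma_p_inv:
  assumes m: "m < p - 1"
  shows "[zp_inv p (gamma_p p (of_nat m / of_nat (p - 1))) k * gam k m = 1] (mod int p ^ k)"
proof (cases "k = 0")
  case False
  define x where "x = gamma_p p (of_nat m / of_nat (p - 1))"
  have g: "[x k = gam k m] (mod int p ^ k)" unfolding x_def by (rule gamma_p_gam[OF m])
  have "[x k = gam k m] (mod int p)" by (rule cong_dvd_modulus[OF g]) (rule dvd_power, use False in simp)
  then have "\<not> int p dvd x k" using gam_not_dvd cong_dvd_iff by blast
  then have "[x k * zp_inv p x k = 1] (mod int p ^ k)" by (rule zp_inv_cong)
  moreover have "[zp_inv p x k * gam k m = zp_inv p x k * x k] (mod int p ^ k)" by (intro cong_mult cong_refl cong_sym[OF g])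
  ultimately show ?thesis unfolding x_def[symmetric] by (metis cong_trans mult.commute)
qed simp

lemma gamma_p_ratio:
  assumes "m < p - 1" "n < p - 1"
  shows "[zp_mult p (gamma_p p (of_nat m / of_nat (p - 1))) (zp_inv p (gamma_p p (of_nat n / of_nat (p - 1)))) k * gam k n = gam k m] (mod int p ^ k)"
proof -
  define i where "i = zp_inv p (gamma_p p (of_nat n / of_nat (p - 1)))"
  have "[zp_mult p (gamma_p p (of_nat m / of_nat (p - 1))) i k * gam k n = gam k m * i k * gam k n] (mod int p ^ k)"
    by (intro cong_mult zp_mult_cong cong_refl gamma_p_gam assms)
  moreover have "[gam k m * (i k * gam k n) = gam k m * 1] (mod int p ^ k)"
    unfolding i_def by (intro cong_mult cong_refl gamma_p_inv assms)
  ultimately show ?thesis unfolding i_def[symmetric] mult.assoc mult_1_right by (rule cong_trans)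
qed

lemma omegabar_chi:
  assumes "\<not> int p dvd u" "j < p - 1" shows "[omegabar_pow p j u k = chi k (p - 1 - j) u] (mod int p ^ k)"
proof -
  have "[teich p u k = tpow k (u mod int p)] (mod int p ^ k)" by (simp add: teich_def tpow_def)
  moreover have "[tpow k (u mod int p) = tpow k u] (mod int p ^ k)" by (rule tpow_cong) simp
  ultimately have "[teich p u k = tpow k u] (mod int p ^ k)" by (rule cong_trans)
  from zp_pow_cong[where x = "teich p u" and k = k, OF this, of "p - 1 - j"] show ?thesis using assms by (simp add: omegabar_pow_def chi_def)
qed

lemma mcG_eval:
  assumes nonneg: "\<And>j. j < p - 1 \<Longrightarrow> fst (mcF p as bs u j) \<ge> 0"
    and W: "[(\<Sum>j<p - 1. int p ^ nat (fst (mcF p as bs u j)) * snd (mcF p as bs u j) k) = - ((int p - 1) * W)] (mod int p ^ k)"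
  shows "fst (mcG p as bs u) = 0" and "[snd (mcG p as bs u) k = W] (mod int p ^ k)"
proof -
  define S where "S = qp_sum p (mcF p as bs u) [0..<p - 1]"
  have n: "fst (mcF p as bs u j) \<ge> 0" if "j \<in> set [0..<p - 1]" for j using nonneg that by simp
  have S0: "fst S = 0" unfolding S_def by (rule qp_sum_nonneg(1)[OF n])
  have "[snd S k = (\<Sum>j\<leftarrow>[0..<p - 1]. int p ^ nat (fst (mcF p as bs u j)) * snd (mcF p as bs u j) k)] (mod int p ^ k)"
    unfolding S_def by (rule qp_sum_nonneg(2)[OF n])
  also have "(\<Sum>j\<leftarrow>[0..<p - 1]. int p ^ nat (fst (mcF p as bs u j)) * snd (mcF p as bs u j) k) = (\<Sum>j<p - 1. int p ^ nat (fst (mcF p as bs u j)) * snd (mcF p as bs u j) k)"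
    by (simp add: interv_sum_list_conv_sum_set_nat lessThan_atLeast0)
  finally have S: "[snd S k = - ((int p - 1) * W)] (mod int p ^ k)" using W by (rule cong_trans)
  define c where "c = zp_of_rat p (- 1 / rat_of_nat (p - 1))"
  have e: "mcG p as bs u = qp_mult p (qp_of_zp c) S" by (simp add: mcG_mcF S_def c_def)
  show "fst (mcG p as bs u) = 0" unfolding e by (rule qp_mult_integral(1)) (simp_all add: qp_of_zp_def S0)
  have v: "[snd (mcG p as bs u) k = c k * - ((int p - 1) * W)] (mod int p ^ k)"
    unfolding e by (rule qp_mult_integral(2)) (simp_all add: qp_of_zp_def S0 S)
  have "- 1 / rat_of_nat (p - 1) * of_int (int (p - 1)) = of_int (-1)" using gt1 by simp
  from zp_of_rat_cong(1)[OF this p1_not_dvd, of k] have c: "[int (p - 1) * c k = -1] (mod int p ^ k)" by (simp only: c_def)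
  have p1: "int (p - 1) = int p - 1" using pos by (simp add: of_nat_diff)
  have 1: "[(int (p - 1) * c k) * - W = - 1 * - W] (mod int p ^ k)" by (intro cong_mult cong_refl c)
  have 2: "(int (p - 1) * c k) * - W = c k * - ((int p - 1) * W)" unfolding p1 by simp
  show "[snd (mcG p as bs u) k = W] (mod int p ^ k)" using cong_trans[OF v 1[unfolded 2]] by simp
qed

text \<open>With all parameters written over \<open>d = p - 1\<close>, fractional parts become
  \<open>mod d\<close> and floors become \<open>div d\<close>. The Gamma denominators stand on the
  left as factors.\<close>

lemma gamma_pair:
  fixes a0 b0 :: int and k j :: nat
  defines "d \<equiv> int (p - 1)" and "jj \<equiv> rat_of_nat j / rat_of_nat (p - 1)"
  assumes a: "a = of_int a0 / of_int d" and b: "- b = of_int b0 / of_int d"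
  shows "[zp_mult p
               (zp_mult p (gamma_p p (frac (a - jj))) (zp_inv p (gamma_p p (frac a))))
               (zp_mult p (gamma_p p (frac (- b + jj))) (zp_inv p (gamma_p p (frac (- b))))) k
           * (gam k (nat (a0 mod d)) * gam k (nat (b0 mod d)))
      = gam k (nat ((a0 - int j) mod d)) * gam k (nat ((b0 + int j) mod d))] (mod int p ^ k)" (is ?P)
    and "- \<lfloor>frac a - jj\<rfloor> - \<lfloor>frac (- b) + jj\<rfloor> = - ((a0 mod d - int j) div d) - ((b0 mod d + int j) div d)" (is ?Q)
proof -
  have d: "d > 0" using gt1 by (simp add: d_def)
  have jj: "jj = of_int (int j) / of_int d" by (simp add: jj_def d_def)
  have fr: "frac (of_int n / of_int d) = of_nat (nat (n mod d)) / rat_of_nat (p - 1)" for n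
    unfolding frac_of_int_div[OF d] using d by (simp add: d_def)
  have lt: "nat (n mod d) < p - 1" for n using d by (simp add: d_def nat_less_iff)
  have s: "a - jj = of_int (a0 - int j) / of_int d" "- b + jj = of_int (b0 + int j) / of_int d"
    unfolding a b jj by (simp_all add: diff_divide_distrib add_divide_distrib)
  define x where "x = zp_mult p (gamma_p p (frac (a - jj))) (zp_inv p (gamma_p p (frac a)))"
  define y where "y = zp_mult p (gamma_p p (frac (- b + jj))) (zp_inv p (gamma_p p (frac (- b))))"
  have x: "[x k * gam k (nat (a0 mod d)) = gam k (nat ((a0 - int j) mod d))] (mod int p ^ k)"
    unfolding x_def s unfolding a fr by (rule gamma_p_ratio[OF lt lt])
  have y: "[y k * gam k (nat (b0 mod d)) = gam k (nat ((b0 + int j) mod d))] (mod int p ^ k)"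
    unfolding y_def s unfolding b fr by (rule gamma_p_ratio[OF lt lt])
  have "[zp_mult p x y k * (gam k (nat (a0 mod d)) * gam k (nat (b0 mod d))) = x k * y k * (gam k (nat (a0 mod d)) * gam k (nat (b0 mod d)))] (mod int p ^ k)"
    by (intro cong_mult zp_mult_cong cong_refl)
  moreover have "x k * y k * (gam k (nat (a0 mod d)) * gam k (nat (b0 mod d))) = (x k * gam k (nat (a0 mod d))) * (y k * gam k (nat (b0 mod d)))"
    by (simp only: mult_ac)
  ultimately have "[zp_mult p x y k * (gam k (nat (a0 mod d)) * gam k (nat (b0 mod d))) = (x k * gam k (nat (a0 mod d))) * (y k * gam k (nat (b0 mod d)))] (mod int p ^ k)"
    by simp
  then show ?P unfolding x_def[symmetric] y_def[symmetric] by (rule cong_trans) (rule cong_mult[OF x y])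
  have "frac a - jj = of_int (a0 mod d - int j) / of_int d" "frac (- b) + jj = of_int (b0 mod d + int j) / of_int d"
    unfolding a b jj frac_of_int_div[OF d] by (simp_all add: diff_divide_distrib add_divide_distrib)
  then show ?Q by (simp only: floor_divide_of_int_eq)
qed

end

context prime_gen4
begin

lemma of_int_d: "(of_int (int (p - 1)) :: rat) = 4 * of_nat tn" "rat_of_nat tn \<noteq> 0"
  using tn by simp_all

lemma quarter: "of_int r / 4 = (of_int (r * t) / of_int (int (p - 1)) :: rat)"
  unfolding of_int_d(1) tn(1)[symmetric] using of_int_d(2) by simp

lemma nat_ix: "j < p - 1 \<Longrightarrow> nat ((int r * t - int j) mod int (p - 1)) = ix r j"
proof -
  assume j: "j < p - 1"
  have "int r * t - int j + int (p - 1) = int (r * tn + (p - 1) - j)" using j tn(1) by (simp add: of_nat_diff)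
  then have "(int r * t - int j) mod int (p - 1) = int (r * tn + (p - 1) - j) mod int (p - 1)"
    by (metis mod_add_self2)
  then show ?thesis by (simp add: ix_def flip: zmod_int)
qed

lemma quarter_div:
  assumes "r \<le> 3" "j < p - 1"
  shows "(int r * t mod int (p - 1) - int j) div int (p - 1) = (if r * tn < j then -1 else 0)"
    and "nat (int r * t mod int (p - 1)) = r * tn"
proof -
  define T where "T = r * tn"
  have T: "T < p - 1" using mult_le_mono1[OF assms(1), of tn] tn unfolding T_def by linarith
  have e: "int r * t = int T" using tn(1) by (simp add: T_def)
  have m: "int T mod int (p - 1) = int T" using T by simp
  show "(int r * t mod int (p - 1) - int j) div int (p - 1) = (if r * tn < j then -1 else 0)"
    unfolding e m T_def[symmetric]
  proof (cases "T < j")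
    case True
    have "(int T - int j) div int (p - 1) = -1"
      by (rule int_div_pos_eq[where r = "int T - int j + int (p - 1)"]) (use True assms(2) T in auto)
    then show "(int T - int j) div int (p - 1) = (if T < j then -1 else 0)" using True by simp
  next
    case False
    have "(int T - int j) div int (p - 1) = 0"
      by (rule int_div_pos_eq[where r = "int T - int j"]) (use False T in auto)
    then show "(int T - int j) div int (p - 1) = (if T < j then -1 else 0)" using False by simp
  qed
  show "nat (int r * t mod int (p - 1)) = r * tn" unfolding e m nat_int by (rule T_def)
qed

lemma zero_pair:
  assumes "j < p - 1"
  shows "nat ((0 + int j) mod int (p - 1)) = j" "(0 mod int (p - 1) + int j) div int (p - 1) = 0" "nat (0 mod int (p - 1)) = 0"
  using assms by simp_all

lemma half_pair:
  assumes "j < p - 1"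
  shows "nat ((-2 * t + int j) mod int (p - 1)) = (j + 2 * tn) mod (p - 1)"
    and "(- 2 * t mod int (p - 1) + int j) div int (p - 1) = (if 2 * tn \<le> j then 1 else 0)"
    and "nat (-2 * t mod int (p - 1)) = 2 * tn"
proof -
  have e: "-2 * t + int j + int (p - 1) = int (j + 2 * tn)" using tn(1) p1 by simp
  then have "(-2 * t + int j) mod int (p - 1) = int (j + 2 * tn) mod int (p - 1)" by (metis mod_add_self2)
  then show "nat ((-2 * t + int j) mod int (p - 1)) = (j + 2 * tn) mod (p - 1)" by (simp only: zmod_int[symmetric] nat_int)
  have "-2 * t + int (p - 1) = 2 * t" using p1 by simp
  then have "-2 * t mod int (p - 1) = 2 * t mod int (p - 1)" by (metis mod_add_self2)
  also have "\<dots> = 2 * t" using p1 t_pos by simp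
  finally have m: "-2 * t mod int (p - 1) = 2 * t" .
  then show "nat (-2 * t mod int (p - 1)) = 2 * tn" using tn(1) by simp
  show "(- 2 * t mod int (p - 1) + int j) div int (p - 1) = (if 2 * tn \<le> j then 1 else 0)"
  proof (cases "2 * tn \<le> j")
    case True
    have "(2 * t + int j) div int (p - 1) = 1"
      by (rule int_div_pos_eq[where r = "2 * t + int j - int (p - 1)"]) (use True assms tn(1) p1 in auto)
    then show ?thesis unfolding m using True by simp
  next
    case False
    then have "0 \<le> 2 * t + int j" "2 * t + int j < int (p - 1)" using tn(1) p1 by linarith+
    then show ?thesis unfolding m using False by simp
  qed
qed

lemma quarter_zero_pair:
  fixes k j :: nat
  assumes r: "r \<le> 3" and j: "j < p - 1"
  defines "jj \<equiv> rat_of_nat j / rat_of_nat (p - 1)"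
  assumes a: "a = of_nat r / 4"
  shows "[zp_mult p
               (zp_mult p (gamma_p p (frac (a - jj))) (zp_inv p (gamma_p p (frac a))))
               (zp_mult p (gamma_p p (frac (- 0 + jj))) (zp_inv p (gamma_p p (frac (- 0))))) k
           * gam k (r * tn) = gam k (ix r j) * gam k j] (mod int p ^ k)" (is "[?z k * _ = _] (mod _)")
    and "- \<lfloor>frac a - jj\<rfloor> - \<lfloor>frac (- 0) + jj\<rfloor> = (if r * tn < j then 1 else 0)"
proof -
  have a': "a = of_int (int r * t) / of_int (int (p - 1))" unfolding a quarter[of "int r", symmetric] by simp
  have b': "- 0 = (of_int 0 / of_int (int (p - 1)) :: rat)" by simp
  have "[?z k * (gam k (r * tn) * gam k 0) = gam k (ix r j) * gam k j] (mod int p ^ k)"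
    using gamma_pair(1)[OF a' b', of j k] unfolding jj_def[symmetric] nat_ix[OF j] zero_pair[OF j] quarter_div(2)[OF r j] .
  moreover have "[?z k * (gam k (r * tn) * gam k 0) = ?z k * (gam k (r * tn) * 1)] (mod int p ^ k)"
    by (intro cong_mult cong_refl gam_0)
  ultimately show "[?z k * gam k (r * tn) = gam k (ix r j) * gam k j] (mod int p ^ k)"
    unfolding mult_1_right using cong_trans cong_sym by blast
  show "- \<lfloor>frac a - jj\<rfloor> - \<lfloor>frac (- 0) + jj\<rfloor> = (if r * tn < j then 1 else 0)"
    using gamma_pair(2)[OF a' b', of j] unfolding jj_def[symmetric] quarter_div(1)[OF r j] zero_pair(2)[OF j] by simp
qed

lemma quarter_half_pair:
  fixes k j :: nat
  assumes j: "j < p - 1"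
  defines "jj \<equiv> rat_of_nat j / rat_of_nat (p - 1)"
  shows "[zp_mult p
               (zp_mult p (gamma_p p (frac (1 / 4 - jj))) (zp_inv p (gamma_p p (frac (1 / 4)))))
               (zp_mult p (gamma_p p (frac (- (2 / 4) + jj))) (zp_inv p (gamma_p p (frac (- (2 / 4)))))) k
           * (gam k tn * gam k (2 * tn)) = gam k (ix 1 j) * gam k ((j + 2 * tn) mod (p - 1))] (mod int p ^ k)"
    and "- \<lfloor>frac (1 / 4) - jj\<rfloor> - \<lfloor>frac (- (2 / 4)) + jj\<rfloor> = (if tn < j \<and> j < 2 * tn then 1 else 0)"
proof -
  have a': "1 / 4 = (of_int (int 1 * t) / of_int (int (p - 1)) :: rat)" unfolding quarter[of "int 1", symmetric] by simp
  have b': "- (2 / 4) = (of_int (- 2 * t) / of_int (int (p - 1)) :: rat)" unfolding quarter[of "-2", symmetric] by simp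
  have j1: "nat (int 1 * t mod int (p - 1)) = tn" using quarter_div(2)[of 1 j] j by simp
  show "[zp_mult p
               (zp_mult p (gamma_p p (frac (1 / 4 - jj))) (zp_inv p (gamma_p p (frac (1 / 4)))))
               (zp_mult p (gamma_p p (frac (- (2 / 4) + jj))) (zp_inv p (gamma_p p (frac (- (2 / 4)))))) k
           * (gam k tn * gam k (2 * tn)) = gam k (ix 1 j) * gam k ((j + 2 * tn) mod (p - 1))] (mod int p ^ k)"
    using gamma_pair(1)[OF a' b', of j k] unfolding jj_def[symmetric] nat_ix[OF j] half_pair(1,3)[OF j] j1 .
  have q: "(int 1 * t mod int (p - 1) - int j) div int (p - 1) = (if 1 * tn < j then -1 else 0)"
    by (rule quarter_div(1)[OF _ j]) simp
  show "- \<lfloor>frac (1 / 4) - jj\<rfloor> - \<lfloor>frac (- (2 / 4)) + jj\<rfloor> = (if tn < j \<and> j < 2 * tn then 1 else 0)"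
    using gamma_pair(2)[OF a' b', of j] tn(3) unfolding jj_def[symmetric] q half_pair(2)[OF j] by auto
qed

theorem mcG3_trace:
  assumes lam: "\<not> int p dvd lam"
  shows "fst (mcG p [1/4, 2/4, 3/4] [0, 0, 0] (lam ^ 4)) = 0"
    and "[snd (mcG p [1/4, 2/4, 3/4] [0, 0, 0] (lam ^ 4)) k = trace3 (- (lam ^ 4))] (mod int p ^ k)"
proof -
  have u: "\<not> int p dvd lam ^ 4" using lam not_dvd_power by simp
  define F where "F = mcF p [1/4, 2/4, 3/4] [0, 0, 0] (lam ^ 4)"
  define e where "e r j = (if r * tn < j then 1 else 0 :: int)" for r j
  define z where "z a j = (let jj = rat_of_nat j / rat_of_nat (p - 1) in zp_mult p
               (zp_mult p (gamma_p p (frac (a - jj))) (zp_inv p (gamma_p p (frac a))))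
               (zp_mult p (gamma_p p (frac (- 0 + jj))) (zp_inv p (gamma_p p (frac (- 0))))))" for a j
  have q: "1 / 4 = (of_nat 1 / 4 :: rat)" "2 / 4 = (of_nat 2 / 4 :: rat)" "3 / 4 = (of_nat 3 / 4 :: rat)" by simp_all
  have zr: "[z a j k * gam k (r * tn) = gam k (ix r j) * gam k j] (mod int p ^ k)" if "r \<le> 3" "j < p - 1" "a = of_nat r / 4" for a r j
    unfolding z_def Let_def by (rule quarter_zero_pair(1)[OF that])
  have er: "- \<lfloor>frac (of_nat r / 4) - rat_of_nat j / rat_of_nat (p - 1)\<rfloor> - \<lfloor>frac (- 0) + rat_of_nat j / rat_of_nat (p - 1)\<rfloor> = e r j" if "r \<le> 3" "j < p - 1" for r j
    unfolding e_def by (rule quarter_zero_pair(2)[OF that refl])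
  have F: "F j = (e 1 j + e 2 j + e 3 j, zp_mult p (zp_mult p (zp_of_int p ((-1) ^ (j * 3))) (zp_mult p (omegabar_pow p j (lam ^ 4))
      (zp_mult p (z (1 / 4) j) (zp_mult p (z (2 / 4) j) (zp_mult p (z (3 / 4) j) (zp_of_int p 1)))))) (zp_of_int p ((-1) ^ nat \<bar>e 1 j + e 2 j + e 3 j\<bar>)))" if j: "j < p - 1" for j
  proof -
    note e1 = er[OF _ j, of 1, simplified] and e2 = er[OF _ j, of 2, simplified] and e3 = er[OF _ j, of 3, simplified]
    have s: "(\<Sum>(a, b) \<leftarrow> zip [1/4, 2/4, 3/4] [0, 0, 0]. - \<lfloor>frac a - rat_of_nat j / rat_of_nat (p - 1)\<rfloor> - \<lfloor>frac (- b) + rat_of_nat j / rat_of_nat (p - 1)\<rfloor>) = e 1 j + e 2 j + e 3 j"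
      using e1 e2 e3 by simp
    have len: "length [1/4, 2/4, 3/4 :: rat] = 3" by simp
    show ?thesis
      unfolding F_def mcF_def Let_def s len
      by (simp only: qp_mult_def qp_of_zp_def negp_pow_def fst_conv snd_conv z_def Let_def zip_Cons_Cons zip_Nil list.map prod.case zp_prod_def foldr.simps o_apply id_apply add_0_left)
  qed
  have nn: "fst (F j) \<ge> 0" if "j < p - 1" for j unfolding F[OF that] by (simp add: e_def)
  have "[(\<Sum>j<p - 1. int p ^ nat (fst (F j)) * snd (F j) k) = - ((int p - 1) * trace3 (- (lam ^ 4)))] (mod int p ^ k)"
  proof (rule sum_trace3[OF lam])
    fix j assume j: "j < p - 1"
    define E where "E = nat (e 1 j + e 2 j + e 3 j)"
    have E: "nat (fst (F j)) = E" "nat \<bar>e 1 j + e 2 j + e 3 j\<bar> = E" unfolding F[OF j] E_def e_def by auto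
    \<comment> \<open>The power of \<open>p\<close> comes from the stored exponent and the sign from
      \<open>negp_pow\<close>; together they give one factor \<open>- p\<close> for each
      \<open>r\<close> with \<open>r * tn < j\<close>.\<close>
    have pe: "int p ^ E * (-1) ^ E = (if tn < j then - int p else 1) * (if 2 * tn < j then - int p else 1) * (if 3 * tn < j then - int p else 1)"
      unfolding E_def e_def power_mult_distrib[symmetric] by (auto simp: power2_eq_square numeral_eq_Suc)
    have m3: "(-1 :: int) ^ (j * 3) = (-1) ^ j" by (simp add: minus_one_power_iff)
    have "[snd (F j) k = (-1) ^ j * (chi k (p - 1 - j) (lam ^ 4) * (z (1 / 4) j k * (z (2 / 4) j k * (z (3 / 4) j k * 1)))) * (-1) ^ E] (mod int p ^ k)"
      unfolding F[OF j] snd_conv E m3 by (intro zp_mult_cong zp_of_int_cong omegabar_chi u j cong_refl)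
    then have 1: "[int p ^ E * snd (F j) k * (gam k tn * gam k (2 * tn) * gam k (3 * tn)) = int p ^ E * ((-1) ^ j * (chi k (p - 1 - j) (lam ^ 4) * (z (1 / 4) j k * (z (2 / 4) j k * (z (3 / 4) j k * 1)))) * (-1) ^ E)
       * (gam k tn * gam k (2 * tn) * gam k (3 * tn))] (mod int p ^ k)" by (intro cong_mult cong_refl)
    have 2: "int p ^ E * ((-1) ^ j * (chi k (p - 1 - j) (lam ^ 4) * (z (1 / 4) j k * (z (2 / 4) j k * (z (3 / 4) j k * 1)))) * (-1) ^ E)
       * (gam k tn * gam k (2 * tn) * gam k (3 * tn)) = (int p ^ E * (-1) ^ E) * ((-1) ^ j * chi k (p - 1 - j) (lam ^ 4)) * ((z (1 / 4) j k * gam k (1 * tn)) * (z (2 / 4) j k * gam k (2 * tn)) * (z (3 / 4) j k * gam k (3 * tn)))"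
      by (simp only: mult_ac mult_1 mult_1_right)
    have 3: "[(int p ^ E * (-1) ^ E) * ((-1) ^ j * chi k (p - 1 - j) (lam ^ 4)) * ((z (1 / 4) j k * gam k (1 * tn)) * (z (2 / 4) j k * gam k (2 * tn)) * (z (3 / 4) j k * gam k (3 * tn)))
      = (int p ^ E * (-1) ^ E) * ((-1) ^ j * chi k (p - 1 - j) (lam ^ 4)) * ((gam k (ix 1 j) * gam k j) * (gam k (ix 2 j) * gam k j) * (gam k (ix 3 j) * gam k j))] (mod int p ^ k)"
      using j by (intro cong_mult cong_refl zr q) simp_all
    have 4: "(int p ^ E * (-1) ^ E) * ((-1) ^ j * chi k (p - 1 - j) (lam ^ 4)) * ((gam k (ix 1 j) * gam k j) * (gam k (ix 2 j) * gam k j) * (gam k (ix 3 j) * gam k j))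
      = (-1) ^ j * chi k (p - 1 - j) (lam ^ 4) *
      (gam k (ix 1 j) * gam k j * (if tn < j then - int p else 1) * (gam k (ix 2 j) * gam k j * (if 2 * tn < j then - int p else 1)) *
      (gam k (ix 3 j) * gam k j * (if 3 * tn < j then - int p else 1)))"
      unfolding pe by (simp only: mult_ac)
    show "[int p ^ nat (fst (F j)) * snd (F j) k * (gam k tn * gam k (2 * tn) * gam k (3 * tn)) = (-1) ^ j * chi k (p - 1 - j) (lam ^ 4) *
      (gam k (ix 1 j) * gam k j * (if tn < j then - int p else 1) * (gam k (ix 2 j) * gam k j * (if 2 * tn < j then - int p else 1)) *
      (gam k (ix 3 j) * gam k j * (if 3 * tn < j then - int p else 1)))] (mod int p ^ k)"
      unfolding E by (rule cong_trans[OF 1[unfolded 2] 3[unfolded 4]])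
  qed
  from mcG_eval[OF nn[unfolded F_def] this[unfolded F_def]] show "fst (mcG p [1/4, 2/4, 3/4] [0, 0, 0] (lam ^ 4)) = 0"
    and "[snd (mcG p [1/4, 2/4, 3/4] [0, 0, 0] (lam ^ 4)) k = trace3 (- (lam ^ 4))] (mod int p ^ k)" by blast+
qed

text \<open>The upper parameter \<open>3/4\<close> is paired with \<open>0\<close> and
  \<open>1/4\<close> with \<open>2/4\<close>, in the order of the lists. This gives the two Jacobi
  sums of \<open>jac2_sum\<close>, with exponents \<open>(ix 3 j, j)\<close> and
  \<open>(ix 1 j, j + 2 * tn)\<close>.\<close>

theorem mcG2_trace:
  assumes lam: "\<not> int p dvd lam"
  shows "fst (mcG p [3/4, 1/4] [0, 2/4] (lam ^ 4)) = 0"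
    and "[snd (mcG p [3/4, 1/4] [0, 2/4] (lam ^ 4)) k = leg (1 + lam ^ 2) + leg (1 - lam ^ 2)] (mod int p ^ k)"
proof -
  have u: "\<not> int p dvd lam ^ 4" using lam not_dvd_power by simp
  define F where "F = mcF p [3/4, 1/4] [0, 2/4] (lam ^ 4)"
  define e1 where "e1 j = (if 3 * tn < j then 1 else 0 :: int)" for j
  define e2 where "e2 j = (if tn < j \<and> j < 2 * tn then 1 else 0 :: int)" for j
  define z1 where "z1 j = (let jj = rat_of_nat j / rat_of_nat (p - 1) in zp_mult p
               (zp_mult p (gamma_p p (frac (3 / 4 - jj))) (zp_inv p (gamma_p p (frac (3 / 4)))))
               (zp_mult p (gamma_p p (frac (- 0 + jj))) (zp_inv p (gamma_p p (frac (- 0))))))" for j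
  define z2 where "z2 j = (let jj = rat_of_nat j / rat_of_nat (p - 1) in zp_mult p
               (zp_mult p (gamma_p p (frac (1 / 4 - jj))) (zp_inv p (gamma_p p (frac (1 / 4)))))
               (zp_mult p (gamma_p p (frac (- (2 / 4) + jj))) (zp_inv p (gamma_p p (frac (- (2 / 4)))))))" for j
  have q: "3 / 4 = (of_nat 3 / 4 :: rat)" by simp
  have z1: "[z1 j k * gam k (3 * tn) = gam k (ix 3 j) * gam k j] (mod int p ^ k)" if "j < p - 1" for j
    unfolding z1_def Let_def by (rule quarter_zero_pair(1)[OF _ that q]) simp
  have z2: "[z2 j k * (gam k tn * gam k (2 * tn)) = gam k (ix 1 j) * gam k ((j + 2 * tn) mod (p - 1))] (mod int p ^ k)" if "j < p - 1" for j
    unfolding z2_def Let_def by (rule quarter_half_pair(1)[OF that])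
  have F: "F j = (e1 j + e2 j, zp_mult p (zp_mult p (zp_of_int p ((-1) ^ (j * 2))) (zp_mult p (omegabar_pow p j (lam ^ 4))
      (zp_mult p (z1 j) (zp_mult p (z2 j) (zp_of_int p 1))))) (zp_of_int p ((-1) ^ nat \<bar>e1 j + e2 j\<bar>)))" if j: "j < p - 1" for j
  proof -
    have a: "- \<lfloor>frac (3 / 4) - rat_of_nat j / rat_of_nat (p - 1)\<rfloor> - \<lfloor>frac (- 0) + rat_of_nat j / rat_of_nat (p - 1)\<rfloor> = e1 j"
      unfolding e1_def by (rule quarter_zero_pair(2)[OF _ j q]) simp
    have b: "- \<lfloor>frac (1 / 4) - rat_of_nat j / rat_of_nat (p - 1)\<rfloor> - \<lfloor>frac (- (2 / 4)) + rat_of_nat j / rat_of_nat (p - 1)\<rfloor> = e2 j"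
      unfolding e2_def by (rule quarter_half_pair(2)[OF j])
    have s: "(\<Sum>(a, b) \<leftarrow> zip [3/4, 1/4] [0, 2/4]. - \<lfloor>frac a - rat_of_nat j / rat_of_nat (p - 1)\<rfloor> - \<lfloor>frac (- b) + rat_of_nat j / rat_of_nat (p - 1)\<rfloor>) = e1 j + e2 j"
      by (simp only: zip_Cons_Cons zip_Nil list.map prod.case a b sum_list.Cons sum_list.Nil add_0_right)
    show ?thesis
      unfolding F_def mcF_def Let_def s
      by (simp only: qp_mult_def qp_of_zp_def negp_pow_def fst_conv snd_conv z1_def z2_def Let_def zip_Cons_Cons zip_Nil list.map prod.case zp_prod_def foldr.simps o_apply id_apply list.size) simp
  qed
  have nn: "fst (F j) \<ge> 0" if "j < p - 1" for j unfolding F[OF that] by (simp add: e1_def e2_def)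
  have "[(\<Sum>j<p - 1. int p ^ nat (fst (F j)) * snd (F j) k) = - ((int p - 1) * (leg (1 + lam ^ 2) + leg (1 - lam ^ 2)))] (mod int p ^ k)"
  proof (rule sum_trace2[OF lam])
    fix j assume j: "j < p - 1"
    define E where "E = nat (e1 j + e2 j)"
    have E: "nat (fst (F j)) = E" "nat \<bar>e1 j + e2 j\<bar> = E" unfolding F[OF j] E_def e1_def e2_def by auto
    have pe: "int p ^ E * (-1) ^ E = (if 3 * tn < j then - int p else 1) * (if tn < j \<and> j < 2 * tn then - int p else 1)"
      unfolding E_def e1_def e2_def power_mult_distrib[symmetric] by (auto simp: power2_eq_square numeral_eq_Suc)
    have m2: "(-1 :: int) ^ (j * 2) = 1" by simp
    have "[snd (F j) k = 1 * (chi k (p - 1 - j) (lam ^ 4) * (z1 j k * (z2 j k * 1))) * (-1) ^ E] (mod int p ^ k)"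
      unfolding F[OF j] snd_conv E m2 by (intro zp_mult_cong zp_of_int_cong omegabar_chi u j cong_refl)
    then have 1: "[int p ^ E * snd (F j) k * (gam k (3 * tn) * (gam k tn * gam k (2 * tn))) = int p ^ E * (1 * (chi k (p - 1 - j) (lam ^ 4) * (z1 j k * (z2 j k * 1))) * (-1) ^ E)
       * (gam k (3 * tn) * (gam k tn * gam k (2 * tn)))] (mod int p ^ k)" by (intro cong_mult cong_refl)
    have 2: "int p ^ E * (1 * (chi k (p - 1 - j) (lam ^ 4) * (z1 j k * (z2 j k * 1))) * (-1) ^ E)
       * (gam k (3 * tn) * (gam k tn * gam k (2 * tn))) = (int p ^ E * (-1) ^ E) * chi k (p - 1 - j) (lam ^ 4) * ((z1 j k * gam k (3 * tn)) * (z2 j k * (gam k tn * gam k (2 * tn))))"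
      by (simp only: mult_ac mult_1 mult_1_right)
    have 3: "[(int p ^ E * (-1) ^ E) * chi k (p - 1 - j) (lam ^ 4) * ((z1 j k * gam k (3 * tn)) * (z2 j k * (gam k tn * gam k (2 * tn))))
      = (int p ^ E * (-1) ^ E) * chi k (p - 1 - j) (lam ^ 4) * ((gam k (ix 3 j) * gam k j) * (gam k (ix 1 j) * gam k ((j + 2 * tn) mod (p - 1))))] (mod int p ^ k)"
      by (intro cong_mult cong_refl z1 z2 j)
    have 4: "(int p ^ E * (-1) ^ E) * chi k (p - 1 - j) (lam ^ 4) * ((gam k (ix 3 j) * gam k j) * (gam k (ix 1 j) * gam k ((j + 2 * tn) mod (p - 1))))
      = chi k (p - 1 - j) (lam ^ 4) * (gam k (ix 3 j) * gam k j * (if 3 * tn < j then - int p else 1) *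
      (gam k (ix 1 j) * gam k ((j + 2 * tn) mod (p - 1)) * (if tn < j \<and> j < 2 * tn then - int p else 1)))"
      unfolding pe by (simp only: mult_ac)
    show "[int p ^ nat (fst (F j)) * snd (F j) k * (gam k (3 * tn) * (gam k tn * gam k (2 * tn))) = chi k (p - 1 - j) (lam ^ 4) *
      (gam k (ix 3 j) * gam k j * (if 3 * tn < j then - int p else 1) *
      (gam k (ix 1 j) * gam k ((j + 2 * tn) mod (p - 1)) * (if tn < j \<and> j < 2 * tn then - int p else 1)))] (mod int p ^ k)"
      unfolding E by (rule cong_trans[OF 1[unfolded 2] 3[unfolded 4]])
  qed
  from mcG_eval[OF nn[unfolded F_def] this[unfolded F_def]] show "fst (mcG p [3/4, 1/4] [0, 2/4] (lam ^ 4)) = 0"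
    and "[snd (mcG p [3/4, 1/4] [0, 2/4] (lam ^ 4)) k = leg (1 + lam ^ 2) + leg (1 - lam ^ 2)] (mod int p ^ k)" by blast+
qed

section \<open>The given character generator and the final count\<close>

lemma zp_valid_cong:
  assumes "zp_valid p x" "k > 0" shows "[x k = x 1] (mod int p)"
proof -
  have "[x (Suc n) = x 1] (mod int p)" for n
  proof (induction n)
    case (Suc n)
    have h: "x (Suc (Suc n)) mod int p ^ Suc n = x (Suc n)" using assms(1) unfolding zp_valid_def by blast
    have "[x (Suc (Suc n)) mod int p ^ Suc n = x (Suc (Suc n))] (mod int p ^ Suc n)" by (simp only: cong_mod_left cong_refl)
    then have "[x (Suc (Suc n)) = x (Suc n)] (mod int p ^ Suc n)" unfolding h by (rule cong_sym)
    then have "[x (Suc (Suc n)) = x (Suc n)] (mod int p)" by (rule cong_dvd_modulus) simp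
    then show ?case using Suc by (rule cong_trans)
  qed simp
  from this[of "k - 1"] show ?thesis using assms(2) by simp
qed

lemma char_power:
  assumes T: "is_char p T" shows "[T (x ^ n) k = T x k ^ n] (mod int p ^ k)"
proof (induction n)
  case 0
  have "T 1 = zp_of_int p 1" using T unfolding is_char_def by blast
  then show ?case using zp_of_int_cong[of p 1 k] by simp
next
  case (Suc n)
  have "T (x * x ^ n) = zp_mult p (T x) (T (x ^ n))" using T unfolding is_char_def by blast
  then have "[T (x * x ^ n) k = T x k * T x k ^ n] (mod int p ^ k)"
    using zp_mult_cong[where x = "T x" and y = "T (x ^ n)" and k = k, OF cong_refl Suc] by simp
  then show ?case by simp
qed

lemma char_cong: "is_char p T \<Longrightarrow> [x = y] (mod int p) \<Longrightarrow> T x = T y"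
  unfolding is_char_def by blast

lemma square_cong_1_prime_power:
  assumes k: "k > 0" and x: "[x ^ 2 = 1] (mod int p ^ k)" and n: "\<not> int p dvd x - 1"
  shows "[x = -1] (mod int p ^ k)"
proof -
  have "[(x - 1) * (x + 1) = (x - 1) * 0] (mod int p ^ k)"
    using x by (simp add: cong_iff_dvd_diff power2_eq_square algebra_simps)
  then have "[x + 1 = 0] (mod int p ^ k)" using n by (rule cong_cancel)
  then show ?thesis by (simp add: cong_iff_dvd_diff)
qed

text \<open>By Fermat the square is 1, so the value is 1 or \<open>-1\<close>. If it were 1 modulo
  \<open>p\<close> at one precision, compatibility of residues would make it 1 at every precision;
  the power \<open>2 * tn\<close> of \<open>T\<close> would then be trivial, contradicting that
  \<open>T\<close> is a generator.\<close>

lemma char_generator_half: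
  assumes T: "is_char_generator p T"
  shows "[T g k ^ (2 * tn) = -1] (mod int p ^ k)"
proof -
  have ch: "is_char p T" using T unfolding is_char_generator_def by blast
  have val: "zp_valid p (T g)" using ch unfolding is_char_def by blast
  have sq: "[(T g k ^ (2 * tn)) ^ 2 = 1] (mod int p ^ k)" for k
  proof -
    have e: "(T g k ^ (2 * tn)) ^ 2 = T g k ^ (p - 1)" using tn(2) by (simp add: power_mult[symmetric] mult.commute)
    have "T (g ^ (p - 1)) = zp_of_int p 1"
      using char_cong[OF ch fermat_int[OF g_not_dvd]] ch unfolding is_char_def by metis
    then have "[1 = T (g ^ (p - 1)) k] (mod int p ^ k)" using zp_of_int_cong[of p 1 k] cong_sym by metis
    from cong_trans[OF this char_power[OF ch]] show ?thesis unfolding e by (rule cong_sym)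
  qed
  have pm: "\<not> int p dvd T g k ^ (2 * tn) - 1" if "k > 0" for k
  proof
    assume "int p dvd T g k ^ (2 * tn) - 1"
    moreover have c: "[T g m = T g 1] (mod int p)" if "m > 0" for m using zp_valid_cong[OF val that] .
    ultimately have one: "[T g m ^ (2 * tn) = 1] (mod int p)" if "m > 0" for m
    proof -
      have "[T g m = T g k] (mod int p)" using c[OF that] c[OF \<open>k > 0\<close>] cong_sym cong_trans by blast
      from cong_pow[OF this] have "[T g m ^ (2 * tn) = T g k ^ (2 * tn)] (mod int p)" .
      moreover have "[T g k ^ (2 * tn) = 1] (mod int p)" using \<open>int p dvd T g k ^ (2 * tn) - 1\<close> by (simp only: cong_iff_dvd_diff)
      ultimately show ?thesis by (rule cong_trans)
    qed
    have full: "[T g m ^ (2 * tn) = 1] (mod int p ^ m)" for m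
    proof (cases "m = 0")
      case False
      define y where "y = T g m ^ (2 * tn)"
      have y1: "[y = 1] (mod int p)" unfolding y_def using one False by simp
      \<comment> \<open>The criterion for square roots of 1 concludes \<open>-1\<close>, so it is
        applied to \<open>- y\<close> in order to obtain \<open>y = 1\<close>.\<close>
      have "\<not> int p dvd (- y) - 1"
      proof
        assume "int p dvd - y - 1"
        moreover have "int p dvd y - 1" using y1 by (simp only: cong_iff_dvd_diff)
        ultimately have "int p dvd (- y - 1) + (y - 1)" by (rule dvd_add)
        then have "int p dvd 2" by simp
        then show False using gt2 by (auto dest: zdvd_imp_le)
      qed
      moreover have "[(- y) ^ 2 = 1] (mod int p ^ m)" using sq[of m] by (simp add: y_def)
      ultimately have "[- y = -1] (mod int p ^ m)" using False by (intro square_cong_1_prime_power) auto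
      then show ?thesis unfolding y_def by (simp only: cong_minus_minus_iff)
    qed simp
    obtain x where x: "\<not> int p dvd x" "zp_pow p (T x) (2 * tn) \<noteq> zp_of_int p 1"
    proof -
      have "0 < 2 * tn \<and> 2 * tn < p - 1" using tn by simp
      then show thesis using that T unfolding is_char_generator_def by blast
    qed
    have "zp_pow p (T x) (2 * tn) m = zp_of_int p 1 m" for m
    proof -
      have "[T x m = T g m ^ ind x] (mod int p ^ m)" using char_cong[OF ch ind[OF x(1)]] char_power[OF ch, of g "ind x" m] by simp
      from cong_pow[OF this, of "2 * tn"] have "[T x m ^ (2 * tn) = (T g m ^ (2 * tn)) ^ ind x] (mod int p ^ m)"
        by (simp add: power_mult[symmetric] mult.commute)
      moreover have "[(T g m ^ (2 * tn)) ^ ind x = 1 ^ ind x] (mod int p ^ m)" by (intro cong_pow full)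
      ultimately have "[T x m ^ (2 * tn) = 1] (mod int p ^ m)" using cong_trans by simp blast
      then show ?thesis by (simp add: zp_pow_def zp_of_int_def cong_def)
    qed
    then show False using x(2) by blast
  qed
  show ?thesis
  proof (cases "k = 0")
    case False
    then show ?thesis using square_cong_1_prime_power[OF _ sq pm] by simp
  qed simp
qed

lemma char_generator_leg:
  assumes T: "is_char_generator p T"
  shows "[T x k ^ (2 * tn) = leg x] (mod int p ^ k)"
proof (cases "int p dvd x")
  case True
  then have "T x = zp_of_int p 0" using T unfolding is_char_generator_def is_char_def by blast
  then show ?thesis using True tn(3) by (simp add: zp_of_int_def leg_def zero_power)
next
  case False
  have ch: "is_char p T" using T unfolding is_char_generator_def by blast
  have "[T x k = T g k ^ ind x] (mod int p ^ k)" using char_cong[OF ch ind[OF False]] char_power[OF ch, of g "ind x" k] by simp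
  from cong_pow[OF this, of "2 * tn"] have 1: "[T x k ^ (2 * tn) = (T g k ^ (2 * tn)) ^ ind x] (mod int p ^ k)"
    by (simp add: power_mult[symmetric] mult.commute)
  have 2: "[(T g k ^ (2 * tn)) ^ ind x = (-1) ^ ind x] (mod int p ^ k)" by (intro cong_pow char_generator_half T)
  have "(-1) ^ ind x = leg x" using False by (simp add: leg_def minus_one_power_iff)
  then show ?thesis using cong_trans[OF 1 2] by simp
qed

text \<open>Since \<open>-1\<close> is \<open>g ^ (2 * tn)\<close>, every generator takes the value
  \<open>-1\<close> there; thus the result does not depend on the choice of
  \<open>T\<close>.\<close>

lemma char_generator_neg_1:
  assumes T: "is_char_generator p T"
  shows "[T (-1) k ^ tn = (-1) ^ tn] (mod int p ^ k)"
proof -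
  have ch: "is_char p T" using T unfolding is_char_generator_def by blast
  have "T (-1) = T (g ^ (2 * tn))" by (rule char_cong[OF ch cong_sym[OF g_half]])
  then have "[T (-1) k = T g k ^ (2 * tn)] (mod int p ^ k)" using char_power[OF ch, of g "2 * tn" k] by simp
  then have "[T (-1) k = -1] (mod int p ^ k)" using char_generator_half[OF T] by (rule cong_trans)
  then show ?thesis by (rule cong_pow)
qed

lemma card_affine_solutions: "int (card (dwork_affine_solutions p lam)) = sol_count (4 * lam) - 1"
proof -
  define Q where "Q = residues \<times> residues \<times> residues \<times> residues"
  define P where "P s = (case s of (x1, x2, x3, x4) \<Rightarrow> int p dvd x1 ^ 4 + x2 ^ 4 + x3 ^ 4 + x4 ^ 4 - 4 * lam * x1 * x2 * x3 * x4)" for s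
  have fQ: "finite Q" by (simp add: Q_def)
  have "sol_count (4 * lam) = (\<Sum>s\<in>Q. if P s then 1 else 0)"
    unfolding sol_count_def Q_def P_def by (simp add: sum.cartesian_product split_def)
  also have "\<dots> = int (card {s\<in>Q. P s})" using fQ by (simp add: sum.inter_filter[symmetric])
  also have "{s\<in>Q. P s} = insert (0, 0, 0, 0) (dwork_affine_solutions p lam)"
    using pos by (auto simp: Q_def P_def dwork_affine_solutions_def residues_def cong_iff_dvd_diff)
  also have "card (insert (0, 0, 0, 0) (dwork_affine_solutions p lam)) = Suc (card (dwork_affine_solutions p lam))"
  proof (rule card_insert_disjoint)
    have "dwork_affine_solutions p lam \<subseteq> Q" by (auto simp: Q_def dwork_affine_solutions_def residues_def)
    then show "finite (dwork_affine_solutions p lam)" using fQ finite_subset by blast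
  qed (auto simp: dwork_affine_solutions_def)
  finally show ?thesis by simp
qed

text \<open>\<open>sol_count\<close> also counts the origin. Without it the count is
  \<open>p ^ 3 - 1\<close> plus a multiple of \<open>p - 1\<close>, hence divisible by
  \<open>p - 1\<close>, and the truncating \<open>div\<close> in \<open>dwork_count\<close> is
  exact.\<close>

theorem dwork_count_formula:
  assumes lam: "\<not> int p dvd lam"
  shows "int (dwork_count p lam) = (int p ^ 3 - 1) div (int p - 1) + (12 * int p * ((-1) ^ tn * leg (1 - lam ^ 4))
    + (trace3 (- (lam ^ 4)) + 3 * int p * (leg (1 + lam ^ 2) + leg (1 - lam ^ 2))))"
proof -
  define W where "W = 12 * int p * ((-1) ^ tn * leg (1 - lam ^ 4)) + (trace3 (- (lam ^ 4)) + 3 * int p * (leg (1 + lam ^ 2) + leg (1 - lam ^ 2)))"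
  have n0: "int p - 1 \<noteq> 0" using gt1 by simp
  have c: "int p ^ 3 - 1 = (int p - 1) * (int p ^ 2 + int p + 1)" by (simp add: power2_eq_square power3_eq_cube algebra_simps)
  have "int (card (dwork_affine_solutions p lam)) = (int p ^ 3 - 1) + (int p - 1) * W"
    unfolding card_affine_solutions sol_count_formula(1)[OF lam] W_def by (simp add: algebra_simps)
  also have "\<dots> = (int p - 1) * (int p ^ 2 + int p + 1 + W)" unfolding c by (simp only: distrib_left)
  finally have "int (dwork_count p lam) = int p ^ 2 + int p + 1 + W"
    unfolding dwork_count_def zdiv_int int_p1 using n0 by simp
  moreover have "(int p ^ 3 - 1) div (int p - 1) = int p ^ 2 + int p + 1" unfolding c using n0 by simp
  ultimately show ?thesis unfolding W_def by simp
qed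

end

theorem theorem3:
  fixes p :: nat and T :: "int \<Rightarrow> zp" and lam :: int
  assumes "prime p" and "p mod 4 = 1"
    and "is_char_generator p T"
    and "\<not> int p dvd lam"
  shows "qp_eq p (qp_of_int p (int (dwork_count p lam)))
    (qp_add p (qp_of_int p ((int p ^ 3 - 1) div (int p - 1)))
    (qp_add p (qp_of_zp (zp_mult p (zp_of_int p (12 * int p))
                  (zp_mult p (zp_pow p (T (-1)) ((p - 1) div 4))
                             (zp_pow p (T (1 - lam ^ 4)) (2 * ((p - 1) div 4))))))
    (qp_add p (mcG p [1/4, 2/4, 3/4] [0, 0, 0] (lam ^ 4))
      (qp_mult p (qp_of_int p (3 * int p)) (mcG p [3/4, 1/4] [0, 2/4] (lam ^ 4))))))"
proof -
  have "p \<noteq> 2" using assms(2) by auto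
  then have "p > 2" using prime_ge_2_nat[OF assms(1)] by linarith
  interpret odd_prime p using assms(1) \<open>p > 2\<close> by unfold_locales
  obtain g where g: "\<not> int p dvd g" "\<And>x. \<not> int p dvd x \<Longrightarrow> \<exists>i<p - 1. [x = g ^ i] (mod int p)"
    "\<And>e. [g ^ e = 1] (mod int p) \<longleftrightarrow> (p - 1) dvd e"
    using exists_generator by metis
  interpret prime_gen4 p g using g assms(2) by unfold_locales
  note T = assms(3) and lam = assms(4)
  \<comment> \<open>Both hypergeometric values carry exponent 0, so every term of the formula does,
    and equality of \<open>qp\<close> values reduces to a congruence of residues for each
    \<open>k\<close>.\<close>
  note F2 = mcG2_trace(1)[OF lam] and F3 = mcG3_trace(1)[OF lam]
  have of_int: "fst (qp_of_int p a) = 0" "[snd (qp_of_int p a) k = a] (mod int p ^ k)" for a k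
    by (simp_all add: qp_of_int_def zp_of_int_cong)
  have of_zp: "fst (qp_of_zp x) = 0" "snd (qp_of_zp x) = x" for x by (simp_all add: qp_of_zp_def)
  show ?thesis
    unfolding tn_def[symmetric]
  proof (rule qp_eq_integral)
    fix k
    have "[snd (qp_add p (qp_of_int p ((int p ^ 3 - 1) div (int p - 1)))
    (qp_add p (qp_of_zp (zp_mult p (zp_of_int p (12 * int p))
                  (zp_mult p (zp_pow p (T (-1)) tn) (zp_pow p (T (1 - lam ^ 4)) (2 * tn)))))
    (qp_add p (mcG p [1/4, 2/4, 3/4] [0, 0, 0] (lam ^ 4))
      (qp_mult p (qp_of_int p (3 * int p)) (mcG p [3/4, 1/4] [0, 2/4] (lam ^ 4)))))) k
     = (int p ^ 3 - 1) div (int p - 1) + (12 * int p * ((-1) ^ tn * leg (1 - lam ^ 4))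
    + (trace3 (- (lam ^ 4)) + 3 * int p * (leg (1 + lam ^ 2) + leg (1 - lam ^ 2))))] (mod int p ^ k)"
    proof (intro qp_add_integral qp_mult_integral of_int of_zp F2 F3 mcG2_trace(2)[OF lam] mcG3_trace(2)[OF lam])
      have "[zp_pow p (T (-1)) tn k = (-1) ^ tn] (mod int p ^ k)"
        using char_generator_neg_1[OF T, of k] by (simp add: zp_pow_def)
      moreover have "[zp_pow p (T (1 - lam ^ 4)) (2 * tn) k = leg (1 - lam ^ 4)] (mod int p ^ k)"
        using char_generator_leg[OF T, of "1 - lam ^ 4" k] by (simp add: zp_pow_def)
      ultimately show "[snd (qp_of_zp (zp_mult p (zp_of_int p (12 * int p))
                  (zp_mult p (zp_pow p (T (-1)) tn) (zp_pow p (T (1 - lam ^ 4)) (2 * tn))))) k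
         = 12 * int p * ((-1) ^ tn * leg (1 - lam ^ 4))] (mod int p ^ k)"
        unfolding of_zp by (intro zp_mult_cong zp_of_int_cong)
    qed
    then show "[snd (qp_of_int p (int (dwork_count p lam))) k = snd (qp_add p (qp_of_int p ((int p ^ 3 - 1) div (int p - 1)))
    (qp_add p (qp_of_zp (zp_mult p (zp_of_int p (12 * int p))
                  (zp_mult p (zp_pow p (T (-1)) tn) (zp_pow p (T (1 - lam ^ 4)) (2 * tn)))))
    (qp_add p (mcG p [1/4, 2/4, 3/4] [0, 0, 0] (lam ^ 4))
      (qp_mult p (qp_of_int p (3 * int p)) (mcG p [3/4, 1/4] [0, 2/4] (lam ^ 4)))))) k] (mod int p ^ k)"
      unfolding dwork_count_formula[OF lam, symmetric] by (rule cong_trans[OF of_int(2) cong_sym])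
  qed (intro qp_add_integral qp_mult_integral of_int of_zp F2 F3)+
qed

end
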